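(* Let $(M,\nabla,\langle\cdot,\cdot\rangle)$ be an affine-Riemann manifold, $(TM,\nabla^1,g_1)$ the associated affine-Riemann structure on $TM$, $\nabla^{LC}$ the Levi-Civita connection of $g_1$, $\Gamma=\nabla^{LC}-\nabla^1$ its difference tensor and $\Gamma^*$ the adjoint of $\Gamma$. For all vector fields $X,Y$ on $M$, $$\Gamma_{X^h}Y^h=(\gamma_XY)^h,\quad \Gamma_{X^h}Y^v=\Gamma_{Y^v}X^h=\tfrac12(\gamma_XY+\gamma_X^*Y)^v,\quad \Gamma_{X^v}Y^v=-\tfrac12(\gamma_X^*Y+\gamma_Y^*X)^h,$$ $$\Gamma^*_{X^h}Y^h=(\gamma^*_XY)^h,\quad \Gamma^*_{X^h}Y^v=\tfrac12(\gamma_XY+\gamma_X^*Y)^v,\quad \Gamma^*_{X^v}Y^h=-\tfrac12(\gamma_XY+\gamma_Y^*X)^v,\quad \Gamma^*_{X^v}Y^v=\tfrac12(\gamma_X^*Y+\gamma_Y^*X)^h,$$ $$\mathrm{tr}_{g_1}(\Gamma)=(\mathrm{tr}_{\langle,\rangle}(\gamma)-\mathrm{tr}_{\langle,\rangle}(\gamma^* ))^h,\qquad \mathrm{tr}_{g_1}(\Gamma^* )=2(\mathrm{tr}_{\langle,\rangle}(\gamma^* ))^h.$$ Moreover, for every $k\ge1$, the Koszul forms $\alpha_k,\xi_k$ of $(T^kM,\nabla^k,g_k)$ and the Lee form $\theta_k$ of $(T^kM,J_k,g_k)$ satisfy $$\xi_k=-\theta_k,\qquad \alpha_k=2^k\,\pi_k^*\circ\cdots\circ\pi_1^*(\alpha),\qquad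 \theta_k=\pi_k^*\circ\cdots\circ\pi_1^*\big((2^k-1)\alpha-\xi\big).$$
   Context: An affine-Riemann manifold $(M,\nabla,\langle\cdot,\cdot\rangle)$ is a manifold with a flat torsionless connection $\nabla$ and a Riemannian metric. $D$ is the Levi-Civita connection of the metric; the difference tensor is $\gamma_XY=D_XY-\nabla_XY$, and its adjoint $\gamma^*$ is defined by $\langle\gamma^*_XY,Z\rangle=\langle Y,\gamma_XZ\rangle$. For a local orthonormal frame $(E_i)$, $\mathrm{tr}_{\langle,\rangle}(\gamma)=\sum_i\gamma_{E_i}E_i$ and $\mathrm{tr}_{\langle,\rangle}(\gamma^* )=\sum_i\gamma^*_{E_i}E_i$. The Koszul forms are $\alpha(X)=\langle\mathrm{tr}_{\langle,\rangle}(\gamma^* ),X\rangle$ and $\xi(X)=\langle\mathrm{tr}_{\langle,\rangle}(\gamma),X\rangle$. The same definitions apply to any affine-Riemann manifold, in particular to $(T^kM,\nabla^k,g_k)$ below. Canonical sequence: for a vector field $X$ on $M$, $X^h$ is the horizontal lift to $TM$ with respect to $\nabla$ and $X^v$ the vertical lift; $\pi_1:TM\to M$ is the projection. On $TM$: $J_1X^h=X^v$, $J_1X^v=-X^h$; $g_1(X^h,Y^h)=g_1(X^v,Y^v)=\langle X,Y\rangle\circ\pi_1$, $g_1(X^h,Y^v)=0$; $\nabla^1_{X^h}Y^h=(\nabla_XY)^h$, $\nabla^1_{X^h}Y^v=(\nabla_XY)^v$, $\nabla^1_{X^v}Y^h=\nabla^1_{X^v}Y^v=0$. Then $(TM,J_1,g_1)$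 is Hermitian and $\nabla^1$ is flat torsionless. Inductively, with $T^1M=TM$, $T^kM=T(T^{k-1}M)$, applying the construction to $(T^{k-1}M,\nabla^{k-1},g_{k-1})$ gives $(J_k,g_k,\nabla^k)$ on $T^kM$; $\pi_k:T^kM\to T^{k-1}M$ is the projection ($T^0M=M$). For a Hermitian manifold $(N,J,g)$: $\omega=g(J\cdot,\cdot)$, $d^*\eta(\cdot)=-\sum_i(\nabla^{LC}_{E_i}\eta)(E_i,\cdot)$, Lee form $\theta=-d^*\omega\circ J$. *)

theory Defs
  imports "HOL-Analysis.Analysis" "HOL-Library.Function_Algebras"
begin

text \<open>
  Coordinate vectors of \<open>\<real>\<^sup>n\<close> are functions of type \<open>nat \<Rightarrow> real\<close> vanishing from index \<open>n\<close> on, i.e.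
  the points of the library topology \<^const>\<open>Euclidean_space\<close>. The dimension is thus a term, as
  needed for the manifolds \<open>T\<^sup>kM\<close> of dimension \<open>2\<^sup>k n\<close> with \<open>k\<close> variable.
\<close>

type_synonym coord = "nat \<Rightarrow> real"

abbreviation Rn :: "nat \<Rightarrow> coord set" where
  "Rn n \<equiv> topspace (Euclidean_space n)"

definition unit_coord :: "nat \<Rightarrow> coord" where
  "unit_coord i = (\<lambda>j. if j = i then 1 else 0)"

definition smult :: "real \<Rightarrow> coord \<Rightarrow> coord"  (infixr \<open>\<cdot>\<^sub>c\<close> 75) where
  "a \<cdot>\<^sub>c x = (\<lambda>i. a * x i)"

definition partial :: "nat \<Rightarrow> (coord \<Rightarrow> real) \<Rightarrow> coord \<Rightarrow> real" where
  "partial i f x = deriv (\<lambda>t. f (x(i := t))) (x i)"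

primrec Ck :: "nat \<Rightarrow> nat \<Rightarrow> coord set \<Rightarrow> (coord \<Rightarrow> real) \<Rightarrow> bool" where
  "Ck 0 n U f \<longleftrightarrow> continuous_map (subtopology (Euclidean_space n) U) euclideanreal f"
| "Ck (Suc k) n U f \<longleftrightarrow>
     continuous_map (subtopology (Euclidean_space n) U) euclideanreal f \<and>
     (\<forall>i<n. (\<forall>x\<in>U. (\<lambda>t. f (x(i := t))) differentiable at (x i)) \<and> Ck k n U (partial i f))"

text \<open>Used for open \<open>U\<close> only.\<close>

definition Cinf :: "nat \<Rightarrow> coord set \<Rightarrow> (coord \<Rightarrow> real) \<Rightarrow> bool" where
  "Cinf n U f \<longleftrightarrow> (\<forall>k. Ck k n U f)"


section \<open>Smooth manifolds\<close>

text \<open>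
  A chart is a domain together with a coordinate map. Besides its atlas, a manifold carries a
  preferred chart around each point; a tangent vector at \<open>p\<close> is represented by its components with
  respect to the preferred chart at \<open>p\<close>, so that every tangent space is \<open>\<real>\<^sup>n\<close> as a vector space.
\<close>

type_synonym 'p chart = "'p set \<times> ('p \<Rightarrow> coord)"

record 'p manifold =
  points :: "'p set"
  mdim :: nat
  atlas :: "'p chart set"
  chart_at :: "'p \<Rightarrow> 'p chart"

definition chart_inv :: "'p chart \<Rightarrow> coord \<Rightarrow> 'p" where
  "chart_inv c = inv_into (fst c) (snd c)"

definition mtop :: "('p, 'x) manifold_scheme \<Rightarrow> 'p topology" where
  "mtop M = topology (\<lambda>W. W \<subseteq> points M \<and>
     (\<forall>c\<in>atlas M. openin (Euclidean_space (mdim M)) (snd c ` (W \<inter> fst c))))"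

definition smooth_manifold :: "('p, 'x) manifold_scheme \<Rightarrow> bool" where
  "smooth_manifold M \<longleftrightarrow>
     (\<Union>c\<in>atlas M. fst c) = points M \<and>
     (\<forall>c\<in>atlas M. inj_on (snd c) (fst c) \<and>
        openin (Euclidean_space (mdim M)) (snd c ` fst c)) \<and>
     (\<forall>c\<in>atlas M. \<forall>d\<in>atlas M.
        openin (Euclidean_space (mdim M)) (snd c ` (fst c \<inter> fst d)) \<and>
        (\<forall>j<mdim M. Cinf (mdim M) (snd c ` (fst c \<inter> fst d)) (\<lambda>x. snd d (chart_inv c x) j))) \<and>
     (\<forall>p\<in>points M. chart_at M p \<in> atlas M \<and> p \<in> fst (chart_at M p)) \<and>
     Hausdorff_space (mtop M) \<and> second_countable (mtop M)"

definition smooth_fun :: "('p, 'x) manifold_scheme \<Rightarrow> 'p set \<Rightarrow> ('p \<Rightarrow> real) \<Rightarrow> bool" where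
  "smooth_fun M W f \<longleftrightarrow>
     (\<forall>c\<in>atlas M. Cinf (mdim M) (snd c ` (W \<inter> fst c)) (f \<circ> chart_inv c))"

definition smooth_fun_at :: "('p, 'x) manifold_scheme \<Rightarrow> 'p \<Rightarrow> ('p \<Rightarrow> real) \<Rightarrow> bool" where
  "smooth_fun_at M p f \<longleftrightarrow> (\<exists>W. openin (mtop M) W \<and> p \<in> W \<and> smooth_fun M W f)"

text \<open>The derivative \<open>v(f)\<close> of a function along the tangent vector \<open>v\<close> at \<open>p\<close>.\<close>

definition dirder :: "('p, 'x) manifold_scheme \<Rightarrow> 'p \<Rightarrow> coord \<Rightarrow> ('p \<Rightarrow> real) \<Rightarrow> real" where
  "dirder M p v f =
     (\<Sum>i<mdim M. partial i (f \<circ> chart_inv (chart_at M p)) (snd (chart_at M p) p) * v i)"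

text \<open>The components, with respect to the chart \<open>c\<close>, of the tangent vector \<open>v\<close> at \<open>p\<close>.\<close>

definition comp_in :: "('p, 'x) manifold_scheme \<Rightarrow> 'p chart \<Rightarrow> 'p \<Rightarrow> coord \<Rightarrow> coord" where
  "comp_in M c p v = (\<lambda>j. dirder M p v (\<lambda>q. snd c q j))"

definition smooth_field :: "('p, 'x) manifold_scheme \<Rightarrow> 'p set \<Rightarrow> ('p \<Rightarrow> coord) \<Rightarrow> bool" where
  "smooth_field M W X \<longleftrightarrow>
     (\<forall>p\<in>W. X p \<in> Rn (mdim M)) \<and>
     (\<forall>c\<in>atlas M. \<forall>j<mdim M. Cinf (mdim M) (snd c ` (W \<inter> fst c))
        ((\<lambda>q. comp_in M c q (X q) j) \<circ> chart_inv c))"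

definition smooth_field_at :: "('p, 'x) manifold_scheme \<Rightarrow> 'p \<Rightarrow> ('p \<Rightarrow> coord) \<Rightarrow> bool" where
  "smooth_field_at M p X \<longleftrightarrow> (\<exists>W. openin (mtop M) W \<and> p \<in> W \<and> smooth_field M W X)"

text \<open>The coordinate vector field \<open>\<partial>\<^sub>b\<close> of the chart \<open>c\<close>.\<close>

definition coord_field :: "('p, 'x) manifold_scheme \<Rightarrow> 'p chart \<Rightarrow> nat \<Rightarrow> 'p \<Rightarrow> coord" where
  "coord_field M c b q =
     (\<lambda>j. partial b (\<lambda>x. snd (chart_at M q) (chart_inv c x) j) (snd c q))"

definition bracket ::
  "('p, 'x) manifold_scheme \<Rightarrow> ('p \<Rightarrow> coord) \<Rightarrow> ('p \<Rightarrow> coord) \<Rightarrow> 'p \<Rightarrow> coord" where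
  "bracket M X Y p =
     (\<lambda>j. dirder M p (X p) (\<lambda>q. comp_in M (chart_at M p) q (Y q) j)
        - dirder M p (Y p) (\<lambda>q. comp_in M (chart_at M p) q (X q) j))"

text \<open>The differential at \<open>p\<close> of a map \<open>F\<close> from \<open>M\<close> to \<open>N\<close>, and the pullback of 1-forms.\<close>

definition differential ::
  "('p, 'x) manifold_scheme \<Rightarrow> ('q, 'y) manifold_scheme \<Rightarrow> ('p \<Rightarrow> 'q) \<Rightarrow> 'p \<Rightarrow> coord \<Rightarrow> coord" where
  "differential M N F p v = (\<lambda>j. dirder M p v (\<lambda>q. snd (chart_at N (F p)) (F q) j))"

definition pullback ::
  "('p, 'x) manifold_scheme \<Rightarrow> ('q, 'y) manifold_scheme \<Rightarrow> ('p \<Rightarrow> 'q) \<Rightarrow>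
   ('q \<Rightarrow> coord \<Rightarrow> real) \<Rightarrow> 'p \<Rightarrow> coord \<Rightarrow> real" where
  "pullback M N F \<beta> p v = \<beta> (F p) (differential M N F p v)"


section \<open>Connections and metrics\<close>

text \<open>
  \<open>nab p v Y\<close> is \<open>\<nabla>\<^sub>vY\<close> for a tangent vector \<open>v\<close> at \<open>p\<close> and a vector field \<open>Y\<close> that is smooth
  near \<open>p\<close>; other arguments are irrelevant. As a connection acts on local vector fields, the
  Leibniz rule for the indicator function of a neighbourhood of \<open>p\<close> shows that \<open>\<nabla>\<^sub>vY\<close> only depends
  on the germ of \<open>Y\<close> at \<open>p\<close>.
\<close>

type_synonym 'p conn = "'p \<Rightarrow> coord \<Rightarrow> ('p \<Rightarrow> coord) \<Rightarrow> coord"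

definition cov :: "'p conn \<Rightarrow> ('p \<Rightarrow> coord) \<Rightarrow> ('p \<Rightarrow> coord) \<Rightarrow> 'p \<Rightarrow> coord" where
  "cov nab X Y = (\<lambda>p. nab p (X p) Y)"

definition is_connection :: "('p, 'x) manifold_scheme \<Rightarrow> 'p conn \<Rightarrow> bool" where
  "is_connection M nab \<longleftrightarrow>
     (\<forall>p\<in>points M. \<forall>Y. smooth_field_at M p Y \<longrightarrow>
        (\<forall>v\<in>Rn (mdim M). nab p v Y \<in> Rn (mdim M) \<and>
           (\<forall>w\<in>Rn (mdim M). \<forall>a b.
              nab p (a \<cdot>\<^sub>c v + b \<cdot>\<^sub>c w) Y = a \<cdot>\<^sub>c nab p v Y + b \<cdot>\<^sub>c nab p w Y) \<and>
           (\<forall>Z. smooth_field_at M p Z \<longrightarrow> nab p v (Y + Z) = nab p v Y + nab p v Z) \<and>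
           (\<forall>f. smooth_fun_at M p f \<longrightarrow>
              nab p v (\<lambda>q. f q \<cdot>\<^sub>c Y q) = dirder M p v f \<cdot>\<^sub>c Y p + f p \<cdot>\<^sub>c nab p v Y))) \<and>
     (\<forall>W X Y. openin (mtop M) W \<longrightarrow> smooth_field M W X \<longrightarrow> smooth_field M W Y \<longrightarrow>
        smooth_field M W (cov nab X Y))"

definition torsionless :: "('p, 'x) manifold_scheme \<Rightarrow> 'p conn \<Rightarrow> bool" where
  "torsionless M nab \<longleftrightarrow>
     (\<forall>W X Y. openin (mtop M) W \<longrightarrow> smooth_field M W X \<longrightarrow> smooth_field M W Y \<longrightarrow>
        (\<forall>p\<in>W. cov nab X Y p - cov nab Y X p = bracket M X Y p))"

definition flat :: "('p, 'x) manifold_scheme \<Rightarrow> 'p conn \<Rightarrow> bool" where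
  "flat M nab \<longleftrightarrow>
     (\<forall>W X Y Z. openin (mtop M) W \<longrightarrow> smooth_field M W X \<longrightarrow> smooth_field M W Y \<longrightarrow>
        smooth_field M W Z \<longrightarrow>
        (\<forall>p\<in>W. cov nab X (cov nab Y Z) p - cov nab Y (cov nab X Z) p
                 - cov nab (bracket M X Y) Z p = 0))"

type_synonym 'p metr = "'p \<Rightarrow> coord \<Rightarrow> coord \<Rightarrow> real"

definition riemannian_metric :: "('p, 'x) manifold_scheme \<Rightarrow> 'p metr \<Rightarrow> bool" where
  "riemannian_metric M g \<longleftrightarrow>
     (\<forall>p\<in>points M.
        (\<forall>u\<in>Rn (mdim M). \<forall>v\<in>Rn (mdim M). \<forall>w\<in>Rn (mdim M). \<forall>a b.
           g p (a \<cdot>\<^sub>c u + b \<cdot>\<^sub>c v) w = a * g p u w + b * g p v w) \<and>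
        (\<forall>u\<in>Rn (mdim M). \<forall>v\<in>Rn (mdim M). g p u v = g p v u) \<and>
        (\<forall>u\<in>Rn (mdim M). u \<noteq> 0 \<longrightarrow> g p u u > 0)) \<and>
     (\<forall>W X Y. openin (mtop M) W \<longrightarrow> smooth_field M W X \<longrightarrow> smooth_field M W Y \<longrightarrow>
        smooth_fun M W (\<lambda>p. g p (X p) (Y p)))"

definition metric_connection :: "('p, 'x) manifold_scheme \<Rightarrow> 'p metr \<Rightarrow> 'p conn \<Rightarrow> bool" where
  "metric_connection M g nab \<longleftrightarrow>
     (\<forall>W X Y Z. openin (mtop M) W \<longrightarrow> smooth_field M W X \<longrightarrow> smooth_field M W Y \<longrightarrow>
        smooth_field M W Z \<longrightarrow>
        (\<forall>p\<in>W. dirder M p (X p) (\<lambda>q. g q (Y q) (Z q))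
                 = g p (cov nab X Y p) (Z p) + g p (Y p) (cov nab X Z p)))"

text \<open>
  The description is unique up to the irrelevant arguments of a connection.
\<close>

definition levi_civita :: "('p, 'x) manifold_scheme \<Rightarrow> 'p metr \<Rightarrow> 'p conn" where
  "levi_civita M g = (SOME D. is_connection M D \<and> torsionless M D \<and> metric_connection M g D)"

text \<open>For tensors, orthonormal bases of the tangent space do the work of orthonormal frames.\<close>

definition orthonormal_basis ::
  "('p, 'x) manifold_scheme \<Rightarrow> 'p metr \<Rightarrow> 'p \<Rightarrow> (nat \<Rightarrow> coord) \<Rightarrow> bool" where
  "orthonormal_basis M g p e \<longleftrightarrow>
     (\<forall>i<mdim M. e i \<in> Rn (mdim M)) \<and>
     (\<forall>i<mdim M. \<forall>j<mdim M. g p (e i) (e j) = (if i = j then 1 else 0))"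


section \<open>Affine-Riemann manifolds\<close>

record 'p affine_riemann = "'p manifold" +
  nabla :: "'p conn"
  met :: "'p metr"

definition affine_riemann_manifold :: "'p affine_riemann \<Rightarrow> bool" where
  "affine_riemann_manifold A \<longleftrightarrow>
     smooth_manifold A \<and> is_connection A (nabla A) \<and> flat A (nabla A) \<and>
     torsionless A (nabla A) \<and> riemannian_metric A (met A)"

text \<open>
  A \<open>(1,2)\<close>-tensor is a family of bilinear maps on the tangent spaces. The value of the difference
  tensor on \<open>v, w\<close> is \<open>D\<^sub>vY - \<nabla>\<^sub>vY\<close> for any local vector field \<open>Y\<close> extending \<open>w\<close>.
\<close>

type_synonym 'p tensor12 = "'p \<Rightarrow> coord \<Rightarrow> coord \<Rightarrow> coord"

definition on_fields :: "'p tensor12 \<Rightarrow> ('p \<Rightarrow> coord) \<Rightarrow> ('p \<Rightarrow> coord) \<Rightarrow> 'p \<Rightarrow> coord" where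
  "on_fields T X Y = (\<lambda>p. T p (X p) (Y p))"

definition difference_tensor :: "'p affine_riemann \<Rightarrow> 'p tensor12" where
  "difference_tensor A p v w = (THE z. \<forall>Y. smooth_field_at A p Y \<and> Y p = w \<longrightarrow>
     z = levi_civita A (met A) p v Y - nabla A p v Y)"

definition adjoint_tensor :: "'p affine_riemann \<Rightarrow> 'p tensor12 \<Rightarrow> 'p tensor12" where
  "adjoint_tensor A T p v w = (THE z. z \<in> Rn (mdim A) \<and>
     (\<forall>y\<in>Rn (mdim A). met A p z y = met A p w (T p v y)))"

definition trace_tensor :: "'p affine_riemann \<Rightarrow> 'p tensor12 \<Rightarrow> 'p \<Rightarrow> coord" where
  "trace_tensor A T p =
     (let e = (SOME e. orthonormal_basis A (met A) p e) in \<Sum>i<mdim A. T p (e i) (e i))"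

abbreviation gam :: "'p affine_riemann \<Rightarrow> 'p tensor12" where
  "gam A \<equiv> difference_tensor A"

abbreviation gam_adj :: "'p affine_riemann \<Rightarrow> 'p tensor12" where
  "gam_adj A \<equiv> adjoint_tensor A (difference_tensor A)"

definition koszul_alpha :: "'p affine_riemann \<Rightarrow> 'p \<Rightarrow> coord \<Rightarrow> real" where
  "koszul_alpha A p v = met A p (trace_tensor A (gam_adj A) p) v"

definition koszul_xi :: "'p affine_riemann \<Rightarrow> 'p \<Rightarrow> coord \<Rightarrow> real" where
  "koszul_xi A p v = met A p (trace_tensor A (gam A) p) v"


section \<open>The Lee form\<close>

text \<open>The value of \<open>\<nabla>\<^sub>v\<eta>\<close> on \<open>a, b\<close>, computed with any local vector fields extending \<open>a, b\<close>.\<close>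

definition cov_form2 ::
  "('p, 'x) manifold_scheme \<Rightarrow> 'p conn \<Rightarrow> ('p \<Rightarrow> coord \<Rightarrow> coord \<Rightarrow> real) \<Rightarrow>
   'p \<Rightarrow> coord \<Rightarrow> coord \<Rightarrow> coord \<Rightarrow> real" where
  "cov_form2 M nab \<eta> p v a b =
     (THE r. \<forall>X Y. smooth_field_at M p X \<and> X p = a \<and> smooth_field_at M p Y \<and> Y p = b \<longrightarrow>
        r = dirder M p v (\<lambda>q. \<eta> q (X q) (Y q)) - \<eta> p (nab p v X) b - \<eta> p a (nab p v Y))"

definition codifferential ::
  "('p, 'x) manifold_scheme \<Rightarrow> 'p metr \<Rightarrow> ('p \<Rightarrow> coord \<Rightarrow> coord \<Rightarrow> real) \<Rightarrow>
   'p \<Rightarrow> coord \<Rightarrow> real" where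
  "codifferential M g \<eta> p w =
     (let e = (SOME e. orthonormal_basis M g p e)
      in - (\<Sum>i<mdim M. cov_form2 M (levi_civita M g) \<eta> p (e i) (e i) w))"

definition fundamental_form ::
  "'p metr \<Rightarrow> ('p \<Rightarrow> coord \<Rightarrow> coord) \<Rightarrow> 'p \<Rightarrow> coord \<Rightarrow> coord \<Rightarrow> real" where
  "fundamental_form g J p v w = g p (J p v) w"

definition lee_form ::
  "('p, 'x) manifold_scheme \<Rightarrow> 'p metr \<Rightarrow> ('p \<Rightarrow> coord \<Rightarrow> coord) \<Rightarrow> 'p \<Rightarrow> coord \<Rightarrow> real" where
  "lee_form M g J p v = - codifferential M g (fundamental_form g J) p (J p v)"


section \<open>The tangent bundle and the canonical sequence\<close>

text \<open>
  \<open>Tangent p y\<close> is the tangent vector \<open>y\<close> at \<open>p\<close> as a point of the tangent bundle. This type is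
  closed under forming tangent bundles, so that all \<open>T\<^sup>kM\<close> live in it; a manifold with points in
  \<open>'a\<close> embeds via \<open>Base\<close>. The bundle projection is \<open>foot\<close>.
\<close>

datatype 'a itpoint = Base 'a | Tangent (foot: "'a itpoint") (fibre: coord)

text \<open>The identification of \<open>\<real>\<^sup>n \<times> \<real>\<^sup>n\<close> with \<open>\<real>\<^sup>2\<^sup>n\<close>.\<close>

definition join :: "nat \<Rightarrow> coord \<Rightarrow> coord \<Rightarrow> coord" where
  "join n x y = (\<lambda>i. if i < n then x i else y (i - n))"

definition fst_half :: "nat \<Rightarrow> coord \<Rightarrow> coord" where
  "fst_half n w = (\<lambda>i. if i < n then w i else 0)"

definition snd_half :: "nat \<Rightarrow> coord \<Rightarrow> coord" where
  "snd_half n w = (\<lambda>i. w (i + n))"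

definition tangent_chart ::
  "('a itpoint, 'x) manifold_scheme \<Rightarrow> 'a itpoint chart \<Rightarrow> 'a itpoint chart" where
  "tangent_chart M c =
     ({Tangent p y | p y. p \<in> fst c \<and> y \<in> Rn (mdim M)},
      \<lambda>u. join (mdim M) (snd c (foot u)) (comp_in M c (foot u) (fibre u)))"

definition tangent_manifold :: "('a itpoint, 'x) manifold_scheme \<Rightarrow> 'a itpoint manifold" where
  "tangent_manifold M =
     \<lparr> points = {Tangent p y | p y. p \<in> points M \<and> y \<in> Rn (mdim M)},
       mdim = 2 * mdim M,
       atlas = tangent_chart M ` atlas M,
       chart_at = (\<lambda>u. tangent_chart M (chart_at M (foot u))) \<rparr>"

text \<open>Christoffel symbols \<open>\<nabla>\<^sub>a \<partial>\<^sub>b\<close> at \<open>p\<close>, with respect to the preferred chart at \<open>p\<close>.\<close>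

definition christoffel :: "('p, 'x) manifold_scheme \<Rightarrow> 'p conn \<Rightarrow> 'p \<Rightarrow> nat \<Rightarrow> nat \<Rightarrow> coord" where
  "christoffel M nab p a b = nab p (unit_coord a) (coord_field M (chart_at M p) b)"

text \<open>
  Lifts of a tangent vector \<open>v\<close> to the point \<open>u\<close> of the tangent bundle. In the coordinates \<open>(x, y)\<close>
  of the tangent bundle, \<open>v\<^sup>h = v\<^sup>a \<partial>/\<partial>x\<^sup>a - \<Gamma>\<^sup>c\<^sub>a\<^sub>b v\<^sup>a y\<^sup>b \<partial>/\<partial>y\<^sup>c\<close> and \<open>v\<^sup>v = v\<^sup>c \<partial>/\<partial>y\<^sup>c\<close>.
\<close>

definition hlift :: "'a itpoint affine_riemann \<Rightarrow> 'a itpoint \<Rightarrow> coord \<Rightarrow> coord" where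
  "hlift A u v = join (mdim A) v
     (- (\<Sum>a<mdim A. \<Sum>b<mdim A. (v a * fibre u b) \<cdot>\<^sub>c christoffel A (nabla A) (foot u) a b))"

definition vlift :: "'a itpoint affine_riemann \<Rightarrow> 'a itpoint \<Rightarrow> coord \<Rightarrow> coord" where
  "vlift A u v = join (mdim A) 0 v"

definition hor :: "'a itpoint affine_riemann \<Rightarrow> ('a itpoint \<Rightarrow> coord) \<Rightarrow> 'a itpoint \<Rightarrow> coord" where
  "hor A X = (\<lambda>u. hlift A u (X (foot u)))"

definition ver :: "'a itpoint affine_riemann \<Rightarrow> ('a itpoint \<Rightarrow> coord) \<Rightarrow> 'a itpoint \<Rightarrow> coord" where
  "ver A X = (\<lambda>u. vlift A u (X (foot u)))"

text \<open>
  Every tangent vector \<open>w\<close> at \<open>u\<close> is uniquely \<open>a\<^sup>h + b\<^sup>v\<close>, where \<open>a\<close> and \<open>b\<close> are the following.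
\<close>

definition hpart :: "'a itpoint affine_riemann \<Rightarrow> 'a itpoint \<Rightarrow> coord \<Rightarrow> coord" where
  "hpart A u w = fst_half (mdim A) w"

definition vpart :: "'a itpoint affine_riemann \<Rightarrow> 'a itpoint \<Rightarrow> coord \<Rightarrow> coord" where
  "vpart A u w = snd_half (mdim A) (w - hlift A u (hpart A u w))"

definition tangent_J :: "'a itpoint affine_riemann \<Rightarrow> 'a itpoint \<Rightarrow> coord \<Rightarrow> coord" where
  "tangent_J A u w = vlift A u (hpart A u w) - hlift A u (vpart A u w)"

definition tangent_met :: "'a itpoint affine_riemann \<Rightarrow> 'a itpoint metr" where
  "tangent_met A u w z =
     met A (foot u) (hpart A u w) (hpart A u z) + met A (foot u) (vpart A u w) (vpart A u z)"

text \<open>Again unique up to the irrelevant arguments, as lifts of local frames are local frames.\<close>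

definition tangent_nabla :: "'a itpoint affine_riemann \<Rightarrow> 'a itpoint conn" where
  "tangent_nabla A = (SOME nab. is_connection (tangent_manifold A) nab \<and>
     (\<forall>W X Y. openin (mtop A) W \<longrightarrow> smooth_field A W X \<longrightarrow> smooth_field A W Y \<longrightarrow>
        (\<forall>u\<in>points (tangent_manifold A). foot u \<in> W \<longrightarrow>
           cov nab (hor A X) (hor A Y) u = hor A (cov (nabla A) X Y) u \<and>
           cov nab (hor A X) (ver A Y) u = ver A (cov (nabla A) X Y) u \<and>
           cov nab (ver A X) (hor A Y) u = 0 \<and>
           cov nab (ver A X) (ver A Y) u = 0)))"

definition tangent :: "'a itpoint affine_riemann \<Rightarrow> 'a itpoint affine_riemann" where
  "tangent A =
     \<lparr> points = points (tangent_manifold A),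
       mdim = mdim (tangent_manifold A),
       atlas = atlas (tangent_manifold A),
       chart_at = chart_at (tangent_manifold A),
       nabla = tangent_nabla A,
       met = tangent_met A \<rparr>"

definition iter_tangent :: "nat \<Rightarrow> 'a itpoint affine_riemann \<Rightarrow> 'a itpoint affine_riemann" where
  "iter_tangent k A = (tangent ^^ k) A"

text \<open>\<open>J\<^sub>k\<close> and the Lee form \<open>\<theta>\<^sub>k\<close> of \<open>(T\<^sup>kM, J\<^sub>k, g\<^sub>k)\<close>; meaningful for \<open>k \<ge> 1\<close>.\<close>

definition iter_J :: "nat \<Rightarrow> 'a itpoint affine_riemann \<Rightarrow> 'a itpoint \<Rightarrow> coord \<Rightarrow> coord" where
  "iter_J k A = tangent_J (iter_tangent (k - 1) A)"

definition iter_lee :: "nat \<Rightarrow> 'a itpoint affine_riemann \<Rightarrow> 'a itpoint \<Rightarrow> coord \<Rightarrow> real" where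
  "iter_lee k A = lee_form (iter_tangent k A) (met (iter_tangent k A)) (iter_J k A)"

text \<open>The composition \<open>\<pi>\<^sub>k\<^sup>* \<circ> \<dots> \<circ> \<pi>\<^sub>1\<^sup>*\<close>.\<close>

primrec iter_pullback ::
  "nat \<Rightarrow> 'a itpoint affine_riemann \<Rightarrow> ('a itpoint \<Rightarrow> coord \<Rightarrow> real) \<Rightarrow>
   'a itpoint \<Rightarrow> coord \<Rightarrow> real" where
  "iter_pullback 0 A \<beta> = \<beta>"
| "iter_pullback (Suc k) A \<beta> =
     pullback (iter_tangent (Suc k) A) (iter_tangent k A) foot (iter_pullback k A \<beta>)"

end

theory Submission
  imports Defs
begin

text \<open>
  Write \<open>D = \<nabla> + \<gamma>\<close>. That \<open>D\<close> is torsionless and metric means that \<open>\<gamma>\<close> is symmetric and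
  \<open>2\<langle>\<gamma>\<^sub>XY, Z\<rangle> = (\<nabla>\<^sub>Xg)(Y, Z) + (\<nabla>\<^sub>Yg)(X, Z) - (\<nabla>\<^sub>Zg)(X, Y)\<close>; solving this equation also
  constructs \<open>D\<close> from the torsionless connection \<open>\<nabla>\<close>.

  On \<open>TM\<close>, the connection \<open>\<nabla>\<^sup>1\<close> acts on the horizontal and on the vertical part of a vector field as
  the pullback of \<open>\<nabla>\<close> along the projection. It is torsionless because flatness of \<open>\<nabla>\<close> makes the
  horizontal distribution involutive, and \<open>\<nabla>\<^sup>1g\<^sub>1\<close> is \<open>\<nabla>g\<close> on each of the two parts, in the direction of
  the horizontal part. Inserting this into the formula above gives \<open>\<Gamma>\<close>; the adjoint and the traces,
  taken in a basis \<open>(e\<^sup>h, e\<^sup>v)\<close>, are then linear algebra.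

  Since \<open>\<nabla>\<^sup>1J = 0\<close>, the Lee form is \<open>\<theta>(v) = \<Sum> g\<^sub>1(\<Gamma>\<^sub>eJe - J\<Gamma>\<^sub>ee, Jv)\<close>. In the basis \<open>(e\<^sup>h, e\<^sup>v)\<close> the
  terms \<open>\<Gamma>\<^sub>eJe\<close> cancel by the symmetry of \<open>\<Gamma>\<close>, so that \<open>\<theta> = -\<xi>\<close>. The formulas for \<open>T\<^sup>kM\<close> follow by
  iterating \<open>\<xi>\<^sub>1 = \<pi>\<^sup>*(\<xi> - \<alpha>)\<close> and \<open>\<alpha>\<^sub>1 = 2\<pi>\<^sup>*\<alpha>\<close>.
\<close>

section \<open>Calculus in coordinate space\<close>

text \<open>The dimension \<open>2 ^ k * n\<close> is a term, so calculus takes place on sequences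
  vanishing from some index on; the chain rule and the symmetry of second derivatives are drawn from
  the mean value theorem in one coordinate. Components of vectors refer to a preferred chart that
  may jump from point to point. Values at one point are read off in that chart, whereas smoothness
  and derivatives need a fixed one, and much of the work compares the two.

  The Levi-Civita connection and \<nabla>^1 are given by descriptions only, the latter just on
  lifts. General fields are reached by expansion in a frame of lifts, which is legitimate for
  tensorial expressions only; hence torsion, curvature and the derivative of J are first shown to be
  tensorial.

  As for the constants: (\<nabla>_X g)(Y, Z) is the inner product of Z with \<gamma> plus its
  adjoint, applied to X and Y. With one vertical argument, a single term of the formula for \<Gamma>
  survives, whence 1/2; with two, only the subtracted term does, whence the minus sign. The
  horizontal and the vertical half of a basis contribute equally to the trace of the adjoint, whence
  2 and, by summation, 2^k - 1.\<close>

lemma Rn_iff: "x \<in> Rn n \<longleftrightarrow> (\<forall>i\<ge>n. x i = 0)"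
  by (simp add: topspace_Euclidean_space)

text \<open>Makes the coordinate space a subspace of all real sequences with the product topology,
  so that \<open>continuous_on\<close> and relative openness become available.\<close>

lemma Euclidean_space_eq_top_of_set: "Euclidean_space n = top_of_set {x. \<forall>i\<ge>n. x i = 0}"
  by (simp add: Euclidean_space_def euclidean_product_topology)

lemma openin_Rn_iff_open: "openin (Euclidean_space n) U \<longleftrightarrow> (\<exists>V. open V \<and> U = Rn n \<inter> V)"
  unfolding topspace_Euclidean_space unfolding Euclidean_space_eq_top_of_set openin_open by simp

lemma openin_Rn_trans:
  "openin (top_of_set V) W \<Longrightarrow> openin (Euclidean_space n) V \<Longrightarrow> openin (Euclidean_space n) W"
  unfolding Euclidean_space_eq_top_of_set by (rule openin_trans)

text \<open>A neighbourhood in the product topology may constrain any coordinate, but points of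
  \<open>Rn n\<close> agree from index \<open>n\<close> on. Only the first \<open>n\<close>
  coordinates count, and boxes with one common radius suffice. The estimates along coordinate lines
  below are phrased with such boxes.\<close>

lemma openin_Rn_iff_box:
  "openin (Euclidean_space n) U \<longleftrightarrow>
     U \<subseteq> Rn n \<and> (\<forall>x\<in>U. \<exists>e>0. \<forall>y\<in>Rn n. (\<forall>j<n. \<bar>y j - x j\<bar> < e) \<longrightarrow> y \<in> U)"
  (is "_ \<longleftrightarrow> ?R")
proof
  assume U: "openin (Euclidean_space n) U"
  then obtain V where V: "open V" "U = Rn n \<inter> V"
    unfolding openin_Rn_iff_open by auto
  have "\<exists>e>0. \<forall>y\<in>Rn n. (\<forall>j<n. \<bar>y j - x j\<bar> < e) \<longrightarrow> y \<in> U" if "x \<in> U" for x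
  proof -
    from that V have "x \<in> V" and xR: "x \<in> Rn n" by auto
    with V(1) obtain B where B: "x \<in> Pi\<^sub>E UNIV B" "\<And>i. open (B i)" "Pi\<^sub>E UNIV B \<subseteq> V"
      unfolding open_fun_def by (auto dest!: product_topology_open_contains_basis)
    have "\<exists>e>0. \<forall>s. \<bar>s - x i\<bar> < e \<longrightarrow> s \<in> B i" for i
      using B(1,2) unfolding open_dist dist_real_def by (auto simp: PiE_iff)
    then obtain e where e: "\<And>i. e i > 0" "\<And>i s. \<bar>s - x i\<bar> < e i \<Longrightarrow> s \<in> B i"
      by metis
    \<comment> \<open>Inserting 1 keeps the minimum over a nonempty set when
      \<open>n = 0\<close>.\<close>
    define d where "d = Min (insert 1 (e ` {..<n}))"
    have d: "d > 0" "\<And>i. i < n \<Longrightarrow> d \<le> e i"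
      using e(1) by (auto simp: d_def)
    have "y \<in> U" if y: "y \<in> Rn n" "\<forall>j<n. \<bar>y j - x j\<bar> < d" for y
    proof -
      have "y i \<in> B i" for i
      proof (cases "i < n")
        case True
        with y(2) d(2) e(2) show ?thesis by (meson less_le_trans)
      next
        case False
        then have "y i = x i" using y(1) xR by (simp add: Rn_iff)
        then show ?thesis using B(1) by (auto simp: PiE_iff)
      qed
      with B(3) V(2) y(1) show ?thesis by (auto simp: PiE_iff)
    qed
    with d(1) show ?thesis by blast
  qed
  with U openin_subset show ?R by blast
next
  assume R: ?R
  show "openin (Euclidean_space n) U"
  proof (subst openin_subopen, intro ballI)
    fix x assume x: "x \<in> U"
    with R obtain e where e: "e > 0" "\<forall>y\<in>Rn n. (\<forall>j<n. \<bar>y j - x j\<bar> < e) \<longrightarrow> y \<in> U" by blast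
    have "{y. \<forall>j\<in>{..<n}. \<bar>y j - x j\<bar> < e} = (\<Inter>j\<in>{..<n}. {y. \<bar>y j - x j\<bar> < e})" by auto
    moreover have "open {y::coord. \<bar>y j - x j\<bar> < e}" for j
      by (intro open_Collect_less continuous_intros continuous_on_product_coordinates)
    ultimately have "open {y. \<forall>j\<in>{..<n}. \<bar>y j - x j\<bar> < e}"
      by (metis (no_types, lifting) finite_lessThan open_INT)
    then have "openin (Euclidean_space n) (Rn n \<inter> {y. \<forall>j\<in>{..<n}. \<bar>y j - x j\<bar> < e})"
      unfolding openin_Rn_iff_open by blast
    moreover have "x \<in> Rn n" using R x by auto
    ultimately show "\<exists>T. openin (Euclidean_space n) T \<and> x \<in> T \<and> T \<subseteq> U"
      using e by (intro exI[of _ "Rn n \<inter> {y. \<forall>j\<in>{..<n}. \<bar>y j - x j\<bar> < e}"]) auto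
  qed
qed

lemma openin_Rn_boxE:
  assumes "openin (Euclidean_space n) U" "x \<in> U"
  obtains e where "e > 0" "\<And>y. y \<in> Rn n \<Longrightarrow> (\<And>j. j < n \<Longrightarrow> \<bar>y j - x j\<bar> < e) \<Longrightarrow> y \<in> U"
  using assms unfolding openin_Rn_iff_box by blast

lemma openin_Rn_subset: "openin (Euclidean_space n) U \<Longrightarrow> x \<in> U \<Longrightarrow> x \<in> Rn n"
  using openin_subset by blast

lemma fun_upd_in_Rn [simp]: "x \<in> Rn n \<Longrightarrow> i < n \<Longrightarrow> x(i := t) \<in> Rn n"
  by (simp add: Rn_iff)

lemma continuous_map_Rn_iff:
  assumes "openin (Euclidean_space n) U"
  shows "continuous_map (subtopology (Euclidean_space n) U) euclideanreal f \<longleftrightarrow> continuous_on U f"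
proof -
  have "subtopology (Euclidean_space n) U = top_of_set U"
    using openin_subset[OF assms] unfolding topspace_Euclidean_space
    by (simp add: Euclidean_space_eq_top_of_set subtopology_subtopology inf_absorb2)
  then show ?thesis by simp
qed

text \<open>Moving one coordinate slightly stays in an open set, so value and existence of a partial
  derivative depend only on the function near the point.\<close>

lemma eventually_fun_upd_in:
  assumes "openin (Euclidean_space n) U" "x \<in> U" "i < n"
  shows "\<forall>\<^sub>F t in nhds (x i). x(i := t) \<in> U"
proof -
  obtain e where e: "e > 0" "\<And>y. y \<in> Rn n \<Longrightarrow> (\<And>j. j < n \<Longrightarrow> \<bar>y j - x j\<bar> < e) \<Longrightarrow> y \<in> U"
    using openin_Rn_boxE[OF assms(1,2)] by metis
  have "x(i := t) \<in> U" if "dist t (x i) < e" for t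
    using that e(1) assms openin_Rn_subset by (intro e(2)) (auto simp: dist_real_def)
  then show ?thesis using e(1) unfolding eventually_nhds_metric by blast
qed

lemma continuous_on_boxE:
  assumes "continuous_on U f" "openin (Euclidean_space n) U" "x \<in> U" "(\<epsilon>::real) > 0"
  obtains e where "e > 0"
    "\<And>y. y \<in> Rn n \<Longrightarrow> (\<And>j. j < n \<Longrightarrow> \<bar>y j - x j\<bar> < e) \<Longrightarrow> y \<in> U \<and> \<bar>f y - f x\<bar> < \<epsilon>"
proof -
  have "openin (top_of_set U) (U \<inter> f -` ball (f x) \<epsilon>)"
    by (rule continuous_openin_preimage_gen[OF assms(1) open_ball])
  then have "openin (Euclidean_space n) (U \<inter> f -` ball (f x) \<epsilon>)"
    using assms(2) by (rule openin_Rn_trans)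
  moreover have "x \<in> U \<inter> f -` ball (f x) \<epsilon>" using assms by auto
  ultimately obtain e where "e > 0"
      "\<And>y. y \<in> Rn n \<Longrightarrow> (\<And>j. j < n \<Longrightarrow> \<bar>y j - x j\<bar> < e) \<Longrightarrow> y \<in> U \<inter> f -` ball (f x) \<epsilon>"
    using openin_Rn_boxE by metis
  then show ?thesis
    by (intro that[of e]) (auto simp: dist_real_def abs_minus_commute)
qed

lemma partial_cong:
  assumes "openin (Euclidean_space n) U" "x \<in> U" "i < n" "\<And>y. y \<in> U \<Longrightarrow> f y = g y"
  shows "partial i f x = partial i g x"
  unfolding partial_def
proof (rule deriv_cong_ev)
  show "\<forall>\<^sub>F t in nhds (x i). f (x(i := t)) = g (x(i := t))"
    using eventually_fun_upd_in[OF assms(1-3)] by eventually_elim (rule assms(4))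
qed simp

lemma has_derivative_fun_upd_cong:
  assumes "openin (Euclidean_space n) U" "x \<in> U" "i < n" "\<And>y. y \<in> U \<Longrightarrow> f y = g y"
    "((\<lambda>t. f (x(i := t))) has_real_derivative D) (at (x i))"
  shows "((\<lambda>t. g (x(i := t))) has_real_derivative D) (at (x i))"
proof -
  have "\<forall>\<^sub>F t in nhds (x i). f (x(i := t)) = g (x(i := t))"
    using eventually_fun_upd_in[OF assms(1-3)] by eventually_elim (rule assms(4))
  then show ?thesis using assms(5) DERIV_cong_ev[OF refl _ refl] by metis
qed

subsection \<open>Functions of class \<open>C\<^sup>k\<close>\<close>

lemma Ck_0_iff: "openin (Euclidean_space n) U \<Longrightarrow> Ck 0 n U f \<longleftrightarrow> continuous_on U f"
  by (simp add: continuous_map_Rn_iff)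

lemma Ck_continuous: "openin (Euclidean_space n) U \<Longrightarrow> Ck k n U f \<Longrightarrow> continuous_on U f"
  by (cases k) (auto simp: continuous_map_Rn_iff)

lemma Ck_Suc_partial: "Ck (Suc k) n U f \<Longrightarrow> i < n \<Longrightarrow> Ck k n U (partial i f)"
  by simp

lemma Ck_Suc_has_derivative:
  assumes "Ck (Suc k) n U f" "i < n" "x \<in> U"
  shows "((\<lambda>t. f (x(i := t))) has_real_derivative partial i f x) (at (x i))"
  using assms by (simp add: partial_def DERIV_deriv_iff_real_differentiable)

lemma Ck_cong:
  assumes "openin (Euclidean_space n) U" "\<And>x. x \<in> U \<Longrightarrow> f x = g x" "Ck k n U f"
  shows "Ck k n U g"
  using assms(2,3)
proof (induction k arbitrary: f g)
  case 0
  then show ?case using assms(1) by (simp add: continuous_map_Rn_iff cong: continuous_on_cong)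
next
  case (Suc k)
  have "Ck k n U (partial i g)" if "i < n" for i
  proof (rule Suc.IH[of "partial i f"])
    show "partial i f x = partial i g x" if "x \<in> U" for x
      by (rule partial_cong[OF assms(1) that \<open>i < n\<close> Suc.prems(1)])
    show "Ck k n U (partial i f)" using Suc.prems(2) \<open>i < n\<close> by simp
  qed
  moreover have "(\<lambda>t. g (x(i := t))) differentiable at (x i)" if "i < n" "x \<in> U" for x i
    unfolding real_differentiable_def
    by (rule exI, rule has_derivative_fun_upd_cong[OF assms(1) that(2,1) Suc.prems(1)
        Ck_Suc_has_derivative[OF Suc.prems(2) that]])
  moreover have "continuous_on U g"
    using Ck_continuous[OF assms(1) Suc.prems(2)] Suc.prems(1) by (simp cong: continuous_on_cong)
  ultimately show ?case using assms(1) by (simp add: continuous_map_Rn_iff)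
qed

text \<open>The candidates \<open>g i\<close> need to be right on \<open>U\<close> only;
  \<open>Ck_cong\<close> carries their regularity over to \<open>partial i f\<close>, whose values
  off \<open>U\<close> are uncontrolled.\<close>

lemma Ck_SucI:
  assumes "openin (Euclidean_space n) U" "continuous_on U f"
    "\<And>i x. i < n \<Longrightarrow> x \<in> U \<Longrightarrow> ((\<lambda>t. f (x(i := t))) has_real_derivative g i x) (at (x i))"
    "\<And>i. i < n \<Longrightarrow> Ck k n U (g i)"
  shows "Ck (Suc k) n U f"
proof -
  have "partial i f x = g i x" if "i < n" "x \<in> U" for i x
    using assms(3)[OF that] by (simp add: partial_def DERIV_imp_deriv)
  then have "Ck k n U (partial i f)" if "i < n" for i
    using that assms by (intro Ck_cong[OF assms(1) _ assms(4)[OF that]]) auto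
  then show ?thesis using assms by (auto simp: continuous_map_Rn_iff real_differentiable_def)
qed

lemma Ck_mono:
  assumes "openin (Euclidean_space n) U" "openin (Euclidean_space n) V" "V \<subseteq> U" "Ck k n U f"
  shows "Ck k n V f"
  using assms(4)
proof (induction k arbitrary: f)
  case 0
  then show ?case using assms continuous_on_subset by (auto simp: continuous_map_Rn_iff)
next
  case (Suc k)
  then show ?case using assms continuous_on_subset by (auto simp: continuous_map_Rn_iff)
qed

lemma continuous_on_local:
  assumes "openin (Euclidean_space n) U"
    "\<And>x. x \<in> U \<Longrightarrow> \<exists>V. openin (Euclidean_space n) V \<and> x \<in> V \<and> continuous_on V (f::coord \<Rightarrow> real)"
  shows "continuous_on U f"
  unfolding continuous_on_eq_continuous_within
proof
  fix x assume x: "x \<in> U"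
  then obtain V where V: "openin (Euclidean_space n) V" "x \<in> V" "continuous_on V f"
    using assms(2) by blast
  obtain S where S: "open S" "V = Rn n \<inter> S"
    using V(1) unfolding openin_Rn_iff_open by auto
  have "continuous (at x within V) f" using V continuous_on_eq_continuous_within by blast
  \<comment> \<open>Near \<open>x\<close> the set \<open>U\<close> lies inside the relatively open
    set \<open>V\<close>, so continuity within \<open>V\<close> is enough.\<close>
  moreover have "at x within U \<le> at x within V"
  proof -
    have "at x within U = at x within (U \<inter> S)"
      using S V(2) by (intro at_within_nhd[of x S]) auto
    also have "\<dots> \<le> at x within V"
      using S openin_subset[OF assms(1)] by (intro at_le) auto
    finally show ?thesis .
  qed
  ultimately show "continuous (at x within U) f" unfolding continuous_within
    using filterlim_mono by blast
qed

text \<open>This is what allows pointwise notions of smoothness: regularity on an open set can be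
  checked near each of its points, because \<open>partial i f\<close> does not refer to the
  set.\<close>

lemma Ck_local:
  assumes "openin (Euclidean_space n) U"
    "\<And>x. x \<in> U \<Longrightarrow> \<exists>V. openin (Euclidean_space n) V \<and> x \<in> V \<and> Ck k n V f"
  shows "Ck k n U f"
  using assms(2)
proof (induction k arbitrary: f)
  case 0
  then show ?case
    using assms(1) continuous_on_local[OF assms(1)] Ck_0_iff by metis
next
  case (Suc k)
  have "continuous_on U f"
    using Suc.prems by (intro continuous_on_local[OF assms(1)]) (metis Ck_continuous)
  moreover have "Ck k n U (partial i f)" if "i < n" for i
    using Suc.prems that by (intro Suc.IH) (metis Ck_Suc_partial)
  moreover have "(\<lambda>t. f (x(i := t))) differentiable at (x i)" if "i < n" "x \<in> U" for x i
    using Suc.prems[OF that(2)] that(1) by auto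
  ultimately show ?case using assms(1) by (simp add: continuous_map_Rn_iff)
qed

lemma Ck_Suc_lower: "openin (Euclidean_space n) U \<Longrightarrow> Ck (Suc k) n U f \<Longrightarrow> Ck k n U f"
proof (induction k arbitrary: f)
  case 0 then show ?case by simp
next
  case (Suc k)
  then show ?case by simp
qed

section \<open>Closure of C^k under arithmetic operations\<close>

lemma Ck_const: "openin (Euclidean_space n) U \<Longrightarrow> Ck k n U (\<lambda>x. a)"
proof (induction k arbitrary: a)
  case 0 then show ?case by simp
next
  case (Suc k)
  show ?case by (rule Ck_SucI[OF Suc.prems, where g="\<lambda>i x. 0"]) (use Suc in auto)
qed

lemma Ck_proj: "openin (Euclidean_space n) U \<Longrightarrow> Ck k n U (\<lambda>x. x j)"
proof (cases k)
  case 0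
  assume "openin (Euclidean_space n) U"
  show ?thesis unfolding 0 Ck_0_iff[OF \<open>openin (Euclidean_space n) U\<close>]
    by (rule continuous_on_product_then_coordinatewise[OF continuous_on_id])
next
  case (Suc k')
  assume U: "openin (Euclidean_space n) U"
  show ?thesis unfolding Suc
  proof (rule Ck_SucI[OF U, where g="\<lambda>i x. if i = j then 1 else 0"])
    show "continuous_on U (\<lambda>x. x j)"
      by (rule continuous_on_product_then_coordinatewise[OF continuous_on_id])
  qed (use U Ck_const in \<open>auto\<close>)
qed

lemma Ck_add:
  "openin (Euclidean_space n) U \<Longrightarrow> Ck k n U f \<Longrightarrow> Ck k n U g \<Longrightarrow> Ck k n U (\<lambda>x. f x + g x)"
proof (induction k arbitrary: f g)
  case 0 then show ?case by (simp add: continuous_map_Rn_iff continuous_on_add)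
next
  case (Suc k)
  show ?case
  proof (rule Ck_SucI[OF Suc.prems(1), where g="\<lambda>i x. partial i f x + partial i g x"])
    show "continuous_on U (\<lambda>x. f x + g x)"
      by (intro continuous_on_add Ck_continuous[OF Suc.prems(1)]) (rule Suc.prems)+
  next
    fix i x assume "i < n" "x \<in> U"
    then show "((\<lambda>t. f (x(i := t)) + g (x(i := t))) has_real_derivative
        partial i f x + partial i g x) (at (x i))"
      by (intro DERIV_add Ck_Suc_has_derivative[OF Suc.prems(2)] Ck_Suc_has_derivative[OF Suc.prems(3)])
  next
    fix i assume "i < n"
    then show "Ck k n U (\<lambda>x. partial i f x + partial i g x)"
      using Suc.prems by (intro Suc.IH) simp_all
  qed
qed

lemma Ck_mult:
  "openin (Euclidean_space n) U \<Longrightarrow> Ck k n U f \<Longrightarrow> Ck k n U g \<Longrightarrow> Ck k n U (\<lambda>x. f x * g x)"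
proof (induction k arbitrary: f g)
  case 0 then show ?case by (simp add: continuous_map_Rn_iff continuous_on_mult)
next
  case (Suc k)
  show ?case
  proof (rule Ck_SucI[OF Suc.prems(1), where g="\<lambda>i x. partial i f x * g x + partial i g x * f x"])
    fix i x assume ix: "i < n" "x \<in> U"
    show "((\<lambda>t. f (x(i := t)) * g (x(i := t))) has_real_derivative
        partial i f x * g x + partial i g x * f x) (at (x i))"
      using DERIV_mult[OF Ck_Suc_has_derivative[OF Suc.prems(2) ix] Ck_Suc_has_derivative[OF Suc.prems(3) ix]]
      unfolding fun_upd_triv .
  next
    show "continuous_on U (\<lambda>x. f x * g x)"
      by (intro continuous_on_mult Ck_continuous[OF Suc.prems(1)]) (rule Suc.prems)+
  next
    fix i assume "i < n"
    then show "Ck k n U (\<lambda>x. partial i f x * g x + partial i g x * f x)"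
      using Suc.prems Ck_Suc_lower[OF Suc.prems(1)] by (intro Ck_add Suc.IH) simp_all
  qed
qed

lemma Ck_sum:
  assumes "openin (Euclidean_space n) U" "\<And>a. a \<in> S \<Longrightarrow> Ck k n U (f a)"
  shows "Ck k n U (\<lambda>x. \<Sum>a\<in>S. f a x)"
  using assms(2)
proof (induction S rule: infinite_finite_induct)
  case (insert a S)
  then show ?case using Ck_add[OF assms(1)] by simp
qed (simp_all add: Ck_const[OF assms(1)])

text \<open>The derivative contains the reciprocal itself, but only to the order already covered by
  the induction hypothesis.\<close>

lemma Ck_inverse:
  assumes "openin (Euclidean_space n) U" "\<And>x. x \<in> U \<Longrightarrow> f x \<noteq> 0" "Ck k n U f"
  shows "Ck k n U (\<lambda>x. inverse (f x))"
  using assms(3)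
proof (induction k)
  case 0 then show ?case using assms by (simp add: continuous_map_Rn_iff continuous_on_inverse)
next
  case (Suc k)
  have inv: "Ck k n U (\<lambda>x. inverse (f x))"
    using Suc Ck_Suc_lower[OF assms(1)] by blast
  show ?case
  proof (rule Ck_SucI[OF assms(1), where g="\<lambda>i x. (-1) * (inverse (f x) * partial i f x * inverse (f x))"])
    show "continuous_on U (\<lambda>x. inverse (f x))"
      using assms(2) by (intro continuous_on_inverse Ck_continuous[OF assms(1) Suc.prems]) auto
  next
    fix i x assume ix: "i < n" "x \<in> U"
    show "((\<lambda>t. inverse (f (x(i := t)))) has_real_derivative
        (-1) * (inverse (f x) * partial i f x * inverse (f x))) (at (x i))"
      using DERIV_inverse'[OF Ck_Suc_has_derivative[OF Suc.prems ix]] assms(2)[OF ix(2)]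
      unfolding fun_upd_triv mult_minus1 by blast
  next
    fix i assume "i < n"
    then show "Ck k n U (\<lambda>x. (-1) * (inverse (f x) * partial i f x * inverse (f x)))"
      using Suc.prems by (intro Ck_mult[OF assms(1)] Ck_const[OF assms(1)] inv) simp
  qed
qed

text \<open>Nothing is assumed about the order of \<open>a\<close> and \<open>b\<close>: in the
  chain rule the increment of a coordinate has unknown sign and may vanish.\<close>

lemma coord_MVT:
  assumes "\<And>s. min a b \<le> s \<Longrightarrow> s \<le> max a b \<Longrightarrow> y(m := s) \<in> U"
    "Ck (Suc k) n U f" "m < n"
  shows "\<exists>s. min a b \<le> s \<and> s \<le> max a b \<and>
    f (y(m := b)) - f (y(m := a)) = partial m f (y(m := s)) * (b - a)"
proof -
  have D: "((\<lambda>t. f (y(m := t))) has_real_derivative partial m f (y(m := s))) (at s)"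
    if "min a b \<le> s" "s \<le> max a b" for s
    using Ck_Suc_has_derivative[OF assms(2,3) assms(1)[OF that]] by simp
  consider "a < b" | "a = b" | "b < a" by linarith
  then show ?thesis
  proof cases
    case 1
    then obtain z where "z > a" "z < b"
      "f (y(m := b)) - f (y(m := a)) = (b - a) * partial m f (y(m := z))"
      using MVT2[of a b "\<lambda>t. f (y(m := t))" "\<lambda>s. partial m f (y(m := s))"] D by auto
    then show ?thesis using 1 by (intro exI[of _ z]) (auto simp: algebra_simps)
  next
    case 2 then show ?thesis by auto
  next
    case 3
    then obtain z where "z > b" "z < a"
      "f (y(m := a)) - f (y(m := b)) = (a - b) * partial m f (y(m := z))"
      using MVT2[of b a "\<lambda>t. f (y(m := t))" "\<lambda>s. partial m f (y(m := s))"] D by auto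
    then show ?thesis using 3 by (intro exI[of _ z]) (auto simp: algebra_simps)
  qed
qed

text \<open>The passage from \<open>\<phi> t0\<close> to \<open>\<phi> t\<close> is broken into
  \<open>n\<close> moves along single coordinates. The mean value theorem turns each move into a
  partial derivative at an intermediate point, and continuity of the partial derivatives gives the
  limit.\<close>

lemma chain_rule:
  fixes \<phi> :: "real \<Rightarrow> coord"
  assumes V: "openin (Euclidean_space n) V" and f: "Ck (Suc k) n V f" and "\<phi> t0 \<in> V"
    and \<phi>': "\<And>j. j < n \<Longrightarrow> ((\<lambda>t. \<phi> t j) has_real_derivative d j) (at t0)"
    and R: "\<forall>\<^sub>F t in nhds t0. \<phi> t \<in> Rn n"
  shows "((\<lambda>t. f (\<phi> t)) has_real_derivative (\<Sum>j<n. partial j f (\<phi> t0) * d j)) (at t0)"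
proof -
  define x where "x = \<phi> t0"
  \<comment> \<open>\<open>h m t\<close> takes its first \<open>m\<close> coordinates from
    \<open>\<phi> t\<close> and the others from \<open>x\<close>, so it runs from \<open>x\<close>
    at \<open>m = 0\<close> to \<open>\<phi> t\<close> at \<open>m = n\<close>.\<close>
  define h where "h m t = (\<lambda>i. if i < m then \<phi> t i else x i)" for m t
  have x: "x \<in> V" "x \<in> Rn n" using assms openin_Rn_subset by (auto simp: x_def)
  have near: "\<forall>\<^sub>F t in nhds t0. \<phi> t \<in> Rn n \<and> (\<forall>j<n. \<bar>\<phi> t j - x j\<bar> < e)" if "e > 0" for e
  proof -
    have "\<forall>\<^sub>F t in nhds t0. \<forall>j\<in>{..<n}. \<bar>\<phi> t j - x j\<bar> < e"
    proof (rule eventually_ball_finite, simp, intro ballI)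
      fix j assume "j \<in> {..<n}"
      then have "isCont (\<lambda>t. \<phi> t j) t0" by (intro DERIV_isCont[OF \<phi>']) simp
      then have "((\<lambda>t. \<phi> t j) \<longlongrightarrow> x j) (nhds t0)"
        unfolding x_def isCont_def using tendsto_at_iff_tendsto_nhds[of "\<lambda>t. \<phi> t j"] by simp
      then show "\<forall>\<^sub>F t in nhds t0. \<bar>\<phi> t j - x j\<bar> < e"
        using \<open>e > 0\<close> by (auto dest: tendstoD simp: dist_real_def)
    qed
    with R show ?thesis by eventually_elim auto
  qed
  have step: "((\<lambda>t. f (h (Suc m) t) - f (h m t)) has_real_derivative partial m f x * d m) (at t0)"
    if m: "m < n" for m
  proof -
    obtain e0 where e0: "e0 > 0" "\<And>y. y \<in> Rn n \<Longrightarrow> (\<And>j. j < n \<Longrightarrow> \<bar>y j - x j\<bar> < e0) \<Longrightarrow> y \<in> V"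
      using openin_Rn_boxE[OF V x(1)] by metis
    have hS: "h (Suc m) t = (h m t)(m := \<phi> t m)" "h m t = (h m t)(m := x m)" for t
      by (auto simp: h_def fun_eq_iff)
    have between: "(h m t)(m := s) \<in> Rn n \<and> (\<forall>j<n. \<bar>((h m t)(m := s)) j - x j\<bar> < e)"
      if "\<phi> t \<in> Rn n \<and> (\<forall>j<n. \<bar>\<phi> t j - x j\<bar> < e)" "min (x m) (\<phi> t m) \<le> s" "s \<le> max (x m) (\<phi> t m)"
        "e > 0" for t s e
    proof -
      have "\<bar>\<phi> t m - x m\<bar> < e" using that m by auto
      then have "\<bar>s - x m\<bar> < e" using that by (auto simp: min_def max_def split: if_splits)
      moreover have "h m t i = 0" if "i \<ge> n" for i
        using that x(2) m by (auto simp: h_def Rn_iff)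
      ultimately show ?thesis using that x m by (auto simp: h_def Rn_iff)
    qed
    define Q where "Q t s \<longleftrightarrow> min (x m) (\<phi> t m) \<le> s \<and> s \<le> max (x m) (\<phi> t m) \<and>
      f (h (Suc m) t) - f (h m t) = partial m f ((h m t)(m := s)) * (\<phi> t m - x m)" for t s
    \<comment> \<open>Only existence of an intermediate value is known; any selection works, since
      the intermediate points are squeezed towards \<open>x\<close>.\<close>
    define p where "p t = (SOME s. Q t s)" for t
    have Qp: "\<forall>\<^sub>F t in nhds t0. Q t (p t)"
      using near[OF e0(1)]
    proof eventually_elim
      case (elim t)
      have "\<exists>s. Q t s"
        unfolding Q_def hS(1)
        using coord_MVT[where U=V and y="h m t" and a="x m" and b="\<phi> t m", OF _ f m]
          between[OF elim] e0 hS(2) by metis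
      then show ?case unfolding p_def by (rule someI_ex)
    qed
    define q where "q t = partial m f ((h m t)(m := p t))" for t
    have contq: "(q \<longlongrightarrow> partial m f x) (nhds t0)"
    proof (rule tendstoI)
      fix \<epsilon> :: real assume "\<epsilon> > 0"
      then obtain e where e: "e > 0"
        "\<And>y. y \<in> Rn n \<Longrightarrow> (\<And>j. j < n \<Longrightarrow> \<bar>y j - x j\<bar> < e) \<Longrightarrow> y \<in> V \<and> \<bar>partial m f y - partial m f x\<bar> < \<epsilon>"
        using continuous_on_boxE[OF Ck_continuous[OF V Ck_Suc_partial[OF f m]] V x(1)] by metis
      show "\<forall>\<^sub>F t in nhds t0. dist (q t) (partial m f x) < \<epsilon>"
        using near[OF e(1)] Qp
      proof eventually_elim
        case (elim t)
        then show ?case using between[OF elim(1) _ _ e(1)] e(2)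
          unfolding Q_def q_def dist_real_def by metis
      qed
    qed
    have "((\<lambda>t. (f (h (Suc m) t) - f (h m t)) / (t - t0)) \<longlongrightarrow> partial m f x * d m) (at t0)"
    proof -
      have "((\<lambda>t. q t * ((\<phi> t m - x m) / (t - t0))) \<longlongrightarrow> partial m f x * d m) (at t0)"
        using \<phi>'[OF m] contq unfolding has_field_derivative_iff x_def
        by (intro tendsto_mult) (auto intro: tendsto_mono[OF at_within_le_nhds])
      moreover have "\<forall>\<^sub>F t in at t0. q t * ((\<phi> t m - x m) / (t - t0)) = (f (h (Suc m) t) - f (h m t)) / (t - t0)"
      proof -
        have "\<forall>\<^sub>F t in at t0. Q t (p t)"
          using Qp eventually_nhds_conv_at by blast
        then show ?thesis by eventually_elim (auto simp: Q_def q_def)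
      qed
      ultimately show ?thesis by (rule Lim_transform_eventually)
    qed
    moreover have "h (Suc m) t0 = x" "h m t0 = x" by (auto simp: h_def x_def)
    ultimately show ?thesis unfolding has_field_derivative_iff by simp
  qed
  have "((\<lambda>t. \<Sum>m<n. f (h (Suc m) t) - f (h m t)) has_real_derivative (\<Sum>m<n. partial m f x * d m)) (at t0)"
    by (rule DERIV_sum) (use step in auto)
  moreover have "(\<Sum>m<n. f (h (Suc m) t) - f (h m t)) = f (h n t) - f (h 0 t)" for t
    by (rule sum_lessThan_telescope)
  moreover have "h 0 t = x" for t by (simp add: h_def)
  ultimately have "((\<lambda>t. f (h n t) - f x + f x) has_real_derivative (\<Sum>m<n. partial m f x * d m) + 0) (at t0)"
    by (intro DERIV_add) auto
  then have *: "((\<lambda>t. f (h n t)) has_real_derivative (\<Sum>m<n. partial m f x * d m)) (at t0)" by simp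
  have "\<forall>\<^sub>F t in nhds t0. f (h n t) = f (\<phi> t)"
    using R
  proof eventually_elim
    case (elim t)
    then have "h n t = \<phi> t" using x(2) by (auto simp: h_def Rn_iff fun_eq_iff)
    then show ?case by simp
  qed
  with * show ?thesis unfolding x_def[symmetric] using DERIV_cong_ev[OF refl _ refl] by metis
qed

text \<open>The induction is over all \<open>f\<close> at once: by the chain rule the partial
  derivatives contain the compositions of \<open>\<phi>\<close> with the partial derivatives of
  \<open>f\<close>.\<close>

lemma Ck_compose:
  assumes U: "openin (Euclidean_space m) U" and V: "openin (Euclidean_space n) V"
    and \<phi>V: "\<And>x. x \<in> U \<Longrightarrow> \<phi> x \<in> V" and \<phi>: "\<And>j. j < n \<Longrightarrow> Ck k m U (\<lambda>x. \<phi> x j)"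
    and f: "Ck k n V f"
  shows "Ck k m U (\<lambda>x. f (\<phi> x))"
  using \<phi> f
proof (induction k arbitrary: f)
  case 0
  have "continuous_on U (\<lambda>x. \<phi> x j)" for j
  proof (cases "j < n")
    case True then show ?thesis using 0 U Ck_0_iff by blast
  next
    case False
    have "\<phi> x j = 0" if "x \<in> U" for x
      using False \<phi>V[OF that] openin_Rn_subset[OF V] by (auto simp: Rn_iff)
    then show ?thesis by (simp cong: continuous_on_cong)
  qed
  then have "continuous_on U \<phi>" by (intro continuous_on_coordinatewise_then_product)
  then have "continuous_on U (f \<circ> \<phi>)"
    using 0 V \<phi>V by (intro continuous_on_compose) (auto simp: Ck_0_iff simp del: Ck.simps intro: continuous_on_subset)
  then show ?case using U by (simp add: Ck_0_iff o_def del: Ck.simps)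
next
  case (Suc k)
  have lower: "Ck k m U (\<lambda>x. \<phi> x j)" if "j < n" for j
    using Suc.prems(1)[OF that] Ck_Suc_lower[OF U] by blast
  have IH: "Ck k m U (\<lambda>x. g (\<phi> x))" if "Ck k n V g" for g
    using Suc.IH[OF lower that] by blast
  have "Ck k m U (\<lambda>x. f (\<phi> x))" using IH Suc.prems(2) Ck_Suc_lower[OF V] by blast
  then have c: "continuous_on U (\<lambda>x. f (\<phi> x))" by (rule Ck_continuous[OF U])
  show ?case
  proof (rule Ck_SucI[OF U c, where g="\<lambda>i x. \<Sum>j<n. partial j f (\<phi> x) * partial i (\<lambda>x. \<phi> x j) x"])
    fix i x assume ix: "i < m" "x \<in> U"
    have "((\<lambda>t. f (\<phi> (x(i := t)))) has_real_derivative
      (\<Sum>j<n. partial j f (\<phi> (x(i := x i))) * partial i (\<lambda>x. \<phi> x j) x)) (at (x i))"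
    proof (rule chain_rule[OF V Suc.prems(2)])
      show "\<forall>\<^sub>F t in nhds (x i). \<phi> (x(i := t)) \<in> Rn n"
        using eventually_fun_upd_in[OF U ix(2,1)]
        by eventually_elim (use \<phi>V openin_Rn_subset[OF V] in blast)
    next
      show "((\<lambda>t. \<phi> (x(i := t)) j) has_real_derivative partial i (\<lambda>x. \<phi> x j) x) (at (x i))"
        if "j < n" for j
        by (rule Ck_Suc_has_derivative[OF Suc.prems(1)[OF that] ix])
    qed (use ix \<phi>V in auto)
    then show "((\<lambda>t. f (\<phi> (x(i := t)))) has_real_derivative
      (\<Sum>j<n. partial j f (\<phi> x) * partial i (\<lambda>x. \<phi> x j) x)) (at (x i))" by simp
  next
    fix i assume "i < m"
    then show "Ck k m U (\<lambda>x. \<Sum>j<n. partial j f (\<phi> x) * partial i (\<lambda>x. \<phi> x j) x)"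
      using Suc.prems IH by (intro Ck_sum[OF U] Ck_mult[OF U]) auto
  qed
qed

lemma partial_compose:
  assumes U: "openin (Euclidean_space m) U" and V: "openin (Euclidean_space n) V"
    and \<phi>V: "\<And>x. x \<in> U \<Longrightarrow> \<phi> x \<in> V" and \<phi>: "\<And>j. j < n \<Longrightarrow> Ck (Suc k) m U (\<lambda>x. \<phi> x j)"
    and f: "Ck (Suc k) n V f" and "i < m" "x \<in> U"
  shows "partial i (\<lambda>x. f (\<phi> x)) x = (\<Sum>j<n. partial j f (\<phi> x) * partial i (\<lambda>x. \<phi> x j) x)"
proof -
  have "((\<lambda>t. f (\<phi> (x(i := t)))) has_real_derivative
    (\<Sum>j<n. partial j f (\<phi> (x(i := x i))) * partial i (\<lambda>x. \<phi> x j) x)) (at (x i))"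
  proof (rule chain_rule[OF V f])
    show "\<forall>\<^sub>F t in nhds (x i). \<phi> (x(i := t)) \<in> Rn n"
      using eventually_fun_upd_in[OF U assms(7,6)]
      by eventually_elim (use \<phi>V openin_Rn_subset[OF V] in blast)
  next
    show "((\<lambda>t. \<phi> (x(i := t)) j) has_real_derivative partial i (\<lambda>x. \<phi> x j) x) (at (x i))"
      if "j < n" for j
      by (rule Ck_Suc_has_derivative[OF \<phi>[OF that] assms(6,7)])
  qed (use assms in auto)
  then show ?thesis by (simp add: partial_def DERIV_imp_deriv)
qed

text \<open>Both iterated derivatives are limits of the same second difference quotient.\<close>

lemma partial_commute:
  assumes U: "openin (Euclidean_space n) U" and f: "Ck (Suc (Suc k)) n U f"
    and x: "x \<in> U" and i: "i < n" and j: "j < n"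
  shows "partial i (partial j f) x = partial j (partial i f) x"
proof (cases "i = j")
  case False
  have second: "\<exists>y\<in>Rn n. (\<forall>l<n. \<bar>y l - x l\<bar> < e) \<and>
      f (x(a := x a + h, b := x b + h)) - f (x(a := x a + h)) - f (x(b := x b + h)) + f x
        = partial b (partial a f) y * h * h"
    if box: "\<And>y. y \<in> Rn n \<Longrightarrow> (\<And>l. l < n \<Longrightarrow> \<bar>y l - x l\<bar> < e) \<Longrightarrow> y \<in> U"
      and h: "0 < h" "h < e" and ab: "a < n" "b < n" "a \<noteq> b" for a b e h
  proof -
    have xR: "x \<in> Rn n" using x U openin_Rn_subset by blast
    have inU: "x(b := t, a := s) \<in> U" if "x a \<le> s" "s \<le> x a + h" "x b \<le> t" "t \<le> x b + h" for s t
      using that h ab xR by (intro box) auto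
    have D: "((\<lambda>s. f (x(b := x b + h, a := s)) - f (x(b := x b, a := s))) has_real_derivative
        partial a f (x(b := x b + h, a := s)) - partial a f (x(b := x b, a := s))) (at s)"
      if "x a \<le> s" "s \<le> x a + h" for s
      using Ck_Suc_has_derivative[OF f ab(1) inU[OF that, of "x b + h"]]
        Ck_Suc_has_derivative[OF f ab(1) inU[OF that, of "x b"]] h
      by (intro DERIV_diff) auto
    obtain s where s: "x a < s" "s < x a + h"
      "(f (x(b := x b + h, a := x a + h)) - f (x(b := x b, a := x a + h)))
        - (f (x(b := x b + h, a := x a)) - f (x(b := x b, a := x a)))
        = h * (partial a f (x(b := x b + h, a := s)) - partial a f (x(b := x b, a := s)))"
      using MVT2[of "x a" "x a + h" _ "\<lambda>s. partial a f (x(b := x b + h, a := s)) - partial a f (x(b := x b, a := s))", OF _ D] h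
      by auto
    have "\<exists>t. min (x b) (x b + h) \<le> t \<and> t \<le> max (x b) (x b + h) \<and>
      partial a f ((x(a := s))(b := x b + h)) - partial a f ((x(a := s))(b := x b))
        = partial b (partial a f) ((x(a := s))(b := t)) * (x b + h - x b)"
    proof (rule coord_MVT[OF _ Ck_Suc_partial[OF f ab(1)] ab(2)])
      fix t assume "min (x b) (x b + h) \<le> t" "t \<le> max (x b) (x b + h)"
      then show "x(a := s, b := t) \<in> U" using inU[of s t] s h ab by (simp add: fun_upd_twist)
    qed
    then obtain t where t: "x b \<le> t" "t \<le> x b + h"
      "partial a f (x(b := x b + h, a := s)) - partial a f (x(b := x b, a := s))
        = partial b (partial a f) (x(a := s, b := t)) * h"
      using h ab by (auto simp: fun_upd_twist simp del: fun_upd_triv fun_upd_idem_iff)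
    show ?thesis
    proof (intro bexI[of _ "x(a := s, b := t)"] conjI)
      show "\<forall>l<n. \<bar>(x(a := s, b := t)) l - x l\<bar> < e" using s t h by auto
      show "f (x(a := x a + h, b := x b + h)) - f (x(a := x a + h)) - f (x(b := x b + h)) + f x
        = partial b (partial a f) (x(a := s, b := t)) * h * h"
        using s(3) t(3) ab(3) by (simp add: fun_upd_twist algebra_simps)
    qed (use xR ab in auto)
  qed
  show ?thesis
  proof (rule ccontr)
    \<comment> \<open>With half the gap as tolerance, values that close to the two derivatives
      cannot coincide, although the common difference quotient forces them to.\<close>
    define \<delta> where "\<delta> = \<bar>partial i (partial j f) x - partial j (partial i f) x\<bar> / 2"
    assume "partial i (partial j f) x \<noteq> partial j (partial i f) x"
    then have \<delta>: "\<delta> > 0" by (simp add: \<delta>_def)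
    have c: "continuous_on U (partial a (partial b f))" if "a < n" "b < n" for a b
      using f that Ck_Suc_partial Ck_continuous[OF U] by blast
    obtain e1 where e1: "e1 > 0" "\<And>y. y \<in> Rn n \<Longrightarrow> (\<And>l. l < n \<Longrightarrow> \<bar>y l - x l\<bar> < e1) \<Longrightarrow>
        y \<in> U \<and> \<bar>partial i (partial j f) y - partial i (partial j f) x\<bar> < \<delta>"
      using continuous_on_boxE[OF c[OF i j] U x \<delta>] by metis
    obtain e2 where e2: "e2 > 0" "\<And>y. y \<in> Rn n \<Longrightarrow> (\<And>l. l < n \<Longrightarrow> \<bar>y l - x l\<bar> < e2) \<Longrightarrow>
        y \<in> U \<and> \<bar>partial j (partial i f) y - partial j (partial i f) x\<bar> < \<delta>"
      using continuous_on_boxE[OF c[OF j i] U x \<delta>] by metis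
    define h where "h = min e1 e2 / 2"
    have h: "0 < h" "h < e1" "h < e2" using e1(1) e2(1) by (auto simp: h_def)
    obtain y where y: "y \<in> Rn n" "\<forall>l<n. \<bar>y l - x l\<bar> < e1"
      "f (x(j := x j + h, i := x i + h)) - f (x(j := x j + h)) - f (x(i := x i + h)) + f x
        = partial i (partial j f) y * h * h"
      using second[of e1 h j i] e1(2) h False i j by metis
    obtain z where z: "z \<in> Rn n" "\<forall>l<n. \<bar>z l - x l\<bar> < e2"
      "f (x(i := x i + h, j := x j + h)) - f (x(i := x i + h)) - f (x(j := x j + h)) + f x
        = partial j (partial i f) z * h * h"
      using second[of e2 h i j] e2(2) h False i j by metis
    have "partial i (partial j f) y * h * h = partial j (partial i f) z * h * h"
      using y(3) z(3) False by (simp add: fun_upd_twist algebra_simps)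
    then have "partial i (partial j f) y = partial j (partial i f) z" using h by simp
    moreover have "\<bar>partial i (partial j f) y - partial i (partial j f) x\<bar> < \<delta>"
      "\<bar>partial j (partial i f) z - partial j (partial i f) x\<bar> < \<delta>"
      using e1(2)[OF y(1)] y(2) e2(2)[OF z(1)] z(2) by auto
    ultimately show False unfolding \<delta>_def by (simp add: abs_if field_simps split: if_splits)
  qed
qed simp

subsection \<open>Smoothness at a point\<close>

text \<open>A single neighbourhood has to serve all orders of differentiability.\<close>

definition Cinf_at :: "nat \<Rightarrow> coord \<Rightarrow> (coord \<Rightarrow> real) \<Rightarrow> bool" where
  "Cinf_at n x f \<longleftrightarrow> (\<exists>V. openin (Euclidean_space n) V \<and> x \<in> V \<and> Cinf n V f)"

lemma Cinf_mono:
  "openin (Euclidean_space n) U \<Longrightarrow> openin (Euclidean_space n) V \<Longrightarrow> V \<subseteq> U \<Longrightarrow> Cinf n U f \<Longrightarrow> Cinf n V f"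
  unfolding Cinf_def using Ck_mono by blast

lemma Cinf_cong:
  "openin (Euclidean_space n) U \<Longrightarrow> (\<And>x. x \<in> U \<Longrightarrow> f x = g x) \<Longrightarrow> Cinf n U f \<Longrightarrow> Cinf n U g"
  unfolding Cinf_def using Ck_cong by blast

lemma Cinf_iff_Cinf_at:
  assumes "openin (Euclidean_space n) U"
  shows "Cinf n U f \<longleftrightarrow> (\<forall>x\<in>U. Cinf_at n x f)"
  using assms Ck_local[OF assms] unfolding Cinf_def Cinf_at_def by meson

lemma Cinf_partial: "Cinf n U f \<Longrightarrow> i < n \<Longrightarrow> Cinf n U (partial i f)"
  unfolding Cinf_def using Ck_Suc_partial by blast

lemma Cinf_compose:
  assumes "openin (Euclidean_space m) U" "openin (Euclidean_space n) V"
    "\<And>x. x \<in> U \<Longrightarrow> \<phi> x \<in> V" "\<And>j. j < n \<Longrightarrow> Cinf m U (\<lambda>x. \<phi> x j)" "Cinf n V f"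
  shows "Cinf m U (\<lambda>x. f (\<phi> x))"
  unfolding Cinf_def
proof
  fix k show "Ck k m U (\<lambda>x. f (\<phi> x))"
    by (rule Ck_compose[OF assms(1-3)]) (use assms(4,5) in \<open>auto simp: Cinf_def\<close>)
qed

lemma openin_Rn_preimage:
  assumes U: "openin (Euclidean_space n) U" and V: "openin (Euclidean_space m) V"
    and \<phi>: "\<And>x. x \<in> U \<Longrightarrow> \<phi> x \<in> Rn m" "\<And>j. j < m \<Longrightarrow> continuous_on U (\<lambda>x. \<phi> x j)"
  shows "openin (Euclidean_space n) {x \<in> U. \<phi> x \<in> V}"
proof -
  have "continuous_on U (\<lambda>x. \<phi> x j)" for j
  proof (cases "j < m")
    case False
    then have "\<phi> x j = 0" if "x \<in> U" for x using \<phi>(1)[OF that] by (simp add: Rn_iff)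
    then show ?thesis by (simp cong: continuous_on_cong)
  qed (rule \<phi>(2))
  then have c: "continuous_on U \<phi>" by (rule continuous_on_coordinatewise_then_product)
  obtain S where S: "open S" "V = Rn m \<inter> S" using V unfolding openin_Rn_iff_open by blast
  have "openin (top_of_set U) (U \<inter> \<phi> -` S)" by (rule continuous_openin_preimage_gen[OF c S(1)])
  moreover have "{x \<in> U. \<phi> x \<in> V} = U \<inter> \<phi> -` S" using \<phi>(1) S(2) by auto
  ultimately show ?thesis using openin_Rn_trans[OF _ U] by simp
qed

lemma Cinf_mult: "openin (Euclidean_space n) U \<Longrightarrow> Cinf n U f \<Longrightarrow> Cinf n U h \<Longrightarrow> Cinf n U (\<lambda>x. f x * h x)"
  unfolding Cinf_def by (simp add: Ck_mult)

lemma Cinf_sum: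
  "openin (Euclidean_space n) U \<Longrightarrow> (\<And>a. a \<in> S \<Longrightarrow> Cinf n U (f a)) \<Longrightarrow> Cinf n U (\<lambda>x. \<Sum>a\<in>S. f a x)"
  unfolding Cinf_def by (simp add: Ck_sum)

lemma Cinf_proj: "openin (Euclidean_space n) U \<Longrightarrow> Cinf n U (\<lambda>x. x j)"
  unfolding Cinf_def by (simp add: Ck_proj)

lemma Cinf_at_const: "x \<in> Rn n \<Longrightarrow> Cinf_at n x (\<lambda>x. a)"
  unfolding Cinf_at_def Cinf_def by (metis Ck_const openin_topspace)

lemma Cinf_at_common:
  assumes "Cinf_at n x f" "Cinf_at n x g"
  obtains V where "openin (Euclidean_space n) V" "x \<in> V" "Cinf n V f" "Cinf n V g"
proof -
  obtain V W where V: "openin (Euclidean_space n) V" "x \<in> V" "Cinf n V f"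
    and W: "openin (Euclidean_space n) W" "x \<in> W" "Cinf n W g"
    using assms unfolding Cinf_at_def by blast
  show ?thesis
    by (rule that[of "V \<inter> W"]) (use V W Cinf_mono[of n V "V \<inter> W"] Cinf_mono[of n W "V \<inter> W"] in auto)
qed

lemma Cinf_at_add: "Cinf_at n x f \<Longrightarrow> Cinf_at n x g \<Longrightarrow> Cinf_at n x (\<lambda>x. f x + g x)"
  by (erule (1) Cinf_at_common) (auto simp: Cinf_at_def Cinf_def intro: Ck_add)

lemma Cinf_at_mult: "Cinf_at n x f \<Longrightarrow> Cinf_at n x g \<Longrightarrow> Cinf_at n x (\<lambda>x. f x * g x)"
  by (erule (1) Cinf_at_common) (auto simp: Cinf_at_def Cinf_def intro: Ck_mult)

lemma Cinf_at_nonzero: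
  assumes "Cinf_at n x f" "f x \<noteq> 0"
  obtains V where "openin (Euclidean_space n) V" "x \<in> V" "\<And>y. y \<in> V \<Longrightarrow> f y \<noteq> 0" "Cinf n V f"
proof -
  obtain V where V: "openin (Euclidean_space n) V" "x \<in> V" "Cinf n V f"
    using assms unfolding Cinf_at_def by blast
  have "continuous_on V f" using V Ck_continuous unfolding Cinf_def by blast
  then have "openin (top_of_set V) (V \<inter> f -` (- {0}))"
    by (rule continuous_openin_preimage_gen) (simp add: open_Compl)
  then have W: "openin (Euclidean_space n) (V \<inter> f -` (- {0}))"
    using V(1) by (rule openin_Rn_trans)
  show ?thesis
    by (rule that[OF W]) (use V W assms Cinf_mono[OF V(1) W] in auto)
qed

lemma Cinf_at_inverse:
  assumes "Cinf_at n x f" "f x \<noteq> 0"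
  shows "Cinf_at n x (\<lambda>x. inverse (f x))"
  by (rule Cinf_at_nonzero[OF assms]) (auto simp: Cinf_at_def Cinf_def intro: Ck_inverse)

section \<open>Coordinate vectors\<close>

lemma smult_apply: "(a \<cdot>\<^sub>c x) i = a * x i"
  by (simp add: smult_def)

lemma sum_fun_apply: "(\<Sum>a\<in>S. f a) x = (\<Sum>a\<in>S. (f a x :: 'b::comm_monoid_add))"
  by (induction S rule: infinite_finite_induct) auto

lemmas coord_simps = plus_fun_apply zero_fun_apply minus_apply uminus_apply smult_apply sum_fun_apply

text \<open>
  Facts obtained by higher-order unification may contain eta-expanded vectors; simplification with
  the pointwise rules would rewrite them below the binder, so these rules are used explicitly only.
\<close>

declare plus_fun_apply [simp del] zero_fun_apply [simp del] minus_apply [simp del] uminus_apply [simp del]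

lemma unit_coord_apply: "unit_coord i j = (if j = i then 1 else 0)"
  by (simp add: unit_coord_def)

text \<open>Gives access to span, independence and the exchange bound, from which the dimension
  count for orthonormal families is drawn.\<close>

interpretation cv: vector_space smult
  by unfold_locales (auto simp: fun_eq_iff algebra_simps coord_simps)

lemma Rn_closed [simp]:
  "0 \<in> Rn n"
  "x \<in> Rn n \<Longrightarrow> y \<in> Rn n \<Longrightarrow> x + y \<in> Rn n"
  "x \<in> Rn n \<Longrightarrow> y \<in> Rn n \<Longrightarrow> x - y \<in> Rn n"
  "x \<in> Rn n \<Longrightarrow> - x \<in> Rn n"
  "x \<in> Rn n \<Longrightarrow> a \<cdot>\<^sub>c x \<in> Rn n"
  by (auto simp: Rn_iff coord_simps)

lemma Rn_sum [simp]: "(\<And>a. a \<in> S \<Longrightarrow> f a \<in> Rn n) \<Longrightarrow> sum f S \<in> Rn n"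
  by (auto simp: Rn_iff coord_simps)

lemma unit_coord_Rn [simp]: "i < n \<Longrightarrow> unit_coord i \<in> Rn n"
  by (auto simp: Rn_iff unit_coord_def)

lemma Rn_eqI: "x \<in> Rn n \<Longrightarrow> y \<in> Rn n \<Longrightarrow> (\<And>i. i < n \<Longrightarrow> x i = y i) \<Longrightarrow> x = y"
  unfolding fun_eq_iff Rn_iff by (metis not_le)

lemma Rn_expand: "x \<in> Rn n \<Longrightarrow> x = (\<Sum>i<n. x i \<cdot>\<^sub>c unit_coord i)"
proof (rule Rn_eqI[of _ n])
  fix i assume "i < n"
  then show "x i = (\<Sum>i<n. x i \<cdot>\<^sub>c unit_coord i) i"
    by (simp add: coord_simps unit_coord_def if_distrib cong: if_cong)
next
  show "(\<Sum>i<n. x i \<cdot>\<^sub>c unit_coord i) \<in> Rn n" by (intro Rn_sum Rn_closed unit_coord_Rn) simp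
qed

text \<open>Frames on the tangent bundle are indexed by pairs, with \<open>True\<close> for
  horizontal and \<open>False\<close> for vertical fields.\<close>

lemma sum_bool_times:
  "(\<Sum>i\<in>(UNIV::bool set) \<times> {..<n}. f i) = (\<Sum>a<n. f (True, a)) + (\<Sum>a<n::nat. (f (False, a) :: 'c::comm_monoid_add))"
proof -
  have "(\<Sum>i\<in>(UNIV::bool set) \<times> {..<n}. f i) = (\<Sum>x\<in>UNIV. \<Sum>a<n. f (x, a))"
    by (subst sum.cartesian_product) simp
  then show ?thesis by (simp add: UNIV_bool add.commute)
qed

lemma sum_lessThan_double:
  fixes f :: "nat \<Rightarrow> 'c::comm_monoid_add"
  shows "(\<Sum>i<2 * n. f i) = (\<Sum>i<n. f i) + (\<Sum>i<n. f (i + n))"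
proof -
  have "(\<Sum>i<n + m. f i) = (\<Sum>i<n. f i) + (\<Sum>i<m. f (i + n))" for m
    by (induction m) (simp_all add: ac_simps)
  from this[of n] show ?thesis by (simp add: mult_2)
qed

section \<open>Smooth atlases\<close>

text \<open>The form in which the manifold structure is handed from \<open>A\<close> to
  \<open>tangent A\<close> by a sublocale.\<close>

locale smooth_atlas =
  fixes M :: "('p, 'x) manifold_scheme"
  assumes atlas_cover: "(\<Union>c\<in>atlas M. fst c) = points M"
    and chart_inj: "c \<in> atlas M \<Longrightarrow> inj_on (snd c) (fst c)"
    and chart_open: "c \<in> atlas M \<Longrightarrow> openin (Euclidean_space (mdim M)) (snd c ` fst c)"
    and overlap_open: "c \<in> atlas M \<Longrightarrow> d \<in> atlas M \<Longrightarrow>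
      openin (Euclidean_space (mdim M)) (snd c ` (fst c \<inter> fst d))"
    and transition: "c \<in> atlas M \<Longrightarrow> d \<in> atlas M \<Longrightarrow> j < mdim M \<Longrightarrow>
      Cinf (mdim M) (snd c ` (fst c \<inter> fst d)) (\<lambda>x. snd d (chart_inv c x) j)"
    and chart_at_atlas [simp]: "p \<in> points M \<Longrightarrow> chart_at M p \<in> atlas M"
    and chart_at_dom [simp]: "p \<in> points M \<Longrightarrow> p \<in> fst (chart_at M p)"

lemma smooth_manifold_imp_smooth_atlas: "smooth_manifold M \<Longrightarrow> smooth_atlas M"
  unfolding smooth_manifold_def smooth_atlas_def by blast

context smooth_atlas
begin

text \<open>With neighbourhood filters, germs are compared by eventual equality, and shrinking to a
  common neighbourhood is left to \<open>eventually_elim\<close>.\<close>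

abbreviation "near p \<equiv> nhdsin (mtop M) p"
abbreviation "sm p f \<equiv> smooth_fun_at M p f"
abbreviation "smf p X \<equiv> smooth_field_at M p X"
abbreviation "pd c i f q \<equiv> partial i (\<lambda>x. f (chart_inv c x)) (snd c q)"

text \<open>\<open>topology\<close> is meaningful only for a family closed under the topological
  operations; closure under intersection is where injectivity of the charts enters.\<close>

lemma openin_mtop:
  "openin (mtop M) W \<longleftrightarrow> W \<subseteq> points M \<and>
     (\<forall>c\<in>atlas M. openin (Euclidean_space (mdim M)) (snd c ` (W \<inter> fst c)))"
proof -
  have "istopology (\<lambda>W. W \<subseteq> points M \<and>
     (\<forall>c\<in>atlas M. openin (Euclidean_space (mdim M)) (snd c ` (W \<inter> fst c))))"
    unfolding istopology_def
  proof (intro conjI allI impI ballI)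
    fix S T c
    assume S: "S \<subseteq> points M \<and> (\<forall>c\<in>atlas M. openin (Euclidean_space (mdim M)) (snd c ` (S \<inter> fst c)))"
      and T: "T \<subseteq> points M \<and> (\<forall>c\<in>atlas M. openin (Euclidean_space (mdim M)) (snd c ` (T \<inter> fst c)))"
    show "S \<inter> T \<subseteq> points M" using S by auto
    assume c: "c \<in> atlas M"
    have "S \<inter> T \<inter> fst c = (S \<inter> fst c) \<inter> (T \<inter> fst c)" by auto
    then have "snd c ` (S \<inter> T \<inter> fst c) = snd c ` (S \<inter> fst c) \<inter> snd c ` (T \<inter> fst c)"
      using inj_on_image_Int[OF chart_inj[OF c], of "S \<inter> fst c" "T \<inter> fst c"] by simp
    then show "openin (Euclidean_space (mdim M)) (snd c ` (S \<inter> T \<inter> fst c))" using S T c by auto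
  next
    fix K c
    assume K: "\<forall>S\<in>K. S \<subseteq> points M \<and> (\<forall>c\<in>atlas M. openin (Euclidean_space (mdim M)) (snd c ` (S \<inter> fst c)))"
    show "\<Union>K \<subseteq> points M" using K by auto
    assume c: "c \<in> atlas M"
    have "snd c ` (\<Union>K \<inter> fst c) = (\<Union>S\<in>K. snd c ` (S \<inter> fst c))" by auto
    then show "openin (Euclidean_space (mdim M)) (snd c ` (\<Union>K \<inter> fst c))" using K c by auto
  qed
  then show ?thesis unfolding mtop_def by (simp add: topology_inverse')
qed

lemma chart_dom_points: "c \<in> atlas M \<Longrightarrow> p \<in> fst c \<Longrightarrow> p \<in> points M"
  using atlas_cover by auto

lemma chart_dom_subset: "c \<in> atlas M \<Longrightarrow> fst c \<subseteq> points M"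
  using atlas_cover by auto

lemma topspace_mtop [simp]: "topspace (mtop M) = points M"
proof -
  have "snd c ` (points M \<inter> fst c) = snd c ` fst c" if "c \<in> atlas M" for c
    using that chart_dom_points by (metis inf.absorb2 subsetI)
  then have "openin (mtop M) (points M)" unfolding openin_mtop using chart_open by simp
  then show ?thesis
    using openin_subset openin_topspace openin_mtop by (metis subset_antisym)
qed

lemma openin_points: "openin (mtop M) W \<Longrightarrow> p \<in> W \<Longrightarrow> p \<in> points M"
  using openin_mtop by blast

lemma chart_inv_snd [simp]: "c \<in> atlas M \<Longrightarrow> p \<in> fst c \<Longrightarrow> chart_inv c (snd c p) = p"
  unfolding chart_inv_def by (simp add: chart_inj)

lemma snd_in_Rn: "c \<in> atlas M \<Longrightarrow> p \<in> fst c \<Longrightarrow> snd c p \<in> Rn (mdim M)"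
  using openin_Rn_subset[OF chart_open] by blast

lemma openin_image:
  "openin (mtop M) W \<Longrightarrow> c \<in> atlas M \<Longrightarrow> openin (Euclidean_space (mdim M)) (snd c ` (W \<inter> fst c))"
  using openin_mtop by blast

lemma openin_chart_dom: "c \<in> atlas M \<Longrightarrow> openin (mtop M) (fst c)"
  unfolding openin_mtop using overlap_open chart_dom_subset by (simp add: Int_commute)

text \<open>Continuity of the chart \<open>c\<close>. In another chart \<open>d\<close> the set
  becomes the preimage of \<open>V\<close> under the transition map.\<close>

lemma openin_chart_preimage:
  assumes c: "c \<in> atlas M" and V: "openin (Euclidean_space (mdim M)) V"
  shows "openin (mtop M) {p \<in> fst c. snd c p \<in> V}"
  unfolding openin_mtop
proof (intro conjI ballI)
  show "{p \<in> fst c. snd c p \<in> V} \<subseteq> points M" using chart_dom_subset[OF c] by blast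
  fix d assume d: "d \<in> atlas M"
  have "snd d ` ({p \<in> fst c. snd c p \<in> V} \<inter> fst d)
      = {x \<in> snd d ` (fst d \<inter> fst c). snd c (chart_inv d x) \<in> V}"
    using d by (auto intro!: image_eqI)
  moreover have "openin (Euclidean_space (mdim M)) {x \<in> snd d ` (fst d \<inter> fst c). snd c (chart_inv d x) \<in> V}"
  proof (rule openin_Rn_preimage[OF overlap_open[OF d c] V])
    show "snd c (chart_inv d x) \<in> Rn (mdim M)" if "x \<in> snd d ` (fst d \<inter> fst c)" for x
      using that d snd_in_Rn[OF c] by auto
    show "continuous_on (snd d ` (fst d \<inter> fst c)) (\<lambda>x. snd c (chart_inv d x) j)" if "j < mdim M" for j
      using transition[OF d c that] Ck_continuous[OF overlap_open[OF d c]] unfolding Cinf_def by blast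
  qed
  ultimately show "openin (Euclidean_space (mdim M)) (snd d ` ({p \<in> fst c. snd c p \<in> V} \<inter> fst d))"
    by simp
qed

section \<open>Neighbourhood filters of points\<close>

lemma eventually_near:
  "p \<in> points M \<Longrightarrow> eventually P (near p) \<longleftrightarrow> (\<exists>W. openin (mtop M) W \<and> p \<in> W \<and> (\<forall>q\<in>W. P q))"
  by (simp add: eventually_nhdsin)

lemma eventually_nearI: "openin (mtop M) W \<Longrightarrow> p \<in> W \<Longrightarrow> (\<And>q. q \<in> W \<Longrightarrow> P q) \<Longrightarrow> eventually P (near p)"
  using eventually_near[of p P] openin_points[of W p] by blast

lemma eventually_nearE:
  assumes "eventually P (near p)" "p \<in> points M"
  obtains W where "openin (mtop M) W" "p \<in> W" "\<And>q. q \<in> W \<Longrightarrow> P q"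
  using assms eventually_near[of p P] by blast

lemma eventually_nearD: "eventually P (near p) \<Longrightarrow> p \<in> points M \<Longrightarrow> P p"
  by (erule eventually_nearE) auto

lemma eventually_near_chart: "c \<in> atlas M \<Longrightarrow> p \<in> fst c \<Longrightarrow> \<forall>\<^sub>F q in near p. q \<in> fst c"
  by (rule eventually_nearI[OF openin_chart_dom])

lemma eventually_near_points: "\<forall>\<^sub>F q in near p. q \<in> points M"
proof (cases "p \<in> points M")
  case True
  have "openin (mtop M) (points M)" using openin_topspace[of "mtop M"] unfolding topspace_mtop .
  from eventually_nearI[OF this True] show ?thesis by simp
qed simp

lemma eventually_near_coordsE:
  assumes "eventually P (near p)" "c \<in> atlas M" "p \<in> fst c"
  obtains V where "openin (Euclidean_space (mdim M)) V" "snd c p \<in> V"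
    "\<And>x. x \<in> V \<Longrightarrow> P (chart_inv c x) \<and> chart_inv c x \<in> fst c \<and> snd c (chart_inv c x) = x"
proof -
  obtain W where W: "openin (mtop M) W" "p \<in> W" "\<And>q. q \<in> W \<Longrightarrow> P q"
    using eventually_nearE[OF assms(1) chart_dom_points[OF assms(2,3)]] by blast
  show ?thesis
    by (rule that[OF openin_image[OF W(1) assms(2)]]) (use W assms in auto)
qed

subsection \<open>Smooth functions\<close>

text \<open>\<open>smooth_fun\<close> asks for smoothness in all charts; smooth transition maps
  reduce this to one chart around the point.\<close>

lemma sm_iff:
  assumes c: "c \<in> atlas M" and p: "p \<in> fst c"
  shows "sm p f \<longleftrightarrow> Cinf_at (mdim M) (snd c p) (\<lambda>x. f (chart_inv c x))"
proof
  assume "sm p f"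
  then obtain W where W: "openin (mtop M) W" "p \<in> W" "smooth_fun M W f"
    unfolding smooth_fun_at_def by blast
  then show "Cinf_at (mdim M) (snd c p) (\<lambda>x. f (chart_inv c x))"
    using openin_image[OF W(1) c] c p unfolding smooth_fun_def Cinf_at_def o_def by blast
next
  assume "Cinf_at (mdim M) (snd c p) (\<lambda>x. f (chart_inv c x))"
  then obtain V where V: "openin (Euclidean_space (mdim M)) V" "snd c p \<in> V"
    "Cinf (mdim M) V (\<lambda>x. f (chart_inv c x))" unfolding Cinf_at_def by blast
  define W where "W = {q \<in> fst c. snd c q \<in> V}"
  have W: "openin (mtop M) W" "p \<in> W" using openin_chart_preimage[OF c V(1)] V(2) p by (auto simp: W_def)
  have "Cinf (mdim M) (snd d ` (W \<inter> fst d)) (f \<circ> chart_inv d)" if d: "d \<in> atlas M" for d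
  proof (rule Cinf_cong[OF openin_image[OF W(1) d]])
    show "Cinf (mdim M) (snd d ` (W \<inter> fst d)) (\<lambda>x. f (chart_inv c (snd c (chart_inv d x))))"
    proof (rule Cinf_compose[OF openin_image[OF W(1) d] V(1) _ _ V(3)])
      show "snd c (chart_inv d x) \<in> V" if "x \<in> snd d ` (W \<inter> fst d)" for x
        using that d by (auto simp: W_def)
      show "Cinf (mdim M) (snd d ` (W \<inter> fst d)) (\<lambda>x. snd c (chart_inv d x) j)" if "j < mdim M" for j
        by (rule Cinf_mono[OF overlap_open[OF d c] openin_image[OF W(1) d] _ transition[OF d c that]])
           (auto simp: W_def)
    qed
  qed (use c d in \<open>auto simp: W_def\<close>)
  then show "sm p f" unfolding smooth_fun_at_def smooth_fun_def using W by blast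
qed

lemma sm_points: "sm p f \<Longrightarrow> p \<in> points M"
  unfolding smooth_fun_at_def using openin_points by blast

lemma sm_iff_chart_at:
  "sm p f \<longleftrightarrow> p \<in> points M \<and> Cinf_at (mdim M) (snd (chart_at M p) p) (\<lambda>x. f (chart_inv (chart_at M p) x))"
  using sm_iff[OF chart_at_atlas chart_at_dom] sm_points by blast

lemma smooth_fun_iff:
  assumes W: "openin (mtop M) W"
  shows "smooth_fun M W f \<longleftrightarrow> (\<forall>p\<in>W. sm p f)"
proof
  assume R: "\<forall>p\<in>W. sm p f"
  have "Cinf (mdim M) (snd c ` (W \<inter> fst c)) (f \<circ> chart_inv c)" if c: "c \<in> atlas M" for c
    using R sm_iff[OF c] unfolding Cinf_iff_Cinf_at[OF openin_image[OF W c]] by (auto simp: o_def)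
  then show "smooth_fun M W f" unfolding smooth_fun_def by blast
qed (use W in \<open>auto simp: smooth_fun_at_def\<close>)

lemma sm_eventually: "sm p f \<Longrightarrow> \<forall>\<^sub>F q in near p. sm q f"
  unfolding smooth_fun_at_def by (auto intro!: eventually_nearI)

lemma sm_const: "p \<in> points M \<Longrightarrow> sm p (\<lambda>q. a)"
  unfolding sm_iff_chart_at by (simp add: Cinf_at_const snd_in_Rn)

lemma sm_add: "sm p f \<Longrightarrow> sm p g \<Longrightarrow> sm p (\<lambda>q. f q + g q)"
  unfolding sm_iff_chart_at using Cinf_at_add by blast

lemma sm_mult: "sm p f \<Longrightarrow> sm p g \<Longrightarrow> sm p (\<lambda>q. f q * g q)"
  unfolding sm_iff_chart_at using Cinf_at_mult by blast

lemma sm_uminus: "sm p f \<Longrightarrow> sm p (\<lambda>q. - f q)"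
  using sm_mult[OF sm_const[of p "-1"], of f] sm_points by simp

lemma sm_diff: "sm p f \<Longrightarrow> sm p g \<Longrightarrow> sm p (\<lambda>q. f q - g q)"
  using sm_add[of p f "\<lambda>q. - g q"] sm_uminus by simp

lemma sm_sum: "p \<in> points M \<Longrightarrow> (\<And>a. a \<in> S \<Longrightarrow> sm p (f a)) \<Longrightarrow> sm p (\<lambda>q. \<Sum>a\<in>S. f a q)"
  by (induction S rule: infinite_finite_induct) (auto intro: sm_const sm_add)

lemma sm_inverse: "sm p f \<Longrightarrow> f p \<noteq> 0 \<Longrightarrow> sm p (\<lambda>q. inverse (f q))"
  unfolding sm_iff_chart_at by (auto intro!: Cinf_at_inverse)

lemma sm_divide: "sm p f \<Longrightarrow> sm p g \<Longrightarrow> g p \<noteq> 0 \<Longrightarrow> sm p (\<lambda>q. f q / g q)"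
  unfolding divide_inverse by (intro sm_mult sm_inverse)

lemma sm_eventually_nonzero:
  assumes "sm p f" "f p \<noteq> 0"
  shows "\<forall>\<^sub>F q in near p. f q \<noteq> 0"
proof -
  define c where "c = chart_at M p"
  have c: "c \<in> atlas M" "p \<in> fst c" using sm_points[OF assms(1)] by (auto simp: c_def)
  obtain V where V: "openin (Euclidean_space (mdim M)) V" "snd c p \<in> V" "\<And>y. y \<in> V \<Longrightarrow> f (chart_inv c y) \<noteq> 0"
    using Cinf_at_nonzero[OF assms(1)[unfolded sm_iff[OF c]]] assms(2) c by auto
  have "f q \<noteq> 0" if "q \<in> {p \<in> fst c. snd c p \<in> V}" for q
    using V(3)[of "snd c q"] that c by auto
  then show ?thesis
    using eventually_nearI[OF openin_chart_preimage[OF c(1) V(1)], of p "\<lambda>q. f q \<noteq> 0"] V(2) c by blast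
qed

lemma sm_cong:
  assumes "\<forall>\<^sub>F q in near p. f q = g q" "sm p f"
  shows "sm p g"
proof -
  have p: "p \<in> points M" using assms sm_points by blast
  obtain W where W: "openin (mtop M) W" "p \<in> W" "smooth_fun M W f"
    using assms unfolding smooth_fun_at_def by blast
  obtain W' where W': "openin (mtop M) W'" "p \<in> W'" "\<And>q. q \<in> W' \<Longrightarrow> f q = g q"
    using eventually_nearE[OF assms(1) p] by blast
  have o: "openin (mtop M) (W \<inter> W')" using W W' by blast
  have "Cinf (mdim M) (snd c ` (W \<inter> W' \<inter> fst c)) (g \<circ> chart_inv c)" if c: "c \<in> atlas M" for c
  proof (rule Cinf_cong[OF openin_image[OF o c], of "f \<circ> chart_inv c"])
    show "Cinf (mdim M) (snd c ` (W \<inter> W' \<inter> fst c)) (f \<circ> chart_inv c)"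
      using W(3) c by (intro Cinf_mono[OF openin_image[OF W(1) c] openin_image[OF o c]])
        (auto simp: smooth_fun_def)
  qed (use W' c in auto)
  then show ?thesis unfolding smooth_fun_at_def smooth_fun_def using o W W' by blast
qed

lemma sm_chart: "c \<in> atlas M \<Longrightarrow> p \<in> fst c \<Longrightarrow> sm p (\<lambda>q. snd c q j)"
proof -
  assume c: "c \<in> atlas M" "p \<in> fst c"
  have "Cinf (mdim M) (snd c ` fst c) (\<lambda>x. snd c (chart_inv c x) j)"
  proof (rule Cinf_cong[OF chart_open[OF c(1)]])
    show "Cinf (mdim M) (snd c ` fst c) (\<lambda>x. x j)"
      unfolding Cinf_def using Ck_proj chart_open[OF c(1)] by blast
  qed (use c in auto)
  then show ?thesis unfolding sm_iff[OF c] Cinf_at_def using chart_open[OF c(1)] c by blast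
qed

text \<open>Smoothness is claimed only at points of \<open>W\<close>, where the function is locally
  constant. As fields and functions are only asked to be smooth near the point at hand, this already
  serves as a cutoff function.\<close>

lemma sm_indicator: "openin (mtop M) W \<Longrightarrow> p \<in> W \<Longrightarrow> sm p (\<lambda>q. if q \<in> W then 1 else 0)"
  using openin_points by (intro sm_cong[OF _ sm_const[of p 1]]) (auto intro!: eventually_nearI)

subsection \<open>Derivatives in charts\<close>

lemma pd_cong:
  assumes "c \<in> atlas M" "p \<in> fst c" "i < mdim M" "\<forall>\<^sub>F q in near p. f q = g q"
  shows "pd c i f p = pd c i g p"
  by (rule eventually_near_coordsE[OF assms(4,1,2)]) (auto intro!: partial_cong assms(3))

lemma pd_has_derivative:
  assumes "c \<in> atlas M" "p \<in> fst c" "i < mdim M" "sm p f"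
  shows "((\<lambda>t. f (chart_inv c ((snd c p)(i := t)))) has_real_derivative pd c i f p) (at (snd c p i))"
proof -
  obtain V where V: "openin (Euclidean_space (mdim M)) V" "snd c p \<in> V"
    "Cinf (mdim M) V (\<lambda>x. f (chart_inv c x))"
    using assms(4) unfolding sm_iff[OF assms(1,2)] Cinf_at_def by blast
  then have "Ck (Suc 0) (mdim M) V (\<lambda>x. f (chart_inv c x))" unfolding Cinf_def by blast
  from Ck_Suc_has_derivative[OF this assms(3) V(2)] show ?thesis .
qed

lemma pd_eqI:
  assumes "((\<lambda>t. f (chart_inv c ((snd c p)(i := t)))) has_real_derivative D) (at (snd c p i))"
  shows "pd c i f p = D"
  unfolding partial_def using DERIV_imp_deriv[OF assms] by simp

lemma pd_const [simp]: "pd c i (\<lambda>q. a) p = 0"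
  by (rule pd_eqI) auto

lemma pd_add:
  assumes "c \<in> atlas M" "p \<in> fst c" "i < mdim M" "sm p f" "sm p g"
  shows "pd c i (\<lambda>q. f q + g q) p = pd c i f p + pd c i g p"
  by (rule pd_eqI, intro DERIV_add pd_has_derivative assms)

lemma pd_mult:
  assumes "c \<in> atlas M" "p \<in> fst c" "i < mdim M" "sm p f" "sm p g"
  shows "pd c i (\<lambda>q. f q * g q) p = pd c i f p * g p + pd c i g p * f p"
  using pd_eqI[OF DERIV_mult[OF pd_has_derivative[OF assms(1-4)] pd_has_derivative[OF assms(1-3,5)]]]
    assms by simp

lemma pd_sm:
  assumes c: "c \<in> atlas M" "p \<in> fst c" and i: "i < mdim M" and f: "sm p f"
  shows "sm p (\<lambda>q. pd c i f q)"
proof -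
  obtain V where V: "openin (Euclidean_space (mdim M)) V" "snd c p \<in> V"
    "Cinf (mdim M) V (\<lambda>x. f (chart_inv c x))"
    using f unfolding sm_iff[OF c] Cinf_at_def by blast
  have o: "openin (Euclidean_space (mdim M)) (V \<inter> snd c ` fst c)"
    using V chart_open[OF c(1)] by blast
  have "Cinf (mdim M) (V \<inter> snd c ` fst c) (\<lambda>x. partial i (\<lambda>x. f (chart_inv c x)) x)"
    using Cinf_mono[OF V(1) o] Cinf_partial[OF V(3) i] by blast
  then have "Cinf (mdim M) (V \<inter> snd c ` fst c) (\<lambda>x. pd c i f (chart_inv c x))"
    by (rule Cinf_cong[OF o, rotated]) (use c in auto)
  then show ?thesis unfolding sm_iff[OF c] Cinf_at_def using o V(2) c by blast
qed

lemma pd_chain: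
  assumes c: "c \<in> atlas M" "p \<in> fst c" and d: "d \<in> atlas M" "p \<in> fst d"
    and i: "i < mdim M" and f: "sm p f"
  shows "pd d i f p = (\<Sum>j<mdim M. pd c j f p * pd d i (\<lambda>q. snd c q j) p)"
proof -
  obtain W where W: "openin (mtop M) W" "p \<in> W" "smooth_fun M W f"
    using f unfolding smooth_fun_at_def by blast
  define U where "U = snd d ` (W \<inter> fst c \<inter> fst d)"
  have U: "openin (Euclidean_space (mdim M)) U"
    unfolding U_def using openin_image[OF openin_Int[OF W(1) openin_chart_dom[OF c(1)]] d(1)] .
  have pU: "snd d p \<in> U" using W c d by (auto simp: U_def)
  have "pd d i f p = partial i (\<lambda>x. f (chart_inv c (snd c (chart_inv d x)))) (snd d p)"
    by (rule partial_cong[OF U pU i]) (use c d in \<open>auto simp: U_def\<close>)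
  also have "\<dots> = (\<Sum>j<mdim M. partial j (\<lambda>x. f (chart_inv c x)) (snd c (chart_inv d (snd d p)))
      * partial i (\<lambda>x. snd c (chart_inv d x) j) (snd d p))"
  proof (rule partial_compose[OF U openin_image[OF W(1) c(1)] _ _ _ i pU])
    show "snd c (chart_inv d x) \<in> snd c ` (W \<inter> fst c)" if "x \<in> U" for x
      using that d by (auto simp: U_def)
    have "Cinf (mdim M) U (\<lambda>x. snd c (chart_inv d x) j)" if "j < mdim M" for j
      by (rule Cinf_mono[OF overlap_open[OF d(1) c(1)] U _ transition[OF d(1) c(1) that]])
         (auto simp: U_def)
    then show "Ck (Suc 0) (mdim M) U (\<lambda>x. snd c (chart_inv d x) j)" if "j < mdim M" for j
      using that unfolding Cinf_def by blast
    show "Ck (Suc 0) (mdim M) (snd c ` (W \<inter> fst c)) (\<lambda>x. f (chart_inv c x))"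
      using W(3) c unfolding smooth_fun_def Cinf_def o_def by blast
  qed
  finally show ?thesis using c d by simp
qed

lemma pd_coord:
  assumes "c \<in> atlas M" "p \<in> fst c" "i < mdim M"
  shows "pd c i (\<lambda>q. snd c q j) p = (if j = i then 1 else 0)"
proof -
  have "pd c i (\<lambda>q. snd c q j) p = partial i (\<lambda>x. x j) (snd c p)"
    by (rule partial_cong[OF chart_open[OF assms(1)] _ assms(3)]) (use assms in auto)
  also have "\<dots> = (if j = i then 1 else 0)"
  proof (cases "j = i")
    case True
    then show ?thesis unfolding partial_def by (auto intro!: DERIV_imp_deriv)
  next
    case False
    then show ?thesis unfolding partial_def by (auto intro!: DERIV_imp_deriv)
  qed
  finally show ?thesis .
qed

lemma pd_commute:
  assumes c: "c \<in> atlas M" "p \<in> fst c" and ij: "i < mdim M" "j < mdim M" and f: "sm p f"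
  shows "pd c i (\<lambda>q. pd c j f q) p = pd c j (\<lambda>q. pd c i f q) p"
proof -
  obtain V where V: "openin (Euclidean_space (mdim M)) V" "snd c p \<in> V"
    "Cinf (mdim M) V (\<lambda>x. f (chart_inv c x))"
    using f unfolding sm_iff[OF c] Cinf_at_def by blast
  have k: "Ck (Suc (Suc 0)) (mdim M) V (\<lambda>x. f (chart_inv c x))" using V(3) unfolding Cinf_def by blast
  have "pd c a (\<lambda>q. pd c b f q) p = partial a (partial b (\<lambda>x. f (chart_inv c x))) (snd c p)"
    if "a < mdim M" for a b
    by (rule partial_cong[OF chart_open[OF c(1)] _ that]) (use c in auto)
  then show ?thesis using partial_commute[OF V(1) k V(2) ij] ij by simp
qed

subsection \<open>Tangent vectors as derivations\<close>

lemma dirder_eq: "dirder M p v f = (\<Sum>i<mdim M. pd (chart_at M p) i f p * v i)"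
  by (simp add: dirder_def o_def)

lemma dirder_cong:
  "p \<in> points M \<Longrightarrow> \<forall>\<^sub>F q in near p. f q = g q \<Longrightarrow> dirder M p v f = dirder M p v g"
  unfolding dirder_eq by (intro sum.cong refl arg_cong2[where f="(*)"] pd_cong) auto

lemma dirder_const [simp]: "dirder M p v (\<lambda>q. a) = 0"
  unfolding dirder_eq by simp

lemma dirder_add: "sm p f \<Longrightarrow> sm p g \<Longrightarrow> dirder M p v (\<lambda>q. f q + g q) = dirder M p v f + dirder M p v g"
  unfolding dirder_eq using sm_points[of p f]
  by (simp add: pd_add sum.distrib algebra_simps)

lemma dirder_mult:
  "sm p f \<Longrightarrow> sm p g \<Longrightarrow> dirder M p v (\<lambda>q. f q * g q) = dirder M p v f * g p + f p * dirder M p v g"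
  unfolding dirder_eq using sm_points[of p f]
  by (simp add: pd_mult sum.distrib sum_distrib_left algebra_simps)

lemma dirder_cmult: "sm p f \<Longrightarrow> dirder M p v (\<lambda>q. a * f q) = a * dirder M p v f"
  using dirder_mult[OF sm_const[of p a], of f v] sm_points[of p f] by simp

lemma dirder_uminus: "sm p f \<Longrightarrow> dirder M p v (\<lambda>q. - f q) = - dirder M p v f"
  using dirder_cmult[of p f v "-1"] by simp

lemma dirder_sum:
  assumes "p \<in> points M" "\<And>a. a \<in> S \<Longrightarrow> sm p (f a)"
  shows "dirder M p v (\<lambda>q. \<Sum>a\<in>S. f a q) = (\<Sum>a\<in>S. dirder M p v (f a))"
  using assms(2)
proof (induction S rule: infinite_finite_induct)
  case (insert a S)
  then show ?case using dirder_add[of p "f a" "\<lambda>q. \<Sum>a\<in>S. f a q"] sm_sum[OF assms(1), of S f] by simp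
qed simp_all

lemma dirder_lin: "dirder M p (a \<cdot>\<^sub>c v + b \<cdot>\<^sub>c w) f = a * dirder M p v f + b * dirder M p w f"
  unfolding dirder_eq by (simp add: coord_simps algebra_simps sum.distrib sum_distrib_left)

lemma dirder_add_vec: "dirder M p (v + w) f = dirder M p v f + dirder M p w f"
  unfolding dirder_eq by (simp add: coord_simps algebra_simps sum.distrib)

lemma dirder_scale_vec: "dirder M p (a \<cdot>\<^sub>c v) f = a * dirder M p v f"
  unfolding dirder_eq by (simp add: coord_simps algebra_simps sum_distrib_left)

lemma dirder_zero_vec [simp]: "dirder M p 0 f = 0"
  unfolding dirder_eq by (simp add: coord_simps)

lemma comp_in_add: "comp_in M c p (v + w) = comp_in M c p v + comp_in M c p w"
  by (auto simp: comp_in_def dirder_add_vec coord_simps)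

lemma comp_in_scale: "comp_in M c p (a \<cdot>\<^sub>c v) = a \<cdot>\<^sub>c comp_in M c p v"
  by (auto simp: comp_in_def dirder_scale_vec coord_simps)

lemma comp_in_zero [simp]: "comp_in M c p 0 = 0"
  by (auto simp: comp_in_def coord_simps)

lemma comp_in_sum: "comp_in M c p (\<Sum>a\<in>S. v a) = (\<Sum>a\<in>S. comp_in M c p (v a))"
  by (induction S rule: infinite_finite_induct) (auto simp: comp_in_add)

text \<open>The derivative is defined in the preferred chart, which changes with the point. To
  differentiate the result once more, or to see that it is smooth, one has to pass to a single
  chart, and this is the formula for doing so.\<close>

lemma dirder_chart:
  assumes c: "c \<in> atlas M" "p \<in> fst c" and f: "sm p f"
  shows "dirder M p v f = (\<Sum>i<mdim M. pd c i f p * comp_in M c p v i)"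
proof -
  have p: "p \<in> points M" using c chart_dom_points by blast
  have "dirder M p v f = (\<Sum>i<mdim M. (\<Sum>j<mdim M. pd c j f p * pd (chart_at M p) i (\<lambda>q. snd c q j) p) * v i)"
    unfolding dirder_eq using pd_chain[OF c chart_at_atlas chart_at_dom _ f] p by simp
  also have "\<dots> = (\<Sum>j<mdim M. pd c j f p * comp_in M c p v j)"
    unfolding comp_in_def dirder_eq sum_distrib_right sum_distrib_left
    by (subst sum.swap) (simp add: mult.assoc)
  finally show ?thesis .
qed

lemma coord_field_eq: "coord_field M c b q = (\<lambda>j. pd c b (\<lambda>q'. snd (chart_at M q) q' j) q)"
  by (simp add: coord_field_def)

lemma dirder_coord_field:
  assumes c: "c \<in> atlas M" "q \<in> fst c" and b: "b < mdim M" and f: "sm q f"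
  shows "dirder M q (coord_field M c b q) f = pd c b f q"
  unfolding dirder_eq coord_field_eq
  using pd_chain[OF chart_at_atlas chart_at_dom c b f] c chart_dom_points by simp

lemma pd_zero:
  assumes "c \<in> atlas M" "q \<in> fst c" "i < mdim M" "\<forall>\<^sub>F q' in near q. f q' = 0"
  shows "pd c i f q = 0"
  using pd_cong[OF assms(1-4)] by simp

lemma eventually_snd_zero:
  assumes "d \<in> atlas M" "q \<in> fst d" "j \<ge> mdim M"
  shows "\<forall>\<^sub>F q' in near q. snd d q' j = 0"
  using eventually_near_chart[OF assms(1,2)]
  by eventually_elim (use snd_in_Rn[OF assms(1)] assms(3) in \<open>auto simp: Rn_iff\<close>)

lemma coord_field_Rn:
  assumes c: "c \<in> atlas M" "q \<in> fst c" and b: "b < mdim M"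
  shows "coord_field M c b q \<in> Rn (mdim M)"
  unfolding Rn_iff coord_field_eq
  using pd_zero[OF c b eventually_snd_zero] c chart_dom_points by simp

lemma comp_in_Rn: "c \<in> atlas M \<Longrightarrow> p \<in> fst c \<Longrightarrow> comp_in M c p v \<in> Rn (mdim M)"
  unfolding Rn_iff comp_in_def
  using dirder_cong[OF chart_dom_points eventually_snd_zero, of c p c] by simp

lemma comp_in_coord_field:
  assumes c: "c \<in> atlas M" "q \<in> fst c" and b: "b < mdim M"
  shows "comp_in M c q (coord_field M c b q) = unit_coord b"
  unfolding comp_in_def using dirder_coord_field[OF c b sm_chart[OF c]] pd_coord[OF c b]
  by (simp add: unit_coord_def)

lemma comp_in_self:
  assumes p: "p \<in> points M" and v: "v \<in> Rn (mdim M)"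
  shows "comp_in M (chart_at M p) p v = v"
proof (rule Rn_eqI)
  show "comp_in M (chart_at M p) p v \<in> Rn (mdim M)" using comp_in_Rn p by simp
  fix j assume "j < mdim M"
  then show "comp_in M (chart_at M p) p v j = v j"
    unfolding comp_in_def dirder_eq using pd_coord[OF chart_at_atlas chart_at_dom] p
    by (simp add: if_distrib[of "\<lambda>x. x * _"] cong: if_cong)
qed (rule v)

lemma coord_field_self:
  assumes p: "p \<in> points M" and b: "b < mdim M"
  shows "coord_field M (chart_at M p) b p = unit_coord b"
  unfolding coord_field_eq using pd_coord[OF chart_at_atlas chart_at_dom b] p
  by (simp add: unit_coord_def)

lemma coord_field_expand:
  assumes c: "c \<in> atlas M" "q \<in> fst c" and v: "v \<in> Rn (mdim M)"
  shows "v = (\<Sum>b<mdim M. comp_in M c q v b \<cdot>\<^sub>c coord_field M c b q)"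
proof
  fix j
  have q: "q \<in> points M" using c chart_dom_points by blast
  have "v j = dirder M q v (\<lambda>q'. snd (chart_at M q) q' j)"
    using comp_in_self[OF q v] by (metis comp_in_def)
  also have "\<dots> = (\<Sum>b<mdim M. coord_field M c b q j * comp_in M c q v b)"
    using dirder_chart[OF c sm_chart[OF chart_at_atlas chart_at_dom]] q by (simp add: coord_field_eq)
  finally show "v j = (\<Sum>b<mdim M. comp_in M c q v b \<cdot>\<^sub>c coord_field M c b q) j"
    by (simp add: coord_simps mult.commute)
qed

lemma comp_in_inj:
  assumes "c \<in> atlas M" "q \<in> fst c" "v \<in> Rn (mdim M)" "w \<in> Rn (mdim M)"
    "comp_in M c q v = comp_in M c q w"
  shows "v = w"
  using coord_field_expand[OF assms(1-3)] coord_field_expand[OF assms(1,2,4)] assms(5) by simp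

lemma comp_in_change:
  assumes c: "c \<in> atlas M" "q \<in> fst c" and d: "d \<in> atlas M" "q \<in> fst d"
  shows "comp_in M d q v j = (\<Sum>b<mdim M. pd c b (\<lambda>q'. snd d q' j) q * comp_in M c q v b)"
  unfolding comp_in_def[of M d] by (rule dirder_chart[OF c sm_chart[OF d]])

subsection \<open>Smooth vector fields\<close>

lemma smf_points: "smf p X \<Longrightarrow> p \<in> points M"
  unfolding smooth_field_at_def using openin_points by blast

lemma smf_eventually: "smf p X \<Longrightarrow> \<forall>\<^sub>F q in near p. smf q X"
  unfolding smooth_field_at_def by (auto intro!: eventually_nearI)

lemma smf_Rn: "smf p X \<Longrightarrow> X p \<in> Rn (mdim M)"
  unfolding smooth_field_at_def smooth_field_def by blast

lemma smf_eventually_Rn: "smf p X \<Longrightarrow> \<forall>\<^sub>F q in near p. X q \<in> Rn (mdim M)"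
  by (rule eventually_mono[OF smf_eventually smf_Rn])

lemma smf_comp_sm:
  assumes "smf p X" "c \<in> atlas M" "p \<in> fst c" "j < mdim M"
  shows "sm p (\<lambda>q. comp_in M c q (X q) j)"
proof -
  obtain W where W: "openin (mtop M) W" "p \<in> W" "smooth_field M W X"
    using assms(1) unfolding smooth_field_at_def by blast
  have "Cinf (mdim M) (snd c ` (W \<inter> fst c)) (\<lambda>x. comp_in M c (chart_inv c x) (X (chart_inv c x)) j)"
    using W(3) assms unfolding smooth_field_def o_def by blast
  then show ?thesis unfolding sm_iff[OF assms(2,3)] Cinf_at_def
    using openin_image[OF W(1) assms(2)] W(2) assms(3) by blast
qed

text \<open>As for functions, one chart suffices: by \<open>comp_in_change\<close> the components in
  another chart are combinations of the given ones with the Jacobian of the transition map as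
  coefficients.\<close>

lemma smfI:
  assumes c: "c \<in> atlas M" "p \<in> fst c" and X: "\<forall>\<^sub>F q in near p. X q \<in> Rn (mdim M)"
    and s: "\<And>j. j < mdim M \<Longrightarrow> sm p (\<lambda>q. comp_in M c q (X q) j)"
  shows "smf p X"
proof -
  have "\<forall>\<^sub>F q in near p. \<forall>j\<in>{..<mdim M}. sm q (\<lambda>q. comp_in M c q (X q) j)"
    by (intro eventually_ball_finite) (auto intro!: sm_eventually s)
  with X eventually_near_chart[OF c]
  have "\<forall>\<^sub>F q in near p. X q \<in> Rn (mdim M) \<and> q \<in> fst c \<and> (\<forall>j<mdim M. sm q (\<lambda>q. comp_in M c q (X q) j))"
    by eventually_elim auto
  from eventually_nearE[OF this chart_dom_points[OF c]]
  obtain W where W0: "openin (mtop M) W" "p \<in> W"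
    "\<And>q. q \<in> W \<Longrightarrow> X q \<in> Rn (mdim M) \<and> q \<in> fst c \<and> (\<forall>j<mdim M. sm q (\<lambda>q. comp_in M c q (X q) j))"
    by metis
  then have W: "openin (mtop M) W" "p \<in> W" "\<And>q. q \<in> W \<Longrightarrow> X q \<in> Rn (mdim M)"
    "\<And>q. q \<in> W \<Longrightarrow> q \<in> fst c" "\<And>q j. q \<in> W \<Longrightarrow> j < mdim M \<Longrightarrow> sm q (\<lambda>q. comp_in M c q (X q) j)"
    by auto
  have "Cinf (mdim M) (snd d ` (W \<inter> fst d)) ((\<lambda>q. comp_in M d q (X q) j) \<circ> chart_inv d)"
    if d: "d \<in> atlas M" and j: "j < mdim M" for d j
    unfolding Cinf_iff_Cinf_at[OF openin_image[OF W(1) d]]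
  proof
    fix x assume "x \<in> snd d ` (W \<inter> fst d)"
    then obtain q where q: "x = snd d q" "q \<in> W" "q \<in> fst d" by blast
    have qc: "q \<in> fst c" using W q by blast
    have "sm q (\<lambda>q'. \<Sum>b<mdim M. pd c b (\<lambda>q'. snd d q' j) q' * comp_in M c q' (X q') b)"
      using W(5)[OF q(2)] c(1) qc chart_dom_points d q
      by (intro sm_sum sm_mult pd_sm sm_chart) auto
    moreover have "\<forall>\<^sub>F q' in near q. (\<Sum>b<mdim M. pd c b (\<lambda>q'. snd d q' j) q' * comp_in M c q' (X q') b)
        = comp_in M d q' (X q') j"
      using eventually_near_chart[OF c(1) qc] eventually_near_chart[OF d q(3)]
      by eventually_elim (rule comp_in_change[symmetric, OF c(1) _ d])
    ultimately have "sm q (\<lambda>q. comp_in M d q (X q) j)" by (rule sm_cong[rotated])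
    then show "Cinf_at (mdim M) x ((\<lambda>q. comp_in M d q (X q) j) \<circ> chart_inv d)"
      unfolding sm_iff[OF d q(3)] o_def q(1) .
  qed
  then have "smooth_field M W X" unfolding smooth_field_def using W(3) by blast
  then show ?thesis unfolding smooth_field_at_def using W by blast
qed

lemma smooth_field_iff:
  assumes W: "openin (mtop M) W"
  shows "smooth_field M W X \<longleftrightarrow> (\<forall>p\<in>W. smf p X)"
proof
  assume R: "\<forall>p\<in>W. smf p X"
  have "Cinf (mdim M) (snd c ` (W \<inter> fst c)) ((\<lambda>q. comp_in M c q (X q) j) \<circ> chart_inv c)"
    if c: "c \<in> atlas M" and j: "j < mdim M" for c j
    unfolding Cinf_iff_Cinf_at[OF openin_image[OF W c]]
  proof
    fix x assume "x \<in> snd c ` (W \<inter> fst c)"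
    then obtain q where q: "x = snd c q" "q \<in> W" "q \<in> fst c" by blast
    have "sm q (\<lambda>q. comp_in M c q (X q) j)" using smf_comp_sm R q c j by blast
    then show "Cinf_at (mdim M) x ((\<lambda>q. comp_in M c q (X q) j) \<circ> chart_inv c)"
      unfolding sm_iff[OF c q(3)] o_def q(1) .
  qed
  then show "smooth_field M W X" unfolding smooth_field_def using R smf_Rn by blast
qed (use W in \<open>auto simp: smooth_field_at_def\<close>)

lemma smf_cong:
  assumes "\<forall>\<^sub>F q in near p. X q = Y q" "smf p X"
  shows "smf p Y"
proof -
  have p: "p \<in> points M" using assms smf_points by blast
  show ?thesis
  proof (rule smfI[OF chart_at_atlas[OF p] chart_at_dom[OF p]])
    show "\<forall>\<^sub>F q in near p. Y q \<in> Rn (mdim M)"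
      using assms(1) smf_eventually_Rn[OF assms(2)] by eventually_elim simp
    fix j assume j: "j < mdim M"
    have "\<forall>\<^sub>F q in near p. comp_in M (chart_at M p) q (X q) j = comp_in M (chart_at M p) q (Y q) j"
      using assms(1) by eventually_elim simp
    then show "sm p (\<lambda>q. comp_in M (chart_at M p) q (Y q) j)"
      by (rule sm_cong) (use smf_comp_sm[OF assms(2) _ _ j] p in simp)
  qed
qed

lemma smf_add:
  assumes "smf p X" "smf p Y"
  shows "smf p (\<lambda>q. X q + Y q)"
proof -
  have p: "p \<in> points M" using assms smf_points by blast
  show ?thesis
  proof (rule smfI[OF chart_at_atlas[OF p] chart_at_dom[OF p]])
    show "\<forall>\<^sub>F q in near p. X q + Y q \<in> Rn (mdim M)"
      using smf_eventually_Rn[OF assms(1)] smf_eventually_Rn[OF assms(2)] by eventually_elim simp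
    show "sm p (\<lambda>q. comp_in M (chart_at M p) q (X q + Y q) j)" if "j < mdim M" for j
      using sm_add[OF smf_comp_sm[OF assms(1)] smf_comp_sm[OF assms(2)]] p that
      by (simp add: comp_in_add coord_simps)
  qed
qed

lemma smf_scale:
  assumes "sm p f" "smf p X"
  shows "smf p (\<lambda>q. f q \<cdot>\<^sub>c X q)"
proof -
  have p: "p \<in> points M" using assms smf_points by blast
  show ?thesis
  proof (rule smfI[OF chart_at_atlas[OF p] chart_at_dom[OF p]])
    show "\<forall>\<^sub>F q in near p. f q \<cdot>\<^sub>c X q \<in> Rn (mdim M)"
      using smf_eventually_Rn[OF assms(2)] by eventually_elim simp
    show "sm p (\<lambda>q. comp_in M (chart_at M p) q (f q \<cdot>\<^sub>c X q) j)" if "j < mdim M" for j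
      using sm_mult[OF assms(1) smf_comp_sm[OF assms(2)]] p that
      by (simp add: comp_in_scale coord_simps)
  qed
qed

lemma smf_zero: "p \<in> points M \<Longrightarrow> smf p (\<lambda>q. 0)"
  by (rule smfI[OF chart_at_atlas chart_at_dom]) (auto intro: sm_const simp: coord_simps)

lemma smf_sum: "p \<in> points M \<Longrightarrow> (\<And>a. a \<in> S \<Longrightarrow> smf p (X a)) \<Longrightarrow> smf p (\<lambda>q. \<Sum>a\<in>S. X a q)"
  by (induction S rule: infinite_finite_induct) (auto intro: smf_zero smf_add)

lemma smf_coord_field:
  assumes c: "c \<in> atlas M" "p \<in> fst c" and b: "b < mdim M"
  shows "smf p (coord_field M c b)"
proof (rule smfI[OF c])
  show "\<forall>\<^sub>F q in near p. coord_field M c b q \<in> Rn (mdim M)"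
    using eventually_near_chart[OF c] by eventually_elim (rule coord_field_Rn[OF c(1) _ b])
  fix j assume "j < mdim M"
  show "sm p (\<lambda>q. comp_in M c q (coord_field M c b q) j)"
  proof (rule sm_cong[OF _ sm_const])
    show "\<forall>\<^sub>F q in near p. unit_coord b j = comp_in M c q (coord_field M c b q) j"
      using eventually_near_chart[OF c] by eventually_elim (simp add: comp_in_coord_field[OF c(1) _ b])
  qed (use c chart_dom_points in blast)
qed

lemma dirder_sm:
  assumes X: "smf p X" and f: "sm p f"
  shows "sm p (\<lambda>q. dirder M q (X q) f)"
proof -
  have p: "p \<in> points M" using f sm_points by blast
  let ?c = "chart_at M p"
  have "sm p (\<lambda>q. \<Sum>i<mdim M. pd ?c i f q * comp_in M ?c q (X q) i)"
    using p X f by (intro sm_sum sm_mult pd_sm smf_comp_sm) auto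
  moreover have "\<forall>\<^sub>F q in near p. (\<Sum>i<mdim M. pd ?c i f q * comp_in M ?c q (X q) i) = dirder M q (X q) f"
    using eventually_near_chart[OF chart_at_atlas[OF p] chart_at_dom[OF p]] sm_eventually[OF f]
    by eventually_elim (rule dirder_chart[symmetric, OF chart_at_atlas[OF p]])
  ultimately show ?thesis by (rule sm_cong[rotated])
qed

text \<open>The standard extension of a tangent vector to a local field, needed wherever a tensor is
  defined through arbitrary extensions. Only its germ at \<open>p\<close> is meaningful.\<close>

definition const_ext :: "'p \<Rightarrow> coord \<Rightarrow> 'p \<Rightarrow> coord" where
  "const_ext p v q = (\<Sum>b<mdim M. v b \<cdot>\<^sub>c coord_field M (chart_at M p) b q)"

lemma smf_const_ext: "p \<in> points M \<Longrightarrow> smf p (const_ext p v)"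
  unfolding const_ext_def by (intro smf_sum smf_scale sm_const smf_coord_field) auto

lemma const_ext_self: "p \<in> points M \<Longrightarrow> v \<in> Rn (mdim M) \<Longrightarrow> const_ext p v p = v"
  unfolding const_ext_def using Rn_expand[of v "mdim M"] by (simp add: coord_field_self)

text \<open>
  Scaling by the indicator function of a neighbourhood shows that an operator which is linear over
  the smooth functions is local; expanding in a coordinate frame then shows that it is pointwise.
\<close>

lemma tensorial_local:
  fixes T :: "('p \<Rightarrow> coord) \<Rightarrow> real"
  assumes scale: "\<And>f X. sm p f \<Longrightarrow> smf p X \<Longrightarrow> T (\<lambda>q. f q \<cdot>\<^sub>c X q) = f p * T X"
    and X: "smf p X" and Y: "smf p Y" and eq: "\<forall>\<^sub>F q in near p. X q = Y q"
  shows "T X = T Y"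
proof -
  have p: "p \<in> points M" using X smf_points by blast
  obtain W where W: "openin (mtop M) W" "p \<in> W" "\<And>q. q \<in> W \<Longrightarrow> X q = Y q"
    using eventually_nearE[OF eq p] by blast
  define f where "f q = (if q \<in> W then 1 else 0 :: real)" for q
  have f: "sm p f" using sm_indicator[OF W(1,2)] by (simp add: f_def[abs_def])
  have "(\<lambda>q. f q \<cdot>\<^sub>c X q) = (\<lambda>q. f q \<cdot>\<^sub>c Y q)" using W(3) by (auto simp: f_def fun_eq_iff coord_simps)
  then show ?thesis using scale[OF f X] scale[OF f Y] W(2) by (simp add: f_def)
qed

lemma tensorial_sum:
  fixes T :: "('p \<Rightarrow> coord) \<Rightarrow> real"
  assumes add: "\<And>X Y. smf p X \<Longrightarrow> smf p Y \<Longrightarrow> T (\<lambda>q. X q + Y q) = T X + T Y"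
    and scale: "\<And>f X. sm p f \<Longrightarrow> smf p X \<Longrightarrow> T (\<lambda>q. f q \<cdot>\<^sub>c X q) = f p * T X"
    and p: "p \<in> points M" and "\<And>a. a \<in> S \<Longrightarrow> smf p (F a)" "\<And>a. a \<in> S \<Longrightarrow> sm p (f a)"
  shows "T (\<lambda>q. \<Sum>a\<in>S. f a q \<cdot>\<^sub>c F a q) = (\<Sum>a\<in>S. f a p * T (F a))"
proof -
  have "T (\<lambda>q. 0 \<cdot>\<^sub>c 0) = 0 * T (\<lambda>q. 0)" by (rule scale[OF sm_const[OF p] smf_zero[OF p]])
  then have T0: "T (\<lambda>q. 0) = 0" by simp
  show ?thesis using assms(4,5)
  proof (induction S rule: infinite_finite_induct)
    case (insert a S)
    have "T (\<lambda>q. \<Sum>a\<in>insert a S. f a q \<cdot>\<^sub>c F a q) = T (\<lambda>q. f a q \<cdot>\<^sub>c F a q + (\<Sum>a\<in>S. f a q \<cdot>\<^sub>c F a q))"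
      using insert by simp
    also have "\<dots> = T (\<lambda>q. f a q \<cdot>\<^sub>c F a q) + T (\<lambda>q. \<Sum>a\<in>S. f a q \<cdot>\<^sub>c F a q)"
      using insert p by (intro add smf_sum smf_scale) auto
    also have "\<dots> = (\<Sum>a\<in>insert a S. f a p * T (F a))" using insert scale by simp
    finally show ?case .
  qed (simp_all add: T0)
qed

lemma smf_frame_expand:
  assumes X: "smf p X" and c: "c \<in> atlas M" "p \<in> fst c"
  shows "\<forall>\<^sub>F q in near p. X q = (\<Sum>b<mdim M. comp_in M c q (X q) b \<cdot>\<^sub>c coord_field M c b q)"
  using smf_eventually_Rn[OF X] eventually_near_chart[OF c]
  by eventually_elim (rule coord_field_expand[OF c(1)])

lemma tensorial:
  fixes T :: "('p \<Rightarrow> coord) \<Rightarrow> real"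
  assumes add: "\<And>X Y. smf p X \<Longrightarrow> smf p Y \<Longrightarrow> T (\<lambda>q. X q + Y q) = T X + T Y"
    and scale: "\<And>f X. sm p f \<Longrightarrow> smf p X \<Longrightarrow> T (\<lambda>q. f q \<cdot>\<^sub>c X q) = f p * T X"
    and X: "smf p X" and Y: "smf p Y" and eq: "X p = Y p"
  shows "T X = T Y"
proof -
  have p: "p \<in> points M" using X smf_points by blast
  let ?c = "chart_at M p"
  have "T X = (\<Sum>b<mdim M. comp_in M ?c p (X p) b * T (coord_field M ?c b))" if X: "smf p X" for X
  proof -
    have "smf p (\<lambda>q. \<Sum>b<mdim M. comp_in M ?c q (X q) b \<cdot>\<^sub>c coord_field M ?c b q)"
      using p X by (intro smf_sum smf_scale smf_coord_field smf_comp_sm) auto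
    then have "T X = T (\<lambda>q. \<Sum>b<mdim M. comp_in M ?c q (X q) b \<cdot>\<^sub>c coord_field M ?c b q)"
      using tensorial_local[of p T, OF scale X _ smf_frame_expand[OF X]] p by simp
    also have "\<dots> = (\<Sum>b<mdim M. comp_in M ?c p (X p) b * T (coord_field M ?c b))"
      using p X by (intro tensorial_sum add scale smf_coord_field smf_comp_sm) auto
    finally show ?thesis .
  qed
  then show ?thesis using X Y eq by simp
qed

text \<open>A tensorial operator may be evaluated on the extension of \<open>X p\<close> with
  constant coefficients, so any family expressing \<open>X p\<close> will do, not just a coordinate
  frame. It is used with frames of lifts.\<close>

lemma tensorial_frame:
  fixes T :: "('p \<Rightarrow> coord) \<Rightarrow> real"
  assumes add: "\<And>X Y. smf p X \<Longrightarrow> smf p Y \<Longrightarrow> T (\<lambda>q. X q + Y q) = T X + T Y"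
    and scale: "\<And>f X. sm p f \<Longrightarrow> smf p X \<Longrightarrow> T (\<lambda>q. f q \<cdot>\<^sub>c X q) = f p * T X"
    and X: "smf p X" and F: "\<And>a. a \<in> S \<Longrightarrow> smf p (F a)" and eq: "X p = (\<Sum>a\<in>S. r a \<cdot>\<^sub>c F a p)"
  shows "T X = (\<Sum>a\<in>S. r a * T (F a))"
proof -
  have p: "p \<in> points M" using X smf_points by blast
  have "T X = T (\<lambda>q. \<Sum>a\<in>S. r a \<cdot>\<^sub>c F a q)"
    by (rule tensorial[of p T, OF add scale X]) (use F p eq in \<open>auto intro!: smf_sum smf_scale sm_const\<close>)
  also have "\<dots> = (\<Sum>a\<in>S. r a * T (F a))"
    by (rule tensorial_sum[of p T, OF add scale p]) (use F p in \<open>auto intro!: sm_const\<close>)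
  finally show ?thesis .
qed

subsection \<open>The Lie bracket\<close>

lemma tangent_eqI:
  assumes "p \<in> points M" "v \<in> Rn (mdim M)" "w \<in> Rn (mdim M)"
    "\<And>j. j < mdim M \<Longrightarrow> dirder M p v (\<lambda>q. snd (chart_at M p) q j) = dirder M p w (\<lambda>q. snd (chart_at M p) q j)"
  shows "v = w"
  by (rule Rn_eqI[OF assms(2,3)])
     (use comp_in_self[OF assms(1,2)] comp_in_self[OF assms(1,3)] assms(4) in \<open>metis comp_in_def\<close>)

lemma bracket_Rn: "p \<in> points M \<Longrightarrow> bracket M X Y p \<in> Rn (mdim M)"
proof -
  assume p: "p \<in> points M"
  have "dirder M p v (\<lambda>q. comp_in M (chart_at M p) q (Z q) j) = 0" if j: "j \<ge> mdim M" for v Z j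
  proof -
    have "\<forall>\<^sub>F q in near p. comp_in M (chart_at M p) q (Z q) j = 0"
      using eventually_near_chart[OF chart_at_atlas[OF p] chart_at_dom[OF p]]
      by eventually_elim (use comp_in_Rn p j in \<open>auto simp: Rn_iff\<close>)
    from dirder_cong[OF p this] show ?thesis by simp
  qed
  then show ?thesis unfolding bracket_def Rn_iff by simp
qed

text \<open>Describing the bracket as a commutator of derivations turns the brackets of lifts,
  computed later, into iterated derivatives of coordinate functions.\<close>

lemma dirder_bracket:
  assumes X: "smf p X" and Y: "smf p Y" and f: "sm p f"
  shows "dirder M p (bracket M X Y p) f
    = dirder M p (X p) (\<lambda>q. dirder M q (Y q) f) - dirder M p (Y p) (\<lambda>q. dirder M q (X q) f)"
proof -
  have p: "p \<in> points M" using f sm_points by blast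
  define c where "c = chart_at M p"
  have c: "c \<in> atlas M" "p \<in> fst c" using p by (auto simp: c_def)
  define D where "D V b q = comp_in M c q (V q) b" for V :: "'p \<Rightarrow> coord" and b q
  \<comment> \<open>The double sum is the second-order part, which is symmetric in the two fields
    because partial derivatives commute; the other sum yields the components of the bracket.\<close>
  have expand: "dirder M p (Z p) (\<lambda>q. dirder M q (V q) f) =
      (\<Sum>b<mdim M. \<Sum>a<mdim M. pd c a (\<lambda>q. pd c b f q) p * Z p a * V p b) +
      (\<Sum>b<mdim M. pd c b f p * dirder M p (Z p) (D V b))" if V: "smf p V" for Z V
  proof -
    have "\<forall>\<^sub>F q in near p. dirder M q (V q) f = (\<Sum>b<mdim M. pd c b f q * D V b q)"
      using eventually_near_chart[OF c] sm_eventually[OF f] unfolding D_def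
      by eventually_elim (rule dirder_chart[OF c(1)])
    then have "dirder M p (Z p) (\<lambda>q. dirder M q (V q) f) = dirder M p (Z p) (\<lambda>q. \<Sum>b<mdim M. pd c b f q * D V b q)"
      by (rule dirder_cong[OF p])
    also have "\<dots> = (\<Sum>b<mdim M. dirder M p (Z p) (\<lambda>q. pd c b f q * D V b q))"
      unfolding D_def by (rule dirder_sum[OF p]) (use c f V in \<open>auto intro!: sm_mult pd_sm smf_comp_sm\<close>)
    also have "\<dots> = (\<Sum>b<mdim M. dirder M p (Z p) (\<lambda>q. pd c b f q) * D V b p + pd c b f p * dirder M p (Z p) (D V b))"
      unfolding D_def by (intro sum.cong refl dirder_mult) (use c f V in \<open>auto intro!: pd_sm smf_comp_sm\<close>)
    also have "\<dots> = (\<Sum>b<mdim M. (\<Sum>a<mdim M. pd c a (\<lambda>q. pd c b f q) p * Z p a) * V p b + pd c b f p * dirder M p (Z p) (D V b))"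
      using comp_in_self[OF p smf_Rn[OF V]] unfolding dirder_eq[of p "Z p" "\<lambda>q. pd c _ f q"]
      by (simp add: D_def c_def)
    finally show ?thesis by (simp add: sum.distrib sum_distrib_right)
  qed
  have "(\<Sum>b<mdim M. \<Sum>a<mdim M. pd c a (\<lambda>q. pd c b f q) p * X p a * Y p b)
      = (\<Sum>b<mdim M. \<Sum>a<mdim M. pd c a (\<lambda>q. pd c b f q) p * Y p a * X p b)"
    by (subst sum.swap, intro sum.cong refl) (use pd_commute[OF c _ _ f] in simp)
  moreover have "dirder M p (bracket M X Y p) f
      = (\<Sum>b<mdim M. pd c b f p * dirder M p (X p) (D Y b)) - (\<Sum>b<mdim M. pd c b f p * dirder M p (Y p) (D X b))"
    unfolding dirder_eq[of p "bracket M X Y p"] unfolding bracket_def D_def c_def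
    by (simp add: right_diff_distrib sum_subtractf)
  ultimately show ?thesis unfolding expand[OF X] expand[OF Y] by simp
qed

lemma bracket_swap: "bracket M Y X p = - bracket M X Y p"
  by (auto simp: bracket_def coord_simps)

lemma bracket_add_left:
  assumes "smf p X" "smf p X'"
  shows "bracket M (\<lambda>q. X q + X' q) Y p = bracket M X Y p + bracket M X' Y p"
proof (rule Rn_eqI)
  have p: "p \<in> points M" using assms smf_points by blast
  show "bracket M (\<lambda>q. X q + X' q) Y p \<in> Rn (mdim M)" "bracket M X Y p + bracket M X' Y p \<in> Rn (mdim M)"
    using bracket_Rn[OF p] by auto
  fix j assume j: "j < mdim M"
  show "bracket M (\<lambda>q. X q + X' q) Y p j = (bracket M X Y p + bracket M X' Y p) j"
    using dirder_add[OF smf_comp_sm[OF assms(1)] smf_comp_sm[OF assms(2)]] p j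
    by (simp add: bracket_def comp_in_add dirder_add_vec coord_simps)
qed

lemma bracket_scale_left:
  assumes "sm p f" "smf p X"
  shows "bracket M (\<lambda>q. f q \<cdot>\<^sub>c X q) Y p = f p \<cdot>\<^sub>c bracket M X Y p - dirder M p (Y p) f \<cdot>\<^sub>c X p"
proof (rule Rn_eqI)
  have p: "p \<in> points M" using assms smf_points by blast
  show "bracket M (\<lambda>q. f q \<cdot>\<^sub>c X q) Y p \<in> Rn (mdim M)"
    "f p \<cdot>\<^sub>c bracket M X Y p - dirder M p (Y p) f \<cdot>\<^sub>c X p \<in> Rn (mdim M)"
    using bracket_Rn[OF p] smf_Rn[OF assms(2)] by auto
  fix j assume j: "j < mdim M"
  show "bracket M (\<lambda>q. f q \<cdot>\<^sub>c X q) Y p j = (f p \<cdot>\<^sub>c bracket M X Y p - dirder M p (Y p) f \<cdot>\<^sub>c X p) j"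
    using dirder_mult[OF assms(1) smf_comp_sm[OF assms(2)]] p j comp_in_self[OF p smf_Rn[OF assms(2)]]
    by (simp add: bracket_def comp_in_scale dirder_scale_vec algebra_simps coord_simps)
qed

lemma bracket_coord_fields:
  assumes p: "p \<in> points M" and ab: "a < mdim M" "b < mdim M"
  shows "bracket M (coord_field M (chart_at M p) a) (coord_field M (chart_at M p) b) p = 0"
proof -
  have "dirder M p v (\<lambda>q. comp_in M (chart_at M p) q (coord_field M (chart_at M p) b q) j) = 0"
    if b: "b < mdim M" for v b j
  proof -
    have "\<forall>\<^sub>F q in near p. comp_in M (chart_at M p) q (coord_field M (chart_at M p) b q) j = unit_coord b j"
      using eventually_near_chart[OF chart_at_atlas[OF p] chart_at_dom[OF p]]
      by eventually_elim (use comp_in_coord_field p b in simp)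
    from dirder_cong[OF p this] show ?thesis by simp
  qed
  then show ?thesis using ab by (simp add: bracket_def fun_eq_iff coord_simps)
qed

end

section \<open>Inner products on coordinate space\<close>

text \<open>Linear algebra of a single tangent space. It is relative to the carrier
  \<open>Rn n\<close>, since \<open>n\<close> is a term.\<close>

locale inner_product_on =
  fixes n :: nat and B :: "coord \<Rightarrow> coord \<Rightarrow> real"
  assumes lin: "u \<in> Rn n \<Longrightarrow> v \<in> Rn n \<Longrightarrow> w \<in> Rn n \<Longrightarrow>
      B (a \<cdot>\<^sub>c u + b \<cdot>\<^sub>c v) w = a * B u w + b * B v w"
    and sym: "u \<in> Rn n \<Longrightarrow> v \<in> Rn n \<Longrightarrow> B u v = B v u"
    and pos: "u \<in> Rn n \<Longrightarrow> u \<noteq> 0 \<Longrightarrow> B u u > 0"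
begin

lemma add_left: "u \<in> Rn n \<Longrightarrow> v \<in> Rn n \<Longrightarrow> w \<in> Rn n \<Longrightarrow> B (u + v) w = B u w + B v w"
  using lin[of u v w 1 1] by simp

lemma scale_left: "u \<in> Rn n \<Longrightarrow> w \<in> Rn n \<Longrightarrow> B (a \<cdot>\<^sub>c u) w = a * B u w"
  using lin[of u u w a 0] by simp

lemma zero_left: "w \<in> Rn n \<Longrightarrow> B 0 w = 0"
  using scale_left[of 0 w 0] by simp

lemma minus_left: "u \<in> Rn n \<Longrightarrow> v \<in> Rn n \<Longrightarrow> w \<in> Rn n \<Longrightarrow> B (u - v) w = B u w - B v w"
  using lin[of u v w 1 "-1"] by simp

lemma uminus_left: "u \<in> Rn n \<Longrightarrow> w \<in> Rn n \<Longrightarrow> B (- u) w = - B u w"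
  using scale_left[of u w "-1"] by simp

lemma sum_left:
  "(\<And>i. i \<in> S \<Longrightarrow> f i \<in> Rn n) \<Longrightarrow> w \<in> Rn n \<Longrightarrow> B (\<Sum>i\<in>S. f i) w = (\<Sum>i\<in>S. B (f i) w)"
  by (induction S rule: infinite_finite_induct) (simp_all add: zero_left add_left)

lemma add_right: "u \<in> Rn n \<Longrightarrow> v \<in> Rn n \<Longrightarrow> w \<in> Rn n \<Longrightarrow> B w (u + v) = B w u + B w v"
  using add_left[of u v w] sym by simp

lemma scale_right: "u \<in> Rn n \<Longrightarrow> w \<in> Rn n \<Longrightarrow> B w (a \<cdot>\<^sub>c u) = a * B w u"
  using scale_left[of u w a] sym by simp

lemma zero_right: "w \<in> Rn n \<Longrightarrow> B w 0 = 0"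
  using zero_left[of w] sym by simp

lemma minus_right: "u \<in> Rn n \<Longrightarrow> v \<in> Rn n \<Longrightarrow> w \<in> Rn n \<Longrightarrow> B w (u - v) = B w u - B w v"
  using minus_left[of u v w] sym by simp

lemma uminus_right: "u \<in> Rn n \<Longrightarrow> w \<in> Rn n \<Longrightarrow> B w (- u) = - B w u"
  using uminus_left[of u w] sym by simp

lemma sum_right:
  assumes "\<And>i. i \<in> S \<Longrightarrow> f i \<in> Rn n" "w \<in> Rn n"
  shows "B w (\<Sum>i\<in>S. f i) = (\<Sum>i\<in>S. B w (f i))"
  using assms by (induction S rule: infinite_finite_induct) (simp_all add: zero_right add_right)

lemmas bilin = add_left scale_left zero_left minus_left uminus_left
  add_right scale_right zero_right minus_right uminus_right

section \<open>Orthonormal families, representation of functionals, traces\<close>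

lemma nondegenerate:
  assumes "u \<in> Rn n" "v \<in> Rn n" "\<And>y. y \<in> Rn n \<Longrightarrow> B u y = B v y"
  shows "u = v"
proof (rule ccontr)
  assume "u \<noteq> v"
  then have "B (u - v) (u - v) > 0" using assms by (intro pos) auto
  moreover have "B (u - v) (u - v) = 0" using assms by (simp add: minus_left)
  ultimately show False by simp
qed

text \<open>The length \<open>m\<close> is independent of \<open>n\<close>, so that bases can be
  built vector by vector.\<close>

definition orthonormal :: "nat \<Rightarrow> (nat \<Rightarrow> coord) \<Rightarrow> bool" where
  "orthonormal m e \<longleftrightarrow> (\<forall>i<m. e i \<in> Rn n) \<and> (\<forall>i<m. \<forall>j<m. B (e i) (e j) = (if i = j then 1 else 0))"

lemma orthonormal_coeff:
  assumes "orthonormal m e" "j < m"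
  shows "B (\<Sum>i<m. r i \<cdot>\<^sub>c e i) (e j) = r j"
proof -
  have "B (\<Sum>i<m. r i \<cdot>\<^sub>c e i) (e j) = (\<Sum>i<m. r i * B (e i) (e j))"
    using assms by (subst sum_left) (auto simp: orthonormal_def scale_left)
  also have "\<dots> = (\<Sum>i<m. if i = j then r i else 0)"
    using assms by (intro sum.cong) (auto simp: orthonormal_def)
  finally show ?thesis using assms(2) by simp
qed

lemma orthonormal_inj: "orthonormal m e \<Longrightarrow> inj_on e {..<m}"
  unfolding orthonormal_def inj_on_def by (metis lessThan_iff zero_neq_one)

lemma orthonormal_independent:
  assumes "orthonormal m e"
  shows "cv.independent (e ` {..<m})"
proof (rule cv.independent_if_scalars_zero)
  fix f x assume f: "(\<Sum>x\<in>e ` {..<m}. f x \<cdot>\<^sub>c x) = 0" and "x \<in> e ` {..<m}"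
  then obtain j where j: "x = e j" "j < m" by auto
  have "(\<Sum>i<m. f (e i) \<cdot>\<^sub>c e i) = 0" using f by (simp add: sum.reindex[OF orthonormal_inj[OF assms]])
  then have "B 0 (e j) = f (e j)" using orthonormal_coeff[OF assms j(2), of "\<lambda>i. f (e i)"] by simp
  then show "f x = 0" using assms j by (simp add: zero_left orthonormal_def)
qed simp

lemma Rn_subset_span: "Rn n \<subseteq> cv.span (unit_coord ` {..<n})"
proof
  fix x assume "x \<in> Rn n"
  then have "x = (\<Sum>i<n. x i \<cdot>\<^sub>c unit_coord i)" by (rule Rn_expand)
  also have "\<dots> \<in> cv.span (unit_coord ` {..<n})"
    by (intro cv.span_sum cv.span_scale cv.span_base) auto
  finally show "x \<in> cv.span (unit_coord ` {..<n})" .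
qed

lemma orthonormal_le:
  assumes "orthonormal m e"
  shows "m \<le> n"
proof -
  have "card (e ` {..<m}) \<le> card (unit_coord ` {..<n})"
    using cv.independent_span_bound[OF _ orthonormal_independent[OF assms], of "unit_coord ` {..<n}"]
      Rn_subset_span assms by (force simp: orthonormal_def)
  also have "\<dots> \<le> n" using card_image_le[of "{..<n}" unit_coord] by simp
  finally show ?thesis using card_image[OF orthonormal_inj[OF assms]] by simp
qed

text \<open>A Gram-Schmidt step that is used in two ways: it builds bases, and, as no family can
  have more than \<open>n\<close> members, it forces every vector to equal its expansion in a family
  of length \<open>n\<close>.\<close>

lemma orthonormal_extend:
  assumes e: "orthonormal m e" and x: "x \<in> Rn n" "x \<noteq> (\<Sum>i<m. B x (e i) \<cdot>\<^sub>c e i)"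
  shows "\<exists>e'. orthonormal (Suc m) e'"
proof -
  define y where "y = x - (\<Sum>i<m. B x (e i) \<cdot>\<^sub>c e i)"
  have eR: "e i \<in> Rn n" if "i < m" for i using e that by (simp add: orthonormal_def)
  have sR: "(\<Sum>i<m. B x (e i) \<cdot>\<^sub>c e i) \<in> Rn n" by (intro Rn_sum Rn_closed eR) simp
  have y: "y \<in> Rn n" "y \<noteq> 0" using x sR by (auto simp: y_def)
  have orth: "B y (e j) = 0" if "j < m" for j
    using that x(1) sR eR by (simp add: y_def minus_left orthonormal_coeff[OF e])
  define z where "z = (1 / sqrt (B y y)) \<cdot>\<^sub>c y"
  have yy: "B y y > 0" using pos y by blast
  have z: "z \<in> Rn n" "B z z = 1" "\<And>j. j < m \<Longrightarrow> B z (e j) = 0"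
    using y yy orth eR by (auto simp: z_def scale_left scale_right)
  have "orthonormal (Suc m) (e(m := z))"
    using e z eR by (auto simp: orthonormal_def less_Suc_eq sym)
  then show ?thesis by blast
qed

lemma independent_unit_coord: "cv.independent (unit_coord ` {..<m})"
proof (rule cv.independent_if_scalars_zero)
  fix f x assume f: "(\<Sum>x\<in>unit_coord ` {..<m}. f x \<cdot>\<^sub>c x) = 0" and "x \<in> unit_coord ` {..<m}"
  then obtain j where j: "x = unit_coord j" "j < m" by auto
  have inj: "inj_on unit_coord {..<m}"
    by (rule inj_onI) (metis unit_coord_apply zero_neq_one)
  have "(\<Sum>i<m. f (unit_coord i) \<cdot>\<^sub>c unit_coord i) = 0" using f by (simp add: sum.reindex[OF inj])
  then have "(\<Sum>i<m. f (unit_coord i) \<cdot>\<^sub>c unit_coord i) j = 0" by (simp add: coord_simps)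
  then show "f x = 0" using j by (simp add: coord_simps unit_coord_def if_distrib cong: if_cong)
qed simp

lemma orthonormal_exists: "m \<le> n \<Longrightarrow> \<exists>e. orthonormal m e"
proof (induction m)
  case 0
  then show ?case by (simp add: orthonormal_def)
next
  case (Suc m)
  then obtain e where e: "orthonormal m e" by auto
  \<comment> \<open>Otherwise the \<open>m\<close> vectors would span all of \<open>Rn n\<close>,
    which contains \<open>n > m\<close> independent unit vectors.\<close>
  have "\<exists>x\<in>Rn n. x \<noteq> (\<Sum>i<m. B x (e i) \<cdot>\<^sub>c e i)"
  proof (rule ccontr)
    assume "\<not> ?thesis"
    then have eq: "x = (\<Sum>i<m. B x (e i) \<cdot>\<^sub>c e i)" if "x \<in> Rn n" for x using that by blast
    have "x \<in> cv.span (e ` {..<m})" if "x \<in> Rn n" for x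
      by (subst eq[OF that]) (intro cv.span_sum cv.span_scale cv.span_base, simp)
    then have "unit_coord ` {..<n} \<subseteq> cv.span (e ` {..<m})" by auto
    then have "card (unit_coord ` {..<n}) \<le> card (e ` {..<m})"
      using cv.independent_span_bound[OF _ independent_unit_coord] by blast
    moreover have "card (unit_coord ` {..<n}) = n"
      by (subst card_image) (auto intro!: inj_onI simp: unit_coord_def fun_eq_iff split: if_splits)
    moreover have "card (e ` {..<m}) \<le> m" using card_image_le[of "{..<m}" e] by simp
    ultimately show False using Suc.prems by simp
  qed
  then show ?case using orthonormal_extend[OF e] by blast
qed

lemma orthonormal_expand:
  assumes "orthonormal n e" "x \<in> Rn n"
  shows "x = (\<Sum>i<n. B x (e i) \<cdot>\<^sub>c e i)"
  using orthonormal_extend[OF assms] orthonormal_le by fastforce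

text \<open>The Levi-Civita difference and the adjoint are both specified by their inner products
  with all vectors; this gives the corresponding descriptions their meaning.\<close>

lemma riesz:
  assumes L: "\<And>u v a b. u \<in> Rn n \<Longrightarrow> v \<in> Rn n \<Longrightarrow> L (a \<cdot>\<^sub>c u + b \<cdot>\<^sub>c v) = a * L u + b * L v"
  shows "\<exists>!z. z \<in> Rn n \<and> (\<forall>y\<in>Rn n. B z y = L y)"
proof -
  obtain e where e: "orthonormal n e" using orthonormal_exists by blast
  have eR: "e i \<in> Rn n" if "i < n" for i using e that by (simp add: orthonormal_def)
  define z where "z = (\<Sum>i<n. L (e i) \<cdot>\<^sub>c e i)"
  have z: "z \<in> Rn n" unfolding z_def by (intro Rn_sum Rn_closed eR) simp
  have L_sum: "L (\<Sum>i\<in>S. r i \<cdot>\<^sub>c e i) = (\<Sum>i\<in>S. r i * L (e i))" if "finite S" "S \<subseteq> {..<n}" for S r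
    using that
  proof (induction S)
    case empty
    show ?case using L[of 0 0 0 0] by simp
  next
    case (insert i S)
    have "(\<Sum>i\<in>S. r i \<cdot>\<^sub>c e i) \<in> Rn n" using insert eR by (intro Rn_sum Rn_closed) auto
    then show ?case using insert L[of "e i" "\<Sum>i\<in>S. r i \<cdot>\<^sub>c e i" "r i" 1] eR by auto
  qed
  have "B z y = L y" if y: "y \<in> Rn n" for y
  proof -
    have "B z y = (\<Sum>i<n. B y (e i) * L (e i))"
      unfolding z_def using y eR by (subst sum_left) (auto simp: scale_right sym[OF _ y] mult.commute)
    also have "\<dots> = L (\<Sum>i<n. B y (e i) \<cdot>\<^sub>c e i)" by (rule L_sum[symmetric]) auto
    finally show ?thesis using orthonormal_expand[OF e y] by simp
  qed
  then show ?thesis using z nondegenerate by (metis (no_types, lifting))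
qed

text \<open>Traces are defined through a basis picked by choice. Invariance under orthonormal
  changes of basis allows it to be replaced by a basis consisting of lifts.\<close>

lemma trace_invariant:
  fixes T :: "coord \<Rightarrow> coord \<Rightarrow> real"
  assumes T: "\<And>u v w a b. u \<in> Rn n \<Longrightarrow> v \<in> Rn n \<Longrightarrow> w \<in> Rn n \<Longrightarrow> T (a \<cdot>\<^sub>c u + b \<cdot>\<^sub>c v) w = a * T u w + b * T v w"
    "\<And>u v w a b. u \<in> Rn n \<Longrightarrow> v \<in> Rn n \<Longrightarrow> w \<in> Rn n \<Longrightarrow> T w (a \<cdot>\<^sub>c u + b \<cdot>\<^sub>c v) = a * T w u + b * T w v"
    and e: "orthonormal n e" and f: "orthonormal n f"
  shows "(\<Sum>i<n. T (e i) (e i)) = (\<Sum>i<n. T (f i) (f i))"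
proof -
  have eR: "e i \<in> Rn n" "f i \<in> Rn n" if "i < n" for i using e f that by (simp_all add: orthonormal_def)
  have left: "T (\<Sum>i\<in>S. r i \<cdot>\<^sub>c e i) w = (\<Sum>i\<in>S. r i * T (e i) w)" if "finite S" "S \<subseteq> {..<n}" "w \<in> Rn n" for S r w
    using that
  proof (induction S)
    case empty
    then show ?case using T(1)[of 0 0 w 0 0] by simp
  next
    case (insert i S)
    have "(\<Sum>i\<in>S. r i \<cdot>\<^sub>c e i) \<in> Rn n" using insert eR by (intro Rn_sum Rn_closed) auto
    then show ?case using insert T(1)[of "e i" "\<Sum>i\<in>S. r i \<cdot>\<^sub>c e i" w "r i" 1] eR by auto
  qed
  have right: "T w (\<Sum>i\<in>S. r i \<cdot>\<^sub>c e i) = (\<Sum>i\<in>S. r i * T w (e i))" if "finite S" "S \<subseteq> {..<n}" "w \<in> Rn n" for S r w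
    using that
  proof (induction S)
    case empty
    then show ?case using T(2)[of 0 0 w 0 0] by simp
  next
    case (insert i S)
    have "(\<Sum>i\<in>S. r i \<cdot>\<^sub>c e i) \<in> Rn n" using insert eR by (intro Rn_sum Rn_closed) auto
    then show ?case using insert T(2)[of "e i" "\<Sum>i\<in>S. r i \<cdot>\<^sub>c e i" w "r i" 1] eR by auto
  qed
  have "(\<Sum>l<n. T (f l) (f l)) = (\<Sum>l<n. \<Sum>i<n. \<Sum>j<n. B (f l) (e i) * B (f l) (e j) * T (e i) (e j))"
  proof (rule sum.cong[OF refl])
    fix l assume "l \<in> {..<n}"
    then have l: "f l \<in> Rn n" using eR by simp
    have "T (f l) (f l) = T (\<Sum>i<n. B (f l) (e i) \<cdot>\<^sub>c e i) (f l)"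
      using orthonormal_expand[OF e l] by simp
    also have "\<dots> = (\<Sum>i<n. B (f l) (e i) * T (e i) (f l))" by (rule left) (use l in auto)
    also have "\<dots> = (\<Sum>i<n. B (f l) (e i) * (\<Sum>j<n. B (f l) (e j) * T (e i) (e j)))"
    proof (intro sum.cong refl arg_cong2[where f="(*)"])
      fix i assume i: "i \<in> {..<n}"
      have "T (e i) (f l) = T (e i) (\<Sum>j<n. B (f l) (e j) \<cdot>\<^sub>c e j)"
        using orthonormal_expand[OF e l] by simp
      also have "\<dots> = (\<Sum>j<n. B (f l) (e j) * T (e i) (e j))" by (rule right) (use i eR in auto)
      finally show "T (e i) (f l) = (\<Sum>j<n. B (f l) (e j) * T (e i) (e j))" .
    qed
    finally show "T (f l) (f l) = (\<Sum>i<n. \<Sum>j<n. B (f l) (e i) * B (f l) (e j) * T (e i) (e j))"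
      by (simp add: sum_distrib_left mult.assoc)
  qed
  also have "\<dots> = (\<Sum>i<n. \<Sum>j<n. \<Sum>l<n. B (f l) (e i) * B (f l) (e j) * T (e i) (e j))"
    by (subst sum.swap, rule sum.cong[OF refl], rule sum.swap)
  also have "\<dots> = (\<Sum>i<n. \<Sum>j<n. (if i = j then 1 else 0) * T (e i) (e j))"
  proof (intro sum.cong refl)
    fix i j assume "i \<in> {..<n}" "j \<in> {..<n}"
    then have i: "e i \<in> Rn n" and j: "e j \<in> Rn n" and ij: "i < n" "j < n" using eR by auto
    \<comment> \<open>Parseval's identity: the matrix of the change of basis is orthogonal.\<close>
    have "B (e i) (e j) = B (\<Sum>l<n. B (e i) (f l) \<cdot>\<^sub>c f l) (e j)" using orthonormal_expand[OF f i] by simp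
    also have "\<dots> = (\<Sum>l<n. B (f l) (e i) * B (f l) (e j))"
      using i j eR by (subst sum_left) (auto simp: scale_left sym[OF i])
    finally have "(\<Sum>l<n. B (f l) (e i) * B (f l) (e j)) = (if i = j then 1 else 0)"
      using e ij by (simp add: orthonormal_def)
    then show "(\<Sum>l<n. B (f l) (e i) * B (f l) (e j) * T (e i) (e j)) = (if i = j then 1 else 0) * T (e i) (e j)"
      by (simp add: sum_distrib_right[symmetric])
  qed
  also have "\<dots> = (\<Sum>i<n. T (e i) (e i))"
    by (simp add: if_distrib[of "\<lambda>x. x * _"] cong: if_cong)
  finally show ?thesis by simp
qed

end

context smooth_atlas
begin

text \<open>Elimination of the last unknown leaves the Schur complement, which is again positive definite.\<close>

lemma sm_solve:
  fixes G :: "nat \<Rightarrow> nat \<Rightarrow> 'p \<Rightarrow> real"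
  assumes p: "p \<in> points M"
    and "\<And>i j. i < n \<Longrightarrow> j < n \<Longrightarrow> sm p (G i j)" "\<And>i. i < n \<Longrightarrow> sm p (r i)"
    and "\<And>\<xi>. \<exists>i<n. \<xi> i \<noteq> 0 \<Longrightarrow> (\<Sum>i<n. \<Sum>j<n. G i j p * \<xi> i * \<xi> j) > 0"
    and "\<And>i. i < n \<Longrightarrow> \<forall>\<^sub>F q in near p. (\<Sum>j<n. G i j q * x j q) = r i q"
    and "j < n"
  shows "sm p (x j)"
  using assms(2-6)
proof (induction n arbitrary: G r j)
  case 0 then show ?case by simp
next
  case (Suc n)
  note smG = Suc.prems(1) and smr = Suc.prems(2) and posG = Suc.prems(3) and eqG = Suc.prems(4)
  \<comment> \<open>Testing positivity on the last unit vector shows that the pivot is positive at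
    \<open>p\<close>, hence nonzero near \<open>p\<close>.\<close>
  have "(\<Sum>i<Suc n. \<Sum>j<Suc n. G i j p * unit_coord n i * unit_coord n j) > 0"
    by (rule posG) (auto simp: unit_coord_def)
  then have Gnn: "G n n p > 0"
    by (simp add: unit_coord_def)
  have nz: "\<forall>\<^sub>F q in near p. G n n q \<noteq> 0" using sm_eventually_nonzero[OF smG[of n n]] Gnn by auto
  define G' where "G' i j q = G i j q - G i n q * G n j q / G n n q" for i j q
  define r' where "r' i q = r i q - G i n q * r n q / G n n q" for i q
  have smx: "sm p (x j)" if "j < n" for j
  proof (rule Suc.IH[of G' r'])
    show "sm p (G' i j)" if "i < n" "j < n" for i j
      unfolding G'_def[abs_def] using that Gnn by (intro sm_diff sm_divide sm_mult smG) auto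
    show "sm p (r' i)" if "i < n" for i
      unfolding r'_def[abs_def] using that Gnn by (intro sm_diff sm_divide sm_mult smG smr) auto
    show "j < n" by fact
    show "(\<Sum>i<n. \<Sum>j<n. G' i j p * \<xi> i * \<xi> j) > 0" if \<xi>: "\<exists>i<n. \<xi> i \<noteq> 0" for \<xi>
    proof -
      \<comment> \<open>This choice annihilates the last component of \<open>G\<close> applied to
        \<open>\<eta>\<close>; what remains of the quadratic form is that of the Schur
        complement.\<close>
      define s where "s = - (\<Sum>j<n. G n j p * \<xi> j) / G n n p"
      define \<eta> where "\<eta> = \<xi>(n := s)"
      have \<eta>: "\<eta> i = \<xi> i" if "i < n" for i using that by (simp add: \<eta>_def)
      have \<eta>n: "\<eta> n = s" by (simp add: \<eta>_def)
      have "(\<Sum>i<Suc n. \<Sum>j<Suc n. G i j p * \<eta> i * \<eta> j) > 0"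
        using \<xi> by (intro posG) (metis \<eta> less_SucI)
      also have "(\<Sum>i<Suc n. \<Sum>j<Suc n. G i j p * \<eta> i * \<eta> j) =
        (\<Sum>i<n. (\<Sum>j<n. G i j p * \<xi> i * \<xi> j) + G i n p * \<xi> i * s) + s * ((\<Sum>j<n. G n j p * \<xi> j) + G n n p * s)"
        by (simp add: \<eta> \<eta>n sum_distrib_left algebra_simps)
      also have "(\<Sum>j<n. G n j p * \<xi> j) + G n n p * s = 0" using Gnn by (simp add: s_def)
      also have "(\<Sum>i<n. (\<Sum>j<n. G i j p * \<xi> i * \<xi> j) + G i n p * \<xi> i * s) + s * 0
          = (\<Sum>i<n. \<Sum>j<n. G' i j p * \<xi> i * \<xi> j)"
        unfolding G'_def s_def
        by (simp add: sum_distrib_left sum_distrib_right sum_subtractf sum_divide_distrib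
            algebra_simps sum.distrib sum_negf)
      finally show ?thesis .
    qed
    show "\<forall>\<^sub>F q in near p. (\<Sum>j<n. G' i j q * x j q) = r' i q" if i: "i < n" for i
    proof -
      have "\<forall>\<^sub>F q in near p. (\<Sum>j<Suc n. G n j q * x j q) = r n q"
        "\<forall>\<^sub>F q in near p. (\<Sum>j<Suc n. G i j q * x j q) = r i q" using eqG i by auto
      with nz show ?thesis
      proof eventually_elim
        case (elim q)
        have 1: "(\<Sum>j<n. G n j q * x j q) = r n q - G n n q * x n q" using elim by simp
        have 2: "(\<Sum>j<n. G i j q * x j q) = r i q - G i n q * x n q" using elim i by simp
        have "(\<Sum>j<n. G' i j q * x j q) = (\<Sum>j<n. G i j q * x j q) - G i n q / G n n q * (\<Sum>j<n. G n j q * x j q)"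
          by (simp add: G'_def sum_distrib_left sum_subtractf algebra_simps)
        then show ?case unfolding 1 2 r'_def using elim by (simp add: field_simps)
      qed
    qed
  qed
  show ?case
  proof (cases "j < n")
    case False
    then have [simp]: "j = n" using Suc.prems(5) by simp
    have "sm p (\<lambda>q. (r n q - (\<Sum>j<n. G n j q * x j q)) / G n n q)"
      using Gnn p by (intro sm_divide sm_diff sm_sum sm_mult smG smr smx) auto
    moreover have "\<forall>\<^sub>F q in near p. (r n q - (\<Sum>j<n. G n j q * x j q)) / G n n q = x n q"
    proof -
      have "\<forall>\<^sub>F q in near p. (\<Sum>j<Suc n. G n j q * x j q) = r n q" by (rule eqG) simp
      with nz show ?thesis by eventually_elim (simp add: field_simps)
    qed
    ultimately have "sm p (\<lambda>q. x n q)" by (rule sm_cong[rotated])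
    then show ?thesis by simp
  qed (rule smx)
qed

end

section \<open>Connections\<close>

context smooth_atlas
begin

text \<open>The conditions on connections quantify over fields on a common open set; this turns them
  into statements about germs at a point. Flatness involves three fields.\<close>

lemma common_domain:
  assumes "smf p X" "smf p Y" "smf p Z"
  obtains W where "openin (mtop M) W" "p \<in> W" "smooth_field M W X" "smooth_field M W Y" "smooth_field M W Z"
proof -
  have "\<forall>\<^sub>F q in near p. smf q X \<and> smf q Y \<and> smf q Z"
    by (intro eventually_conj smf_eventually assms)
  then obtain W where W: "openin (mtop M) W" "p \<in> W" "\<And>q. q \<in> W \<Longrightarrow> smf q X \<and> smf q Y \<and> smf q Z"
    using eventually_nearE[OF _ smf_points[OF assms(1)], of "\<lambda>q. smf q X \<and> smf q Y \<and> smf q Z"] by blast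
  then show ?thesis using that[OF W(1,2)] smooth_field_iff[OF W(1)] by blast
qed

section \<open>Pointwise forms of the conditions on a connection\<close>

lemma torsionless_iff:
  "torsionless M nab \<longleftrightarrow> (\<forall>p X Y. smf p X \<longrightarrow> smf p Y \<longrightarrow>
     nab p (X p) Y - nab p (Y p) X = bracket M X Y p)"
proof
  assume T: "torsionless M nab"
  show "\<forall>p X Y. smf p X \<longrightarrow> smf p Y \<longrightarrow> nab p (X p) Y - nab p (Y p) X = bracket M X Y p"
  proof (intro allI impI)
    fix p X Y assume "smf p X" "smf p Y"
    then obtain W where "openin (mtop M) W" "p \<in> W" "smooth_field M W X" "smooth_field M W Y"
      using common_domain by metis
    then show "nab p (X p) Y - nab p (Y p) X = bracket M X Y p"
      using T unfolding torsionless_def cov_def by blast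
  qed
next
  assume "\<forall>p X Y. smf p X \<longrightarrow> smf p Y \<longrightarrow> nab p (X p) Y - nab p (Y p) X = bracket M X Y p"
  then show "torsionless M nab" unfolding torsionless_def cov_def smooth_field_at_def by blast
qed

lemma flat_iff:
  "flat M nab \<longleftrightarrow> (\<forall>p X Y Z. smf p X \<longrightarrow> smf p Y \<longrightarrow> smf p Z \<longrightarrow>
     nab p (X p) (cov nab Y Z) - nab p (Y p) (cov nab X Z) - nab p (bracket M X Y p) Z = 0)"
proof
  assume T: "flat M nab"
  show "\<forall>p X Y Z. smf p X \<longrightarrow> smf p Y \<longrightarrow> smf p Z \<longrightarrow>
     nab p (X p) (cov nab Y Z) - nab p (Y p) (cov nab X Z) - nab p (bracket M X Y p) Z = 0"
  proof (intro allI impI)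
    fix p X Y Z assume "smf p X" "smf p Y" "smf p Z"
    then obtain W where "openin (mtop M) W" "p \<in> W" "smooth_field M W X" "smooth_field M W Y" "smooth_field M W Z"
      using common_domain by metis
    then have "cov nab X (cov nab Y Z) p - cov nab Y (cov nab X Z) p - cov nab (bracket M X Y) Z p = 0"
      using T unfolding flat_def by blast
    then show "nab p (X p) (cov nab Y Z) - nab p (Y p) (cov nab X Z) - nab p (bracket M X Y p) Z = 0"
      by (simp add: cov_def)
  qed
next
  assume R: "\<forall>p X Y Z. smf p X \<longrightarrow> smf p Y \<longrightarrow> smf p Z \<longrightarrow>
     nab p (X p) (cov nab Y Z) - nab p (Y p) (cov nab X Z) - nab p (bracket M X Y p) Z = 0"
  show "flat M nab" unfolding flat_def
  proof (intro allI impI ballI)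
    fix W X Y Z p
    assume "openin (mtop M) W" "smooth_field M W X" "smooth_field M W Y" "smooth_field M W Z" "p \<in> W"
    then have "smf p X" "smf p Y" "smf p Z" unfolding smooth_field_at_def by blast+
    then show "cov nab X (cov nab Y Z) p - cov nab Y (cov nab X Z) p - cov nab (bracket M X Y) Z p = 0"
      using R unfolding cov_def[of nab X "cov nab Y Z"] cov_def[of nab Y "cov nab X Z"]
        cov_def[of nab "bracket M X Y" Z] by blast
  qed
qed

lemma metric_connection_iff:
  "metric_connection M g nab \<longleftrightarrow> (\<forall>p X Y Z. smf p X \<longrightarrow> smf p Y \<longrightarrow> smf p Z \<longrightarrow>
     dirder M p (X p) (\<lambda>q. g q (Y q) (Z q)) = g p (nab p (X p) Y) (Z p) + g p (Y p) (nab p (X p) Z))"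
proof
  assume T: "metric_connection M g nab"
  show "\<forall>p X Y Z. smf p X \<longrightarrow> smf p Y \<longrightarrow> smf p Z \<longrightarrow>
     dirder M p (X p) (\<lambda>q. g q (Y q) (Z q)) = g p (nab p (X p) Y) (Z p) + g p (Y p) (nab p (X p) Z)"
  proof (intro allI impI)
    fix p X Y Z assume "smf p X" "smf p Y" "smf p Z"
    then obtain W where "openin (mtop M) W" "p \<in> W" "smooth_field M W X" "smooth_field M W Y" "smooth_field M W Z"
      using common_domain by metis
    then show "dirder M p (X p) (\<lambda>q. g q (Y q) (Z q)) = g p (nab p (X p) Y) (Z p) + g p (Y p) (nab p (X p) Z)"
      using T unfolding metric_connection_def cov_def by blast
  qed
next
  assume "\<forall>p X Y Z. smf p X \<longrightarrow> smf p Y \<longrightarrow> smf p Z \<longrightarrow>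
     dirder M p (X p) (\<lambda>q. g q (Y q) (Z q)) = g p (nab p (X p) Y) (Z p) + g p (Y p) (nab p (X p) Z)"
  then show "metric_connection M g nab" unfolding metric_connection_def cov_def smooth_field_at_def by blast
qed

lemma is_connectionI:
  assumes "\<And>p v Y. smf p Y \<Longrightarrow> v \<in> Rn (mdim M) \<Longrightarrow> nab p v Y \<in> Rn (mdim M)"
    and "\<And>p v w a b Y. smf p Y \<Longrightarrow> v \<in> Rn (mdim M) \<Longrightarrow> w \<in> Rn (mdim M) \<Longrightarrow>
      nab p (a \<cdot>\<^sub>c v + b \<cdot>\<^sub>c w) Y = a \<cdot>\<^sub>c nab p v Y + b \<cdot>\<^sub>c nab p w Y"
    and "\<And>p v Y Z. smf p Y \<Longrightarrow> smf p Z \<Longrightarrow> v \<in> Rn (mdim M) \<Longrightarrow> nab p v (Y + Z) = nab p v Y + nab p v Z"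
    and "\<And>p v f Y. smf p Y \<Longrightarrow> sm p f \<Longrightarrow> v \<in> Rn (mdim M) \<Longrightarrow>
      nab p v (\<lambda>q. f q \<cdot>\<^sub>c Y q) = dirder M p v f \<cdot>\<^sub>c Y p + f p \<cdot>\<^sub>c nab p v Y"
    and "\<And>p X Y. smf p X \<Longrightarrow> smf p Y \<Longrightarrow> smf p (cov nab X Y)"
  shows "is_connection M nab"
proof -
  have "smooth_field M W (cov nab X Y)" if "openin (mtop M) W" "smooth_field M W X" "smooth_field M W Y" for W X Y
    using assms(5) that smooth_field_iff[OF that(1)] by blast
  then show ?thesis unfolding is_connection_def using assms(1-4) by simp
qed

end

locale connection_on = smooth_atlas M for M :: "('p, 'x) manifold_scheme" +
  fixes nab :: "'p conn"
  assumes connection: "is_connection M nab"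
begin

lemma nab_Rn: "smf p Y \<Longrightarrow> v \<in> Rn (mdim M) \<Longrightarrow> nab p v Y \<in> Rn (mdim M)"
  using connection smf_points unfolding is_connection_def by blast

lemma nab_lin: "smf p Y \<Longrightarrow> v \<in> Rn (mdim M) \<Longrightarrow> w \<in> Rn (mdim M) \<Longrightarrow>
      nab p (a \<cdot>\<^sub>c v + b \<cdot>\<^sub>c w) Y = a \<cdot>\<^sub>c nab p v Y + b \<cdot>\<^sub>c nab p w Y"
  using connection smf_points unfolding is_connection_def by blast

lemma nab_plus: "smf p Y \<Longrightarrow> smf p Z \<Longrightarrow> v \<in> Rn (mdim M) \<Longrightarrow> nab p v (Y + Z) = nab p v Y + nab p v Z"
  using connection smf_points unfolding is_connection_def by blast

lemma nab_add: "smf p Y \<Longrightarrow> smf p Z \<Longrightarrow> v \<in> Rn (mdim M) \<Longrightarrow> nab p v (\<lambda>q. Y q + Z q) = nab p v Y + nab p v Z"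
  using nab_plus[of p Y Z v] by (simp add: plus_fun_def[of Y Z])

lemma nab_leibniz: "smf p Y \<Longrightarrow> sm p f \<Longrightarrow> v \<in> Rn (mdim M) \<Longrightarrow>
      nab p v (\<lambda>q. f q \<cdot>\<^sub>c Y q) = dirder M p v f \<cdot>\<^sub>c Y p + f p \<cdot>\<^sub>c nab p v Y"
proof -
  assume a: "smf p Y" "sm p f" "v \<in> Rn (mdim M)"
  then have "p \<in> points M" by (blast intro: smf_points)
  then show ?thesis using connection a unfolding is_connection_def by simp
qed

lemma nab_add_vec: "smf p Y \<Longrightarrow> v \<in> Rn (mdim M) \<Longrightarrow> w \<in> Rn (mdim M) \<Longrightarrow> nab p (v + w) Y = nab p v Y + nab p w Y"
  using nab_lin[of p Y v w 1 1] by simp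

lemma nab_scale_vec: "smf p Y \<Longrightarrow> v \<in> Rn (mdim M) \<Longrightarrow> nab p (a \<cdot>\<^sub>c v) Y = a \<cdot>\<^sub>c nab p v Y"
  using nab_lin[of p Y v v a 0] by simp

lemma nab_zero_vec: "smf p Y \<Longrightarrow> nab p 0 Y = 0"
  using nab_scale_vec[of p Y 0 0] by simp

lemma nab_uminus_vec: "smf p Y \<Longrightarrow> v \<in> Rn (mdim M) \<Longrightarrow> nab p (- v) Y = - nab p v Y"
  using nab_scale_vec[of p Y v "-1"] by simp

lemma nab_minus_vec: "smf p Y \<Longrightarrow> v \<in> Rn (mdim M) \<Longrightarrow> w \<in> Rn (mdim M) \<Longrightarrow> nab p (v - w) Y = nab p v Y - nab p w Y"
  using nab_lin[of p Y v w 1 "-1"] by simp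

lemma nab_sum_vec:
  "smf p Y \<Longrightarrow> (\<And>a. a \<in> S \<Longrightarrow> v a \<in> Rn (mdim M)) \<Longrightarrow> nab p (\<Sum>a\<in>S. v a) Y = (\<Sum>a\<in>S. nab p (v a) Y)"
  by (induction S rule: infinite_finite_induct) (simp_all add: nab_zero_vec nab_add_vec)

lemma nab_zero: "p \<in> points M \<Longrightarrow> v \<in> Rn (mdim M) \<Longrightarrow> nab p v (\<lambda>q. 0) = 0"
  using nab_leibniz[OF smf_zero[of p] sm_const[of p 0], of v] by simp

lemma nab_cong:
  assumes X: "smf p X" and v: "v \<in> Rn (mdim M)" and eq: "\<forall>\<^sub>F q in near p. X q = Y q"
  shows "nab p v X = nab p v Y"
proof -
  have p: "p \<in> points M" using X smf_points by blast
  have Y: "smf p Y" by (rule smf_cong[OF eq X])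
  obtain W where W: "openin (mtop M) W" "p \<in> W" "\<And>q. q \<in> W \<Longrightarrow> X q = Y q"
    using eventually_nearE[OF eq p] by blast
  define f where "f q = (if q \<in> W then 1 else 0 :: real)" for q
  have f: "sm p f" using sm_indicator[OF W(1,2)] by (simp add: f_def[abs_def])
  have "\<forall>\<^sub>F q in near p. f q = 1" by (rule eventually_nearI[OF W(1,2)]) (simp add: f_def)
  from dirder_cong[OF p this] have d: "dirder M p v f = 0" by simp
  have "(\<lambda>q. f q \<cdot>\<^sub>c X q) = (\<lambda>q. f q \<cdot>\<^sub>c Y q)" using W(3) by (auto simp: f_def fun_eq_iff coord_simps)
  then show ?thesis using nab_leibniz[OF X f v] nab_leibniz[OF Y f v] W(2) d by (simp add: f_def)
qed

lemma nab_sum: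
  assumes "p \<in> points M" "v \<in> Rn (mdim M)" "\<And>a. a \<in> S \<Longrightarrow> smf p (F a)" "\<And>a. a \<in> S \<Longrightarrow> sm p (f a)"
  shows "nab p v (\<lambda>q. \<Sum>a\<in>S. f a q \<cdot>\<^sub>c F a q)
    = (\<Sum>a\<in>S. dirder M p v (f a) \<cdot>\<^sub>c F a p + f a p \<cdot>\<^sub>c nab p v (F a))"
  using assms(3,4)
proof (induction S rule: infinite_finite_induct)
  case (insert a S)
  have "nab p v (\<lambda>q. \<Sum>a\<in>insert a S. f a q \<cdot>\<^sub>c F a q) = nab p v (\<lambda>q. f a q \<cdot>\<^sub>c F a q + (\<Sum>a\<in>S. f a q \<cdot>\<^sub>c F a q))"
    using insert by simp
  also have "\<dots> = nab p v (\<lambda>q. f a q \<cdot>\<^sub>c F a q) + nab p v (\<lambda>q. \<Sum>a\<in>S. f a q \<cdot>\<^sub>c F a q)"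
    using insert assms(1,2) by (intro nab_add smf_sum smf_scale) auto
  also have "\<dots> = (\<Sum>a\<in>insert a S. dirder M p v (f a) \<cdot>\<^sub>c F a p + f a p \<cdot>\<^sub>c nab p v (F a))"
    using insert assms(2) nab_leibniz by simp
  finally show ?case .
qed (use assms in \<open>simp_all add: nab_zero\<close>)

text \<open>Holds in every chart around \<open>p\<close>, not only in the preferred one. Applied to
  the coordinate fields of another chart it becomes the transformation law of the Christoffel
  symbols.\<close>

lemma nab_expand:
  assumes Y: "smf p Y" and v: "v \<in> Rn (mdim M)" and c: "c \<in> atlas M" "p \<in> fst c"
  shows "nab p v Y = (\<Sum>b<mdim M. dirder M p v (\<lambda>q. comp_in M c q (Y q) b) \<cdot>\<^sub>c coord_field M c b p
    + comp_in M c p (Y p) b \<cdot>\<^sub>c nab p v (coord_field M c b))"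
proof -
  have p: "p \<in> points M" using Y smf_points by blast
  have "nab p v Y = nab p v (\<lambda>q. \<Sum>b<mdim M. comp_in M c q (Y q) b \<cdot>\<^sub>c coord_field M c b q)"
    by (rule nab_cong[OF Y v smf_frame_expand[OF Y c]])
  also have "\<dots> = (\<Sum>b<mdim M. dirder M p v (\<lambda>q. comp_in M c q (Y q) b) \<cdot>\<^sub>c coord_field M c b p
    + comp_in M c p (Y p) b \<cdot>\<^sub>c nab p v (coord_field M c b))"
    using c by (intro nab_sum p v smf_coord_field smf_comp_sm[OF Y]) auto
  finally show ?thesis .
qed

lemma cov_smf:
  assumes "smf p X" "smf p Y"
  shows "smf p (cov nab X Y)"
proof -
  obtain W where W: "openin (mtop M) W" "p \<in> W" "smooth_field M W X" "smooth_field M W Y"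
    using common_domain[OF assms assms(1)] by metis
  then show ?thesis
    using conjunct2[OF connection[unfolded is_connection_def], rule_format, OF W(1,3,4)]
    unfolding smooth_field_at_def by blast
qed

text \<open>The terms of the torsion are not linear over functions, but their combination is, so it
  is decided on vectors spanning the tangent space at the point. On the tangent bundle these will be
  lifts of coordinate fields, whose brackets can be computed.\<close>

lemma torsion_zero_if_zero_on_frame:
  assumes F: "\<And>a. a \<in> S \<Longrightarrow> smf p (F a)"
    and span: "\<And>v. v \<in> Rn (mdim M) \<Longrightarrow> \<exists>r. v = (\<Sum>a\<in>S. r a \<cdot>\<^sub>c F a p)"
    and zero: "\<And>a b. a \<in> S \<Longrightarrow> b \<in> S \<Longrightarrow> nab p (F a p) (F b) - nab p (F b p) (F a) = bracket M (F a) (F b) p"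
    and X: "smf p X" and Y: "smf p Y"
  shows "nab p (X p) Y - nab p (Y p) X = bracket M X Y p"
proof
  fix j
  define T where "T X Y = (nab p (X p) Y - nab p (Y p) X - bracket M X Y p) j" for X Y
  have swap: "T Y X = - T X Y" for X Y
    by (simp add: T_def bracket_swap[of Y X] coord_simps)
  have add: "T (\<lambda>q. X q + X' q) Y = T X Y + T X' Y" if "smf p X" "smf p X'" "smf p Y" for X X' Y
    using that smf_Rn by (simp add: T_def nab_add_vec nab_add bracket_add_left coord_simps)
  have scale: "T (\<lambda>q. f q \<cdot>\<^sub>c X q) Y = f p * T X Y" if "sm p f" "smf p X" "smf p Y" for f X Y
    using that smf_Rn[OF that(2)] smf_Rn[OF that(3)]
    by (simp add: T_def nab_scale_vec nab_leibniz bracket_scale_left coord_simps algebra_simps)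
  \<comment> \<open>Linearity is needed in the first argument only; \<open>swap\<close> carries the
    conclusion over to the second.\<close>
  have frame: "T X Y = 0" if T0: "\<And>a. a \<in> S \<Longrightarrow> T (F a) Y = 0" and X: "smf p X" and Y: "smf p Y" for X Y
  proof -
    obtain r where "X p = (\<Sum>a\<in>S. r a \<cdot>\<^sub>c F a p)" using span[OF smf_Rn[OF X]] by blast
    then have "T X Y = (\<Sum>a\<in>S. r a * T (F a) Y)"
      using X Y F by (intro tensorial_frame[of p "\<lambda>X. T X Y"] add scale) auto
    then show ?thesis using T0 by simp
  qed
  have "T (F a) (F b) = 0" if "a \<in> S" "b \<in> S" for a b using zero[OF that] by (simp add: T_def coord_simps)
  then have "T X (F b) = 0" if "b \<in> S" for b using frame[OF _ X F] that by blast
  then have "T X Y = 0" using frame[OF _ Y X] swap[of X] by simp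
  then show "(nab p (X p) Y - nab p (Y p) X) j = bracket M X Y p j" by (simp add: T_def coord_simps)
qed

lemma cov_add_right:
  assumes "smf p Y" "smf p Z" "smf p Z'"
  shows "\<forall>\<^sub>F q in near p. cov nab Y (\<lambda>q. Z q + Z' q) q = cov nab Y Z q + cov nab Y Z' q"
  using smf_eventually[OF assms(1)] smf_eventually[OF assms(2)] smf_eventually[OF assms(3)]
  by eventually_elim (simp add: cov_def nab_add smf_Rn)

lemma cov_leibniz:
  assumes "smf p Y" "smf p Z" "sm p f"
  shows "\<forall>\<^sub>F q in near p. cov nab Y (\<lambda>q. f q \<cdot>\<^sub>c Z q) q = dirder M q (Y q) f \<cdot>\<^sub>c Z q + f q \<cdot>\<^sub>c cov nab Y Z q"
  using smf_eventually[OF assms(1)] smf_eventually[OF assms(2)] sm_eventually[OF assms(3)]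
  by eventually_elim (simp add: cov_def nab_leibniz smf_Rn)

lemma nab_cov_leibniz:
  assumes X: "smf p X" and Y: "smf p Y" and Z: "smf p Z" and f: "sm p f"
  shows "nab p (X p) (cov nab Y (\<lambda>q. f q \<cdot>\<^sub>c Z q))
    = (dirder M p (X p) (\<lambda>q. dirder M q (Y q) f) \<cdot>\<^sub>c Z p + dirder M p (Y p) f \<cdot>\<^sub>c nab p (X p) Z)
      + (dirder M p (X p) f \<cdot>\<^sub>c nab p (Y p) Z + f p \<cdot>\<^sub>c nab p (X p) (cov nab Y Z))"
proof -
  have v: "X p \<in> Rn (mdim M)" using X smf_Rn by blast
  have "nab p (X p) (cov nab Y (\<lambda>q. f q \<cdot>\<^sub>c Z q))
      = nab p (X p) (\<lambda>q. dirder M q (Y q) f \<cdot>\<^sub>c Z q + f q \<cdot>\<^sub>c cov nab Y Z q)"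
    by (rule nab_cong[OF cov_smf[OF Y smf_scale[OF f Z]] v cov_leibniz[OF Y Z f]])
  also have "\<dots> = nab p (X p) (\<lambda>q. dirder M q (Y q) f \<cdot>\<^sub>c Z q) + nab p (X p) (\<lambda>q. f q \<cdot>\<^sub>c cov nab Y Z q)"
    by (intro nab_add smf_scale dirder_sm cov_smf X Y Z f v)
  finally show ?thesis
    using nab_leibniz[OF Z dirder_sm[OF Y f] v] nab_leibniz[OF cov_smf[OF Y Z] f v] by (simp add: cov_def)
qed

text \<open>Curvature is linear over functions in all arguments: in the first by the rules for
  brackets, in the second by antisymmetry, and in the third because the second derivatives of the
  factor form the commutator described by \<open>dirder_bracket\<close>.\<close>

lemma curvature_zero_if_zero_on_frame:
  assumes F: "\<And>a. a \<in> S \<Longrightarrow> smf p (F a)"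
    and span: "\<And>v. v \<in> Rn (mdim M) \<Longrightarrow> \<exists>r. v = (\<Sum>a\<in>S. r a \<cdot>\<^sub>c F a p)"
    and zero: "\<And>a b c. a \<in> S \<Longrightarrow> b \<in> S \<Longrightarrow> c \<in> S \<Longrightarrow>
      nab p (F a p) (cov nab (F b) (F c)) - nab p (F b p) (cov nab (F a) (F c)) - nab p (bracket M (F a) (F b) p) (F c) = 0"
    and X: "smf p X" and Y: "smf p Y" and Z: "smf p Z"
  shows "nab p (X p) (cov nab Y Z) - nab p (Y p) (cov nab X Z) - nab p (bracket M X Y p) Z = 0"
proof
  fix j
  define T where "T X Y Z = (nab p (X p) (cov nab Y Z) - nab p (Y p) (cov nab X Z) - nab p (bracket M X Y p) Z) j"
    for X Y Z
  have p: "p \<in> points M" using X smf_points by blast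
  have swap: "T Y X Z = - T X Y Z" if "smf p Z" for X Y Z
    using that by (simp add: T_def bracket_swap[of Y X] nab_uminus_vec bracket_Rn[OF p] coord_simps)
  have add: "T (\<lambda>q. X q + X' q) Y Z = T X Y Z + T X' Y Z" if X: "smf p X" and X': "smf p X'" and Y: "smf p Y" and Z: "smf p Z" for X X' Y Z
  proof -
    \<comment> \<open>Linearity in the direction is available only where the fields are smooth, that
      is near \<open>p\<close>; locality of the outer derivative makes this sufficient.\<close>
    have "\<forall>\<^sub>F q in near p. cov nab X Z q + cov nab X' Z q = cov nab (\<lambda>q. X q + X' q) Z q"
      using smf_eventually[OF X] smf_eventually[OF X'] smf_eventually[OF Z]
      by eventually_elim (simp add: cov_def nab_add_vec smf_Rn)
    then have "nab p (Y p) (\<lambda>q. cov nab X Z q + cov nab X' Z q) = nab p (Y p) (cov nab (\<lambda>q. X q + X' q) Z)"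
      by (intro nab_cong smf_add cov_smf X X' Z smf_Rn[OF Y])
    moreover have "nab p (Y p) (\<lambda>q. cov nab X Z q + cov nab X' Z q) = nab p (Y p) (cov nab X Z) + nab p (Y p) (cov nab X' Z)"
      by (intro nab_add cov_smf X X' Z smf_Rn[OF Y])
    ultimately have k: "nab p (Y p) (cov nab (\<lambda>q. X q + X' q) Z) = nab p (Y p) (cov nab X Z) + nab p (Y p) (cov nab X' Z)"
      by simp
    show ?thesis
      using that smf_Rn[OF X] smf_Rn[OF X'] bracket_Rn[OF p]
      by (simp add: T_def k nab_add_vec bracket_add_left coord_simps cov_smf)
  qed
  have scale: "T (\<lambda>q. f q \<cdot>\<^sub>c X q) Y Z = f p * T X Y Z" if f: "sm p f" and X: "smf p X" and Y: "smf p Y" and Z: "smf p Z" for f X Y Z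
  proof -
    have "\<forall>\<^sub>F q in near p. f q \<cdot>\<^sub>c cov nab X Z q = cov nab (\<lambda>q. f q \<cdot>\<^sub>c X q) Z q"
      using smf_eventually[OF X] smf_eventually[OF Z]
      by eventually_elim (simp add: cov_def nab_scale_vec smf_Rn)
    then have "nab p (Y p) (\<lambda>q. f q \<cdot>\<^sub>c cov nab X Z q) = nab p (Y p) (cov nab (\<lambda>q. f q \<cdot>\<^sub>c X q) Z)"
      by (intro nab_cong smf_scale f cov_smf X Z smf_Rn[OF Y])
    moreover have "nab p (Y p) (\<lambda>q. f q \<cdot>\<^sub>c cov nab X Z q) = dirder M p (Y p) f \<cdot>\<^sub>c nab p (X p) Z + f p \<cdot>\<^sub>c nab p (Y p) (cov nab X Z)"
      using nab_leibniz[OF cov_smf[OF X Z] f smf_Rn[OF Y]] by (simp add: cov_def)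
    ultimately have k: "nab p (Y p) (cov nab (\<lambda>q. f q \<cdot>\<^sub>c X q) Z)
        = dirder M p (Y p) f \<cdot>\<^sub>c nab p (X p) Z + f p \<cdot>\<^sub>c nab p (Y p) (cov nab X Z)" by simp
    show ?thesis
      using that smf_Rn[OF X] bracket_Rn[OF p] cov_smf[OF Y Z]
      by (simp add: T_def k nab_scale_vec nab_minus_vec bracket_scale_left coord_simps algebra_simps)
  qed
  have add3: "T X Y (\<lambda>q. Z q + Z' q) = T X Y Z + T X Y Z'" if X: "smf p X" and Y: "smf p Y" and Z: "smf p Z" and Z': "smf p Z'" for X Y Z Z'
  proof -
    have "nab p (X p) (cov nab Y (\<lambda>q. Z q + Z' q)) = nab p (X p) (cov nab Y Z) + nab p (X p) (cov nab Y Z')"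
      if X: "smf p X" and Y: "smf p Y" for X Y
    proof -
      have "nab p (X p) (cov nab Y (\<lambda>q. Z q + Z' q)) = nab p (X p) (\<lambda>q. cov nab Y Z q + cov nab Y Z' q)"
        by (rule nab_cong[OF cov_smf[OF Y smf_add[OF Z Z']] smf_Rn[OF X] cov_add_right[OF Y Z Z']])
      also have "\<dots> = nab p (X p) (cov nab Y Z) + nab p (X p) (cov nab Y Z')"
        by (intro nab_add cov_smf Y Z Z' smf_Rn[OF X])
      finally show ?thesis .
    qed
    then show ?thesis using that bracket_Rn[OF p] by (simp add: T_def nab_add coord_simps)
  qed
  have scale3: "T X Y (\<lambda>q. f q \<cdot>\<^sub>c Z q) = f p * T X Y Z" if f: "sm p f" and X: "smf p X" and Y: "smf p Y" and Z: "smf p Z" for f X Y Z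
    unfolding T_def nab_cov_leibniz[OF X Y Z f] nab_cov_leibniz[OF Y X Z f]
      nab_leibniz[OF Z f bracket_Rn[OF p]] dirder_bracket[OF X Y f]
    by (simp add: coord_simps algebra_simps)
  have frame: "T X Y Z = 0"
    if T0: "\<And>a. a \<in> S \<Longrightarrow> T (F a) Y Z = 0" and X: "smf p X" and Y: "smf p Y" and Z: "smf p Z" for X Y Z
  proof -
    obtain r where "X p = (\<Sum>a\<in>S. r a \<cdot>\<^sub>c F a p)" using span[OF smf_Rn[OF X]] by blast
    then have "T X Y Z = (\<Sum>a\<in>S. r a * T (F a) Y Z)"
      using X Y Z F by (intro tensorial_frame[of p "\<lambda>X. T X Y Z"] add scale) auto
    then show ?thesis using T0 by simp
  qed
  have T1: "T (F a) (F b) (F c) = 0" if "a \<in> S" "b \<in> S" "c \<in> S" for a b c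
    using zero[OF that] by (simp add: T_def coord_simps)
  have T2: "T (F a) (F b) Z = 0" if ab: "a \<in> S" "b \<in> S" for a b
  proof -
    obtain r where "Z p = (\<Sum>c\<in>S. r c \<cdot>\<^sub>c F c p)" using span[OF smf_Rn[OF Z]] by blast
    then have "T (F a) (F b) Z = (\<Sum>c\<in>S. r c * T (F a) (F b) (F c))"
      using ab F Z by (intro tensorial_frame[of p "\<lambda>Z. T (F a) (F b) Z"] add3 scale3) auto
    then show ?thesis using T1 ab by simp
  qed
  then have "T X (F b) Z = 0" if "b \<in> S" for b using frame[OF _ X F Z] that by blast
  then have "T X Y Z = 0" using frame[OF _ Y X Z] swap[OF Z, of X] by simp
  then show "(nab p (X p) (cov nab Y Z) - nab p (Y p) (cov nab X Z) - nab p (bracket M X Y p) Z) j = 0 j"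
    by (simp add: T_def coord_simps)
qed

end

section \<open>Riemannian metrics and the Levi-Civita connection\<close>

locale riemannian = smooth_atlas M for M :: "('p, 'x) manifold_scheme" +
  fixes g :: "'p metr"
  assumes metric: "riemannian_metric M g"
begin

lemma inner:
  assumes "p \<in> points M"
  shows "inner_product_on (mdim M) (g p)"
proof -
  note g = bspec[OF conjunct1[OF metric[unfolded riemannian_metric_def]] assms]
  show ?thesis
  proof
    show "g p (a \<cdot>\<^sub>c u + b \<cdot>\<^sub>c v) w = a * g p u w + b * g p v w"
      if "u \<in> Rn (mdim M)" "v \<in> Rn (mdim M)" "w \<in> Rn (mdim M)" for u v w a b
      using conjunct1[OF g] that by blast
    show "g p u v = g p v u" if "u \<in> Rn (mdim M)" "v \<in> Rn (mdim M)" for u v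
      using g that by blast
    show "g p u u > 0" if "u \<in> Rn (mdim M)" "u \<noteq> 0" for u
      using g that by blast
  qed
qed

lemma g_sm:
  assumes "smf p X" "smf p Y"
  shows "sm p (\<lambda>q. g q (X q) (Y q))"
proof -
  obtain W where W: "openin (mtop M) W" "p \<in> W" "smooth_field M W X" "smooth_field M W Y"
    using common_domain[OF assms assms(1)] by metis
  then show ?thesis
    using conjunct2[OF metric[unfolded riemannian_metric_def], rule_format, OF W(1,3,4)]
    unfolding smooth_fun_at_def by blast
qed

text \<open>Raising an index preserves smoothness: the components of \<open>V\<close> solve a linear
  system whose matrix is the Gram matrix of a coordinate frame. It is needed because the Levi-Civita
  difference is known only through its inner products.\<close>

lemma smf_if_inner_sm:
  assumes p: "p \<in> points M" and V: "\<forall>\<^sub>F q in near p. V q \<in> Rn (mdim M)"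
    and s: "\<And>X. smf p X \<Longrightarrow> sm p (\<lambda>q. g q (V q) (X q))"
  shows "smf p V"
proof -
  interpret I: inner_product_on "mdim M" "g p" by (rule inner[OF p])
  let ?c = "chart_at M p"
  let ?E = "coord_field M ?c"
  have c: "?c \<in> atlas M" "p \<in> fst ?c" using p by auto
  show ?thesis
  proof (rule smfI[OF c V])
    fix j assume j: "j < mdim M"
    show "sm p (\<lambda>q. comp_in M ?c q (V q) j)"
    proof (rule sm_solve[where n="mdim M" and x="\<lambda>j q. comp_in M ?c q (V q) j"
          and G="\<lambda>i j q. g q (?E j q) (?E i q)" and r="\<lambda>i q. g q (V q) (?E i q)", OF p _ _ _ _ j])
      show "sm p (\<lambda>q. g q (?E j q) (?E i q))" if "i < mdim M" "j < mdim M" for i j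
        using that c by (intro g_sm smf_coord_field)
      show "sm p (\<lambda>q. g q (V q) (?E i q))" if "i < mdim M" for i
        using that c by (intro s smf_coord_field)
      show "(\<Sum>i<mdim M. \<Sum>j<mdim M. g p (?E j p) (?E i p) * \<xi> i * \<xi> j) > 0"
        if \<xi>: "\<exists>i<mdim M. \<xi> i \<noteq> 0" for \<xi>
      proof -
        define v where "v = (\<Sum>i<mdim M. \<xi> i \<cdot>\<^sub>c unit_coord i)"
        have v: "v \<in> Rn (mdim M)" unfolding v_def by (intro Rn_sum Rn_closed unit_coord_Rn) simp
        have vi: "v i = \<xi> i" if "i < mdim M" for i
          using that by (simp add: v_def coord_simps unit_coord_def if_distrib cong: if_cong)
        have "v \<noteq> 0" using \<xi> vi by (auto simp: coord_simps)
        then have "g p v v > 0" using v I.pos by blast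
        also have "g p v v = (\<Sum>j<mdim M. \<xi> j * g p (unit_coord j) v)"
          unfolding v_def by (subst I.sum_left) (auto simp: I.scale_left v_def[symmetric] v)
        also have "\<dots> = (\<Sum>j<mdim M. \<Sum>i<mdim M. g p (unit_coord j) (unit_coord i) * \<xi> i * \<xi> j)"
        proof (rule sum.cong[OF refl])
          fix j assume "j \<in> {..<mdim M}"
          then show "\<xi> j * g p (unit_coord j) v = (\<Sum>i<mdim M. g p (unit_coord j) (unit_coord i) * \<xi> i * \<xi> j)"
            unfolding v_def by (subst I.sum_right) (auto simp: I.scale_right sum_distrib_left mult_ac)
        qed
        also have "\<dots> = (\<Sum>i<mdim M. \<Sum>j<mdim M. g p (unit_coord j) (unit_coord i) * \<xi> i * \<xi> j)"
          by (rule sum.swap)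
        also have "\<dots> = (\<Sum>i<mdim M. \<Sum>j<mdim M. g p (?E j p) (?E i p) * \<xi> i * \<xi> j)"
          using coord_field_self[OF p] by simp
        finally show ?thesis .
      qed
      show "\<forall>\<^sub>F q in near p. (\<Sum>j<mdim M. g q (?E j q) (?E i q) * comp_in M ?c q (V q) j) = g q (V q) (?E i q)"
        if i: "i < mdim M" for i
        using V eventually_near_chart[OF c] eventually_near_points
      proof eventually_elim
        case (elim q)
        interpret J: inner_product_on "mdim M" "g q" by (rule inner[OF elim(3)])
        have E: "?E b q \<in> Rn (mdim M)" if "b < mdim M" for b using coord_field_Rn[OF c(1) elim(2) that] .
        have "g q (V q) (?E i q) = g q (\<Sum>b<mdim M. comp_in M ?c q (V q) b \<cdot>\<^sub>c ?E b q) (?E i q)"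
          using coord_field_expand[OF c(1) elim(2,1)] by simp
        also have "\<dots> = (\<Sum>j<mdim M. g q (?E j q) (?E i q) * comp_in M ?c q (V q) j)"
          using E i by (subst J.sum_left) (auto simp: J.scale_left mult.commute)
        finally show ?case by simp
      qed
    qed
  qed
qed

end

locale riemannian_connection = connection_on M nab + riemannian M g
  for M :: "('p, 'x) manifold_scheme" and nab :: "'p conn" and g :: "'p metr" +
  assumes torsion_free: "torsionless M nab"
begin

lemma torsion_free_at: "smf p X \<Longrightarrow> smf p Y \<Longrightarrow> nab p (X p) Y - nab p (Y p) X = bracket M X Y p"
  using torsion_free unfolding torsionless_iff by blast

text \<open>This is (\<nabla>_v g)(X, Y), computed on fields; \<open>nabla_g\<close> is the same
  tensor on vectors.\<close>

definition metric_der :: "'p \<Rightarrow> coord \<Rightarrow> ('p \<Rightarrow> coord) \<Rightarrow> ('p \<Rightarrow> coord) \<Rightarrow> real" where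
  "metric_der p v X Y = dirder M p v (\<lambda>q. g q (X q) (Y q)) - g p (nab p v X) (Y p) - g p (X p) (nab p v Y)"

definition nabla_g :: "'p \<Rightarrow> coord \<Rightarrow> coord \<Rightarrow> coord \<Rightarrow> real" where
  "nabla_g p v a b = metric_der p v (const_ext p a) (const_ext p b)"

lemma metric_der_sym:
  assumes "smf p X" "smf p Y" "v \<in> Rn (mdim M)"
  shows "metric_der p v X Y = metric_der p v Y X"
proof -
  have p: "p \<in> points M" using assms smf_points by blast
  interpret I: inner_product_on "mdim M" "g p" by (rule inner[OF p])
  have "\<forall>\<^sub>F q in near p. g q (X q) (Y q) = g q (Y q) (X q)"
    using smf_eventually_Rn[OF assms(1)] smf_eventually_Rn[OF assms(2)] eventually_near_points
    by eventually_elim (rule inner_product_on.sym[OF inner])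
  from dirder_cong[OF p this] show ?thesis
    using assms I.sym smf_Rn nab_Rn by (simp add: metric_der_def)
qed

lemma metric_der_add:
  assumes X: "smf p X" and X': "smf p X'" and Y: "smf p Y" and v: "v \<in> Rn (mdim M)"
  shows "metric_der p v (\<lambda>q. X q + X' q) Y = metric_der p v X Y + metric_der p v X' Y"
proof -
  have p: "p \<in> points M" using X smf_points by blast
  interpret I: inner_product_on "mdim M" "g p" by (rule inner[OF p])
  have "\<forall>\<^sub>F q in near p. g q (X q + X' q) (Y q) = g q (X q) (Y q) + g q (X' q) (Y q)"
    using smf_eventually_Rn[OF X] smf_eventually_Rn[OF X'] smf_eventually_Rn[OF Y] eventually_near_points
    by eventually_elim (rule inner_product_on.add_left[OF inner])
  from dirder_cong[OF p this] have "dirder M p v (\<lambda>q. g q (X q + X' q) (Y q))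
      = dirder M p v (\<lambda>q. g q (X q) (Y q)) + dirder M p v (\<lambda>q. g q (X' q) (Y q))"
    using dirder_add[OF g_sm[OF X Y] g_sm[OF X' Y]] by simp
  then show ?thesis
    using assms smf_Rn nab_Rn by (simp add: metric_der_def nab_add I.add_left)
qed

lemma metric_der_scale:
  assumes f: "sm p f" and X: "smf p X" and Y: "smf p Y" and v: "v \<in> Rn (mdim M)"
  shows "metric_der p v (\<lambda>q. f q \<cdot>\<^sub>c X q) Y = f p * metric_der p v X Y"
proof -
  have p: "p \<in> points M" using X smf_points by blast
  interpret I: inner_product_on "mdim M" "g p" by (rule inner[OF p])
  have "\<forall>\<^sub>F q in near p. g q (f q \<cdot>\<^sub>c X q) (Y q) = f q * g q (X q) (Y q)"
    using smf_eventually_Rn[OF X] smf_eventually_Rn[OF Y] eventually_near_points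
    by eventually_elim (rule inner_product_on.scale_left[OF inner])
  from dirder_cong[OF p this] have "dirder M p v (\<lambda>q. g q (f q \<cdot>\<^sub>c X q) (Y q))
      = dirder M p v f * g p (X p) (Y p) + f p * dirder M p v (\<lambda>q. g q (X q) (Y q))"
    using dirder_mult[OF f g_sm[OF X Y]] by simp
  then show ?thesis
    using assms smf_Rn nab_Rn by (simp add: metric_der_def nab_leibniz I.add_left I.scale_left algebra_simps)
qed

text \<open>Tensoriality is proved in the first field only and reaches the second through the
  symmetry of the metric.\<close>

lemma metric_der_eq:
  assumes X: "smf p X" and Y: "smf p Y" and v: "v \<in> Rn (mdim M)"
  shows "metric_der p v X Y = nabla_g p v (X p) (Y p)"
proof -
  have p: "p \<in> points M" using X smf_points by blast
  have ext: "smf p (const_ext p a)" for a by (rule smf_const_ext[OF p])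
  have tens: "metric_der p v X Y = metric_der p v X' Y" if "smf p X" "smf p X'" "smf p Y" "X p = X' p" for X X' Y
    by (rule tensorial[of p "\<lambda>X. metric_der p v X Y"]) (use that v metric_der_add metric_der_scale in auto)
  have "metric_der p v X Y = metric_der p v (const_ext p (X p)) Y"
    by (rule tens) (use X Y ext const_ext_self[OF p smf_Rn[OF X]] in auto)
  also have "\<dots> = metric_der p v Y (const_ext p (X p))" by (rule metric_der_sym[OF ext Y v])
  also have "\<dots> = metric_der p v (const_ext p (Y p)) (const_ext p (X p))"
    by (rule tens) (use Y ext const_ext_self[OF p smf_Rn[OF Y]] in auto)
  also have "\<dots> = nabla_g p v (X p) (Y p)"
    unfolding nabla_g_def by (rule metric_der_sym[OF ext ext v])
  finally show ?thesis .
qed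

lemma nabla_g_sym:
  assumes "p \<in> points M" "v \<in> Rn (mdim M)"
  shows "nabla_g p v a b = nabla_g p v b a"
  unfolding nabla_g_def by (intro metric_der_sym smf_const_ext assms)

lemma nabla_g_lin2:
  assumes p: "p \<in> points M" and "v \<in> Rn (mdim M)" "a \<in> Rn (mdim M)" "b \<in> Rn (mdim M)" "c \<in> Rn (mdim M)"
  shows "nabla_g p v (r \<cdot>\<^sub>c a + s \<cdot>\<^sub>c b) c = r * nabla_g p v a c + s * nabla_g p v b c"
proof -
  have ext: "smf p (const_ext p a)" for a by (rule smf_const_ext[OF p])
  have "nabla_g p v (r \<cdot>\<^sub>c a + s \<cdot>\<^sub>c b) c
      = metric_der p v (\<lambda>q. r \<cdot>\<^sub>c const_ext p a q + s \<cdot>\<^sub>c const_ext p b q) (const_ext p c)"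
    using metric_der_eq[of p "\<lambda>q. r \<cdot>\<^sub>c const_ext p a q + s \<cdot>\<^sub>c const_ext p b q" "const_ext p c" v]
      assms ext const_ext_self[OF p] smf_add[OF smf_scale[OF sm_const ext] smf_scale[OF sm_const ext]] by simp
  also have "\<dots> = r * metric_der p v (const_ext p a) (const_ext p c) + s * metric_der p v (const_ext p b) (const_ext p c)"
    using metric_der_add[OF smf_scale[OF sm_const[OF p, of r] ext[of a]] smf_scale[OF sm_const[OF p, of s] ext[of b]]
        ext[of c] assms(2)]
      metric_der_scale[OF sm_const[OF p] ext ext assms(2)] by simp
  finally show ?thesis by (simp add: nabla_g_def)
qed

lemma nabla_g_lin1:
  assumes p: "p \<in> points M" and v: "v \<in> Rn (mdim M)" "w \<in> Rn (mdim M)" and ab: "a \<in> Rn (mdim M)" "b \<in> Rn (mdim M)"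
  shows "nabla_g p (r \<cdot>\<^sub>c v + s \<cdot>\<^sub>c w) a b = r * nabla_g p v a b + s * nabla_g p w a b"
proof -
  interpret I: inner_product_on "mdim M" "g p" by (rule inner[OF p])
  have ext: "smf p (const_ext p a)" for a by (rule smf_const_ext[OF p])
  show ?thesis
    using assms ext nab_Rn[OF ext] const_ext_self[OF p]
    by (simp add: nabla_g_def metric_der_def dirder_lin nab_lin I.bilin algebra_simps)
qed

lemma nabla_g_lin3:
  assumes "p \<in> points M" "v \<in> Rn (mdim M)" "a \<in> Rn (mdim M)" "b \<in> Rn (mdim M)" "c \<in> Rn (mdim M)"
  shows "nabla_g p v c (r \<cdot>\<^sub>c a + s \<cdot>\<^sub>c b) = r * nabla_g p v c a + s * nabla_g p v c b"
  using nabla_g_lin2[OF assms] nabla_g_sym[OF assms(1,2)] by simp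

text \<open>The Koszul formula, solved for \<open>D - \<nabla>\<close>.\<close>

definition lc_diff :: "'p \<Rightarrow> coord \<Rightarrow> coord \<Rightarrow> coord" where
  "lc_diff p v a = (THE z. z \<in> Rn (mdim M) \<and>
     (\<forall>b\<in>Rn (mdim M). g p z b = (nabla_g p v a b + nabla_g p a v b - nabla_g p b v a) / 2))"

lemma lc_diff:
  assumes p: "p \<in> points M" and v: "v \<in> Rn (mdim M)" and a: "a \<in> Rn (mdim M)"
  shows lc_diff_Rn: "lc_diff p v a \<in> Rn (mdim M)"
    and g_lc_diff: "b \<in> Rn (mdim M) \<Longrightarrow> g p (lc_diff p v a) b = (nabla_g p v a b + nabla_g p a v b - nabla_g p b v a) / 2"
proof -
  interpret I: inner_product_on "mdim M" "g p" by (rule inner[OF p])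
  have "\<exists>!z. z \<in> Rn (mdim M) \<and>
     (\<forall>b\<in>Rn (mdim M). g p z b = (nabla_g p v a b + nabla_g p a v b - nabla_g p b v a) / 2)"
    by (rule I.riesz) (use assms nabla_g_lin1 nabla_g_lin3 in \<open>simp add: field_simps\<close>)
  from theI'[OF this] show "lc_diff p v a \<in> Rn (mdim M)"
    "b \<in> Rn (mdim M) \<Longrightarrow> g p (lc_diff p v a) b = (nabla_g p v a b + nabla_g p a v b - nabla_g p b v a) / 2"
    unfolding lc_diff_def by blast+
qed

lemma lc_diff_unique:
  assumes p: "p \<in> points M" and v: "v \<in> Rn (mdim M)" and a: "a \<in> Rn (mdim M)" and z: "z \<in> Rn (mdim M)"
    and "\<And>b. b \<in> Rn (mdim M) \<Longrightarrow> 2 * g p z b = nabla_g p v a b + nabla_g p a v b - nabla_g p b v a"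
  shows "lc_diff p v a = z"
proof -
  interpret I: inner_product_on "mdim M" "g p" by (rule inner[OF p])
  show ?thesis
  proof (rule I.nondegenerate[OF lc_diff_Rn[OF p v a] z])
    fix y assume "y \<in> Rn (mdim M)"
    then show "g p (lc_diff p v a) y = g p z y" using g_lc_diff[OF p v a, of y] assms(5)[of y] by simp
  qed
qed

lemma lc_diff_sym:
  assumes p: "p \<in> points M" and v: "v \<in> Rn (mdim M)" and a: "a \<in> Rn (mdim M)"
  shows "lc_diff p v a = lc_diff p a v"
proof (rule lc_diff_unique[OF p v a lc_diff_Rn[OF p a v]])
  fix b assume "b \<in> Rn (mdim M)"
  then show "2 * g p (lc_diff p a v) b = nabla_g p v a b + nabla_g p a v b - nabla_g p b v a"
    using g_lc_diff[OF p a v, of b] nabla_g_sym[OF p, of b v a] by simp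
qed

lemma lc_diff_lin:
  assumes p: "p \<in> points M" and v: "v \<in> Rn (mdim M)" "w \<in> Rn (mdim M)" and a: "a \<in> Rn (mdim M)"
  shows "lc_diff p (r \<cdot>\<^sub>c v + s \<cdot>\<^sub>c w) a = r \<cdot>\<^sub>c lc_diff p v a + s \<cdot>\<^sub>c lc_diff p w a"
proof -
  interpret I: inner_product_on "mdim M" "g p" by (rule inner[OF p])
  show ?thesis
  proof (rule lc_diff_unique)
    fix b assume b: "b \<in> Rn (mdim M)"
    show "2 * g p (r \<cdot>\<^sub>c lc_diff p v a + s \<cdot>\<^sub>c lc_diff p w a) b =
        nabla_g p (r \<cdot>\<^sub>c v + s \<cdot>\<^sub>c w) a b + nabla_g p a (r \<cdot>\<^sub>c v + s \<cdot>\<^sub>c w) b - nabla_g p b (r \<cdot>\<^sub>c v + s \<cdot>\<^sub>c w) a"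
      using p v a b lc_diff_Rn
      by (simp add: I.lin g_lc_diff nabla_g_lin1 nabla_g_lin2 field_simps)
  qed (use assms lc_diff_Rn in auto)
qed

lemma lc_diff_lin2:
  assumes p: "p \<in> points M" and v: "v \<in> Rn (mdim M)" "w \<in> Rn (mdim M)" and a: "a \<in> Rn (mdim M)"
  shows "lc_diff p a (r \<cdot>\<^sub>c v + s \<cdot>\<^sub>c w) = r \<cdot>\<^sub>c lc_diff p a v + s \<cdot>\<^sub>c lc_diff p a w"
  using lc_diff_lin[OF assms] lc_diff_sym assms by simp

lemma lc_diff_metric:
  assumes p: "p \<in> points M" and "v \<in> Rn (mdim M)" "a \<in> Rn (mdim M)" "b \<in> Rn (mdim M)"
  shows "g p (lc_diff p v a) b + g p a (lc_diff p v b) = nabla_g p v a b"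
proof -
  interpret I: inner_product_on "mdim M" "g p" by (rule inner[OF p])
  show ?thesis
    using assms lc_diff_Rn[OF p] I.sym[of a "lc_diff p v b"] nabla_g_sym[OF p, of v a b]
    by (simp add: g_lc_diff field_simps nabla_g_sym[OF p, of _ v])
qed

lemma lc_diff_smf:
  assumes X: "smf p X" and Y: "smf p Y"
  shows "smf p (\<lambda>q. lc_diff q (X q) (Y q))"
proof (rule smf_if_inner_sm)
  show p: "p \<in> points M" using X smf_points by blast
  show "\<forall>\<^sub>F q in near p. lc_diff q (X q) (Y q) \<in> Rn (mdim M)"
    using smf_eventually_Rn[OF X] smf_eventually_Rn[OF Y] eventually_near_points
    by eventually_elim (rule lc_diff_Rn)
  fix Z assume Z: "smf p Z"
  \<comment> \<open>\<open>nabla_g\<close> extends its arguments anew at every point, which hides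
    its smoothness. The version on given fields has the same values and consists of visibly smooth
    terms.\<close>
  have s: "sm p (\<lambda>q. metric_der q (U q) V W)" if "smf p U" "smf p V" "smf p W" for U V W
  proof -
    have "sm p (\<lambda>q. g q (cov nab U V q) (W q))" "sm p (\<lambda>q. g q (V q) (cov nab U W q))"
      by (intro g_sm cov_smf that)+
    then show ?thesis unfolding metric_der_def cov_def
      by (intro sm_diff dirder_sm[OF that(1) g_sm[OF that(2,3)]])
  qed
  have "sm p (\<lambda>q. (metric_der q (X q) Y Z + metric_der q (Y q) X Z - metric_der q (Z q) X Y) * (1/2))"
    by (intro sm_mult sm_diff sm_add s X Y Z sm_const p)
  moreover have "\<forall>\<^sub>F q in near p. (metric_der q (X q) Y Z + metric_der q (Y q) X Z - metric_der q (Z q) X Y) * (1/2)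
      = g q (lc_diff q (X q) (Y q)) (Z q)"
    using smf_eventually[OF X] smf_eventually[OF Y] smf_eventually[OF Z]
    by eventually_elim (simp add: metric_der_eq smf_Rn g_lc_diff smf_points)
  ultimately show "sm p (\<lambda>q. g q (lc_diff q (X q) (Y q)) (Z q))" by (rule sm_cong[rotated])
qed

lemma levi_civita_exists:
  "\<exists>D. is_connection M D \<and> torsionless M D \<and> metric_connection M g D"
proof (intro exI conjI)
  define D where "D p v Y = nab p v Y + lc_diff p v (Y p)" for p v and Y :: "'p \<Rightarrow> coord"
  show "is_connection M D"
  proof (rule is_connectionI)
    fix p v w a b and Y Z :: "'p \<Rightarrow> coord" and f :: "'p \<Rightarrow> real"
    assume Y: "smf p Y" and v: "v \<in> Rn (mdim M)"
    have p: "p \<in> points M" using Y smf_points by blast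
    note Yp = smf_Rn[OF Y]
    show "D p v Y \<in> Rn (mdim M)" using nab_Rn[OF Y v] lc_diff_Rn[OF p v Yp] by (simp add: D_def)
    show "D p (a \<cdot>\<^sub>c v + b \<cdot>\<^sub>c w) Y = a \<cdot>\<^sub>c D p v Y + b \<cdot>\<^sub>c D p w Y" if "w \<in> Rn (mdim M)"
      using that v Yp p Y by (simp add: D_def nab_lin lc_diff_lin cv.scale_right_distrib)
    show "D p v (Y + Z) = D p v Y + D p v Z" if "smf p Z"
      using lc_diff_lin2[OF p Yp smf_Rn[OF that] v, of 1 1] nab_plus[OF Y that v]
      by (simp add: D_def plus_fun_apply)
    show "D p v (\<lambda>q. f q \<cdot>\<^sub>c Y q) = dirder M p v f \<cdot>\<^sub>c Y p + f p \<cdot>\<^sub>c D p v Y" if "sm p f"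
      using lc_diff_lin2[OF p Yp Yp v, of "f p" 0] nab_leibniz[OF Y that v]
      by (simp add: D_def cv.scale_right_distrib)
  next
    fix p X Y assume X: "smf p X" and Y: "smf p Y"
    have "smf p (\<lambda>q. cov nab X Y q + lc_diff q (X q) (Y q))" by (intro smf_add cov_smf lc_diff_smf X Y)
    then show "smf p (cov D X Y)" by (simp add: cov_def D_def)
  qed
  show "torsionless M D"
    unfolding torsionless_iff
  proof (intro allI impI)
    fix p X Y assume X: "smf p X" and Y: "smf p Y"
    show "D p (X p) Y - D p (Y p) X = bracket M X Y p"
      using torsion_free_at[OF X Y] lc_diff_sym[OF smf_points[OF X] smf_Rn[OF X] smf_Rn[OF Y]]
      by (simp add: D_def)
  qed
  show "metric_connection M g D"
    unfolding metric_connection_iff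
  proof (intro allI impI)
    fix p X Y Z assume X: "smf p X" and Y: "smf p Y" and Z: "smf p Z"
    have p: "p \<in> points M" using X smf_points by blast
    interpret I: inner_product_on "mdim M" "g p" by (rule inner[OF p])
    note XYZ = smf_Rn[OF X] smf_Rn[OF Y] smf_Rn[OF Z]
    have "metric_der p (X p) Y Z = g p (lc_diff p (X p) (Y p)) (Z p) + g p (Y p) (lc_diff p (X p) (Z p))"
      using metric_der_eq[OF Y Z XYZ(1)] lc_diff_metric[OF p XYZ] by simp
    then show "dirder M p (X p) (\<lambda>q. g q (Y q) (Z q)) = g p (D p (X p) Y) (Z p) + g p (Y p) (D p (X p) Z)"
      using XYZ nab_Rn[OF Y XYZ(1)] nab_Rn[OF Z XYZ(1)] lc_diff_Rn[OF p XYZ(1) XYZ(2)] lc_diff_Rn[OF p XYZ(1) XYZ(3)]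
      by (simp add: D_def I.add_left I.add_right metric_der_def)
  qed
qed

lemma levi_civita:
  shows levi_civita_connection: "is_connection M (levi_civita M g)"
    and levi_civita_torsionless: "torsionless M (levi_civita M g)"
    and levi_civita_metric: "metric_connection M g (levi_civita M g)"
  using someI_ex[OF levi_civita_exists] unfolding levi_civita_def by blast+

text \<open>Uniqueness, which makes the choice in \<open>levi_civita\<close> harmless: the
  difference of the two connections is symmetric and compatible with the derivative of the metric,
  and these two properties determine it.\<close>

lemma levi_civita_eq:
  assumes Y: "smf p Y" and v: "v \<in> Rn (mdim M)"
  shows "levi_civita M g p v Y = nab p v Y + lc_diff p v (Y p)"
proof -
  have p: "p \<in> points M" using Y smf_points by blast
  interpret I: inner_product_on "mdim M" "g p" by (rule inner[OF p])
  interpret L: connection_on M "levi_civita M g" by unfold_locales (rule levi_civita_connection)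
  define \<delta> where "\<delta> v Y = levi_civita M g p v Y - nab p v Y" for v Y
  have \<delta>R: "\<delta> v Y \<in> Rn (mdim M)" if "smf p Y" "v \<in> Rn (mdim M)" for v Y
    using that L.nab_Rn nab_Rn by (simp add: \<delta>_def)
  have sym: "\<delta> (X p) Y = \<delta> (Y p) X" if "smf p X" "smf p Y" for X Y
  proof -
    have "levi_civita M g p (X p) Y - levi_civita M g p (Y p) X = bracket M X Y p"
      using levi_civita_torsionless that unfolding torsionless_iff by blast
    also have "\<dots> = nab p (X p) Y - nab p (Y p) X" using torsion_free_at[OF that] by simp
    finally show ?thesis by (simp add: \<delta>_def algebra_simps)
  qed
  have compat: "g p (\<delta> (X p) Y) (Z p) + g p (Y p) (\<delta> (X p) Z) = nabla_g p (X p) (Y p) (Z p)"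
    if "smf p X" "smf p Y" "smf p Z" for X Y Z
  proof -
    have "dirder M p (X p) (\<lambda>q. g q (Y q) (Z q)) = g p (levi_civita M g p (X p) Y) (Z p) + g p (Y p) (levi_civita M g p (X p) Z)"
      using levi_civita_metric that unfolding metric_connection_iff by blast
    then show ?thesis
      using metric_der_eq[OF that(2,3) smf_Rn[OF that(1)]] that smf_Rn L.nab_Rn nab_Rn
      by (simp add: \<delta>_def metric_der_def I.minus_left I.minus_right)
  qed
  define V where "V = const_ext p v"
  have V: "smf p V" "V p = v" using smf_const_ext[OF p] const_ext_self[OF p v] by (auto simp: V_def)
  have "lc_diff p v (Y p) = \<delta> v Y"
  proof (rule lc_diff_unique[OF p v smf_Rn[OF Y] \<delta>R[OF Y v]])
    fix b assume b: "b \<in> Rn (mdim M)"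
    define Z where "Z = const_ext p b"
    have Z: "smf p Z" "Z p = b" using smf_const_ext[OF p] const_ext_self[OF p b] by (auto simp: Z_def)
    have R: "V p \<in> Rn (mdim M)" "Y p \<in> Rn (mdim M)" "Z p \<in> Rn (mdim M)" using V Y Z smf_Rn by auto
    \<comment> \<open>The compatibility equations in the directions \<open>V\<close> and
      \<open>Y\<close> are added and that in the direction \<open>Z\<close> is subtracted; the
      symmetry of \<open>\<delta>\<close> cancels the other terms.\<close>
    have "2 * g p (\<delta> (V p) Y) (Z p) = nabla_g p (V p) (Y p) (Z p) + nabla_g p (Y p) (V p) (Z p) - nabla_g p (Z p) (V p) (Y p)"
      using compat[OF V(1) Y Z(1)] compat[OF Y V(1) Z(1)] compat[OF Z(1) V(1) Y]
        sym[OF V(1) Y] sym[OF V(1) Z(1)] sym[OF Y Z(1)]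
        I.sym[OF R(2) \<delta>R[OF V(1) R(3)]] I.sym[OF R(1) \<delta>R[OF Y R(3)]] by simp
    then show "2 * g p (\<delta> v Y) b = nabla_g p v (Y p) b + nabla_g p (Y p) v b - nabla_g p b v (Y p)"
      using V Z by simp
  qed
  then show ?thesis by (simp add: \<delta>_def)
qed

end

section \<open>The tangent bundle as a manifold\<close>

lemma fst_half_Rn [simp]: "fst_half n w \<in> Rn n"
  by (simp add: fst_half_def Rn_iff)

lemma snd_half_Rn: "w \<in> Rn (2 * n) \<Longrightarrow> snd_half n w \<in> Rn n"
  by (simp add: snd_half_def Rn_iff)

lemma join_Rn: "y \<in> Rn n \<Longrightarrow> join n x y \<in> Rn (2 * n)"
  by (simp add: join_def Rn_iff)

lemma fst_half_join: "x \<in> Rn n \<Longrightarrow> fst_half n (join n x y) = x"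
  by (auto simp: fst_half_def join_def Rn_iff fun_eq_iff)

lemma snd_half_join: "snd_half n (join n x y) = y"
  by (auto simp: snd_half_def join_def)

lemma join_halves: "join n (fst_half n w) (snd_half n w) = w"
  by (auto simp: snd_half_def join_def fst_half_def)

lemma half_lin:
  "fst_half n (x + y) = fst_half n x + fst_half n y"
  "fst_half n (x - y) = fst_half n x - fst_half n y"
  "fst_half n (a \<cdot>\<^sub>c x) = a \<cdot>\<^sub>c fst_half n x"
  "snd_half n (x + y) = snd_half n x + snd_half n y"
  "snd_half n (x - y) = snd_half n x - snd_half n y"
  "snd_half n (a \<cdot>\<^sub>c x) = a \<cdot>\<^sub>c snd_half n x"
  by (auto simp: fst_half_def snd_half_def coord_simps fun_eq_iff)

lemma half_zero [simp]: "fst_half n 0 = 0" "snd_half n 0 = 0"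
  by (auto simp: fst_half_def snd_half_def coord_simps fun_eq_iff)

lemma join_eqI: "fst_half n w = fst_half n z \<Longrightarrow> snd_half n w = snd_half n z \<Longrightarrow> w = z"
  using join_halves by metis

lemma fst_half_upd: "fst_half n (z(i := t)) = (if i < n then (fst_half n z)(i := t) else fst_half n z)"
  by (auto simp: fst_half_def fun_eq_iff)

lemma openin_fst_half:
  assumes "openin (Euclidean_space n) V"
  shows "openin (Euclidean_space (2 * n)) {z \<in> Rn (2 * n). fst_half n z \<in> V}"
proof (rule openin_Rn_preimage[OF openin_topspace assms])
  show "continuous_on (Rn (2 * n)) (\<lambda>z. fst_half n z j)" if "j < n" for j
    using that Ck_continuous[OF openin_topspace Ck_proj[OF openin_topspace[of "Euclidean_space (2 * n)"], of 0 j]]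
    by (simp add: fst_half_def)
qed simp

lemma Cinf_fst_half:
  assumes V: "openin (Euclidean_space n) V" and f: "Cinf n V f"
  shows "Cinf (2 * n) {z \<in> Rn (2 * n). fst_half n z \<in> V} (\<lambda>z. f (fst_half n z))"
proof (rule Cinf_compose[OF openin_fst_half[OF V] V _ _ f])
  show "Cinf (2 * n) {z \<in> Rn (2 * n). fst_half n z \<in> V} (\<lambda>z. fst_half n z j)" if "j < n" for j
    using that Cinf_proj[OF openin_fst_half[OF V], of j] by (simp add: fst_half_def)
qed simp

locale affine_metric = riemannian_connection A "nabla A" "met A" for A :: "'p affine_riemann" +
  assumes flatness: "flat A (nabla A)"

lemma affine_riemann_manifold_imp_affine_metric:
  assumes "affine_riemann_manifold A"
  shows "affine_metric A"
proof -
  interpret smooth_atlas A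
    using assms smooth_manifold_imp_smooth_atlas unfolding affine_riemann_manifold_def by blast
  show ?thesis
    by unfold_locales (use assms in \<open>auto simp: affine_riemann_manifold_def\<close>)
qed

text \<open>Fixes a point type that \<open>tangent\<close> maps to itself, so that with
  \<open>tangent_affine_metric\<close> this context can be instantiated at every stage of the
  sequence.\<close>

locale tangent_bundle = affine_metric A for A :: "'a itpoint affine_riemann"
begin

abbreviation "T \<equiv> tangent A"
abbreviation "tc \<equiv> tangent_chart A"
abbreviation "nb \<equiv> nabla A"

lemma mdim_tangent [simp]: "mdim T = 2 * mdim A"
  by (simp add: tangent_def tangent_manifold_def)

lemma atlas_tangent: "atlas T = tc ` atlas A"
  by (simp add: tangent_def tangent_manifold_def)

lemma chart_at_tangent: "chart_at T u = tc (chart_at A (foot u))"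
  by (simp add: tangent_def tangent_manifold_def)

lemma points_tangent: "points T = {Tangent p y | p y. p \<in> points A \<and> y \<in> Rn (mdim A)}"
  by (simp add: tangent_def tangent_manifold_def)

lemma points_tangentD:
  assumes "u \<in> points T"
  shows foot_points: "foot u \<in> points A" and fibre_Rn: "fibre u \<in> Rn (mdim A)"
    and Tangent_foot_fibre: "Tangent (foot u) (fibre u) = u"
  using assms by (auto simp: points_tangent)

lemma dom_tc: "c \<in> atlas A \<Longrightarrow> fst (tc c) = {u \<in> points T. foot u \<in> fst c}"
  using chart_dom_points[of c] by (auto simp: tangent_chart_def points_tangent)

lemma snd_tc: "snd (tc c) u = join (mdim A) (snd c (foot u)) (comp_in A c (foot u) (fibre u))"
  by (simp add: tangent_chart_def)

text \<open>The inverse of a tangent chart in explicit form: the second half of \<open>z\<close>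
  gives the coefficients of a vector with respect to the coordinate fields. Transition maps are
  computed from it.\<close>

definition tinv :: "'a itpoint chart \<Rightarrow> coord \<Rightarrow> 'a itpoint" where
  "tinv c z = Tangent (chart_inv c (fst_half (mdim A) z))
     (\<Sum>b<mdim A. z (b + mdim A) \<cdot>\<^sub>c coord_field A c b (chart_inv c (fst_half (mdim A) z)))"

lemma tinv:
  assumes c: "c \<in> atlas A" and z: "z \<in> Rn (2 * mdim A)" "fst_half (mdim A) z \<in> snd c ` fst c"
  shows tinv_dom: "tinv c z \<in> fst (tc c)" and snd_tinv: "snd (tc c) (tinv c z) = z"
proof -
  let ?p = "chart_inv c (fst_half (mdim A) z)"
  have p: "?p \<in> fst c" "snd c ?p = fst_half (mdim A) z" using z(2) c by auto
  have y: "(\<Sum>b<mdim A. z (b + mdim A) \<cdot>\<^sub>c coord_field A c b ?p) \<in> Rn (mdim A)"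
    by (intro Rn_sum Rn_closed coord_field_Rn[OF c p(1)]) simp
  show "tinv c z \<in> fst (tc c)"
    unfolding dom_tc[OF c] using p y chart_dom_points[OF c p(1)] by (auto simp: tinv_def points_tangent)
  have "comp_in A c ?p (\<Sum>b<mdim A. z (b + mdim A) \<cdot>\<^sub>c coord_field A c b ?p)
      = (\<Sum>b<mdim A. snd_half (mdim A) z b \<cdot>\<^sub>c unit_coord b)"
    using comp_in_coord_field[OF c p(1)] by (simp add: comp_in_sum comp_in_scale snd_half_def)
  also have "\<dots> = snd_half (mdim A) z" using Rn_expand[OF snd_half_Rn[OF z(1)]] by simp
  finally show "snd (tc c) (tinv c z) = z"
    using p by (simp add: snd_tc tinv_def join_halves)
qed

lemma tc_inj:
  assumes c: "c \<in> atlas A"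
  shows "inj_on (snd (tc c)) (fst (tc c))"
proof (rule inj_onI)
  fix u u' assume u: "u \<in> fst (tc c)" and u': "u' \<in> fst (tc c)" and eq: "snd (tc c) u = snd (tc c) u'"
  have R: "snd c (foot u) \<in> Rn (mdim A)" "snd c (foot u') \<in> Rn (mdim A)"
    using u u' snd_in_Rn[OF c] by (auto simp: dom_tc[OF c])
  have "fst_half (mdim A) (snd (tc c) u) = fst_half (mdim A) (snd (tc c) u')" using eq by simp
  then have "snd c (foot u) = snd c (foot u')" using R by (simp add: snd_tc fst_half_join)
  then have f: "foot u = foot u'" using u u' chart_inj[OF c] by (auto simp: dom_tc[OF c] inj_on_def)
  have "snd_half (mdim A) (snd (tc c) u) = snd_half (mdim A) (snd (tc c) u')" using eq by simp
  then have "comp_in A c (foot u) (fibre u) = comp_in A c (foot u) (fibre u')"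
    by (simp add: snd_tc snd_half_join f)
  moreover have "fibre u \<in> Rn (mdim A)" "fibre u' \<in> Rn (mdim A)" "foot u \<in> fst c"
    using u u' fibre_Rn by (auto simp: dom_tc[OF c])
  ultimately have "fibre u = fibre u'" using comp_in_inj[OF c] by blast
  then show "u = u'" using f u u' Tangent_foot_fibre by (metis (no_types, lifting) dom_tc[OF c] mem_Collect_eq)
qed

lemma chart_inv_tc:
  assumes "c \<in> atlas A" "z \<in> Rn (2 * mdim A)" "fst_half (mdim A) z \<in> snd c ` fst c"
  shows "chart_inv (tc c) z = tinv c z"
  unfolding chart_inv_def
  using inv_into_f_f[OF tc_inj[OF assms(1)] tinv_dom[OF assms]] snd_tinv[OF assms] by simp

lemma tc_Rn: "c \<in> atlas A \<Longrightarrow> u \<in> fst (tc c) \<Longrightarrow> snd (tc c) u \<in> Rn (2 * mdim A)"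
  unfolding snd_tc dom_tc using join_Rn comp_in_Rn by blast

lemma fst_half_tc: "c \<in> atlas A \<Longrightarrow> u \<in> fst (tc c) \<Longrightarrow> fst_half (mdim A) (snd (tc c) u) = snd c (foot u)"
  unfolding snd_tc dom_tc using fst_half_join[OF snd_in_Rn] by blast

lemma tc_image:
  assumes c: "c \<in> atlas A"
  shows "snd (tc c) ` {u \<in> fst (tc c). foot u \<in> W}
    = {z \<in> Rn (2 * mdim A). fst_half (mdim A) z \<in> snd c ` (W \<inter> fst c)}"
proof (intro equalityI subsetI)
  fix z assume "z \<in> snd (tc c) ` {u \<in> fst (tc c). foot u \<in> W}"
  then obtain u where "z = snd (tc c) u" "u \<in> fst (tc c)" "foot u \<in> W" by blast
  then show "z \<in> {z \<in> Rn (2 * mdim A). fst_half (mdim A) z \<in> snd c ` (W \<inter> fst c)}"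
    using tc_Rn[OF c] fst_half_tc[OF c] dom_tc[OF c] by auto
next
  fix z assume z: "z \<in> {z \<in> Rn (2 * mdim A). fst_half (mdim A) z \<in> snd c ` (W \<inter> fst c)}"
  then have z': "z \<in> Rn (2 * mdim A)" "fst_half (mdim A) z \<in> snd c ` fst c" by auto
  have "foot (tinv c z) \<in> W" using z c by (auto simp: tinv_def)
  then have "tinv c z \<in> {u \<in> fst (tc c). foot u \<in> W}" using tinv_dom[OF c z'] by simp
  then show "z \<in> snd (tc c) ` {u \<in> fst (tc c). foot u \<in> W}"
    using snd_tinv[OF c z'] by (intro image_eqI[where x="tinv c z"]) simp_all
qed

lemma tc_dom_Int: "c \<in> atlas A \<Longrightarrow> d \<in> atlas A \<Longrightarrow> fst (tc c) \<inter> fst (tc d) = {u \<in> fst (tc c). foot u \<in> fst d}"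
  by (auto simp: dom_tc)

text \<open>The first half of the new coordinates is the transition map of \<open>A\<close>; the
  second is linear in the old fibre coordinates, with the Jacobian of that map as matrix.\<close>

lemma tc_transition:
  assumes c: "c \<in> atlas A" and d: "d \<in> atlas A" and j: "j < 2 * mdim A"
  shows "Cinf (2 * mdim A) (snd (tc c) ` (fst (tc c) \<inter> fst (tc d))) (\<lambda>z. snd (tc d) (chart_inv (tc c) z) j)"
proof -
  let ?n = "mdim A"
  let ?V = "snd c ` (fst c \<inter> fst d)"
  let ?U = "{z \<in> Rn (2 * ?n). fst_half ?n z \<in> ?V}"
  have V: "openin (Euclidean_space ?n) ?V" by (rule overlap_open[OF c d])
  note U = openin_fst_half[OF V]
  have im: "snd (tc c) ` (fst (tc c) \<inter> fst (tc d)) = ?U"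
    unfolding tc_dom_Int[OF c d] tc_image[OF c] by (simp add: Int_commute)
  have val: "snd (tc d) (chart_inv (tc c) z) = join ?n (snd d (chart_inv c (fst_half ?n z)))
      (\<lambda>j. \<Sum>b<?n. z (b + ?n) * partial b (\<lambda>x. snd d (chart_inv c x) j) (fst_half ?n z))" if z: "z \<in> ?U" for z
  proof -
    let ?p = "chart_inv c (fst_half ?n z)"
    have p: "?p \<in> fst c" "?p \<in> fst d" "snd c ?p = fst_half ?n z" using z c by auto
    have "comp_in A d ?p (coord_field A c b ?p) j = partial b (\<lambda>x. snd d (chart_inv c x) j) (fst_half ?n z)"
      if "b < ?n" for b j
      unfolding comp_in_def using dirder_coord_field[OF c p(1) that sm_chart[OF d p(2)]] p(3) by simp
    then have "comp_in A d ?p (\<Sum>b<?n. z (b + ?n) \<cdot>\<^sub>c coord_field A c b ?p)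
        = (\<lambda>j. \<Sum>b<?n. z (b + ?n) * partial b (\<lambda>x. snd d (chart_inv c x) j) (fst_half ?n z))"
      by (auto simp: comp_in_sum comp_in_scale coord_simps)
    moreover have "chart_inv (tc c) z = tinv c z" by (rule chart_inv_tc[OF c]) (use z in auto)
    ultimately show ?thesis by (simp add: snd_tc tinv_def)
  qed
  show ?thesis unfolding im
  proof (cases "j < ?n")
    case True
    have "Cinf (2 * ?n) ?U (\<lambda>z. snd d (chart_inv c (fst_half ?n z)) j)"
      by (rule Cinf_fst_half[OF V transition[OF c d True]])
    then show "Cinf (2 * ?n) ?U (\<lambda>z. snd (tc d) (chart_inv (tc c) z) j)"
      by (rule Cinf_cong[OF U, rotated]) (simp only: val join_def True if_True)
  next
    case False
    then have j': "j - ?n < ?n" using j by simp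
    have "Cinf (2 * ?n) ?U (\<lambda>z. \<Sum>b<?n. z (b + ?n) * partial b (\<lambda>x. snd d (chart_inv c x) (j - ?n)) (fst_half ?n z))"
      by (intro Cinf_sum[OF U] Cinf_mult[OF U] Cinf_proj[OF U] Cinf_fst_half[OF V] Cinf_partial transition[OF c d j']) simp
    then show "Cinf (2 * ?n) ?U (\<lambda>z. snd (tc d) (chart_inv (tc c) z) j)"
      by (rule Cinf_cong[OF U, rotated]) (simp only: val join_def False if_False)
  qed
qed

sublocale T: smooth_atlas "tangent A"
proof
  show "(\<Union>c\<in>atlas T. fst c) = points T"
    unfolding atlas_tangent using atlas_cover foot_points by (auto simp: dom_tc)
  show "inj_on (snd c) (fst c)" if "c \<in> atlas T" for c
    using that tc_inj by (auto simp: atlas_tangent)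
  show "openin (Euclidean_space (mdim T)) (snd c ` fst c)" if "c \<in> atlas T" for c
  proof -
    obtain c' where c': "c' \<in> atlas A" "c = tc c'" using \<open>c \<in> atlas T\<close> atlas_tangent by auto
    show ?thesis
      using tc_image[OF c'(1), of UNIV] openin_fst_half[OF chart_open[OF c'(1)]] c'(2) by simp
  qed
  fix c d assume "c \<in> atlas T" "d \<in> atlas T"
  then obtain c' d' where c': "c' \<in> atlas A" "c = tc c'" and d': "d' \<in> atlas A" "d = tc d'"
    using atlas_tangent by auto
  show "openin (Euclidean_space (mdim T)) (snd c ` (fst c \<inter> fst d))"
    using tc_image[OF c'(1), of "fst d'"] tc_dom_Int[OF c'(1) d'(1)]
      openin_fst_half[OF overlap_open[OF c'(1) d'(1)]] c'(2) d'(2) by (simp add: Int_commute)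
  show "Cinf (mdim T) (snd c ` (fst c \<inter> fst d)) (\<lambda>x. snd d (chart_inv c x) j)" if "j < mdim T" for j
    using tc_transition[OF c'(1) d'(1)] that c'(2) d'(2) by simp
next
  fix u assume u: "u \<in> points T"
  show "chart_at T u \<in> atlas T" "u \<in> fst (chart_at T u)"
    using foot_points[OF u] u by (auto simp: chart_at_tangent atlas_tangent dom_tc)
qed

subsection \<open>Base and fibre coordinates\<close>

lemma tc_atlas: "c \<in> atlas A \<Longrightarrow> tc c \<in> atlas T"
  by (simp add: atlas_tangent)

lemma openin_foot:
  assumes W: "openin (mtop A) W"
  shows "openin (mtop T) {u \<in> points T. foot u \<in> W}"
  unfolding T.openin_mtop
proof (intro conjI ballI)
  fix c assume "c \<in> atlas T"
  then obtain c' where c': "c' \<in> atlas A" "c = tc c'" using atlas_tangent by auto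
  have "{u \<in> points T. foot u \<in> W} \<inter> fst c = {u \<in> fst (tc c'). foot u \<in> W}"
    using c' by (auto simp: dom_tc)
  then show "openin (Euclidean_space (mdim T)) (snd c ` ({u \<in> points T. foot u \<in> W} \<inter> fst c))"
    using tc_image[OF c'(1), of W] openin_fst_half[OF openin_image[OF W c'(1)]] c'(2) by simp
qed auto

lemma eventually_foot:
  assumes "eventually P (near (foot u))" "u \<in> points T"
  shows "\<forall>\<^sub>F u' in T.near u. P (foot u')"
proof -
  obtain W where W: "openin (mtop A) W" "foot u \<in> W" "\<And>q. q \<in> W \<Longrightarrow> P q"
    using eventually_nearE[OF assms(1) foot_points[OF assms(2)]] by blast
  show ?thesis by (rule T.eventually_nearI[OF openin_foot[OF W(1)]]) (use W assms in auto)
qed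

lemma foot_chart_inv:
  assumes c: "c \<in> atlas A" and z: "z \<in> snd (tc c) ` fst (tc c)"
  shows "foot (chart_inv (tc c) z) = chart_inv c (fst_half (mdim A) z)"
proof -
  obtain u where u: "z = snd (tc c) u" "u \<in> fst (tc c)" using z by blast
  have "z \<in> Rn (2 * mdim A)" "fst_half (mdim A) z \<in> snd c ` fst c"
    using u tc_Rn[OF c] fst_half_tc[OF c] by (auto simp: dom_tc[OF c])
  then show ?thesis using chart_inv_tc[OF c] by (simp add: tinv_def)
qed

lemma sm_foot:
  assumes u: "u \<in> points T" and f: "sm (foot u) f"
  shows "T.sm u (\<lambda>u'. f (foot u'))"
proof -
  define c where "c = chart_at A (foot u)"
  have c: "c \<in> atlas A" "foot u \<in> fst c" using foot_points[OF u] by (auto simp: c_def)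
  have tcu: "tc c \<in> atlas T" "u \<in> fst (tc c)" using tc_atlas c u by (auto simp: dom_tc)
  obtain W where W: "openin (mtop A) W" "foot u \<in> W" "smooth_fun A W f"
    using f unfolding smooth_fun_at_def by blast
  let ?U = "{z \<in> Rn (2 * mdim A). fst_half (mdim A) z \<in> snd c ` (W \<inter> fst c)}"
  have V: "openin (Euclidean_space (mdim A)) (snd c ` (W \<inter> fst c))" by (rule openin_image[OF W(1) c(1)])
  have "Cinf (2 * mdim A) ?U (\<lambda>z. (f \<circ> chart_inv c) (fst_half (mdim A) z))"
    by (rule Cinf_fst_half[OF V]) (rule bspec[OF W(3)[unfolded smooth_fun_def] c(1)])
  then have "Cinf (2 * mdim A) ?U (\<lambda>z. f (foot (chart_inv (tc c) z)))"
  proof (rule Cinf_cong[OF openin_fst_half[OF V], rotated])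
    fix z assume "z \<in> ?U"
    then have "z \<in> snd (tc c) ` {u \<in> fst (tc c). foot u \<in> W}" by (simp only: tc_image[OF c(1)])
    then show "(f \<circ> chart_inv c) (fst_half (mdim A) z) = f (foot (chart_inv (tc c) z))"
      using foot_chart_inv[OF c(1), of z] by auto
  qed
  moreover have "snd (tc c) u \<in> ?U"
    using tcu(2) W(2) unfolding tc_image[OF c(1), symmetric] by blast
  ultimately show ?thesis
    unfolding T.sm_iff[OF tcu] Cinf_at_def using openin_fst_half[OF V] by auto
qed

text \<open>In a tangent chart such a function is constant in the fibre coordinates, so
  \<open>fst_half\<close> represents the differential of the projection.\<close>

lemma dirder_foot:
  assumes u: "u \<in> points T"
  shows "dirder T u w (\<lambda>u'. f (foot u')) = dirder A (foot u) (fst_half (mdim A) w) f"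
proof -
  let ?n = "mdim A"
  define c where "c = chart_at A (foot u)"
  have c: "c \<in> atlas A" "foot u \<in> fst c" using foot_points[OF u] by (auto simp: c_def)
  have tcu: "tc c \<in> atlas T" "u \<in> fst (tc c)" using tc_atlas c u by (auto simp: dom_tc)
  have fh: "fst_half ?n (snd (tc c) u) = snd c (foot u)" by (rule fst_half_tc[OF c(1) tcu(2)])
  have "T.pd (tc c) i (\<lambda>u'. f (foot u')) u = (if i < ?n then pd c i f (foot u) else 0)" if i: "i < 2 * ?n" for i
  proof -
    have "T.pd (tc c) i (\<lambda>u'. f (foot u')) u = partial i (\<lambda>z. f (chart_inv c (fst_half ?n z))) (snd (tc c) u)"
      using T.chart_open[OF tcu(1)] tcu(2) i foot_chart_inv[OF c(1)]
      by (intro partial_cong[of "2 * ?n" "snd (tc c) ` fst (tc c)"]) auto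
    also have "\<dots> = (if i < ?n then pd c i f (foot u) else 0)"
    proof (cases "i < ?n")
      case True
      then have "snd (tc c) u i = snd c (foot u) i" unfolding fh[symmetric] by (simp add: fst_half_def)
      then show ?thesis using True by (simp add: partial_def fst_half_upd fh)
    next
      case False
      then show ?thesis by (simp add: partial_def fst_half_upd)
    qed
    finally show ?thesis .
  qed
  then have "dirder T u w (\<lambda>u'. f (foot u')) = (\<Sum>i<2 * ?n. (if i < ?n then pd c i f (foot u) else 0) * w i)"
    unfolding T.dirder_eq chart_at_tangent c_def[symmetric] by simp
  also have "\<dots> = (\<Sum>i<?n. (if i < ?n then pd c i f (foot u) else 0) * w i)"
    by (rule sum.mono_neutral_right) auto
  also have "\<dots> = dirder A (foot u) (fst_half ?n w) f"
    unfolding dirder_eq c_def[symmetric] by (simp add: fst_half_def)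
  finally show ?thesis .
qed

text \<open>The fibre coordinate functions of an arbitrary chart, whereas \<open>fibre u\<close>
  refers to the preferred one. Together with the base coordinates they detect tangent vectors of the
  tangent bundle.\<close>

abbreviation "yc c j u \<equiv> comp_in A c (foot u) (fibre u) j"

lemma yc_eq: "snd (tc c) u (j + mdim A) = yc c j u"
  by (simp add: snd_tc join_def)

lemma yc_sm: "u \<in> points T \<Longrightarrow> c \<in> atlas A \<Longrightarrow> foot u \<in> fst c \<Longrightarrow> T.sm u (\<lambda>u'. yc c j u')"
  using T.sm_chart[OF tc_atlas, of c u "j + mdim A"] by (simp add: yc_eq dom_tc)

lemma comp_in_tc_base:
  assumes "u \<in> points T" "j < mdim A"
  shows "comp_in T (tc c) u w j = comp_in A c (foot u) (fst_half (mdim A) w) j"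
  using dirder_foot[OF assms(1), of w "\<lambda>q. snd c q j"] assms(2)
  by (simp add: comp_in_def snd_tc join_def)

lemma comp_in_tc_fibre: "comp_in T (tc c) u w (j + mdim A) = dirder T u w (\<lambda>u'. yc c j u')"
  unfolding comp_in_def[of T] yc_eq ..

lemma dirder_yc_self:
  assumes u: "u \<in> points T" and w: "w \<in> Rn (2 * mdim A)"
  shows "dirder T u w (\<lambda>u'. yc (chart_at A (foot u)) j u') = w (j + mdim A)"
  using T.comp_in_self[OF u] w comp_in_tc_fibre[of "chart_at A (foot u)" u w j]
  by (simp add: chart_at_tangent)

text \<open>Near \<open>u\<close>, the fibre coordinates of \<open>c\<close> are those of the
  preferred chart at \<open>foot u\<close> multiplied by a Jacobian that depends on the base point.
  The product rule gives one sum from the variation of the Jacobian and one term from the fibre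
  direction.\<close>

lemma dirder_yc:
  assumes u: "u \<in> points T" and w: "w \<in> Rn (2 * mdim A)" and c: "c \<in> atlas A" "foot u \<in> fst c"
  shows "dirder T u w (\<lambda>u'. yc c j u') =
    (\<Sum>b<mdim A. fibre u b * dirder A (foot u) (fst_half (mdim A) w)
        (\<lambda>q. comp_in A c q (coord_field A (chart_at A (foot u)) b q) j))
    + comp_in A c (foot u) (snd_half (mdim A) w) j"
proof -
  let ?n = "mdim A"
  define p where "p = foot u"
  define d where "d = chart_at A p"
  have p: "p \<in> points A" "p \<in> fst c" using foot_points[OF u] c by (auto simp: p_def)
  have d: "d \<in> atlas A" "p \<in> fst d" using p by (auto simp: d_def)
  have E: "smf p (coord_field A d b)" if "b < ?n" for b using that d by (intro smf_coord_field)
  define h where "h b q = comp_in A c q (coord_field A d b q) j" for b q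
  have ev: "\<forall>\<^sub>F u' in T.near u. yc c j u' = (\<Sum>b<?n. yc d b u' * h b (foot u'))"
    using T.eventually_near_points
      eventually_foot[OF eventually_near_chart[OF d[unfolded p_def]] u]
  proof eventually_elim
    case (elim u')
    have "fibre u' = (\<Sum>b<?n. yc d b u' \<cdot>\<^sub>c coord_field A d b (foot u'))"
      using coord_field_expand[OF d(1) elim(2) fibre_Rn[OF elim(1)]] .
    then have "comp_in A c (foot u') (fibre u') = comp_in A c (foot u') (\<Sum>b<?n. yc d b u' \<cdot>\<^sub>c coord_field A d b (foot u'))"
      by (rule arg_cong)
    then show ?case by (simp add: comp_in_sum comp_in_scale coord_simps h_def)
  qed
  have hs: "T.sm u (\<lambda>u'. h b (foot u'))" if "b < mdim A" for b
  proof (cases "j < ?n")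
    case True
    then show ?thesis unfolding h_def using sm_foot[OF u] smf_comp_sm[OF E[OF that] c(1) p(2) True] p_def by simp
  next
    case False
    have "\<forall>\<^sub>F u' in T.near u. 0 = h b (foot u')"
      using eventually_foot[OF eventually_near_chart[OF c] u]
      by eventually_elim (use comp_in_Rn[OF c(1)] False in \<open>auto simp: h_def Rn_iff\<close>)
    then show ?thesis by (rule T.sm_cong) (rule T.sm_const[OF u])
  qed
  have ys: "T.sm u (\<lambda>u'. yc d b u')" for b using yc_sm[OF u d(1)] d(2) p_def by simp
  have "dirder T u w (\<lambda>u'. yc c j u') = dirder T u w (\<lambda>u'. \<Sum>b<?n. yc d b u' * h b (foot u'))"
    by (rule T.dirder_cong[OF u ev])
  also have "\<dots> = (\<Sum>b<?n. dirder T u w (\<lambda>u'. yc d b u' * h b (foot u')))"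
    by (rule T.dirder_sum[OF u]) (use ys hs in \<open>auto intro!: T.sm_mult\<close>)
  also have "\<dots> = (\<Sum>b<?n. dirder T u w (\<lambda>u'. yc d b u') * h b p + yc d b u * dirder T u w (\<lambda>u'. h b (foot u')))"
    unfolding p_def by (intro sum.cong refl T.dirder_mult ys hs) auto
  also have "\<dots> = (\<Sum>b<?n. snd_half ?n w b * h b p + fibre u b * dirder A p (fst_half ?n w) (h b))"
    using dirder_yc_self[OF u w] dirder_foot[OF u] comp_in_self[OF p(1) fibre_Rn[OF u]]
    by (simp add: d_def p_def snd_half_def)
  also have "\<dots> = (\<Sum>b<?n. snd_half ?n w b * h b p) + (\<Sum>b<?n. fibre u b * dirder A p (fst_half ?n w) (h b))"
    by (rule sum.distrib)
  also have "(\<Sum>b<?n. snd_half ?n w b * h b p) = comp_in A c p (\<Sum>b<?n. snd_half ?n w b \<cdot>\<^sub>c unit_coord b) j"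
    using coord_field_self[OF p(1)] by (simp add: comp_in_sum comp_in_scale coord_simps h_def d_def)
  also have "(\<Sum>b<?n. snd_half ?n w b \<cdot>\<^sub>c unit_coord b) = snd_half ?n w"
    using Rn_expand[OF snd_half_Rn[OF w]] by simp
  finally show ?thesis by (simp add: h_def[abs_def] p_def d_def)
qed

subsection \<open>Horizontal and vertical lifts\<close>

text \<open>Contracting the Christoffel symbols with \<open>v\<close> brings in the connection
  itself, from which \<open>hlift\<close> inherits its linearity in \<open>v\<close>.\<close>

lemma hlift_eq:
  assumes u: "u \<in> points T" and v: "v \<in> Rn (mdim A)"
  shows "hlift A u v = join (mdim A) v
    (- (\<Sum>b<mdim A. fibre u b \<cdot>\<^sub>c nb (foot u) v (coord_field A (chart_at A (foot u)) b)))"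
proof -
  let ?E = "coord_field A (chart_at A (foot u))"
  have p: "foot u \<in> points A" using foot_points[OF u] .
  have E: "smf (foot u) (?E b)" if "b < mdim A" for b using that p by (intro smf_coord_field) auto
  have "nb (foot u) v (?E b) = (\<Sum>a<mdim A. v a \<cdot>\<^sub>c nb (foot u) (unit_coord a) (?E b))" if b: "b < mdim A" for b
  proof -
    have "nb (foot u) v (?E b) = nb (foot u) (\<Sum>a<mdim A. v a \<cdot>\<^sub>c unit_coord a) (?E b)"
      using Rn_expand[OF v] by simp
    also have "\<dots> = (\<Sum>a<mdim A. nb (foot u) (v a \<cdot>\<^sub>c unit_coord a) (?E b))"
      by (rule nab_sum_vec[OF E[OF b]]) (auto intro: Rn_closed unit_coord_Rn)
    also have "\<dots> = (\<Sum>a<mdim A. v a \<cdot>\<^sub>c nb (foot u) (unit_coord a) (?E b))"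
      by (intro sum.cong refl nab_scale_vec[OF E[OF b]]) (auto intro: unit_coord_Rn)
    finally show ?thesis .
  qed
  then have "(\<Sum>b<mdim A. fibre u b \<cdot>\<^sub>c nb (foot u) v (?E b))
      = (\<Sum>b<mdim A. \<Sum>a<mdim A. (v a * fibre u b) \<cdot>\<^sub>c christoffel A nb (foot u) a b)"
    by (simp add: cv.scale_sum_right christoffel_def mult.commute)
  also have "\<dots> = (\<Sum>a<mdim A. \<Sum>b<mdim A. (v a * fibre u b) \<cdot>\<^sub>c christoffel A nb (foot u) a b)"
    by (rule sum.swap)
  finally show ?thesis by (simp add: hlift_def)
qed

lemma hlift_vert_Rn:
  assumes u: "u \<in> points T" and v: "v \<in> Rn (mdim A)"
  shows "- (\<Sum>b<mdim A. fibre u b \<cdot>\<^sub>c nb (foot u) v (coord_field A (chart_at A (foot u)) b)) \<in> Rn (mdim A)"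
  using foot_points[OF u] by (intro Rn_closed Rn_sum nab_Rn smf_coord_field v) auto

lemma hlift_Rn: "u \<in> points T \<Longrightarrow> v \<in> Rn (mdim A) \<Longrightarrow> hlift A u v \<in> Rn (2 * mdim A)"
  unfolding hlift_eq by (rule join_Rn[OF hlift_vert_Rn])

lemma vlift_Rn: "v \<in> Rn (mdim A) \<Longrightarrow> vlift A u v \<in> Rn (2 * mdim A)"
  unfolding vlift_def by (rule join_Rn)

lemma fst_half_hlift: "v \<in> Rn (mdim A) \<Longrightarrow> fst_half (mdim A) (hlift A u v) = v"
  by (simp add: hlift_def fst_half_join)

lemma fst_half_vlift: "fst_half (mdim A) (vlift A u v) = 0"
  by (simp add: vlift_def fst_half_join)

lemma snd_half_vlift: "snd_half (mdim A) (vlift A u v) = v"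
  by (simp add: vlift_def snd_half_join)

lemma snd_half_hlift: "u \<in> points T \<Longrightarrow> v \<in> Rn (mdim A) \<Longrightarrow> snd_half (mdim A) (hlift A u v)
    = - (\<Sum>b<mdim A. fibre u b \<cdot>\<^sub>c nb (foot u) v (coord_field A (chart_at A (foot u)) b))"
  by (simp add: hlift_eq snd_half_join)

lemma hlift_lin:
  assumes u: "u \<in> points T" and v: "v \<in> Rn (mdim A)" and w: "w \<in> Rn (mdim A)"
  shows "hlift A u (a \<cdot>\<^sub>c v + b \<cdot>\<^sub>c w) = a \<cdot>\<^sub>c hlift A u v + b \<cdot>\<^sub>c hlift A u w"
proof (rule join_eqI)
  have E: "smf (foot u) (coord_field A (chart_at A (foot u)) b)" if "b < mdim A" for b
    using that foot_points[OF u] by (intro smf_coord_field) auto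
  show "snd_half (mdim A) (hlift A u (a \<cdot>\<^sub>c v + b \<cdot>\<^sub>c w)) = snd_half (mdim A) (a \<cdot>\<^sub>c hlift A u v + b \<cdot>\<^sub>c hlift A u w)"
    using u v w E by (simp add: half_lin snd_half_hlift nab_lin fun_eq_iff coord_simps
        sum_distrib_left sum.distrib algebra_simps sum_negf)
qed (use u v w in \<open>simp add: half_lin fst_half_hlift\<close>)

lemma hlift_add: "u \<in> points T \<Longrightarrow> v \<in> Rn (mdim A) \<Longrightarrow> w \<in> Rn (mdim A) \<Longrightarrow> hlift A u (v + w) = hlift A u v + hlift A u w"
  using hlift_lin[of u v w 1 1] by simp

lemma hlift_scale: "u \<in> points T \<Longrightarrow> v \<in> Rn (mdim A) \<Longrightarrow> hlift A u (a \<cdot>\<^sub>c v) = a \<cdot>\<^sub>c hlift A u v"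
  using hlift_lin[of u v v a 0] by simp

lemma hlift_zero: "u \<in> points T \<Longrightarrow> hlift A u 0 = 0"
  using hlift_scale[of u 0 0] by simp

lemma hlift_uminus: "u \<in> points T \<Longrightarrow> v \<in> Rn (mdim A) \<Longrightarrow> hlift A u (- v) = - hlift A u v"
  using hlift_scale[of u v "-1"] by simp

lemma hlift_sum: "u \<in> points T \<Longrightarrow> (\<And>i. i \<in> S \<Longrightarrow> f i \<in> Rn (mdim A)) \<Longrightarrow> hlift A u (\<Sum>i\<in>S. f i) = (\<Sum>i\<in>S. hlift A u (f i))"
  by (induction S rule: infinite_finite_induct) (simp_all add: hlift_zero hlift_add)

lemma vlift_lin: "vlift A u (a \<cdot>\<^sub>c v + b \<cdot>\<^sub>c w) = a \<cdot>\<^sub>c vlift A u v + b \<cdot>\<^sub>c vlift A u w"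
  by (auto simp: vlift_def join_def coord_simps fun_eq_iff)

lemma vlift_add: "vlift A u (v + w) = vlift A u v + vlift A u w"
  using vlift_lin[of u 1 v 1 w] by simp

lemma vlift_scale: "vlift A u (a \<cdot>\<^sub>c v) = a \<cdot>\<^sub>c vlift A u v"
  using vlift_lin[of u a v 0 v] by simp

lemma vlift_zero: "vlift A u 0 = 0"
  using vlift_scale[of u 0 0] by simp

lemma vlift_uminus: "vlift A u (- v) = - vlift A u v"
  using vlift_scale[of u "-1" v] by simp

lemma vlift_sum: "vlift A u (\<Sum>i\<in>S. f i) = (\<Sum>i\<in>S. vlift A u (f i))"
  by (induction S rule: infinite_finite_induct) (simp_all add: vlift_zero vlift_add)

section \<open>Horizontal and vertical parts\<close>

lemma hpart_Rn: "hpart A u w \<in> Rn (mdim A)"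
  by (simp add: hpart_def)

lemma vpart_Rn: "u \<in> points T \<Longrightarrow> w \<in> Rn (2 * mdim A) \<Longrightarrow> vpart A u w \<in> Rn (mdim A)"
  unfolding vpart_def by (intro snd_half_Rn Rn_closed hlift_Rn hpart_Rn)

lemma hv_decomp:
  assumes "u \<in> points T"
  shows "hlift A u (hpart A u w) + vlift A u (vpart A u w) = w"
  by (rule join_eqI[of "mdim A"])
     (simp_all add: half_lin fst_half_hlift fst_half_vlift snd_half_vlift hpart_Rn vpart_def, simp add: hpart_def)

lemma hpart_hlift: "v \<in> Rn (mdim A) \<Longrightarrow> hpart A u (hlift A u v) = v"
  by (simp add: hpart_def fst_half_hlift)

lemma vpart_hlift: "v \<in> Rn (mdim A) \<Longrightarrow> vpart A u (hlift A u v) = 0"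
  by (simp add: vpart_def hpart_hlift)

lemma hpart_vlift: "hpart A u (vlift A u v) = 0"
  by (simp add: hpart_def fst_half_vlift)

lemma vpart_vlift: "u \<in> points T \<Longrightarrow> vpart A u (vlift A u v) = v"
  by (simp add: vpart_def hpart_vlift hlift_zero snd_half_vlift)

lemma hpart_lin: "hpart A u (a \<cdot>\<^sub>c v + b \<cdot>\<^sub>c w) = a \<cdot>\<^sub>c hpart A u v + b \<cdot>\<^sub>c hpart A u w"
  by (simp add: hpart_def half_lin)

lemma vpart_lin: "u \<in> points T \<Longrightarrow> vpart A u (a \<cdot>\<^sub>c v + b \<cdot>\<^sub>c w) = a \<cdot>\<^sub>c vpart A u v + b \<cdot>\<^sub>c vpart A u w"
  by (simp add: vpart_def hpart_lin half_lin hlift_lin hpart_Rn cv.scale_right_diff_distrib)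

lemma hpart_add: "hpart A u (v + w) = hpart A u v + hpart A u w"
  using hpart_lin[of u 1 v 1 w] by simp

lemma vpart_add: "u \<in> points T \<Longrightarrow> vpart A u (v + w) = vpart A u v + vpart A u w"
  using vpart_lin[of u 1 v 1 w] by simp

lemma hpart_scale: "hpart A u (a \<cdot>\<^sub>c v) = a \<cdot>\<^sub>c hpart A u v"
  using hpart_lin[of u a v 0 v] by simp

lemma vpart_scale: "u \<in> points T \<Longrightarrow> vpart A u (a \<cdot>\<^sub>c v) = a \<cdot>\<^sub>c vpart A u v"
  using vpart_lin[of u a v 0 v] by simp

section \<open>Lifts as derivations of base and fibre coordinates\<close>

lemma dirder_hlift_foot:
  "u \<in> points T \<Longrightarrow> v \<in> Rn (mdim A) \<Longrightarrow> dirder T u (hlift A u v) (\<lambda>u'. f (foot u')) = dirder A (foot u) v f"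
  by (simp add: dirder_foot fst_half_hlift)

lemma dirder_vlift_foot: "u \<in> points T \<Longrightarrow> dirder T u (vlift A u v) (\<lambda>u'. f (foot u')) = 0"
  by (simp add: dirder_foot fst_half_vlift)

lemma dirder_vlift_yc:
  assumes "u \<in> points T" "v \<in> Rn (mdim A)" "c \<in> atlas A" "foot u \<in> fst c"
  shows "dirder T u (vlift A u v) (\<lambda>u'. yc c j u') = comp_in A c (foot u) v j"
  using dirder_yc[OF assms(1) vlift_Rn[OF assms(2)] assms(3,4)] by (simp add: fst_half_vlift snd_half_vlift)

text \<open>\<open>hlift\<close> is defined in the preferred chart; this shows that its coordinate
  formula is the same in every chart, so that it can be differentiated along the tangent
  bundle.\<close>

lemma dirder_hlift_yc:
  assumes u: "u \<in> points T" and v: "v \<in> Rn (mdim A)" and c: "c \<in> atlas A" "foot u \<in> fst c" and j: "j < mdim A"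
  shows "dirder T u (hlift A u v) (\<lambda>u'. yc c j u')
    = - (\<Sum>k<mdim A. yc c k u * comp_in A c (foot u) (nb (foot u) v (coord_field A c k)) j)"
proof -
  let ?n = "mdim A"
  define p where "p = foot u"
  define d where "d = chart_at A p"
  have p: "p \<in> points A" "p \<in> fst c" using foot_points[OF u] c by (auto simp: p_def)
  have d: "d \<in> atlas A" "p \<in> fst d" using p by (auto simp: d_def)
  have E: "smf p (coord_field A d b)" if "b < ?n" for b using that d by (intro smf_coord_field)
  define h where "h b k q = comp_in A c q (coord_field A d b q) k" for b k q
  define \<theta> where "\<theta> k = comp_in A c p (nb p v (coord_field A c k)) j" for k
  \<comment> \<open>The first summand is the inhomogeneous term in the transformation law of the
    Christoffel symbols. It cancels the derivative of the Jacobian that \<open>dirder_yc\<close>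
    produces.\<close>
  have nbE: "comp_in A c p (nb p v (coord_field A d b)) j = dirder A p v (h b j) + (\<Sum>k<?n. h b k p * \<theta> k)" if b: "b < ?n" for b
  proof -
    have "comp_in A c p (nb p v (coord_field A d b)) =
        (\<Sum>k<?n. dirder A p v (h b k) \<cdot>\<^sub>c unit_coord k + h b k p \<cdot>\<^sub>c comp_in A c p (nb p v (coord_field A c k)))"
      unfolding nab_expand[OF E[OF b] v c(1) p(2)] h_def
      using comp_in_coord_field[OF c(1) p(2)] by (simp add: comp_in_sum comp_in_add comp_in_scale)
    then show ?thesis
      using j by (simp add: coord_simps sum.distrib unit_coord_def \<theta>_def if_distrib cong: if_cong)
  qed
  have "dirder T u (hlift A u v) (\<lambda>u'. yc c j u') = (\<Sum>b<?n. fibre u b * dirder A p v (h b j))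
     + comp_in A c p (- (\<Sum>b<?n. fibre u b \<cdot>\<^sub>c nb p v (coord_field A d b))) j"
    using dirder_yc[OF u hlift_Rn[OF u v] c]
    by (simp add: fst_half_hlift[OF v] snd_half_hlift[OF u v] p_def d_def h_def[abs_def])
  also have "comp_in A c p (- (\<Sum>b<?n. fibre u b \<cdot>\<^sub>c nb p v (coord_field A d b))) j
      = - (\<Sum>b<?n. fibre u b * (dirder A p v (h b j) + (\<Sum>k<?n. h b k p * \<theta> k)))"
    using comp_in_scale[of c p "-1" "\<Sum>b<?n. fibre u b \<cdot>\<^sub>c nb p v (coord_field A d b)"] nbE
    by (simp add: comp_in_sum comp_in_scale coord_simps)
  also have "(\<Sum>b<?n. fibre u b * dirder A p v (h b j)) + - (\<Sum>b<?n. fibre u b * (dirder A p v (h b j) + (\<Sum>k<?n. h b k p * \<theta> k)))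
      = - (\<Sum>b<?n. \<Sum>k<?n. fibre u b * h b k p * \<theta> k)"
    by (simp add: distrib_left sum.distrib sum_distrib_left mult.assoc)
  also have "(\<Sum>b<?n. \<Sum>k<?n. fibre u b * h b k p * \<theta> k) = (\<Sum>k<?n. (\<Sum>b<?n. fibre u b * h b k p) * \<theta> k)"
    by (subst sum.swap) (simp add: sum_distrib_right)
  also have "\<dots> = (\<Sum>k<?n. yc c k u * \<theta> k)"
  proof (intro sum.cong refl arg_cong2[where f="(*)"])
    fix k
    have "yc c k u = comp_in A c p (\<Sum>b<?n. fibre u b \<cdot>\<^sub>c unit_coord b) k"
      using Rn_expand[OF fibre_Rn[OF u]] by (simp add: p_def)
    then show "(\<Sum>b<?n. fibre u b * h b k p) = yc c k u"
      using coord_field_self[OF p(1)] by (simp add: comp_in_sum comp_in_scale coord_simps h_def d_def)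
  qed
  finally show ?thesis by (simp add: \<theta>_def p_def)
qed

subsection \<open>Smooth vector fields along the projection\<close>

text \<open>Smooth sections of the pullback along the projection of the tangent bundle of
  \<open>A\<close>. The horizontal and the vertical part of a field on \<open>T\<close> are of this
  kind, but usually not pulled back from a field on \<open>A\<close>.\<close>

definition smal :: "'a itpoint \<Rightarrow> ('a itpoint \<Rightarrow> coord) \<Rightarrow> bool" where
  "smal u s \<longleftrightarrow> u \<in> points T \<and> (\<forall>\<^sub>F u' in T.near u. s u' \<in> Rn (mdim A)) \<and>
     (\<forall>c\<in>atlas A. foot u \<in> fst c \<longrightarrow> (\<forall>j<mdim A. T.sm u (\<lambda>u'. comp_in A c (foot u') (s u') j)))"

lemma smalI:
  assumes u: "u \<in> points T" and s: "\<forall>\<^sub>F u' in T.near u. s u' \<in> Rn (mdim A)"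
    and c: "c \<in> atlas A" "foot u \<in> fst c"
    and sm: "\<And>j. j < mdim A \<Longrightarrow> T.sm u (\<lambda>u'. comp_in A c (foot u') (s u') j)"
  shows "smal u s"
proof -
  have "T.sm u (\<lambda>u'. comp_in A d (foot u') (s u') j)" if d: "d \<in> atlas A" "foot u \<in> fst d" for d j
  proof -
    have "T.sm u (\<lambda>u'. \<Sum>b<mdim A. pd c b (\<lambda>q'. snd d q' j) (foot u') * comp_in A c (foot u') (s u') b)"
      using c d by (intro T.sm_sum T.sm_mult u sm_foot[OF u] pd_sm sm_chart sm) auto
    moreover have "\<forall>\<^sub>F u' in T.near u. (\<Sum>b<mdim A. pd c b (\<lambda>q'. snd d q' j) (foot u') * comp_in A c (foot u') (s u') b)
        = comp_in A d (foot u') (s u') j"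
      using eventually_foot[OF eventually_near_chart[OF c] u] eventually_foot[OF eventually_near_chart[OF d] u]
      by eventually_elim (rule comp_in_change[symmetric, OF c(1) _ d(1)])
    ultimately show ?thesis by (rule T.sm_cong[rotated])
  qed
  then show ?thesis unfolding smal_def using u s by blast
qed

lemma smal_points: "smal u s \<Longrightarrow> u \<in> points T"
  by (simp add: smal_def)

lemma smal_eventually_Rn: "smal u s \<Longrightarrow> \<forall>\<^sub>F u' in T.near u. s u' \<in> Rn (mdim A)"
  by (simp add: smal_def)

lemma smal_Rn: "smal u s \<Longrightarrow> s u \<in> Rn (mdim A)"
  using T.eventually_nearD[OF smal_eventually_Rn smal_points] .

lemma smal_comp_sm:
  "smal u s \<Longrightarrow> c \<in> atlas A \<Longrightarrow> foot u \<in> fst c \<Longrightarrow> j < mdim A \<Longrightarrow> T.sm u (\<lambda>u'. comp_in A c (foot u') (s u') j)"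
  unfolding smal_def by blast

lemma smal_eventually:
  assumes s: "smal u s"
  shows "\<forall>\<^sub>F u' in T.near u. smal u' s"
proof -
  have u: "u \<in> points T" using s smal_points by blast
  define c where "c = chart_at A (foot u)"
  have c: "c \<in> atlas A" "foot u \<in> fst c" using foot_points[OF u] by (auto simp: c_def)
  have "\<forall>\<^sub>F u' in T.near u. \<forall>j\<in>{..<mdim A}. T.sm u' (\<lambda>u'. comp_in A c (foot u') (s u') j)"
    by (intro eventually_ball_finite) (auto intro!: T.sm_eventually smal_comp_sm[OF s c])
  with T.eventually_near_points smal_eventually_Rn[OF s] eventually_foot[OF eventually_near_chart[OF c] u]
  have "\<forall>\<^sub>F u' in T.near u. s u' \<in> Rn (mdim A) \<and> foot u' \<in> fst c \<and> u' \<in> points T \<and>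
      (\<forall>j<mdim A. T.sm u' (\<lambda>u'. comp_in A c (foot u') (s u') j))"
    by eventually_elim auto
  then obtain W where W: "openin (mtop T) W" "u \<in> W" "\<And>u'. u' \<in> W \<Longrightarrow> s u' \<in> Rn (mdim A) \<and> foot u' \<in> fst c \<and> u' \<in> points T \<and>
      (\<forall>j<mdim A. T.sm u' (\<lambda>u'. comp_in A c (foot u') (s u') j))"
    using T.eventually_nearE[OF _ u, of "\<lambda>u'. s u' \<in> Rn (mdim A) \<and> foot u' \<in> fst c \<and> u' \<in> points T \<and>
      (\<forall>j<mdim A. T.sm u' (\<lambda>u'. comp_in A c (foot u') (s u') j))"] by blast
  show ?thesis
  proof (rule T.eventually_nearI[OF W(1,2)])
    fix u' assume u': "u' \<in> W"
    have "\<forall>\<^sub>F u'' in T.near u'. s u'' \<in> Rn (mdim A)"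
      by (rule T.eventually_nearI[OF W(1) u']) (use W(3) in blast)
    then show "smal u' s" using W(3)[OF u'] c(1) by (intro smalI[of u' s c]) auto
  qed
qed

lemma smal_foot:
  assumes u: "u \<in> points T" and X: "smf (foot u) X"
  shows "smal u (\<lambda>u'. X (foot u'))"
proof -
  have p: "foot u \<in> points A" by (rule foot_points[OF u])
  show ?thesis
    using p by (intro smalI[OF u eventually_foot[OF smf_eventually_Rn[OF X] u] chart_at_atlas[OF p] chart_at_dom[OF p]]
        sm_foot[OF u] smf_comp_sm[OF X]) auto
qed

lemma smal_cong:
  assumes "\<forall>\<^sub>F u' in T.near u. s u' = t u'" "smal u s"
  shows "smal u t"
proof -
  have u: "u \<in> points T" using assms smal_points by blast
  have p: "foot u \<in> points A" by (rule foot_points[OF u])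
  show ?thesis
  proof (rule smalI[OF u _ chart_at_atlas[OF p] chart_at_dom[OF p]])
    show "\<forall>\<^sub>F u' in T.near u. t u' \<in> Rn (mdim A)"
      using assms(1) smal_eventually_Rn[OF assms(2)] by eventually_elim simp
    fix j assume j: "j < mdim A"
    have "\<forall>\<^sub>F u' in T.near u. comp_in A (chart_at A (foot u)) (foot u') (s u') j = comp_in A (chart_at A (foot u)) (foot u') (t u') j"
      using assms(1) by eventually_elim simp
    then show "T.sm u (\<lambda>u'. comp_in A (chart_at A (foot u)) (foot u') (t u') j)"
      by (rule T.sm_cong) (use smal_comp_sm[OF assms(2) _ _ j] p in simp)
  qed
qed

lemma smal_add:
  assumes "smal u s" "smal u t"
  shows "smal u (\<lambda>u'. s u' + t u')"
proof -
  have u: "u \<in> points T" using assms smal_points by blast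
  have p: "foot u \<in> points A" by (rule foot_points[OF u])
  show ?thesis
  proof (rule smalI[OF u _ chart_at_atlas[OF p] chart_at_dom[OF p]])
    show "\<forall>\<^sub>F u' in T.near u. s u' + t u' \<in> Rn (mdim A)"
      using smal_eventually_Rn[OF assms(1)] smal_eventually_Rn[OF assms(2)] by eventually_elim simp
    show "T.sm u (\<lambda>u'. comp_in A (chart_at A (foot u)) (foot u') (s u' + t u') j)" if "j < mdim A" for j
      using T.sm_add[OF smal_comp_sm[OF assms(1)] smal_comp_sm[OF assms(2)]] p that
      by (simp add: comp_in_add coord_simps)
  qed
qed

lemma smal_scale:
  assumes "T.sm u f" "smal u s"
  shows "smal u (\<lambda>u'. f u' \<cdot>\<^sub>c s u')"
proof -
  have u: "u \<in> points T" using assms smal_points by blast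
  have p: "foot u \<in> points A" by (rule foot_points[OF u])
  show ?thesis
  proof (rule smalI[OF u _ chart_at_atlas[OF p] chart_at_dom[OF p]])
    show "\<forall>\<^sub>F u' in T.near u. f u' \<cdot>\<^sub>c s u' \<in> Rn (mdim A)"
      using smal_eventually_Rn[OF assms(2)] by eventually_elim simp
    show "T.sm u (\<lambda>u'. comp_in A (chart_at A (foot u)) (foot u') (f u' \<cdot>\<^sub>c s u') j)" if "j < mdim A" for j
      using T.sm_mult[OF assms(1) smal_comp_sm[OF assms(2)]] p that
      by (simp add: comp_in_scale coord_simps)
  qed
qed

lemma smal_zero: "u \<in> points T \<Longrightarrow> smal u (\<lambda>u'. 0)"
  using smal_foot[OF _ smf_zero[OF foot_points]] by simp

lemma smal_sum: "u \<in> points T \<Longrightarrow> (\<And>a. a \<in> S \<Longrightarrow> smal u (s a)) \<Longrightarrow> smal u (\<lambda>u'. \<Sum>a\<in>S. s a u')"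
  by (induction S rule: infinite_finite_induct) (auto intro: smal_zero smal_add)

lemma smal_expand:
  assumes s: "smal u s" and c: "c \<in> atlas A" "foot u \<in> fst c"
  shows "\<forall>\<^sub>F u' in T.near u. s u' = (\<Sum>b<mdim A. comp_in A c (foot u') (s u') b \<cdot>\<^sub>c coord_field A c b (foot u'))"
  using smal_eventually_Rn[OF s] eventually_foot[OF eventually_near_chart[OF c] smal_points[OF s]]
  by eventually_elim (rule coord_field_expand[OF c(1)])

lemma smal_nab:
  assumes s: "smal u s" and X: "smf (foot u) X"
  shows "smal u (\<lambda>u'. nb (foot u') (s u') X)"
proof -
  have u: "u \<in> points T" using s smal_points by blast
  define c where "c = chart_at A (foot u)"
  have c: "c \<in> atlas A" "foot u \<in> fst c" using foot_points[OF u] by (auto simp: c_def)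
  have "smal u (\<lambda>u'. \<Sum>b<mdim A. comp_in A c (foot u') (s u') b \<cdot>\<^sub>c cov nb (coord_field A c b) X (foot u'))"
    using c by (intro smal_sum u smal_scale smal_comp_sm[OF s] smal_foot[OF u] cov_smf X smf_coord_field) auto
  moreover have "\<forall>\<^sub>F u' in T.near u. (\<Sum>b<mdim A. comp_in A c (foot u') (s u') b \<cdot>\<^sub>c cov nb (coord_field A c b) X (foot u'))
      = nb (foot u') (s u') X"
    using smal_expand[OF s c] eventually_foot[OF eventually_near_chart[OF c] u] eventually_foot[OF smf_eventually[OF X] u]
  proof eventually_elim
    case (elim u')
    have E: "coord_field A c b (foot u') \<in> Rn (mdim A)" if "b < mdim A" for b
      using coord_field_Rn[OF c(1) elim(2) that] .
    have "nb (foot u') (s u') X = nb (foot u') (\<Sum>b<mdim A. comp_in A c (foot u') (s u') b \<cdot>\<^sub>c coord_field A c b (foot u')) X"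
      using elim(1) by (rule arg_cong)
    also have "\<dots> = (\<Sum>b<mdim A. nb (foot u') (comp_in A c (foot u') (s u') b \<cdot>\<^sub>c coord_field A c b (foot u')) X)"
      by (rule nab_sum_vec[OF elim(3)]) (use E in auto)
    also have "\<dots> = (\<Sum>b<mdim A. comp_in A c (foot u') (s u') b \<cdot>\<^sub>c cov nb (coord_field A c b) X (foot u'))"
      unfolding cov_def by (intro sum.cong refl nab_scale_vec[OF elim(3)] E) simp
    finally show ?case by simp
  qed
  ultimately show ?thesis by (rule smal_cong[rotated])
qed

lemma dirder_tangent_yc:
  assumes "u \<in> points T" "w \<in> Rn (2 * mdim A)" "c \<in> atlas A" "foot u \<in> fst c" "j < mdim A"
  shows "dirder T u w (\<lambda>u'. yc c j u') = comp_in A c (foot u) (vpart A u w) j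
    - (\<Sum>k<mdim A. yc c k u * comp_in A c (foot u) (nb (foot u) (hpart A u w) (coord_field A c k)) j)"
proof -
  have "dirder T u w (\<lambda>u'. yc c j u') = dirder T u (hlift A u (hpart A u w) + vlift A u (vpart A u w)) (\<lambda>u'. yc c j u')"
    using hv_decomp[OF assms(1)] by simp
  then show ?thesis
    using dirder_hlift_yc[OF assms(1) hpart_Rn assms(3,4,5)] dirder_vlift_yc[OF assms(1) vpart_Rn[OF assms(1,2)] assms(3,4)]
    by (simp add: T.dirder_add_vec)
qed

text \<open>The splitting of tangent vectors into two parts is smooth, so a field on
  \<open>T\<close> amounts to a pair of smooth fields along the projection. Connection, metric and
  complex structure are all treated through this pair.\<close>

lemma T_smf_iff:
  assumes u: "u \<in> points T"
  shows "T.smf u Y \<longleftrightarrow> (\<forall>\<^sub>F u' in T.near u. Y u' \<in> Rn (2 * mdim A)) \<and>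
    smal u (\<lambda>u'. hpart A u' (Y u')) \<and> smal u (\<lambda>u'. vpart A u' (Y u'))"
proof -
  let ?n = "mdim A"
  define c where "c = chart_at A (foot u)"
  have c: "c \<in> atlas A" "foot u \<in> fst c" using foot_points[OF u] by (auto simp: c_def)
  have tcu: "tc c \<in> atlas T" "u \<in> fst (tc c)" using tc_atlas c u by (auto simp: dom_tc)
  \<comment> \<open>The correction between \<open>vpart\<close> and the fibre components in the
    tangent chart. It depends on the horizontal part only, whose smoothness is therefore settled
    first.\<close>
  define R where "R j u' = (\<Sum>k<?n. yc c k u' * comp_in A c (foot u') (nb (foot u') (hpart A u' (Y u')) (coord_field A c k)) j)" for j u'
  have Rsm: "T.sm u (R j)" if "smal u (\<lambda>u'. hpart A u' (Y u'))" "j < ?n" for j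
    unfolding R_def[abs_def] using c that(2)
    by (intro T.sm_sum T.sm_mult u yc_sm smal_comp_sm[OF smal_nab[OF that(1) smf_coord_field]]) auto
  have base: "\<forall>\<^sub>F u' in T.near u. comp_in T (tc c) u' (Y u') j = comp_in A c (foot u') (hpart A u' (Y u')) j"
    if "j < ?n" for j
    using T.eventually_near_points by eventually_elim (simp add: comp_in_tc_base that hpart_def)
  have fib: "\<forall>\<^sub>F u' in T.near u. comp_in T (tc c) u' (Y u') (j + ?n) = comp_in A c (foot u') (vpart A u' (Y u')) j - R j u'"
    if "j < ?n" "\<forall>\<^sub>F u' in T.near u. Y u' \<in> Rn (2 * ?n)" for j
    using T.eventually_near_points that(2) eventually_foot[OF eventually_near_chart[OF c] u]
    by eventually_elim (simp add: comp_in_tc_fibre R_def dirder_tangent_yc c(1) that(1))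
  show ?thesis
  proof (intro iffI conjI; (elim conjE)?)
    assume Y: "T.smf u Y"
    show YR: "\<forall>\<^sub>F u' in T.near u. Y u' \<in> Rn (2 * ?n)" using T.smf_eventually_Rn[OF Y] by simp
    show h: "smal u (\<lambda>u'. hpart A u' (Y u'))"
    proof (rule smalI[OF u _ c])
      fix j assume j: "j < ?n"
      show "T.sm u (\<lambda>u'. comp_in A c (foot u') (hpart A u' (Y u')) j)"
        by (rule T.sm_cong[OF base[OF j]]) (use T.smf_comp_sm[OF Y tcu] j in simp)
    qed (simp add: hpart_Rn)
    show "smal u (\<lambda>u'. vpart A u' (Y u'))"
    proof (rule smalI[OF u _ c])
      show "\<forall>\<^sub>F u' in T.near u. vpart A u' (Y u') \<in> Rn ?n"
        using YR T.eventually_near_points by eventually_elim (rule vpart_Rn)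
      fix j assume j: "j < ?n"
      have "T.sm u (\<lambda>u'. comp_in T (tc c) u' (Y u') (j + ?n) + R j u')"
        by (intro T.sm_add T.smf_comp_sm[OF Y tcu] Rsm[OF h j]) (use j in simp)
      moreover have "\<forall>\<^sub>F u' in T.near u. comp_in T (tc c) u' (Y u') (j + ?n) + R j u' = comp_in A c (foot u') (vpart A u' (Y u')) j"
        using fib[OF j YR] by eventually_elim simp
      ultimately show "T.sm u (\<lambda>u'. comp_in A c (foot u') (vpart A u' (Y u')) j)" by (rule T.sm_cong[rotated])
    qed
  next
    assume YR: "\<forall>\<^sub>F u' in T.near u. Y u' \<in> Rn (2 * ?n)" and h: "smal u (\<lambda>u'. hpart A u' (Y u'))"
      and v: "smal u (\<lambda>u'. vpart A u' (Y u'))"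
    show "T.smf u Y"
    proof (rule T.smfI[OF tcu])
      show "\<forall>\<^sub>F u' in T.near u. Y u' \<in> Rn (mdim T)" using YR by simp
      fix j assume j: "j < mdim T"
      show "T.sm u (\<lambda>u'. comp_in T (tc c) u' (Y u') j)"
      proof (cases "j < ?n")
        case True
        have "\<forall>\<^sub>F u' in T.near u. comp_in A c (foot u') (hpart A u' (Y u')) j = comp_in T (tc c) u' (Y u') j"
          using base[OF True] by eventually_elim simp
        then show ?thesis by (rule T.sm_cong) (rule smal_comp_sm[OF h c True])
      next
        case False
        define i where "i = j - ?n"
        have i: "i < ?n" "j = i + ?n" using False j by (auto simp: i_def)
        have "\<forall>\<^sub>F u' in T.near u. comp_in A c (foot u') (vpart A u' (Y u')) i - R i u' = comp_in T (tc c) u' (Y u') j"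
          using fib[OF i(1) YR] unfolding i(2) by eventually_elim simp
        then show ?thesis by (rule T.sm_cong) (intro T.sm_diff smal_comp_sm[OF v c i(1)] Rsm[OF h i(1)])
      qed
    qed
  qed
qed

lemma smf_hlift:
  assumes s: "smal u s"
  shows "T.smf u (\<lambda>u'. hlift A u' (s u'))"
proof -
  have u: "u \<in> points T" using s smal_points by blast
  have "\<forall>\<^sub>F u' in T.near u. hlift A u' (s u') \<in> Rn (2 * mdim A)"
    using smal_eventually_Rn[OF s] T.eventually_near_points by eventually_elim (rule hlift_Rn)
  moreover have "smal u (\<lambda>u'. hpart A u' (hlift A u' (s u')))"
    by (rule smal_cong[OF _ s], rule eventually_mono[OF smal_eventually_Rn[OF s]]) (simp add: hpart_hlift)
  moreover have "smal u (\<lambda>u'. vpart A u' (hlift A u' (s u')))"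
    by (rule smal_cong[OF _ smal_zero[OF u]], rule eventually_mono[OF smal_eventually_Rn[OF s]]) (simp add: vpart_hlift)
  ultimately show ?thesis unfolding T_smf_iff[OF u] by blast
qed

lemma smf_vlift:
  assumes s: "smal u s"
  shows "T.smf u (\<lambda>u'. vlift A u' (s u'))"
proof -
  have u: "u \<in> points T" using s smal_points by blast
  have "\<forall>\<^sub>F u' in T.near u. vlift A u' (s u') \<in> Rn (2 * mdim A)"
    using smal_eventually_Rn[OF s] by eventually_elim (rule vlift_Rn)
  moreover have "smal u (\<lambda>u'. hpart A u' (vlift A u' (s u')))"
    using smal_zero[OF u] by (simp add: hpart_vlift)
  moreover have "smal u (\<lambda>u'. vpart A u' (vlift A u' (s u')))"
    by (rule smal_cong[OF _ s], rule eventually_mono[OF T.eventually_near_points]) (simp add: vpart_vlift)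
  ultimately show ?thesis unfolding T_smf_iff[OF u] by blast
qed

lemma smf_hor: "u \<in> points T \<Longrightarrow> smf (foot u) X \<Longrightarrow> T.smf u (hor A X)"
  unfolding hor_def by (intro smf_hlift smal_foot)

lemma smf_ver: "u \<in> points T \<Longrightarrow> smf (foot u) X \<Longrightarrow> T.smf u (ver A X)"
  unfolding ver_def by (intro smf_vlift smal_foot)

lemma smal_inner:
  assumes s: "smal u s" and t: "smal u t"
  shows "T.sm u (\<lambda>u'. met A (foot u') (s u') (t u'))"
proof -
  have u: "u \<in> points T" using s smal_points by blast
  define c where "c = chart_at A (foot u)"
  have c: "c \<in> atlas A" "foot u \<in> fst c" using foot_points[OF u] by (auto simp: c_def)
  let ?E = "coord_field A c"
  have "T.sm u (\<lambda>u'. \<Sum>a<mdim A. \<Sum>b<mdim A. comp_in A c (foot u') (s u') a * (comp_in A c (foot u') (t u') b * met A (foot u') (?E a (foot u')) (?E b (foot u'))))"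
    using c by (intro T.sm_sum T.sm_mult u smal_comp_sm s t sm_foot[OF u] g_sm smf_coord_field) auto
  moreover have "\<forall>\<^sub>F u' in T.near u. (\<Sum>a<mdim A. \<Sum>b<mdim A. comp_in A c (foot u') (s u') a * (comp_in A c (foot u') (t u') b * met A (foot u') (?E a (foot u')) (?E b (foot u'))))
      = met A (foot u') (s u') (t u')"
    using smal_expand[OF s c] smal_expand[OF t c] eventually_foot[OF eventually_near_chart[OF c] u] T.eventually_near_points
      smal_eventually_Rn[OF t]
  proof eventually_elim
    case (elim u')
    interpret I: inner_product_on "mdim A" "met A (foot u')" by (rule inner[OF foot_points[OF elim(4)]])
    have E: "?E b (foot u') \<in> Rn (mdim A)" if "b < mdim A" for b using coord_field_Rn[OF c(1) elim(3) that] .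
    have "met A (foot u') (s u') (t u') = met A (foot u') (\<Sum>a<mdim A. comp_in A c (foot u') (s u') a \<cdot>\<^sub>c ?E a (foot u')) (t u')"
      using elim(1) by (rule arg_cong)
    also have "\<dots> = (\<Sum>a<mdim A. comp_in A c (foot u') (s u') a * met A (foot u') (?E a (foot u')) (t u'))"
      using E elim(5) by (subst I.sum_left) (auto simp: I.scale_left)
    also have "\<dots> = (\<Sum>a<mdim A. comp_in A c (foot u') (s u') a * (\<Sum>b<mdim A. comp_in A c (foot u') (t u') b * met A (foot u') (?E a (foot u')) (?E b (foot u'))))"
    proof (intro sum.cong refl arg_cong2[where f="(*)"])
      fix a assume a: "a \<in> {..<mdim A}"
      have "met A (foot u') (?E a (foot u')) (t u') = met A (foot u') (?E a (foot u')) (\<Sum>b<mdim A. comp_in A c (foot u') (t u') b \<cdot>\<^sub>c ?E b (foot u'))"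
        using elim(2) by (rule arg_cong)
      also have "\<dots> = (\<Sum>b<mdim A. comp_in A c (foot u') (t u') b * met A (foot u') (?E a (foot u')) (?E b (foot u')))"
        using E a by (subst I.sum_right) (auto simp: I.scale_right)
      finally show "met A (foot u') (?E a (foot u')) (t u') = (\<Sum>b<mdim A. comp_in A c (foot u') (t u') b * met A (foot u') (?E a (foot u')) (?E b (foot u')))" .
    qed
    finally show ?case by (simp add: sum_distrib_left)
  qed
  ultimately show ?thesis by (rule T.sm_cong[rotated])
qed

end

section \<open>The connection and the metric of the tangent bundle\<close>

context tangent_bundle
begin

text \<open>The pullback of \<open>\<nabla>\<close> along the projection; \<open>s\<close> is a vector field along the projection.\<close>

definition pull_nab :: "'a itpoint \<Rightarrow> coord \<Rightarrow> ('a itpoint \<Rightarrow> coord) \<Rightarrow> coord" where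
  "pull_nab u w s = (\<Sum>b<mdim A.
     dirder T u w (\<lambda>u'. comp_in A (chart_at A (foot u)) (foot u') (s u') b) \<cdot>\<^sub>c unit_coord b
     + s u b \<cdot>\<^sub>c nb (foot u) (hpart A u w) (coord_field A (chart_at A (foot u)) b))"

lemma frame_smf: "p \<in> points A \<Longrightarrow> b < mdim A \<Longrightarrow> smf p (coord_field A (chart_at A p) b)"
  by (intro smf_coord_field) auto

lemma pull_nab_Rn:
  assumes u: "u \<in> points T"
  shows "pull_nab u w s \<in> Rn (mdim A)"
  unfolding pull_nab_def
  by (intro Rn_sum Rn_closed unit_coord_Rn nab_Rn[OF frame_smf[OF foot_points[OF u]] hpart_Rn]) auto

lemma pull_nab_lin:
  assumes u: "u \<in> points T"
  shows "pull_nab u (a \<cdot>\<^sub>c v + b \<cdot>\<^sub>c w) s = a \<cdot>\<^sub>c pull_nab u v s + b \<cdot>\<^sub>c pull_nab u w s"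
  unfolding pull_nab_def
  using nab_lin[OF frame_smf[OF foot_points[OF u]] hpart_Rn hpart_Rn]
  by (simp add: hpart_lin T.dirder_lin fun_eq_iff coord_simps sum_distrib_left sum.distrib[symmetric] algebra_simps)

lemma pull_nab_add:
  assumes s: "smal u s" and t: "smal u t"
  shows "pull_nab u w (\<lambda>u'. s u' + t u') = pull_nab u w s + pull_nab u w t"
proof -
  have u: "u \<in> points T" using s smal_points by blast
  have p: "foot u \<in> points A" by (rule foot_points[OF u])
  show ?thesis
    using T.dirder_add[OF smal_comp_sm[OF s] smal_comp_sm[OF t]] p
    by (simp add: pull_nab_def comp_in_add fun_eq_iff coord_simps sum.distrib[symmetric] algebra_simps)
qed

lemma pull_nab_leibniz:
  assumes f: "T.sm u f" and s: "smal u s"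
  shows "pull_nab u w (\<lambda>u'. f u' \<cdot>\<^sub>c s u') = dirder T u w f \<cdot>\<^sub>c s u + f u \<cdot>\<^sub>c pull_nab u w s"
proof -
  have u: "u \<in> points T" using s smal_points by blast
  let ?c = "chart_at A (foot u)"
  have p: "foot u \<in> points A" by (rule foot_points[OF u])
  have "pull_nab u w (\<lambda>u'. f u' \<cdot>\<^sub>c s u') = (\<Sum>b<mdim A. (dirder T u w f * s u b) \<cdot>\<^sub>c unit_coord b) + f u \<cdot>\<^sub>c pull_nab u w s"
    using T.dirder_mult[OF f smal_comp_sm[OF s]] p comp_in_self[OF p smal_Rn[OF s]]
    by (simp add: pull_nab_def comp_in_scale fun_eq_iff coord_simps sum_distrib_left sum.distrib[symmetric] algebra_simps)
  also have "(\<Sum>b<mdim A. (dirder T u w f * s u b) \<cdot>\<^sub>c unit_coord b) = dirder T u w f \<cdot>\<^sub>c (\<Sum>b<mdim A. s u b \<cdot>\<^sub>c unit_coord b)"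
    by (simp add: cv.scale_sum_right)
  finally show ?thesis using Rn_expand[OF smal_Rn[OF s]] by simp
qed

lemma pull_nab_cong:
  assumes u: "u \<in> points T" and eq: "\<forall>\<^sub>F u' in T.near u. s u' = t u'"
  shows "pull_nab u w s = pull_nab u w t"
proof -
  have "\<forall>\<^sub>F u' in T.near u. comp_in A (chart_at A (foot u)) (foot u') (s u') b = comp_in A (chart_at A (foot u)) (foot u') (t u') b" for b
    using eq by eventually_elim simp
  then have "dirder T u w (\<lambda>u'. comp_in A (chart_at A (foot u)) (foot u') (s u') b)
     = dirder T u w (\<lambda>u'. comp_in A (chart_at A (foot u)) (foot u') (t u') b)" for b
    by (rule T.dirder_cong[OF u])
  moreover have "s u = t u" by (rule T.eventually_nearD[OF eq u])
  ultimately show ?thesis by (simp add: pull_nab_def)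
qed

lemma pull_nab_zero: "pull_nab u w (\<lambda>u'. 0) = 0"
  by (simp add: pull_nab_def coord_simps)

text \<open>On pulled back fields the defining formula collapses to the expansion of \<nabla> in the
  preferred chart. Together with the Leibniz rule this permits evaluating \<open>pull_nab\<close> in
  any other chart.\<close>

lemma pull_nab_foot:
  assumes u: "u \<in> points T" and X: "smf (foot u) X"
  shows "pull_nab u w (\<lambda>u'. X (foot u')) = nb (foot u) (hpart A u w) X"
proof -
  have p: "foot u \<in> points A" by (rule foot_points[OF u])
  show ?thesis
    using nab_expand[OF X hpart_Rn chart_at_atlas[OF p] chart_at_dom[OF p]]
      comp_in_self[OF p smf_Rn[OF X]] coord_field_self[OF p]
      dirder_foot[OF u, of w "\<lambda>q. comp_in A (chart_at A (foot u)) q (X q) _"]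
    by (simp add: pull_nab_def hpart_def)
qed

lemma pull_nab_sum:
  assumes u: "u \<in> points T" and "\<And>a. a \<in> S \<Longrightarrow> smal u (s a)" "\<And>a. a \<in> S \<Longrightarrow> T.sm u (f a)"
  shows "pull_nab u w (\<lambda>u'. \<Sum>a\<in>S. f a u' \<cdot>\<^sub>c s a u')
    = (\<Sum>a\<in>S. dirder T u w (f a) \<cdot>\<^sub>c s a u + f a u \<cdot>\<^sub>c pull_nab u w (s a))"
  using assms(2,3)
proof (induction S rule: infinite_finite_induct)
  case (insert a S)
  have "pull_nab u w (\<lambda>u'. \<Sum>a\<in>insert a S. f a u' \<cdot>\<^sub>c s a u')
      = pull_nab u w (\<lambda>u'. f a u' \<cdot>\<^sub>c s a u' + (\<Sum>a\<in>S. f a u' \<cdot>\<^sub>c s a u'))"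
    using insert by simp
  also have "\<dots> = pull_nab u w (\<lambda>u'. f a u' \<cdot>\<^sub>c s a u') + pull_nab u w (\<lambda>u'. \<Sum>a\<in>S. f a u' \<cdot>\<^sub>c s a u')"
    using insert u by (intro pull_nab_add smal_sum smal_scale) auto
  also have "\<dots> = (\<Sum>a\<in>insert a S. dirder T u w (f a) \<cdot>\<^sub>c s a u + f a u \<cdot>\<^sub>c pull_nab u w (s a))"
    using insert pull_nab_leibniz by simp
  finally show ?case .
qed (simp_all add: pull_nab_zero)

text \<open>\<open>pull_nab\<close> is defined through the preferred chart at each point, so its
  smoothness becomes visible only after expanding the section in one fixed chart.\<close>

lemma pull_nab_smal:
  assumes Z: "T.smf u Z" and s: "smal u s"
  shows "smal u (\<lambda>u'. pull_nab u' (Z u') s)"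
proof -
  have u: "u \<in> points T" using s smal_points by blast
  define c where "c = chart_at A (foot u)"
  have c: "c \<in> atlas A" "foot u \<in> fst c" using foot_points[OF u] by (auto simp: c_def)
  let ?E = "coord_field A c"
  define \<sigma> where "\<sigma> b u' = comp_in A c (foot u') (s u') b" for b u'
  have \<sigma>: "T.sm u (\<sigma> b)" if "b < mdim A" for b
    unfolding \<sigma>_def[abs_def] by (rule smal_comp_sm[OF s c that])
  have h: "smal u (\<lambda>u'. hpart A u' (Z u'))" using Z T_smf_iff[OF u] by blast
  have "smal u (\<lambda>u'. \<Sum>b<mdim A. dirder T u' (Z u') (\<sigma> b) \<cdot>\<^sub>c ?E b (foot u') + \<sigma> b u' \<cdot>\<^sub>c nb (foot u') (hpart A u' (Z u')) (?E b))"
    using c by (intro smal_sum u smal_add smal_scale T.dirder_sm Z \<sigma> smal_foot[OF u] smal_nab[OF h] smf_coord_field) auto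
  moreover have "\<forall>\<^sub>F u' in T.near u. (\<Sum>b<mdim A. dirder T u' (Z u') (\<sigma> b) \<cdot>\<^sub>c ?E b (foot u') + \<sigma> b u' \<cdot>\<^sub>c nb (foot u') (hpart A u' (Z u')) (?E b))
      = pull_nab u' (Z u') s"
    using smal_eventually[OF s] eventually_foot[OF eventually_near_chart[OF c] u]
  proof eventually_elim
    case (elim u')
    have u': "u' \<in> points T" using elim(1) smal_points by blast
    have E: "smf (foot u') (?E b)" if "b < mdim A" for b using c(1) elim(2) that by (intro smf_coord_field)
    have "pull_nab u' (Z u') s = pull_nab u' (Z u') (\<lambda>u'. \<Sum>b<mdim A. \<sigma> b u' \<cdot>\<^sub>c ?E b (foot u'))"
      unfolding \<sigma>_def by (rule pull_nab_cong[OF u' smal_expand[OF elim(1) c(1) elim(2)]])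
    also have "\<dots> = (\<Sum>b<mdim A. dirder T u' (Z u') (\<sigma> b) \<cdot>\<^sub>c ?E b (foot u') + \<sigma> b u' \<cdot>\<^sub>c pull_nab u' (Z u') (\<lambda>u'. ?E b (foot u')))"
      by (rule pull_nab_sum[OF u'])
         (auto intro!: smal_foot[OF u'] E smal_comp_sm[OF elim(1) c(1) elim(2)] simp: \<sigma>_def[abs_def])
    finally show ?case using pull_nab_foot[OF u' E] by simp
  qed
  ultimately show ?thesis by (rule smal_cong[rotated])
qed

text \<open>Without a witness the choice in \<open>tangent_nabla\<close> would say nothing. The
  witness has the prescribed values because one part of a lift is zero and the other is pulled back
  from the base, where \<open>pull_nab\<close> sees only the horizontal part of the
  direction.\<close>

lemma tangent_nabla_exists:
  "\<exists>nab. is_connection (tangent_manifold A) nab \<and>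
     (\<forall>W X Y. openin (mtop A) W \<longrightarrow> smooth_field A W X \<longrightarrow> smooth_field A W Y \<longrightarrow>
        (\<forall>u\<in>points (tangent_manifold A). foot u \<in> W \<longrightarrow>
           cov nab (hor A X) (hor A Y) u = hor A (cov (nabla A) X Y) u \<and>
           cov nab (hor A X) (ver A Y) u = ver A (cov (nabla A) X Y) u \<and>
           cov nab (ver A X) (hor A Y) u = 0 \<and>
           cov nab (ver A X) (ver A Y) u = 0))"
proof (intro exI conjI allI impI ballI)
  define nab where "nab u w Y = hlift A u (pull_nab u w (\<lambda>u'. hpart A u' (Y u')))
    + vlift A u (pull_nab u w (\<lambda>u'. vpart A u' (Y u')))" for u w and Y :: "'a itpoint \<Rightarrow> coord"
  have "is_connection T nab"
  proof (rule T.is_connectionI)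
    fix u v w a b and Y Z :: "'a itpoint \<Rightarrow> coord" and f :: "'a itpoint \<Rightarrow> real"
    assume Y: "T.smf u Y" and v: "v \<in> Rn (mdim T)"
    have u: "u \<in> points T" using Y T.smf_points by blast
    note hY = conjunct1[OF conjunct2[OF iffD1[OF T_smf_iff[OF u] Y]]]
      and vY = conjunct2[OF conjunct2[OF iffD1[OF T_smf_iff[OF u] Y]]]
    note R = pull_nab_Rn[OF u]
    show "nab u v Y \<in> Rn (mdim T)"
      using hlift_Rn[OF u R] vlift_Rn[OF R] by (simp add: nab_def)
    show "nab u (a \<cdot>\<^sub>c v + b \<cdot>\<^sub>c w) Y = a \<cdot>\<^sub>c nab u v Y + b \<cdot>\<^sub>c nab u w Y"
      using u R by (simp add: nab_def pull_nab_lin hlift_lin vlift_lin cv.scale_right_distrib)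
    show "nab u v (Y + Z) = nab u v Y + nab u v Z" if Z: "T.smf u Z"
    proof -
      note hZ = conjunct1[OF conjunct2[OF iffD1[OF T_smf_iff[OF u] Z]]]
        and vZ = conjunct2[OF conjunct2[OF iffD1[OF T_smf_iff[OF u] Z]]]
      have "pull_nab u v (\<lambda>u'. hpart A u' ((Y + Z) u')) = pull_nab u v (\<lambda>u'. hpart A u' (Y u') + hpart A u' (Z u'))"
        by (rule pull_nab_cong[OF u], rule always_eventually) (simp add: plus_fun_apply hpart_add)
      moreover have "pull_nab u v (\<lambda>u'. vpart A u' ((Y + Z) u')) = pull_nab u v (\<lambda>u'. vpart A u' (Y u') + vpart A u' (Z u'))"
        by (rule pull_nab_cong[OF u], rule eventually_mono[OF T.eventually_near_points]) (simp add: plus_fun_apply vpart_add)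
      ultimately show ?thesis
        using u R pull_nab_add[OF hY hZ] pull_nab_add[OF vY vZ] by (simp add: nab_def hlift_add vlift_add)
    qed
    show "nab u v (\<lambda>q. f q \<cdot>\<^sub>c Y q) = dirder T u v f \<cdot>\<^sub>c Y u + f u \<cdot>\<^sub>c nab u v Y" if f: "T.sm u f"
    proof -
      have "pull_nab u v (\<lambda>u'. hpart A u' (f u' \<cdot>\<^sub>c Y u')) = dirder T u v f \<cdot>\<^sub>c hpart A u (Y u) + f u \<cdot>\<^sub>c pull_nab u v (\<lambda>u'. hpart A u' (Y u'))"
        using pull_nab_leibniz[OF f hY] by (simp add: hpart_scale)
      moreover have "pull_nab u v (\<lambda>u'. vpart A u' (f u' \<cdot>\<^sub>c Y u')) = pull_nab u v (\<lambda>u'. f u' \<cdot>\<^sub>c vpart A u' (Y u'))"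
        by (rule pull_nab_cong[OF u], rule eventually_mono[OF T.eventually_near_points]) (simp add: vpart_scale)
      ultimately have "nab u v (\<lambda>q. f q \<cdot>\<^sub>c Y q)
          = dirder T u v f \<cdot>\<^sub>c (hlift A u (hpart A u (Y u)) + vlift A u (vpart A u (Y u))) + f u \<cdot>\<^sub>c nab u v Y"
        using u R pull_nab_leibniz[OF f vY]
        by (simp add: nab_def hlift_lin vlift_lin hpart_Rn cv.scale_right_distrib algebra_simps)
      then show ?thesis using hv_decomp[OF u] by simp
    qed
  next
    fix u X Y assume X: "T.smf u X" and Y: "T.smf u Y"
    have u: "u \<in> points T" using Y T.smf_points by blast
    note hY = conjunct1[OF conjunct2[OF iffD1[OF T_smf_iff[OF u] Y]]]
      and vY = conjunct2[OF conjunct2[OF iffD1[OF T_smf_iff[OF u] Y]]]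
    show "T.smf u (cov nab X Y)"
      unfolding cov_def nab_def
      by (intro T.smf_add smf_hlift smf_vlift pull_nab_smal X hY vY)
  qed
  \<comment> \<open>\<open>tangent A\<close> and \<open>tangent_manifold A\<close> are records of
    different types with the same manifold fields, and the notions unfolded here depend on these
    fields only.\<close>
  then show "is_connection (tangent_manifold A) nab"
    unfolding is_connection_def smooth_field_at_def smooth_field_def smooth_fun_at_def smooth_fun_def
      mtop_def comp_in_def[abs_def] dirder_def[abs_def] by (simp add: tangent_def)
  fix W X Y u
  assume W: "openin (mtop A) W" and X: "smooth_field A W X" and Y: "smooth_field A W Y"
    and "u \<in> points (tangent_manifold A)" and uW: "foot u \<in> W"
  then have u: "u \<in> points T" by (simp add: tangent_def)
  have X': "smf (foot u) X" and Y': "smf (foot u) Y"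
    using W X Y uW unfolding smooth_field_at_def by blast+
  note XR = smf_Rn[OF X'] and YR = smf_Rn[OF Y'] and evY = eventually_foot[OF smf_eventually_Rn[OF Y'] u]
  have hh: "pull_nab u w (\<lambda>u'. hpart A u' (hor A Y u')) = nb (foot u) (hpart A u w) Y" for w
  proof -
    have "\<forall>\<^sub>F u' in T.near u. hpart A u' (hor A Y u') = Y (foot u')"
      using evY by eventually_elim (simp add: hor_def hpart_hlift)
    then show ?thesis using pull_nab_cong[OF u] pull_nab_foot[OF u Y'] by simp
  qed
  have vh: "pull_nab u w (\<lambda>u'. vpart A u' (hor A Y u')) = 0" for w
  proof -
    have "\<forall>\<^sub>F u' in T.near u. vpart A u' (hor A Y u') = 0"
      using evY by eventually_elim (simp add: hor_def vpart_hlift)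
    then show ?thesis using pull_nab_cong[OF u] pull_nab_zero by simp
  qed
  have hv: "pull_nab u w (\<lambda>u'. hpart A u' (ver A Y u')) = 0" for w
    using pull_nab_zero by (simp add: ver_def hpart_vlift)
  have vv: "pull_nab u w (\<lambda>u'. vpart A u' (ver A Y u')) = nb (foot u) (hpart A u w) Y" for w
  proof -
    have "\<forall>\<^sub>F u' in T.near u. vpart A u' (ver A Y u') = Y (foot u')"
      using T.eventually_near_points by eventually_elim (simp add: ver_def vpart_vlift)
    then show ?thesis using pull_nab_cong[OF u] pull_nab_foot[OF u Y'] by simp
  qed
  show "cov nab (hor A X) (hor A Y) u = hor A (cov (nabla A) X Y) u"
    unfolding cov_def nab_def hh vh by (simp add: hor_def hpart_hlift[OF XR] vlift_zero)
  show "cov nab (hor A X) (ver A Y) u = ver A (cov (nabla A) X Y) u"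
    unfolding cov_def nab_def hv vv by (simp add: hor_def ver_def hpart_hlift[OF XR] hlift_zero[OF u])
  show "cov nab (ver A X) (hor A Y) u = 0"
    unfolding cov_def nab_def hh vh by (simp add: ver_def hpart_vlift vlift_zero hlift_zero[OF u] nab_zero_vec[OF Y'])
  show "cov nab (ver A X) (ver A Y) u = 0"
    unfolding cov_def nab_def hv vv by (simp add: ver_def hpart_vlift vlift_zero hlift_zero[OF u] nab_zero_vec[OF Y'])
qed

abbreviation "nb1 \<equiv> tangent_nabla A"

lemma nb1_spec: "is_connection (tangent_manifold A) nb1 \<and>
     (\<forall>W X Y. openin (mtop A) W \<longrightarrow> smooth_field A W X \<longrightarrow> smooth_field A W Y \<longrightarrow>
        (\<forall>u\<in>points (tangent_manifold A). foot u \<in> W \<longrightarrow>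
           cov nb1 (hor A X) (hor A Y) u = hor A (cov (nabla A) X Y) u \<and>
           cov nb1 (hor A X) (ver A Y) u = ver A (cov (nabla A) X Y) u \<and>
           cov nb1 (ver A X) (hor A Y) u = 0 \<and>
           cov nb1 (ver A X) (ver A Y) u = 0))"
  unfolding tangent_nabla_def by (rule someI_ex[OF tangent_nabla_exists])

lemma nb1_connection: "is_connection T nb1"
  using conjunct1[OF nb1_spec]
  unfolding is_connection_def smooth_field_at_def smooth_field_def smooth_fun_at_def smooth_fun_def
    mtop_def comp_in_def[abs_def] dirder_def[abs_def] by (simp add: tangent_def)

sublocale T: connection_on "tangent A" "tangent_nabla A"
  by unfold_locales (rule nb1_connection)

text \<open>The specification of \<open>nb1\<close> covers derivatives of lifts along lifts. Any
  direction is the value at \<open>u\<close> of a horizontal plus a vertical lift, and linearity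
  does the rest.\<close>

lemma nb1_lifts:
  assumes u: "u \<in> points T" and w: "w \<in> Rn (2 * mdim A)" and Y: "smf (foot u) Y"
  shows nb1_hor: "nb1 u w (hor A Y) = hlift A u (nb (foot u) (hpart A u w) Y)"
    and nb1_ver: "nb1 u w (ver A Y) = vlift A u (nb (foot u) (hpart A u w) Y)"
proof -
  have p: "foot u \<in> points A" by (rule foot_points[OF u])
  have u': "u \<in> points (tangent_manifold A)" using u by (simp add: tangent_def)
  note hR = hpart_Rn[of u w] and vR = vpart_Rn[OF u w]
  define H where "H = const_ext (foot u) (hpart A u w)"
  define V where "V = const_ext (foot u) (vpart A u w)"
  have H: "smf (foot u) H" "H (foot u) = hpart A u w" and V: "smf (foot u) V" "V (foot u) = vpart A u w"
    unfolding H_def V_def using smf_const_ext[OF p] const_ext_self[OF p] hR vR by auto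
  obtain W where W: "openin (mtop A) W" "foot u \<in> W" "smooth_field A W H" "smooth_field A W V" "smooth_field A W Y"
    using common_domain[OF H(1) V(1) Y] by metis
  note sH = conjunct2[OF nb1_spec, rule_format, OF W(1,3,5) u' W(2)]
    and sV = conjunct2[OF nb1_spec, rule_format, OF W(1,4,5) u' W(2)]
  have eq: "w = hor A H u + ver A V u" using hv_decomp[OF u, of w] H(2) V(2) by (simp add: hor_def ver_def)
  have R: "hor A H u \<in> Rn (mdim T)" "ver A V u \<in> Rn (mdim T)"
    using hlift_Rn[OF u hR] vlift_Rn[OF vR] H(2) V(2) by (auto simp: hor_def ver_def)
  have "nb1 u w (hor A Y) = cov nb1 (hor A H) (hor A Y) u + cov nb1 (ver A V) (hor A Y) u"
    unfolding cov_def by (subst eq) (rule T.nab_add_vec[OF smf_hor[OF u Y] R])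
  also have "\<dots> = hor A (cov nb H Y) u" using sH sV by simp
  finally show "nb1 u w (hor A Y) = hlift A u (nb (foot u) (hpart A u w) Y)"
    using H(2) by (simp add: hor_def cov_def)
  have "nb1 u w (ver A Y) = cov nb1 (hor A H) (ver A Y) u + cov nb1 (ver A V) (ver A Y) u"
    unfolding cov_def by (subst eq) (rule T.nab_add_vec[OF smf_ver[OF u Y] R])
  also have "\<dots> = ver A (cov nb H Y) u" using sH sV by simp
  finally show "nb1 u w (ver A Y) = vlift A u (nb (foot u) (hpart A u w) Y)"
    using H(2) by (simp add: ver_def cov_def)
qed

text \<open>The frame on which torsion and curvature are tested. Lifting coordinate fields is
  convenient because these commute on the base.\<close>

definition lift_frame :: "'a itpoint \<Rightarrow> bool \<times> nat \<Rightarrow> 'a itpoint \<Rightarrow> coord" where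
  "lift_frame u i = (if fst i then hor A (coord_field A (chart_at A (foot u)) (snd i))
     else ver A (coord_field A (chart_at A (foot u)) (snd i)))"

lemma lift_frame_smf:
  assumes u: "u \<in> points T" and i: "i \<in> UNIV \<times> {..<mdim A}"
  shows "T.smf u (lift_frame u i)"
  using i smf_hor[OF u frame_smf[OF foot_points[OF u]]] smf_ver[OF u frame_smf[OF foot_points[OF u]]]
  by (auto simp: lift_frame_def)

lemma lift_frame_span:
  assumes u: "u \<in> points T" and w: "w \<in> Rn (2 * mdim A)"
  shows "\<exists>r. w = (\<Sum>i\<in>UNIV \<times> {..<mdim A}. r i \<cdot>\<^sub>c lift_frame u i u)"
proof
  let ?r = "\<lambda>i. (if fst i then hpart A u w else vpart A u w) (snd i)"
  have p: "foot u \<in> points A" by (rule foot_points[OF u])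
  have "(\<Sum>i\<in>UNIV \<times> {..<mdim A}. ?r i \<cdot>\<^sub>c lift_frame u i u)
      = (\<Sum>a<mdim A. hpart A u w a \<cdot>\<^sub>c hlift A u (unit_coord a)) + (\<Sum>a<mdim A. vpart A u w a \<cdot>\<^sub>c vlift A u (unit_coord a))"
    using coord_field_self[OF p] by (simp add: sum_bool_times lift_frame_def hor_def ver_def)
  also have "\<dots> = hlift A u (\<Sum>a<mdim A. hpart A u w a \<cdot>\<^sub>c unit_coord a) + vlift A u (\<Sum>a<mdim A. vpart A u w a \<cdot>\<^sub>c unit_coord a)"
    using u by (subst hlift_sum[OF u]) (auto intro!: Rn_closed unit_coord_Rn simp: vlift_sum hlift_scale vlift_scale)
  also have "\<dots> = hlift A u (hpart A u w) + vlift A u (vpart A u w)"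
    using Rn_expand[OF hpart_Rn[of u w]] Rn_expand[OF vpart_Rn[OF u w]] by simp
  finally show "w = (\<Sum>i\<in>UNIV \<times> {..<mdim A}. ?r i \<cdot>\<^sub>c lift_frame u i u)" using hv_decomp[OF u] by simp
qed

subsection \<open>Brackets of lifts\<close>

lemma tangent_T_eqI:
  assumes u: "u \<in> points T" and vw: "v \<in> Rn (2 * mdim A)" "w \<in> Rn (2 * mdim A)"
    and base: "\<And>j. j < mdim A \<Longrightarrow> dirder T u v (\<lambda>u'. snd (chart_at A (foot u)) (foot u') j)
      = dirder T u w (\<lambda>u'. snd (chart_at A (foot u)) (foot u') j)"
    and fib: "\<And>j. j < mdim A \<Longrightarrow> dirder T u v (\<lambda>u'. yc (chart_at A (foot u)) j u')
      = dirder T u w (\<lambda>u'. yc (chart_at A (foot u)) j u')"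
  shows "v = w"
proof (rule T.tangent_eqI[OF u])
  fix j assume j: "j < mdim T"
  let ?c = "chart_at A (foot u)"
  show "dirder T u v (\<lambda>q. snd (chart_at T u) q j) = dirder T u w (\<lambda>q. snd (chart_at T u) q j)"
  proof (cases "j < mdim A")
    case True
    then show ?thesis using base[OF True] by (simp add: chart_at_tangent snd_tc join_def)
  next
    case False
    define i where "i = j - mdim A"
    have i: "i < mdim A" "j = i + mdim A" using False j by (auto simp: i_def)
    show ?thesis unfolding i(2) chart_at_tangent yc_eq by (rule fib[OF i(1)])
  qed
qed (use vw in auto)

lemma dirder_hor_foot:
  assumes u: "u \<in> points T" and X: "smf (foot u) X"
  shows "\<forall>\<^sub>F u' in T.near u. dirder T u' (hor A X u') (\<lambda>u'. f (foot u')) = dirder A (foot u') (X (foot u')) f"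
  using T.eventually_near_points eventually_foot[OF smf_eventually_Rn[OF X] u]
  by eventually_elim (simp add: hor_def dirder_hlift_foot)

lemma dirder_ver_foot:
  "\<forall>\<^sub>F u' in T.near u. dirder T u' (ver A X u') (\<lambda>u'. f (foot u')) = 0"
  using T.eventually_near_points by eventually_elim (simp add: ver_def dirder_vlift_foot)

lemma dirder_ver_yc:
  assumes u: "u \<in> points T" and X: "smf (foot u) X" and c: "c \<in> atlas A" "foot u \<in> fst c"
  shows "\<forall>\<^sub>F u' in T.near u. dirder T u' (ver A X u') (\<lambda>u'. yc c j u') = comp_in A c (foot u') (X (foot u')) j"
  using T.eventually_near_points eventually_foot[OF smf_eventually_Rn[OF X] u] eventually_foot[OF eventually_near_chart[OF c] u]
  by eventually_elim (simp add: ver_def dirder_vlift_yc c(1))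

lemma dirder_hor_yc:
  assumes u: "u \<in> points T" and X: "smf (foot u) X" and c: "c \<in> atlas A" "foot u \<in> fst c" and j: "j < mdim A"
  shows "\<forall>\<^sub>F u' in T.near u. dirder T u' (hor A X u') (\<lambda>u'. yc c j u')
    = - (\<Sum>k<mdim A. yc c k u' * comp_in A c (foot u') (cov nb X (coord_field A c k) (foot u')) j)"
  using T.eventually_near_points eventually_foot[OF smf_eventually_Rn[OF X] u] eventually_foot[OF eventually_near_chart[OF c] u]
  by eventually_elim (simp add: hor_def dirder_hlift_yc c(1) j cov_def)

lemma flat_at:
  "smf p X \<Longrightarrow> smf p Y \<Longrightarrow> smf p Z \<Longrightarrow>
     nb p (X p) (cov nb Y Z) - nb p (Y p) (cov nb X Z) - nb p (bracket A X Y p) Z = 0"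
  using flatness unfolding flat_iff by blast

text \<open>On base coordinates the two horizontal derivations commute because the coordinate fields
  do. On fibre coordinates their commutator is, up to sign, the curvature of \<nabla> applied to the
  fibre vector; this is where flatness makes the horizontal distribution involutive.\<close>

lemma bracket_hor_hor:
  assumes u: "u \<in> points T" and ab: "a < mdim A" "b < mdim A"
  shows "bracket T (lift_frame u (True, a)) (lift_frame u (True, b)) u = 0"
proof -
  let ?n = "mdim A"
  define p where "p = foot u"
  define c where "c = chart_at A p"
  define E where "E = coord_field A c"
  have p: "p \<in> points A" using foot_points[OF u] by (simp add: p_def)
  have c: "c \<in> atlas A" "p \<in> fst c" using p by (auto simp: c_def)
  have fp: "foot u = p" by (simp add: p_def)
  have E: "smf p (E i)" if "i < ?n" for i unfolding E_def using c that by (intro smf_coord_field)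
  have F: "lift_frame u (True, i) = hor A (E i)" for i by (simp add: lift_frame_def E_def c_def fp)
  have hE: "T.smf u (hor A (E i))" if "i < ?n" for i using smf_hor[OF u] E[OF that] fp by simp
  have br0: "bracket A (E a) (E b) p = 0" unfolding E_def c_def using bracket_coord_fields[OF p ab] .
  have "bracket T (hor A (E a)) (hor A (E b)) u = 0"
  proof (rule tangent_T_eqI[OF u])
    show "bracket T (hor A (E a)) (hor A (E b)) u \<in> Rn (2 * ?n)" using T.bracket_Rn[OF u] by simp
    fix j assume j: "j < ?n"
    let ?x = "\<lambda>q. snd c q j"
    have x: "sm p ?x" by (rule sm_chart[OF c])
    have "dirder T u (hor A (E i) u) (\<lambda>u'. dirder T u' (hor A (E k) u') (\<lambda>u'. ?x (foot u')))
        = dirder A p (E i p) (\<lambda>q. dirder A q (E k q) ?x)" if i: "i < ?n" and k: "k < ?n" for i k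
    proof -
      have "dirder T u (hor A (E i) u) (\<lambda>u'. dirder T u' (hor A (E k) u') (\<lambda>u'. ?x (foot u')))
          = dirder T u (hor A (E i) u) (\<lambda>u'. dirder A (foot u') (E k (foot u')) ?x)"
        by (rule T.dirder_cong[OF u dirder_hor_foot[OF u]]) (simp add: fp E[OF k])
      then show ?thesis using dirder_hlift_foot[OF u smf_Rn[OF E[OF i]], of "\<lambda>q. dirder A q (E k q) ?x"]
        by (simp add: hor_def fp)
    qed
    then have "dirder T u (bracket T (hor A (E a)) (hor A (E b)) u) (\<lambda>u'. ?x (foot u')) = dirder A p (bracket A (E a) (E b) p) ?x"
      using T.dirder_bracket[OF hE[OF ab(1)] hE[OF ab(2)] sm_foot[OF u, unfolded fp, OF x]]
        dirder_bracket[OF E[OF ab(1)] E[OF ab(2)] x] ab by simp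
    then show "dirder T u (bracket T (hor A (E a)) (hor A (E b)) u) (\<lambda>u'. snd (chart_at A (foot u)) (foot u') j)
        = dirder T u 0 (\<lambda>u'. snd (chart_at A (foot u)) (foot u') j)"
      using br0 by (simp add: fp c_def)
    \<comment> \<open>The connection coefficients: \<nabla> of \<open>E m\<close> along
      \<open>E i\<close> has \<open>l\<close>-th component \<open>\<theta> i m l\<close>, and a
      horizontal field acts linearly on fibre coordinates through them.\<close>
    define \<theta> where "\<theta> i m l q = comp_in A c q (cov nb (E i) (E m) q) l" for i m l q
    have \<theta>: "sm p (\<theta> i m l)" if "i < ?n" "m < ?n" "l < ?n" for i m l
      unfolding \<theta>_def[abs_def] using that c by (intro smf_comp_sm cov_smf E)
    have ys: "T.sm u (\<lambda>u'. yc c l u')" for l using yc_sm[OF u c(1)] c(2) fp by simp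
    have hy: "\<forall>\<^sub>F u' in T.near u. dirder T u' (hor A (E i) u') (\<lambda>u'. yc c l u')
        = - (\<Sum>m<?n. yc c m u' * \<theta> i m l (foot u'))" if "i < ?n" "l < ?n" for i l
      using dirder_hor_yc[OF u, unfolded fp, OF E[OF that(1)] c that(2)] unfolding \<theta>_def E_def .
    have hy0: "dirder T u (hor A (E i) u) (\<lambda>u'. yc c l u') = - (\<Sum>m<?n. yc c m u * \<theta> i m l p)" if "i < ?n" "l < ?n" for i l
      using T.eventually_nearD[OF hy[OF that] u] fp by simp
    have nbb: "comp_in A c p (nb p (E i p) (cov nb (E k) (E l))) j
        = dirder A p (E i p) (\<theta> k l j) + (\<Sum>m<?n. \<theta> k l m p * \<theta> i m j p)" if ikl: "i < ?n" "k < ?n" "l < ?n" for i k l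
    proof -
      have "comp_in A c p (nb p (E i p) (cov nb (E k) (E l)))
          = (\<Sum>m<?n. dirder A p (E i p) (\<theta> k l m) \<cdot>\<^sub>c unit_coord m + \<theta> k l m p \<cdot>\<^sub>c comp_in A c p (cov nb (E i) (E m) p))"
        unfolding nab_expand[OF cov_smf[OF E[OF ikl(2)] E[OF ikl(3)]] smf_Rn[OF E[OF ikl(1)]] c] \<theta>_def
        using comp_in_coord_field[OF c] by (simp add: comp_in_sum comp_in_add comp_in_scale cov_def E_def)
      then show ?thesis
        using j by (simp add: coord_simps sum.distrib unit_coord_def \<theta>_def[of _ _ j] if_distrib cong: if_cong)
    qed
    \<comment> \<open>The last sum is symmetric in \<open>i\<close> and \<open>k\<close>, so only
      the second covariant derivatives remain in the commutator, and flatness identifies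
      them.\<close>
    have second: "dirder T u (hor A (E i) u) (\<lambda>u'. dirder T u' (hor A (E k) u') (\<lambda>u'. yc c j u'))
        = - (\<Sum>l<?n. yc c l u * comp_in A c p (nb p (E i p) (cov nb (E k) (E l))) j)
          + (\<Sum>l<?n. \<Sum>m<?n. yc c l u * (\<theta> k l m p * \<theta> i m j p + \<theta> i l m p * \<theta> k m j p))"
      if ik: "i < ?n" "k < ?n" for i k
    proof -
      have "dirder T u (hor A (E i) u) (\<lambda>u'. dirder T u' (hor A (E k) u') (\<lambda>u'. yc c j u'))
          = dirder T u (hor A (E i) u) (\<lambda>u'. - (\<Sum>m<?n. yc c m u' * \<theta> k m j (foot u')))"
        by (rule T.dirder_cong[OF u hy[OF ik(2) j]])
      also have "\<dots> = - dirder T u (hor A (E i) u) (\<lambda>u'. \<Sum>m<?n. yc c m u' * \<theta> k m j (foot u'))"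
        using ik j by (intro T.dirder_uminus T.sm_sum u T.sm_mult ys sm_foot[OF u]) (simp add: fp \<theta>)
      also have "dirder T u (hor A (E i) u) (\<lambda>u'. \<Sum>m<?n. yc c m u' * \<theta> k m j (foot u'))
          = (\<Sum>m<?n. dirder T u (hor A (E i) u) (\<lambda>u'. yc c m u' * \<theta> k m j (foot u')))"
        using ik j by (intro T.dirder_sum u T.sm_mult ys sm_foot[OF u]) (simp add: fp \<theta>)
      also have "\<dots> = (\<Sum>m<?n. dirder T u (hor A (E i) u) (\<lambda>u'. yc c m u') * \<theta> k m j (foot u)
          + yc c m u * dirder T u (hor A (E i) u) (\<lambda>u'. \<theta> k m j (foot u')))"
        using ik j by (intro sum.cong refl T.dirder_mult ys sm_foot[OF u]) (simp add: fp \<theta>)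
      also have "\<dots> = (\<Sum>m<?n. - (\<Sum>l<?n. yc c l u * \<theta> i l m p) * \<theta> k m j p + yc c m u * dirder A p (E i p) (\<theta> k m j))"
        using hy0[OF ik(1)] dirder_hlift_foot[OF u smf_Rn[OF E[OF ik(1)]]] by (simp add: fp hor_def)
      also have "\<dots> = (\<Sum>l<?n. yc c l u * dirder A p (E i p) (\<theta> k l j)) - (\<Sum>m<?n. \<Sum>l<?n. yc c l u * \<theta> i l m p * \<theta> k m j p)"
        by (simp add: sum_subtractf sum_distrib_right)
      also have "(\<Sum>m<?n. \<Sum>l<?n. yc c l u * \<theta> i l m p * \<theta> k m j p) = (\<Sum>l<?n. \<Sum>m<?n. yc c l u * \<theta> i l m p * \<theta> k m j p)"
        by (rule sum.swap)
      also have "(\<Sum>l<?n. yc c l u * dirder A p (E i p) (\<theta> k l j))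
          = (\<Sum>l<?n. yc c l u * comp_in A c p (nb p (E i p) (cov nb (E k) (E l))) j) - (\<Sum>l<?n. \<Sum>m<?n. yc c l u * (\<theta> k l m p * \<theta> i m j p))"
        using nbb[OF ik] by (simp add: distrib_left sum.distrib sum_distrib_left)
      finally show ?thesis by (simp add: distrib_left sum.distrib mult.assoc)
    qed
    have "comp_in A c p (nb p (E a p) (cov nb (E b) (E l))) j = comp_in A c p (nb p (E b p) (cov nb (E a) (E l))) j" if "l < ?n" for l
    proof -
      have "nb p (E a p) (cov nb (E b) (E l)) = nb p (E b p) (cov nb (E a) (E l))"
        using flat_at[OF E[OF ab(1)] E[OF ab(2)] E[OF that]] br0 nab_zero_vec[OF E[OF that]] by simp
      then show ?thesis by simp
    qed
    then have "dirder T u (bracket T (hor A (E a)) (hor A (E b)) u) (\<lambda>u'. yc c j u') = 0"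
      unfolding T.dirder_bracket[OF hE[OF ab(1)] hE[OF ab(2)] ys] second[OF ab] second[OF ab(2,1)]
      by (simp add: add.commute)
    then show "dirder T u (bracket T (hor A (E a)) (hor A (E b)) u) (\<lambda>u'. yc (chart_at A (foot u)) j u')
        = dirder T u 0 (\<lambda>u'. yc (chart_at A (foot u)) j u')"
      by (simp add: fp c_def)
  qed simp
  then show ?thesis by (simp add: F)
qed

text \<open>The instance for coordinate fields of
  \<open>[X^h, Y^v] = (\<nabla>\<^sub>X Y)^v\<close>. The vertical lift has constant fibre
  components, so the only contribution is the vertical derivative of the fibre components of the
  horizontal lift, which are linear in the fibre.\<close>

lemma bracket_hor_ver:
  assumes u: "u \<in> points T" and ab: "a < mdim A" "b < mdim A"
  shows "bracket T (lift_frame u (True, a)) (lift_frame u (False, b)) u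
    = vlift A u (nb (foot u) (unit_coord a) (coord_field A (chart_at A (foot u)) b))"
proof -
  let ?n = "mdim A"
  define p where "p = foot u"
  define c where "c = chart_at A p"
  define E where "E = coord_field A c"
  have p: "p \<in> points A" using foot_points[OF u] by (simp add: p_def)
  have c: "c \<in> atlas A" "p \<in> fst c" using p by (auto simp: c_def)
  have fp: "foot u = p" by (simp add: p_def)
  have E: "smf p (E i)" if "i < ?n" for i unfolding E_def using c that by (intro smf_coord_field)
  have F: "lift_frame u (True, i) = hor A (E i)" "lift_frame u (False, i) = ver A (E i)" for i
    by (simp_all add: lift_frame_def E_def c_def fp)
  have hE: "T.smf u (hor A (E i))" "T.smf u (ver A (E i))" if "i < ?n" for i
    using smf_hor[OF u] smf_ver[OF u] E[OF that] fp by simp_all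
  have Eu: "E i p = unit_coord i" if "i < ?n" for i unfolding E_def c_def by (rule coord_field_self[OF p that])
  have R: "nb p (E a p) (E b) \<in> Rn ?n" by (rule nab_Rn[OF E[OF ab(2)] smf_Rn[OF E[OF ab(1)]]])
  have "bracket T (hor A (E a)) (ver A (E b)) u = vlift A u (nb p (E a p) (E b))"
  proof (rule tangent_T_eqI[OF u])
    show "bracket T (hor A (E a)) (ver A (E b)) u \<in> Rn (2 * ?n)" using T.bracket_Rn[OF u] by simp
    show "vlift A u (nb p (E a p) (E b)) \<in> Rn (2 * ?n)" by (rule vlift_Rn[OF R])
    fix j assume j: "j < ?n"
    let ?x = "\<lambda>q. snd c q j"
    have x: "sm p ?x" by (rule sm_chart[OF c])
    have 1: "dirder T u (hor A (E a) u) (\<lambda>u'. dirder T u' (ver A (E b) u') (\<lambda>u'. ?x (foot u'))) = 0"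
      using T.dirder_cong[OF u dirder_ver_foot[where u=u and X="E b" and f="?x"]] by simp
    have 2: "dirder T u (ver A (E b) u) (\<lambda>u'. dirder T u' (hor A (E a) u') (\<lambda>u'. ?x (foot u'))) = 0"
    proof -
      have "dirder T u (ver A (E b) u) (\<lambda>u'. dirder T u' (hor A (E a) u') (\<lambda>u'. ?x (foot u')))
          = dirder T u (ver A (E b) u) (\<lambda>u'. dirder A (foot u') (E a (foot u')) ?x)"
        by (rule T.dirder_cong[OF u dirder_hor_foot[OF u]]) (simp add: fp E[OF ab(1)])
      then show ?thesis using dirder_vlift_foot[OF u, of _ "\<lambda>q. dirder A q (E a q) ?x"] by (simp add: ver_def)
    qed
    have "dirder T u (bracket T (hor A (E a)) (ver A (E b)) u) (\<lambda>u'. ?x (foot u')) = 0"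
      unfolding T.dirder_bracket[OF hE(1)[OF ab(1)] hE(2)[OF ab(2)] sm_foot[OF u, unfolded fp, OF x]] 1 2 by simp
    then show "dirder T u (bracket T (hor A (E a)) (ver A (E b)) u) (\<lambda>u'. snd (chart_at A (foot u)) (foot u') j)
        = dirder T u (vlift A u (nb p (E a p) (E b))) (\<lambda>u'. snd (chart_at A (foot u)) (foot u') j)"
      using dirder_vlift_foot[OF u, of _ ?x] by (simp add: fp c_def)
    define \<theta> where "\<theta> m q = comp_in A c q (cov nb (E a) (E m) q) j" for m q
    have \<theta>: "sm p (\<theta> m)" if "m < ?n" for m
      unfolding \<theta>_def[abs_def] using that c j ab by (intro smf_comp_sm cov_smf E)
    have ys: "T.sm u (\<lambda>u'. yc c l u')" for l using yc_sm[OF u c(1)] c(2) fp by simp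
    have 3: "dirder T u (hor A (E a) u) (\<lambda>u'. dirder T u' (ver A (E b) u') (\<lambda>u'. yc c j u')) = 0"
    proof -
      have "\<forall>\<^sub>F u' in T.near u. dirder T u' (ver A (E b) u') (\<lambda>u'. yc c j u') = unit_coord b j"
        using dirder_ver_yc[OF u, unfolded fp, OF E[OF ab(2)] c] eventually_foot[OF eventually_near_chart[OF c, folded fp] u]
        by eventually_elim (simp add: E_def comp_in_coord_field[OF c(1) _ ab(2)])
      from T.dirder_cong[OF u this] show ?thesis by simp
    qed
    have 4: "dirder T u (ver A (E b) u) (\<lambda>u'. dirder T u' (hor A (E a) u') (\<lambda>u'. yc c j u')) = - \<theta> b p"
    proof -
      have "\<forall>\<^sub>F u' in T.near u. dirder T u' (hor A (E a) u') (\<lambda>u'. yc c j u') = - (\<Sum>m<?n. yc c m u' * \<theta> m (foot u'))"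
        using dirder_hor_yc[OF u, unfolded fp, OF E[OF ab(1)] c j] unfolding \<theta>_def E_def .
      from T.dirder_cong[OF u this]
      have "dirder T u (ver A (E b) u) (\<lambda>u'. dirder T u' (hor A (E a) u') (\<lambda>u'. yc c j u'))
          = dirder T u (ver A (E b) u) (\<lambda>u'. - (\<Sum>m<?n. yc c m u' * \<theta> m (foot u')))" .
      also have "\<dots> = - dirder T u (ver A (E b) u) (\<lambda>u'. \<Sum>m<?n. yc c m u' * \<theta> m (foot u'))"
        by (intro T.dirder_uminus T.sm_sum u T.sm_mult ys sm_foot[OF u]) (simp add: fp \<theta>)
      also have "dirder T u (ver A (E b) u) (\<lambda>u'. \<Sum>m<?n. yc c m u' * \<theta> m (foot u'))
          = (\<Sum>m<?n. dirder T u (ver A (E b) u) (\<lambda>u'. yc c m u' * \<theta> m (foot u')))"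
        by (intro T.dirder_sum u T.sm_mult ys sm_foot[OF u]) (simp add: fp \<theta>)
      also have "\<dots> = (\<Sum>m<?n. dirder T u (ver A (E b) u) (\<lambda>u'. yc c m u') * \<theta> m (foot u)
          + yc c m u * dirder T u (ver A (E b) u) (\<lambda>u'. \<theta> m (foot u')))"
        by (intro sum.cong refl T.dirder_mult ys sm_foot[OF u]) (simp add: fp \<theta>)
      also have "\<dots> = (\<Sum>m<?n. unit_coord b m * \<theta> m p)"
        using dirder_vlift_foot[OF u] dirder_vlift_yc[OF u, unfolded fp, OF smf_Rn[OF E[OF ab(2)]] c]
          comp_in_coord_field[OF c ab(2)] by (simp add: ver_def fp E_def)
      also have "\<dots> = \<theta> b p" using ab by (simp add: unit_coord_def if_distrib[of "\<lambda>x. x * _"] cong: if_cong)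
      finally show ?thesis .
    qed
    have "dirder T u (bracket T (hor A (E a)) (ver A (E b)) u) (\<lambda>u'. yc c j u') = \<theta> b p"
      unfolding T.dirder_bracket[OF hE(1)[OF ab(1)] hE(2)[OF ab(2)] ys] 3 4 by simp
    also have "\<dots> = dirder T u (vlift A u (nb p (E a p) (E b))) (\<lambda>u'. yc c j u')"
      using dirder_vlift_yc[OF u R c(1)] c(2) by (simp add: fp \<theta>_def cov_def)
    finally show "dirder T u (bracket T (hor A (E a)) (ver A (E b)) u) (\<lambda>u'. yc (chart_at A (foot u)) j u')
        = dirder T u (vlift A u (nb p (E a p) (E b))) (\<lambda>u'. yc (chart_at A (foot u)) j u')"
      by (simp add: fp c_def)
  qed
  then show ?thesis using Eu[OF ab(1)] by (simp add: F fp E_def c_def)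
qed

text \<open>Vertical lifts of coordinate fields have constant components in the tangent
  chart.\<close>

lemma bracket_ver_ver:
  assumes u: "u \<in> points T" and ab: "a < mdim A" "b < mdim A"
  shows "bracket T (lift_frame u (False, a)) (lift_frame u (False, b)) u = 0"
proof -
  let ?n = "mdim A"
  define p where "p = foot u"
  define c where "c = chart_at A p"
  define E where "E = coord_field A c"
  have p: "p \<in> points A" using foot_points[OF u] by (simp add: p_def)
  have c: "c \<in> atlas A" "p \<in> fst c" using p by (auto simp: c_def)
  have fp: "foot u = p" by (simp add: p_def)
  have E: "smf p (E i)" if "i < ?n" for i unfolding E_def using c that by (intro smf_coord_field)
  have F: "lift_frame u (False, i) = ver A (E i)" for i
    by (simp_all add: lift_frame_def E_def c_def fp)
  have hE: "T.smf u (ver A (E i))" if "i < ?n" for i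
    using smf_ver[OF u] E[OF that] fp by simp
  have "bracket T (ver A (E a)) (ver A (E b)) u = 0"
  proof (rule tangent_T_eqI[OF u])
    show "bracket T (ver A (E a)) (ver A (E b)) u \<in> Rn (2 * ?n)" using T.bracket_Rn[OF u] by simp
    fix j assume j: "j < ?n"
    let ?x = "\<lambda>q. snd c q j"
    have x: "sm p ?x" by (rule sm_chart[OF c])
    have 1: "dirder T u w (\<lambda>u'. dirder T u' (ver A (E b) u') (\<lambda>u'. ?x (foot u'))) = 0" for w b
      using T.dirder_cong[OF u dirder_ver_foot[where u=u and X="E b" and f="?x"]] by simp
    have "dirder T u (bracket T (ver A (E a)) (ver A (E b)) u) (\<lambda>u'. ?x (foot u')) = 0"
      unfolding T.dirder_bracket[OF hE[OF ab(1)] hE[OF ab(2)] sm_foot[OF u, unfolded fp, OF x]] 1 by simp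
    then show "dirder T u (bracket T (ver A (E a)) (ver A (E b)) u) (\<lambda>u'. snd (chart_at A (foot u)) (foot u') j)
        = dirder T u 0 (\<lambda>u'. snd (chart_at A (foot u)) (foot u') j)"
      by (simp add: fp c_def)
    have ys: "T.sm u (\<lambda>u'. yc c l u')" for l using yc_sm[OF u c(1)] c(2) fp by simp
    have 3: "dirder T u w (\<lambda>u'. dirder T u' (ver A (E b) u') (\<lambda>u'. yc c j u')) = 0" if "b < ?n" for b w
    proof -
      have "\<forall>\<^sub>F u' in T.near u. dirder T u' (ver A (E b) u') (\<lambda>u'. yc c j u') = unit_coord b j"
        using dirder_ver_yc[OF u, unfolded fp, OF E[OF that] c] eventually_foot[OF eventually_near_chart[OF c, folded fp] u]
        by eventually_elim (simp add: E_def comp_in_coord_field[OF c(1) _ that])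
      from T.dirder_cong[OF u this] show ?thesis by simp
    qed
    have "dirder T u (bracket T (ver A (E a)) (ver A (E b)) u) (\<lambda>u'. yc c j u') = 0"
      unfolding T.dirder_bracket[OF hE[OF ab(1)] hE[OF ab(2)] ys] 3[OF ab(1)] 3[OF ab(2)] by simp
    then show "dirder T u (bracket T (ver A (E a)) (ver A (E b)) u) (\<lambda>u'. yc (chart_at A (foot u)) j u')
        = dirder T u 0 (\<lambda>u'. yc (chart_at A (foot u)) j u')"
      by (simp add: fp c_def)
  qed simp
  then show ?thesis by (simp add: F)
qed

subsection \<open>The tangent bundle is again affine-Riemann\<close>

lemma nb1_frame:
  assumes u: "u \<in> points T" and i: "i \<in> UNIV \<times> {..<mdim A}" and Y: "smf (foot u) Y"
  shows "nb1 u (lift_frame u i u) (hor A Y) = (if fst i then hlift A u (nb (foot u) (unit_coord (snd i)) Y) else 0)"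
    and "nb1 u (lift_frame u i u) (ver A Y) = (if fst i then vlift A u (nb (foot u) (unit_coord (snd i)) Y) else 0)"
proof -
  have p: "foot u \<in> points A" by (rule foot_points[OF u])
  have w: "lift_frame u i u \<in> Rn (2 * mdim A)" using T.smf_Rn[OF lift_frame_smf[OF u i]] by simp
  have h: "hpart A u (lift_frame u i u) = (if fst i then unit_coord (snd i) else 0)"
    using i coord_field_self[OF p] by (auto simp: lift_frame_def hor_def ver_def hpart_hlift hpart_vlift)
  show "nb1 u (lift_frame u i u) (hor A Y) = (if fst i then hlift A u (nb (foot u) (unit_coord (snd i)) Y) else 0)"
    using nb1_hor[OF u w Y] nab_zero_vec[OF Y] by (simp add: h hlift_zero[OF u])
  show "nb1 u (lift_frame u i u) (ver A Y) = (if fst i then vlift A u (nb (foot u) (unit_coord (snd i)) Y) else 0)"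
    using nb1_ver[OF u w Y] nab_zero_vec[OF Y] by (simp add: h vlift_zero)
qed

lemma frame_torsion:
  assumes p: "p \<in> points A" and ab: "a < mdim A" "b < mdim A"
  shows "nb p (unit_coord a) (coord_field A (chart_at A p) b) = nb p (unit_coord b) (coord_field A (chart_at A p) a)"
  using torsion_free_at[OF frame_smf[OF p ab(1)] frame_smf[OF p ab(2)]] bracket_coord_fields[OF p ab]
    coord_field_self[OF p] ab by simp

lemma nb1_torsionless: "torsionless T nb1"
  unfolding T.torsionless_iff
proof (intro allI impI)
  fix u X Y assume X: "T.smf u X" and Y: "T.smf u Y"
  have u: "u \<in> points T" using X T.smf_points by blast
  have p: "foot u \<in> points A" by (rule foot_points[OF u])
  let ?S = "(UNIV :: bool set) \<times> {..<mdim A}"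
  show "nb1 u (X u) Y - nb1 u (Y u) X = bracket T X Y u"
  proof (rule T.torsion_zero_if_zero_on_frame[of ?S u "lift_frame u", OF lift_frame_smf[OF u] _ _ X Y])
    show "\<exists>r. v = (\<Sum>a\<in>?S. r a \<cdot>\<^sub>c lift_frame u a u)" if "v \<in> Rn (mdim T)" for v
      using lift_frame_span[OF u] that by simp
    fix i k :: "bool \<times> nat" assume i: "i \<in> ?S" and k: "k \<in> ?S"
    obtain x a where ia: "i = (x, a)" "a < mdim A" using i by auto
    obtain y b where kb: "k = (y, b)" "b < mdim A" using k by auto
    have nb1: "nb1 u (lift_frame u i u) (lift_frame u k) = (if x then (if y then hlift A u else vlift A u)
        (nb (foot u) (unit_coord a) (coord_field A (chart_at A (foot u)) b)) else 0)"
      if "i = (x, a)" "k = (y, b)" "a < mdim A" "b < mdim A" for i k x y a b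
      using nb1_frame[OF u, of i, OF _ frame_smf[OF p that(4)]] that
      by (cases y) (simp_all add: lift_frame_def[of u "(_, b)"])
    \<comment> \<open>For two horizontal fields this is the symmetry of the base connection and a
      zero bracket. For a mixed pair only the derivative along the horizontal field survives, and it
      is the bracket up to order. For two vertical fields everything vanishes.\<close>
    show "nb1 u (lift_frame u i u) (lift_frame u k) - nb1 u (lift_frame u k u) (lift_frame u i) = bracket T (lift_frame u i) (lift_frame u k) u"
      unfolding nb1[OF ia(1) kb(1) ia(2) kb(2)] nb1[OF kb(1) ia(1) kb(2) ia(2)]
      using frame_torsion[OF p ia(2) kb(2)] bracket_hor_hor[OF u ia(2) kb(2)] bracket_hor_ver[OF u ia(2) kb(2)]
        bracket_hor_ver[OF u kb(2) ia(2)] bracket_ver_ver[OF u ia(2) kb(2)] T.bracket_swap[of "lift_frame u i" "lift_frame u k" u]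
      by (cases x; cases y) (simp_all add: ia kb)
  qed
qed

text \<open>Stated near \<open>u\<close> and not just at \<open>u\<close>, because curvature
  differentiates these fields once more.\<close>

lemma nb1_cov_frame:
  assumes u: "u \<in> points T" and b: "b < mdim A" and X: "smf (foot u) X"
  shows "\<forall>\<^sub>F u' in T.near u. cov nb1 (hor A X) (hor A (coord_field A (chart_at A (foot u)) b)) u'
      = hor A (cov nb X (coord_field A (chart_at A (foot u)) b)) u'"
    and "\<forall>\<^sub>F u' in T.near u. cov nb1 (hor A X) (ver A (coord_field A (chart_at A (foot u)) b)) u'
      = ver A (cov nb X (coord_field A (chart_at A (foot u)) b)) u'"
    and "\<forall>\<^sub>F u' in T.near u. cov nb1 (ver A X) (hor A (coord_field A (chart_at A (foot u)) b)) u' = 0"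
    and "\<forall>\<^sub>F u' in T.near u. cov nb1 (ver A X) (ver A (coord_field A (chart_at A (foot u)) b)) u' = 0"
proof -
  let ?E = "coord_field A (chart_at A (foot u)) b"
  have E: "smf (foot u) ?E" by (rule frame_smf[OF foot_points[OF u] b])
  note ev = T.eventually_near_points eventually_foot[OF smf_eventually[OF X] u] eventually_foot[OF smf_eventually[OF E] u]
  show "\<forall>\<^sub>F u' in T.near u. cov nb1 (hor A X) (hor A ?E) u' = hor A (cov nb X ?E) u'"
    using ev by eventually_elim (simp add: cov_def hor_def nb1_hor[unfolded hor_def] hlift_Rn hpart_hlift smf_Rn)
  show "\<forall>\<^sub>F u' in T.near u. cov nb1 (hor A X) (ver A ?E) u' = ver A (cov nb X ?E) u'"
    using ev by eventually_elim (simp add: cov_def hor_def ver_def nb1_ver[unfolded ver_def] hlift_Rn hpart_hlift smf_Rn)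
  show "\<forall>\<^sub>F u' in T.near u. cov nb1 (ver A X) (hor A ?E) u' = 0"
    using ev by eventually_elim (simp add: cov_def hor_def ver_def nb1_hor[unfolded hor_def] vlift_Rn hpart_vlift smf_Rn nab_zero_vec hlift_zero)
  show "\<forall>\<^sub>F u' in T.near u. cov nb1 (ver A X) (ver A ?E) u' = 0"
    using ev by eventually_elim (simp add: cov_def ver_def nb1_ver[unfolded ver_def] vlift_Rn hpart_vlift smf_Rn nab_zero_vec vlift_zero)
qed

text \<open>Second derivatives of lifts are lifts of second derivatives on the base, and vanish if
  one of the directions is vertical; the remaining symmetry is flatness on the base.\<close>

lemma nb1_flat: "flat T nb1"
  unfolding T.flat_iff
proof (intro allI impI)
  fix u X Y Z assume X: "T.smf u X" and Y: "T.smf u Y" and Z: "T.smf u Z"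
  have u: "u \<in> points T" using X T.smf_points by blast
  have p: "foot u \<in> points A" by (rule foot_points[OF u])
  let ?S = "(UNIV :: bool set) \<times> {..<mdim A}"
  let ?E = "coord_field A (chart_at A (foot u))"
  note E = frame_smf[OF p]
  show "nb1 u (X u) (cov nb1 Y Z) - nb1 u (Y u) (cov nb1 X Z) - nb1 u (bracket T X Y u) Z = 0"
  proof (rule T.curvature_zero_if_zero_on_frame[of ?S u "lift_frame u", OF lift_frame_smf[OF u] _ _ X Y Z])
    show "\<exists>r. v = (\<Sum>a\<in>?S. r a \<cdot>\<^sub>c lift_frame u a u)" if "v \<in> Rn (mdim T)" for v
      using lift_frame_span[OF u] that by simp
    have cov: "nb1 u (lift_frame u (x, a) u) (cov nb1 (lift_frame u (y, b)) (lift_frame u (z, c)))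
        = (if x \<and> y then (if z then hlift A u else vlift A u) (nb (foot u) (unit_coord a) (cov nb (?E b) (?E c))) else 0)"
      if abc: "a < mdim A" "b < mdim A" "c < mdim A" for x y z a b c
    proof -
      have w: "lift_frame u (x, a) u \<in> Rn (mdim T)" using T.smf_Rn[OF lift_frame_smf[OF u]] abc by simp
      have s: "T.smf u (cov nb1 (lift_frame u (y, b)) (lift_frame u (z, c)))"
        using abc by (intro T.cov_smf lift_frame_smf u) auto
      have EE: "smf (foot u) (cov nb (?E b) (?E c))" by (intro cov_smf E abc)
      note nf = nb1_frame[OF u, of "(x, a)", OF _ EE]
      note ev = nb1_cov_frame[OF u abc(3) E[OF abc(2)]]
      consider "y" "z" | "y" "\<not> z" | "\<not> y" by blast
      then show ?thesis
      proof cases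
        case 1
        have "nb1 u (lift_frame u (x, a) u) (cov nb1 (lift_frame u (y, b)) (lift_frame u (z, c)))
            = nb1 u (lift_frame u (x, a) u) (hor A (cov nb (?E b) (?E c)))"
          by (rule T.nab_cong[OF s w]) (use ev(1) 1 in \<open>simp add: lift_frame_def\<close>)
        then show ?thesis using nf(1) abc 1 by simp
      next
        case 2
        have "nb1 u (lift_frame u (x, a) u) (cov nb1 (lift_frame u (y, b)) (lift_frame u (z, c)))
            = nb1 u (lift_frame u (x, a) u) (ver A (cov nb (?E b) (?E c)))"
          by (rule T.nab_cong[OF s w]) (use ev(2) 2 in \<open>simp add: lift_frame_def\<close>)
        then show ?thesis using nf(2) abc 2 by simp
      next
        case 3
        have "nb1 u (lift_frame u (x, a) u) (cov nb1 (lift_frame u (y, b)) (lift_frame u (z, c)))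
            = nb1 u (lift_frame u (x, a) u) (\<lambda>q. 0)"
          by (rule T.nab_cong[OF s w]) (use ev(3,4) 3 in \<open>cases z; simp add: lift_frame_def\<close>)
        then show ?thesis using T.nab_zero[OF u w] 3 by simp
      qed
    qed
    have zero: "nb1 u (bracket T (lift_frame u (x, a)) (lift_frame u (y, b)) u) (lift_frame u (z, c)) = 0"
      if abc: "a < mdim A" "b < mdim A" "c < mdim A" for x y z a b c
    proof -
      have s: "T.smf u (lift_frame u (z, c))" using lift_frame_smf[OF u] abc by simp
      \<comment> \<open>All brackets of the frame are vertical, and lifts have zero derivative in
        vertical directions; hence the bracket term of the curvature drops out.\<close>
      have "\<exists>v\<in>Rn (mdim A). bracket T (lift_frame u (x, a)) (lift_frame u (y, b)) u = vlift A u v"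
      proof (cases x; cases y)
        assume "x" "y" then show ?thesis using bracket_hor_hor[OF u abc(1,2)] vlift_zero by (intro bexI[of _ 0]) auto
      next
        assume "x" "\<not> y"
        then show ?thesis using bracket_hor_ver[OF u abc(1,2)] nab_Rn[OF E[OF abc(2)] unit_coord_Rn[OF abc(1)]] by auto
      next
        assume xy: "\<not> x" "y"
        then have "bracket T (lift_frame u (x, a)) (lift_frame u (y, b)) u = vlift A u (- nb (foot u) (unit_coord b) (?E a))"
          using T.bracket_swap[of "lift_frame u (False, a)" "lift_frame u (True, b)" u] bracket_hor_ver[OF u abc(2,1)]
          by (simp add: vlift_uminus)
        then show ?thesis using nab_Rn[OF E[OF abc(1)] unit_coord_Rn[OF abc(2)]] by (metis Rn_closed(4))
      next
        assume "\<not> x" "\<not> y" then show ?thesis using bracket_ver_ver[OF u abc(1,2)] vlift_zero by (intro bexI[of _ 0]) auto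
      qed
      then obtain v where v: "v \<in> Rn (mdim A)" "bracket T (lift_frame u (x, a)) (lift_frame u (y, b)) u = vlift A u v" by blast
      show ?thesis
        unfolding v(2) using nb1_hor[OF u vlift_Rn[OF v(1)] E[OF abc(3)]] nb1_ver[OF u vlift_Rn[OF v(1)] E[OF abc(3)]]
          nab_zero_vec[OF E[OF abc(3)]] hlift_zero[OF u] vlift_zero
        by (cases z) (simp_all add: lift_frame_def hpart_vlift)
    qed
    fix i k l :: "bool \<times> nat" assume "i \<in> ?S" "k \<in> ?S" "l \<in> ?S"
    then obtain x a y b z c where ikl: "i = (x, a)" "k = (y, b)" "l = (z, c)" and abc: "a < mdim A" "b < mdim A" "c < mdim A"
      by auto
    have "nb (foot u) (unit_coord a) (cov nb (?E b) (?E c)) = nb (foot u) (unit_coord b) (cov nb (?E a) (?E c))"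
      using flat_at[OF E[OF abc(1)] E[OF abc(2)] E[OF abc(3)]] bracket_coord_fields[OF p abc(1,2)]
        nab_zero_vec[OF E[OF abc(3)]] coord_field_self[OF p] abc by simp
    then show "nb1 u (lift_frame u i u) (cov nb1 (lift_frame u k) (lift_frame u l))
        - nb1 u (lift_frame u k u) (cov nb1 (lift_frame u i) (lift_frame u l))
        - nb1 u (bracket T (lift_frame u i) (lift_frame u k) u) (lift_frame u l) = 0"
      unfolding ikl zero[OF abc] cov[OF abc] cov[OF abc(2,1,3)] by simp
  qed
qed

section \<open>The metric of the tangent bundle\<close>

lemma nabla_tangent: "nabla T = nb1"
  by (simp add: tangent_def)

lemma met_tangent: "met T = tangent_met A"
  by (simp add: tangent_def)

lemma tangent_met_riemannian: "riemannian_metric T (tangent_met A)"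
  unfolding riemannian_metric_def
proof (intro conjI ballI allI impI)
  fix u assume u: "u \<in> points T"
  interpret I: inner_product_on "mdim A" "met A (foot u)" by (rule inner[OF foot_points[OF u]])
  fix v w assume v: "v \<in> Rn (mdim T)" and w: "w \<in> Rn (mdim T)"
  note R = hpart_Rn vpart_Rn[OF u]
  show "tangent_met A u v w = tangent_met A u w v"
    using v w R by (simp add: tangent_met_def I.sym)
  fix z a b assume z: "z \<in> Rn (mdim T)"
  show "tangent_met A u (a \<cdot>\<^sub>c v + b \<cdot>\<^sub>c w) z = a * tangent_met A u v z + b * tangent_met A u w z"
    using v w z R by (simp add: tangent_met_def hpart_lin vpart_lin[OF u] I.lin algebra_simps)
next
  fix u v assume u: "u \<in> points T" and v: "v \<in> Rn (mdim T)" "v \<noteq> 0"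
  interpret I: inner_product_on "mdim A" "met A (foot u)" by (rule inner[OF foot_points[OF u]])
  note R = hpart_Rn[of u v] vpart_Rn[OF u v(1)[unfolded mdim_tangent]]
  have ge: "met A (foot u) x x \<ge> 0" if "x \<in> Rn (mdim A)" for x
    using I.pos[OF that] I.zero_left[OF that] by (cases "x = 0") auto
  have "hpart A u v \<noteq> 0 \<or> vpart A u v \<noteq> 0"
    using hv_decomp[OF u, of v] v(2) hlift_zero[OF u] vlift_zero by force
  then show "tangent_met A u v v > 0"
    unfolding tangent_met_def using I.pos[OF R(1)] I.pos[OF R(2)] ge[OF R(1)] ge[OF R(2)] by force
next
  fix W X Y assume W: "openin (mtop T) W" and X: "smooth_field T W X" and Y: "smooth_field T W Y"
  have "T.sm u (\<lambda>u. tangent_met A u (X u) (Y u))" if uW: "u \<in> W" for u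
  proof -
    have u: "u \<in> points T" using T.openin_points[OF W uW] .
    have "T.smf u X" "T.smf u Y" using W X Y uW unfolding smooth_field_at_def by blast+
    then show ?thesis unfolding tangent_met_def T_smf_iff[OF u] by (intro T.sm_add smal_inner) auto
  qed
  then show "smooth_fun T W (\<lambda>u. tangent_met A u (X u) (Y u))"
    unfolding T.smooth_fun_iff[OF W] by blast
qed

text \<open>Closes the circle: everything shown for \<open>A\<close> in this context holds for
  \<open>tangent A\<close> as well, which permits the iteration.\<close>

lemma tangent_affine_metric: "affine_metric T"
proof -
  interpret R: riemannian_connection T "tangent_nabla A" "tangent_met A"
    by unfold_locales (rule tangent_met_riemannian nb1_torsionless)+
  show ?thesis
    unfolding affine_metric_def affine_metric_axioms_def nabla_tangent met_tangent
    using R.riemannian_connection_axioms nb1_flat by blast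
qed

end

section \<open>Difference tensors, adjoints and traces\<close>

context affine_metric
begin

text \<open>The description ranges over all extensions of \<open>w\<close>:
  \<open>levi_civita_eq\<close> shows that they give the same value, and \<open>const_ext\<close>
  that there is one.\<close>

lemma gam_eq:
  assumes p: "p \<in> points A" and v: "v \<in> Rn (mdim A)" and w: "w \<in> Rn (mdim A)"
  shows "gam A p v w = lc_diff p v w"
  unfolding difference_tensor_def
proof (rule the_equality)
  show "\<forall>Y. smf p Y \<and> Y p = w \<longrightarrow> lc_diff p v w = levi_civita A (met A) p v Y - nabla A p v Y"
    using levi_civita_eq v by simp
  fix z assume "\<forall>Y. smf p Y \<and> Y p = w \<longrightarrow> z = levi_civita A (met A) p v Y - nabla A p v Y"
  then have "z = levi_civita A (met A) p v (const_ext p w) - nabla A p v (const_ext p w)"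
    using smf_const_ext[OF p] const_ext_self[OF p w] by blast
  then show "z = lc_diff p v w"
    using levi_civita_eq[OF smf_const_ext[OF p] v] const_ext_self[OF p w] by simp
qed

lemma gam_Rn: "p \<in> points A \<Longrightarrow> v \<in> Rn (mdim A) \<Longrightarrow> w \<in> Rn (mdim A) \<Longrightarrow> gam A p v w \<in> Rn (mdim A)"
  by (simp add: gam_eq lc_diff_Rn)

lemma gam_sym: "p \<in> points A \<Longrightarrow> v \<in> Rn (mdim A) \<Longrightarrow> w \<in> Rn (mdim A) \<Longrightarrow> gam A p v w = gam A p w v"
  by (simp add: gam_eq lc_diff_sym)

lemma gam_lin:
  assumes "p \<in> points A" "v \<in> Rn (mdim A)" "w \<in> Rn (mdim A)" "a \<in> Rn (mdim A)"
  shows "gam A p (r \<cdot>\<^sub>c v + s \<cdot>\<^sub>c w) a = r \<cdot>\<^sub>c gam A p v a + s \<cdot>\<^sub>c gam A p w a"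
    and "gam A p a (r \<cdot>\<^sub>c v + s \<cdot>\<^sub>c w) = r \<cdot>\<^sub>c gam A p a v + s \<cdot>\<^sub>c gam A p a w"
  using assms lc_diff_lin lc_diff_lin2 by (simp_all add: gam_eq)

lemma gam_zero:
  assumes "p \<in> points A" "v \<in> Rn (mdim A)"
  shows "gam A p 0 v = 0" "gam A p v 0 = 0"
  using gam_lin(1)[OF assms(1) Rn_closed(1) Rn_closed(1) assms(2), of 0 0]
    gam_lin(2)[OF assms(1) Rn_closed(1) Rn_closed(1) assms(2), of 0 0] by simp_all

lemma gam_metric:
  assumes "p \<in> points A" "v \<in> Rn (mdim A)" "a \<in> Rn (mdim A)" "b \<in> Rn (mdim A)"
  shows "nabla_g p v a b = met A p (gam A p v a) b + met A p a (gam A p v b)"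
  using lc_diff_metric[OF assms] assms by (simp add: gam_eq)

lemma gam_unique:
  assumes "p \<in> points A" "v \<in> Rn (mdim A)" "a \<in> Rn (mdim A)" "z \<in> Rn (mdim A)"
    "\<And>b. b \<in> Rn (mdim A) \<Longrightarrow> 2 * met A p z b = nabla_g p v a b + nabla_g p a v b - nabla_g p b v a"
  shows "gam A p v a = z"
  using lc_diff_unique[OF assms] gam_eq assms(1-3) by simp

section \<open>The adjoint of the difference tensor\<close>

lemma gam_adj_ex1:
  assumes p: "p \<in> points A" and v: "v \<in> Rn (mdim A)" and w: "w \<in> Rn (mdim A)"
  shows "\<exists>!z. z \<in> Rn (mdim A) \<and> (\<forall>y\<in>Rn (mdim A). met A p z y = met A p w (gam A p v y))"
proof -
  interpret I: inner_product_on "mdim A" "met A p" by (rule inner[OF p])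
  show ?thesis
    by (rule I.riesz) (use p v w gam_Rn in \<open>simp add: gam_lin(2) I.add_right I.scale_right\<close>)
qed

lemma gam_adj:
  assumes p: "p \<in> points A" and v: "v \<in> Rn (mdim A)" and w: "w \<in> Rn (mdim A)"
  shows gam_adj_Rn: "gam_adj A p v w \<in> Rn (mdim A)"
    and met_gam_adj: "y \<in> Rn (mdim A) \<Longrightarrow> met A p (gam_adj A p v w) y = met A p w (gam A p v y)"
  using theI'[OF gam_adj_ex1[OF assms]] unfolding adjoint_tensor_def by blast+

lemma gam_adj_unique:
  assumes p: "p \<in> points A" and v: "v \<in> Rn (mdim A)" and w: "w \<in> Rn (mdim A)" and z: "z \<in> Rn (mdim A)"
    and eq: "\<And>y. y \<in> Rn (mdim A) \<Longrightarrow> met A p z y = met A p w (gam A p v y)"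
  shows "gam_adj A p v w = z"
proof -
  interpret I: inner_product_on "mdim A" "met A p" by (rule inner[OF p])
  show ?thesis
    by (rule I.nondegenerate) (use assms gam_adj_Rn met_gam_adj in simp_all)
qed

lemma gam_adj_lin:
  assumes p: "p \<in> points A" and v: "v \<in> Rn (mdim A)" and w: "w \<in> Rn (mdim A)" and a: "a \<in> Rn (mdim A)"
  shows "gam_adj A p (r \<cdot>\<^sub>c v + s \<cdot>\<^sub>c w) a = r \<cdot>\<^sub>c gam_adj A p v a + s \<cdot>\<^sub>c gam_adj A p w a"
    and "gam_adj A p a (r \<cdot>\<^sub>c v + s \<cdot>\<^sub>c w) = r \<cdot>\<^sub>c gam_adj A p a v + s \<cdot>\<^sub>c gam_adj A p a w"
proof -
  interpret I: inner_product_on "mdim A" "met A p" by (rule inner[OF p])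
  show "gam_adj A p (r \<cdot>\<^sub>c v + s \<cdot>\<^sub>c w) a = r \<cdot>\<^sub>c gam_adj A p v a + s \<cdot>\<^sub>c gam_adj A p w a"
    by (rule gam_adj_unique)
       (use assms gam_adj_Rn gam_Rn in \<open>simp_all add: I.lin met_gam_adj gam_lin(1) I.add_right I.scale_right\<close>)
  show "gam_adj A p a (r \<cdot>\<^sub>c v + s \<cdot>\<^sub>c w) = r \<cdot>\<^sub>c gam_adj A p a v + s \<cdot>\<^sub>c gam_adj A p a w"
    by (rule gam_adj_unique)
       (use assms gam_adj_Rn gam_Rn in \<open>simp_all add: I.lin met_gam_adj\<close>)
qed

lemma gam_adj_zero:
  assumes "p \<in> points A" "v \<in> Rn (mdim A)"
  shows "gam_adj A p 0 v = 0" "gam_adj A p v 0 = 0"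
  using gam_adj_lin(1)[OF assms(1) Rn_closed(1) Rn_closed(1) assms(2), of 0 0]
    gam_adj_lin(2)[OF assms(1) Rn_closed(1) Rn_closed(1) assms(2), of 0 0] by simp_all

section \<open>Traces in orthonormal bases\<close>

lemma orthonormal_basis_iff:
  assumes "p \<in> points A"
  shows "orthonormal_basis A (met A) p e \<longleftrightarrow> inner_product_on.orthonormal (mdim A) (met A p) (mdim A) e"
  unfolding orthonormal_basis_def inner_product_on.orthonormal_def[OF inner[OF assms]] ..

lemma orthonormal_basis_some:
  assumes p: "p \<in> points A"
  shows "orthonormal_basis A (met A) p (SOME e. orthonormal_basis A (met A) p e)"
proof -
  have "\<exists>e. orthonormal_basis A (met A) p e"
    unfolding orthonormal_basis_iff[OF p] by (rule inner_product_on.orthonormal_exists[OF inner[OF p]]) simp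
  then show ?thesis by (rule someI_ex)
qed

lemma trace_invariant_real:
  fixes F :: "coord \<Rightarrow> coord \<Rightarrow> real"
  assumes p: "p \<in> points A"
    and "\<And>u v w a b. u \<in> Rn (mdim A) \<Longrightarrow> v \<in> Rn (mdim A) \<Longrightarrow> w \<in> Rn (mdim A) \<Longrightarrow>
      F (a \<cdot>\<^sub>c u + b \<cdot>\<^sub>c v) w = a * F u w + b * F v w"
    and "\<And>u v w a b. u \<in> Rn (mdim A) \<Longrightarrow> v \<in> Rn (mdim A) \<Longrightarrow> w \<in> Rn (mdim A) \<Longrightarrow>
      F w (a \<cdot>\<^sub>c u + b \<cdot>\<^sub>c v) = a * F w u + b * F w v"
    and "orthonormal_basis A (met A) p e" "orthonormal_basis A (met A) p f"
  shows "(\<Sum>i<mdim A. F (e i) (e i)) = (\<Sum>i<mdim A. F (f i) (f i))"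
proof -
  interpret I: inner_product_on "mdim A" "met A p" by (rule inner[OF p])
  show ?thesis
    by (rule I.trace_invariant) (use assms orthonormal_basis_iff[OF p] in auto)
qed

text \<open>Each coordinate of the tensor is a scalar bilinear form with an invariant trace, so any
  convenient orthonormal basis may replace the chosen one.\<close>

lemma trace_tensor_eq:
  assumes p: "p \<in> points A"
    and F: "\<And>u v w a b. u \<in> Rn (mdim A) \<Longrightarrow> v \<in> Rn (mdim A) \<Longrightarrow> w \<in> Rn (mdim A) \<Longrightarrow>
      F p (a \<cdot>\<^sub>c u + b \<cdot>\<^sub>c v) w = a \<cdot>\<^sub>c F p u w + b \<cdot>\<^sub>c F p v w"
    "\<And>u v w a b. u \<in> Rn (mdim A) \<Longrightarrow> v \<in> Rn (mdim A) \<Longrightarrow> w \<in> Rn (mdim A) \<Longrightarrow>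
      F p w (a \<cdot>\<^sub>c u + b \<cdot>\<^sub>c v) = a \<cdot>\<^sub>c F p w u + b \<cdot>\<^sub>c F p w v"
    and f: "orthonormal_basis A (met A) p f"
  shows "trace_tensor A F p = (\<Sum>i<mdim A. F p (f i) (f i))"
proof
  fix j
  let ?e = "SOME e. orthonormal_basis A (met A) p e"
  have "(\<Sum>i<mdim A. F p (?e i) (?e i) j) = (\<Sum>i<mdim A. F p (f i) (f i) j)"
    by (rule trace_invariant_real[where F="\<lambda>x y. F p x y j", OF p _ _ orthonormal_basis_some[OF p] f])
       (simp_all add: F, simp_all add: coord_simps)
  then show "trace_tensor A F p j = (\<Sum>i<mdim A. F p (f i) (f i)) j"
    unfolding trace_tensor_def Let_def by (simp add: coord_simps)
qed

lemma trace_gam: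
  assumes "p \<in> points A" "orthonormal_basis A (met A) p f"
  shows "trace_tensor A (gam A) p = (\<Sum>i<mdim A. gam A p (f i) (f i))"
    and "trace_tensor A (gam_adj A) p = (\<Sum>i<mdim A. gam_adj A p (f i) (f i))"
  by (rule trace_tensor_eq[OF assms(1) _ _ assms(2)], use assms gam_lin gam_adj_lin in auto)+

lemma trace_gam_Rn:
  assumes "p \<in> points A"
  shows "trace_tensor A (gam A) p \<in> Rn (mdim A)" "trace_tensor A (gam_adj A) p \<in> Rn (mdim A)"
proof -
  obtain e where e: "orthonormal_basis A (met A) p e" using orthonormal_basis_some[OF assms] by blast
  show "trace_tensor A (gam A) p \<in> Rn (mdim A)" "trace_tensor A (gam_adj A) p \<in> Rn (mdim A)"
    unfolding trace_gam[OF assms e] using e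
    by (auto intro!: Rn_sum gam_Rn gam_adj_Rn assms simp: orthonormal_basis_def)
qed

end

section \<open>The difference tensor of the tangent bundle\<close>

context tangent_bundle
begin

abbreviation "g1 \<equiv> tangent_met A"

text \<open>Transfers the general theory to the tangent bundle; the rewrites replace the record
  fields of \<open>tangent A\<close> by the names under which they are computed.\<close>

sublocale TT: affine_metric "tangent A"
  rewrites "nabla (tangent A) = tangent_nabla A" and "met (tangent A) = tangent_met A"
    and "mdim (tangent A) = 2 * mdim A"
  by (rule tangent_affine_metric) (simp_all add: nabla_tangent met_tangent)

lemma g1_lifts:
  assumes u: "u \<in> points T" and a: "a \<in> Rn (mdim A)" and b: "b \<in> Rn (mdim A)"
  shows "g1 u (hlift A u a) (hlift A u b) = met A (foot u) a b"
    "g1 u (vlift A u a) (vlift A u b) = met A (foot u) a b"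
    "g1 u (hlift A u a) (vlift A u b) = 0" "g1 u (vlift A u a) (hlift A u b) = 0"
proof -
  interpret I: inner_product_on "mdim A" "met A (foot u)" by (rule inner[OF foot_points[OF u]])
  show "g1 u (hlift A u a) (hlift A u b) = met A (foot u) a b"
    "g1 u (vlift A u a) (vlift A u b) = met A (foot u) a b"
    "g1 u (hlift A u a) (vlift A u b) = 0" "g1 u (vlift A u a) (hlift A u b) = 0"
    using assms by (simp_all add: tangent_met_def hpart_hlift hpart_vlift vpart_hlift vpart_vlift I.zero_left I.zero_right)
qed

lemma g1_split: "g1 u (hlift A u a + vlift A u b) w = met A (foot u) a (hpart A u w) + met A (foot u) b (vpart A u w)"
  if "u \<in> points T" "a \<in> Rn (mdim A)" "b \<in> Rn (mdim A)"
  using that by (simp add: tangent_met_def hpart_add vpart_add hpart_hlift vpart_hlift hpart_vlift vpart_vlift)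

text \<open>Evaluated on lifts of base fields, for which the metric and the derivatives along
  \<open>w\<close> are all pulled back from the base.\<close>

lemma nabla_g1_lifts:
  assumes u: "u \<in> points T" and w: "w \<in> Rn (2 * mdim A)" and a: "a \<in> Rn (mdim A)" and b: "b \<in> Rn (mdim A)"
  shows "TT.nabla_g u w (hlift A u a) (hlift A u b) = nabla_g (foot u) (hpart A u w) a b"
    "TT.nabla_g u w (vlift A u a) (vlift A u b) = nabla_g (foot u) (hpart A u w) a b"
    "TT.nabla_g u w (hlift A u a) (vlift A u b) = 0"
proof -
  define p where "p = foot u"
  have p: "p \<in> points A" using foot_points[OF u] by (simp add: p_def)
  have fp: "foot u = p" by (simp add: p_def)
  define X where "X = const_ext p a"
  define Y where "Y = const_ext p b"
  have X: "smf p X" "X p = a" and Y: "smf p Y" "Y p = b"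
    unfolding X_def Y_def using smf_const_ext[OF p] const_ext_self[OF p] a b by auto
  note hX = smf_hor[OF u, unfolded fp, OF X(1)] smf_ver[OF u, unfolded fp, OF X(1)]
    and hY = smf_hor[OF u, unfolded fp, OF Y(1)] smf_ver[OF u, unfolded fp, OF Y(1)]
  have val: "hor A X u = hlift A u a" "ver A X u = vlift A u a" "hor A Y u = hlift A u b" "ver A Y u = vlift A u b"
    by (simp_all add: hor_def ver_def fp X(2) Y(2))
  note n1 = nb1_hor[OF u w, unfolded fp] nb1_ver[OF u w, unfolded fp]
  have R: "nb p (hpart A u w) X \<in> Rn (mdim A)" "nb p (hpart A u w) Y \<in> Rn (mdim A)"
    using nab_Rn[OF _ hpart_Rn] X Y by auto
  note ev = T.eventually_near_points eventually_foot[OF smf_eventually_Rn[OF X(1), folded fp] u] eventually_foot[OF smf_eventually_Rn[OF Y(1), folded fp] u]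
  have d: "dirder T u w (\<lambda>u'. met A (foot u') (X (foot u')) (Y (foot u'))) = dirder A p (hpart A u w) (\<lambda>q. met A q (X q) (Y q))"
    using dirder_foot[OF u, of w "\<lambda>q. met A q (X q) (Y q)"] by (simp add: fp hpart_def)
  have N: "nabla_g p (hpart A u w) a b = metric_der p (hpart A u w) X Y"
    using metric_der_eq[OF X(1) Y(1) hpart_Rn] X(2) Y(2) by simp
  have "\<forall>\<^sub>F u' in T.near u. g1 u' (hor A X u') (hor A Y u') = met A (foot u') (X (foot u')) (Y (foot u'))"
    using ev by eventually_elim (simp add: hor_def g1_lifts)
  note 1 = T.dirder_cong[OF u this]
  show "TT.nabla_g u w (hlift A u a) (hlift A u b) = nabla_g (foot u) (hpart A u w) a b"
    using TT.metric_der_eq[OF hX(1) hY(1) w] 1 d n1 X Y R g1_lifts[OF u] a b N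
    by (simp add: TT.metric_der_def metric_der_def val fp)
  have "\<forall>\<^sub>F u' in T.near u. g1 u' (ver A X u') (ver A Y u') = met A (foot u') (X (foot u')) (Y (foot u'))"
    using ev by eventually_elim (simp add: ver_def g1_lifts)
  note 2 = T.dirder_cong[OF u this]
  show "TT.nabla_g u w (vlift A u a) (vlift A u b) = nabla_g (foot u) (hpart A u w) a b"
    using TT.metric_der_eq[OF hX(2) hY(2) w] 2 d n1 X Y R g1_lifts[OF u] a b N
    by (simp add: TT.metric_der_def metric_der_def val fp)
  have "\<forall>\<^sub>F u' in T.near u. g1 u' (hor A X u') (ver A Y u') = 0"
    using ev by eventually_elim (simp add: hor_def ver_def g1_lifts)
  note 3 = T.dirder_cong[OF u this]
  show "TT.nabla_g u w (hlift A u a) (vlift A u b) = 0"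
    using TT.metric_der_eq[OF hX(1) hY(2) w] 3 n1 X Y R g1_lifts[OF u] a b
    by (simp add: TT.metric_der_def val fp)
qed

lemma nabla_g1:
  assumes u: "u \<in> points T" and w: "w \<in> Rn (2 * mdim A)" and x: "x \<in> Rn (2 * mdim A)" and y: "y \<in> Rn (2 * mdim A)"
  shows "TT.nabla_g u w x y = nabla_g (foot u) (hpart A u w) (hpart A u x) (hpart A u y)
    + nabla_g (foot u) (hpart A u w) (vpart A u x) (vpart A u y)"
proof -
  note R = hpart_Rn[of u x] vpart_Rn[OF u x] hpart_Rn[of u y] vpart_Rn[OF u y]
  note L = hlift_Rn[OF u R(1)] vlift_Rn[OF R(2)] hlift_Rn[OF u R(3)] vlift_Rn[OF R(4)]
  have l2: "TT.nabla_g u w (b + c) z = TT.nabla_g u w b z + TT.nabla_g u w c z"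
    if "b \<in> Rn (2 * mdim A)" "c \<in> Rn (2 * mdim A)" "z \<in> Rn (2 * mdim A)" for b c z
    using TT.nabla_g_lin2[OF u w that, of 1 1] by simp
  have l3: "TT.nabla_g u w z (b + c) = TT.nabla_g u w z b + TT.nabla_g u w z c"
    if "b \<in> Rn (2 * mdim A)" "c \<in> Rn (2 * mdim A)" "z \<in> Rn (2 * mdim A)" for b c z
    using TT.nabla_g_lin3[OF u w that, of 1 1] by simp
  have "TT.nabla_g u w x y = TT.nabla_g u w (hlift A u (hpart A u x) + vlift A u (vpart A u x))
      (hlift A u (hpart A u y) + vlift A u (vpart A u y))"
    using hv_decomp[OF u] by simp
  then show ?thesis
    using L R nabla_g1_lifts[OF u w R(1,3)] nabla_g1_lifts[OF u w R(2,4)] nabla_g1_lifts(3)[OF u w R(1,4)]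
      nabla_g1_lifts(3)[OF u w R(3,2)] TT.nabla_g_sym[OF u w, of "vlift A u (vpart A u x)" "hlift A u (hpart A u y)"]
    by (simp add: l2 l3)
qed

text \<open>By \<open>gam_metric\<close> the derivative of the metric is \<gamma> plus its adjoint.
  Two horizontal arguments reproduce the formula for \<gamma> on the base; a mixed pair leaves one
  positive term, hence half of that sum; two vertical ones leave only the subtracted term, and thus
  a horizontal value.\<close>

lemma gam_tangent:
  assumes u: "u \<in> points T" and w: "w \<in> Rn (2 * mdim A)" and x: "x \<in> Rn (2 * mdim A)"
  defines "p \<equiv> foot u" and "hw \<equiv> hpart A u w" and "vw \<equiv> vpart A u w" and "hx \<equiv> hpart A u x" and "vx \<equiv> vpart A u x"
  shows "gam T u w x = hlift A u (gam A p hw hx - (1/2) \<cdot>\<^sub>c (gam_adj A p vw vx + gam_adj A p vx vw))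
    + vlift A u ((1/2) \<cdot>\<^sub>c (gam A p hw vx + gam_adj A p hw vx) + (1/2) \<cdot>\<^sub>c (gam A p hx vw + gam_adj A p hx vw))"
    (is "_ = hlift A u ?h + vlift A u ?v")
proof -
  have p: "p \<in> points A" unfolding p_def by (rule foot_points[OF u])
  interpret I: inner_product_on "mdim A" "met A p" by (rule inner[OF p])
  have R: "hw \<in> Rn (mdim A)" "vw \<in> Rn (mdim A)" "hx \<in> Rn (mdim A)" "vx \<in> Rn (mdim A)"
    unfolding hw_def vw_def hx_def vx_def using hpart_Rn vpart_Rn[OF u w] vpart_Rn[OF u x] by auto
  note G = gam_Rn[OF p] gam_adj_Rn[OF p]
  have hv: "?h \<in> Rn (mdim A)" "?v \<in> Rn (mdim A)" using R G by simp_all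
  show ?thesis
  proof (rule TT.gam_unique[OF u w x])
    show "hlift A u ?h + vlift A u ?v \<in> Rn (2 * mdim A)" using hlift_Rn[OF u hv(1)] vlift_Rn[OF hv(2)] by simp
    fix y assume y: "y \<in> Rn (2 * mdim A)"
    define hy where "hy = hpart A u y"
    define vy where "vy = vpart A u y"
    have S: "hy \<in> Rn (mdim A)" "vy \<in> Rn (mdim A)"
      unfolding hy_def vy_def using hpart_Rn vpart_Rn[OF u y] by auto
    have "g1 u (hlift A u ?h + vlift A u ?v) y = met A p ?h hy + met A p ?v vy"
      using g1_split[OF u hv] by (simp add: p_def hy_def vy_def)
    \<comment> \<open>Both subtracted terms have the horizontal part of the test vector as
      direction; the second of them is the contribution of the two vertical parts.\<close>
    moreover have "2 * met A p ?h hy = nabla_g p hw hx hy + nabla_g p hx hw hy - nabla_g p hy hw hx - nabla_g p hy vw vx"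
      using R S G
      by (simp add: gam_metric p I.bilin met_gam_adj gam_sym[OF p S(1)] gam_sym[OF p R(3) R(1)]
          I.sym[OF R(1) G(1)] I.sym[OF R(3) G(1)] I.sym[OF R(2) G(1)] I.sym[OF R(4) G(1)] algebra_simps)
    moreover have "2 * met A p ?v vy = nabla_g p hw vx vy + nabla_g p hx vw vy"
      using R S G by (simp add: gam_metric p I.bilin met_gam_adj algebra_simps)
    ultimately show "2 * g1 u (hlift A u ?h + vlift A u ?v) y
        = TT.nabla_g u w x y + TT.nabla_g u x w y - TT.nabla_g u y w x"
      unfolding nabla_g1[OF u w x y] nabla_g1[OF u x w y] nabla_g1[OF u y w x]
      by (simp add: p_def[symmetric] hw_def[symmetric] vw_def[symmetric] hx_def[symmetric] vx_def[symmetric]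
          hy_def[symmetric] vy_def[symmetric])
  qed
qed

text \<open>Transposes \<open>gam_tangent\<close> block by block. In a horizontal direction the
  vertical block, being half of \<gamma> plus its adjoint, is symmetric. In a vertical direction the
  two off-diagonal blocks are interchanged, which moves the minus sign from the horizontal to the
  vertical value.\<close>

lemma gam_adj_tangent:
  assumes u: "u \<in> points T" and w: "w \<in> Rn (2 * mdim A)" and x: "x \<in> Rn (2 * mdim A)"
  defines "p \<equiv> foot u" and "hw \<equiv> hpart A u w" and "vw \<equiv> vpart A u w" and "hx \<equiv> hpart A u x" and "vx \<equiv> vpart A u x"
  shows "gam_adj T u w x = hlift A u (gam_adj A p hw hx + (1/2) \<cdot>\<^sub>c (gam_adj A p vw vx + gam_adj A p vx vw))
    + vlift A u ((1/2) \<cdot>\<^sub>c (gam A p hw vx + gam_adj A p hw vx) - (1/2) \<cdot>\<^sub>c (gam A p vw hx + gam_adj A p hx vw))"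
    (is "_ = hlift A u ?h + vlift A u ?v")
proof -
  have p: "p \<in> points A" unfolding p_def by (rule foot_points[OF u])
  interpret I: inner_product_on "mdim A" "met A p" by (rule inner[OF p])
  have R: "hw \<in> Rn (mdim A)" "vw \<in> Rn (mdim A)" "hx \<in> Rn (mdim A)" "vx \<in> Rn (mdim A)"
    unfolding hw_def vw_def hx_def vx_def using hpart_Rn vpart_Rn[OF u w] vpart_Rn[OF u x] by auto
  note G = gam_Rn[OF p] gam_adj_Rn[OF p]
  have hv: "?h \<in> Rn (mdim A)" "?v \<in> Rn (mdim A)" using R G by simp_all
  show ?thesis
  proof (rule TT.gam_adj_unique[OF u w x])
    show "hlift A u ?h + vlift A u ?v \<in> Rn (2 * mdim A)" using hlift_Rn[OF u hv(1)] vlift_Rn[OF hv(2)] by simp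
    fix y assume y: "y \<in> Rn (2 * mdim A)"
    define hy where "hy = hpart A u y"
    define vy where "vy = vpart A u y"
    have S: "hy \<in> Rn (mdim A)" "vy \<in> Rn (mdim A)"
      unfolding hy_def vy_def using hpart_Rn vpart_Rn[OF u y] by auto
    let ?k = "gam A p hw hy - (1/2) \<cdot>\<^sub>c (gam_adj A p vw vy + gam_adj A p vy vw)"
    let ?l = "(1/2) \<cdot>\<^sub>c (gam A p hw vy + gam_adj A p hw vy) + (1/2) \<cdot>\<^sub>c (gam A p hy vw + gam_adj A p hy vw)"
    have kl: "?k \<in> Rn (mdim A)" "?l \<in> Rn (mdim A)" using R S G by simp_all
    have gy: "gam T u w y = hlift A u ?k + vlift A u ?l"
      using gam_tangent[OF u w y] unfolding p_def hw_def vw_def hy_def vy_def .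
    have gR: "gam T u w y \<in> Rn (2 * mdim A)"
      unfolding gy using hlift_Rn[OF u kl(1)] vlift_Rn[OF kl(2)] by simp
    have "g1 u x (gam T u w y) = met A p hx ?k + met A p vx ?l"
      unfolding gy tangent_met_def p_def[symmetric]
      using u kl by (simp add: hpart_add vpart_add hpart_hlift vpart_hlift hpart_vlift vpart_vlift hx_def vx_def)
    moreover have "g1 u (hlift A u ?h + vlift A u ?v) y = met A p ?h hy + met A p ?v vy"
      using g1_split[OF u hv] by (simp add: p_def hy_def vy_def)
    moreover have "met A p ?h hy + met A p ?v vy = met A p hx ?k + met A p vx ?l"
    proof -
      have adj: "met A p a (gam_adj A p b c) = met A p c (gam A p b a)"
        if "a \<in> Rn (mdim A)" "b \<in> Rn (mdim A)" "c \<in> Rn (mdim A)" for a b c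
        using I.sym[OF that(1) gam_adj_Rn[OF p that(2,3)]] met_gam_adj[OF p that(2,3,1)] by simp
      have s: "gam A p hy vx = gam A p vx hy" "gam A p hy vw = gam A p vw hy" "gam A p hx vy = gam A p vy hx"
        using gam_sym[OF p] R S by auto
      show ?thesis
        using R S G
        by (simp add: I.bilin met_gam_adj p adj s I.sym[OF G(1) S(2)] algebra_simps)
    qed
    ultimately show "g1 u (hlift A u ?h + vlift A u ?v) y = g1 u x (gam T u w y)" by simp
  qed
qed

lemma gam_tangent_lifts:
  assumes u: "u \<in> points T" and a: "a \<in> Rn (mdim A)" and b: "b \<in> Rn (mdim A)"
  defines "p \<equiv> foot u"
  shows "gam T u (hlift A u a) (hlift A u b) = hlift A u (gam A p a b)"
    and "gam T u (hlift A u a) (vlift A u b) = (1/2) \<cdot>\<^sub>c vlift A u (gam A p a b + gam_adj A p a b)"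
    and "gam T u (vlift A u b) (hlift A u a) = (1/2) \<cdot>\<^sub>c vlift A u (gam A p a b + gam_adj A p a b)"
    and "gam T u (vlift A u a) (vlift A u b) = (-1/2) \<cdot>\<^sub>c hlift A u (gam_adj A p a b + gam_adj A p b a)"
    and "gam_adj T u (hlift A u a) (hlift A u b) = hlift A u (gam_adj A p a b)"
    and "gam_adj T u (hlift A u a) (vlift A u b) = (1/2) \<cdot>\<^sub>c vlift A u (gam A p a b + gam_adj A p a b)"
    and "gam_adj T u (vlift A u a) (hlift A u b) = (-1/2) \<cdot>\<^sub>c vlift A u (gam A p a b + gam_adj A p b a)"
    and "gam_adj T u (vlift A u a) (vlift A u b) = (1/2) \<cdot>\<^sub>c hlift A u (gam_adj A p a b + gam_adj A p b a)"
proof -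
  have p: "p \<in> points A" unfolding p_def by (rule foot_points[OF u])
  have fp: "foot u = p" by (simp add: p_def)
  note L = hlift_Rn[OF u a] hlift_Rn[OF u b] vlift_Rn[OF a] vlift_Rn[OF b]
  note G = gam_Rn[OF p a b] gam_adj_Rn[OF p a b] gam_adj_Rn[OF p b a]
  note parts = hpart_hlift vpart_hlift hpart_vlift vpart_vlift[OF u]
  note z = gam_zero[OF p] gam_adj_zero[OF p]
  note s = hlift_zero[OF u] vlift_zero hlift_scale[OF u] vlift_scale
  show "gam T u (hlift A u a) (hlift A u b) = hlift A u (gam A p a b)"
    "gam T u (hlift A u a) (vlift A u b) = (1/2) \<cdot>\<^sub>c vlift A u (gam A p a b + gam_adj A p a b)"
    "gam T u (vlift A u b) (hlift A u a) = (1/2) \<cdot>\<^sub>c vlift A u (gam A p a b + gam_adj A p a b)"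
    "gam_adj T u (hlift A u a) (hlift A u b) = hlift A u (gam_adj A p a b)"
    "gam_adj T u (hlift A u a) (vlift A u b) = (1/2) \<cdot>\<^sub>c vlift A u (gam A p a b + gam_adj A p a b)"
    "gam_adj T u (vlift A u a) (vlift A u b) = (1/2) \<cdot>\<^sub>c hlift A u (gam_adj A p a b + gam_adj A p b a)"
    using u a b L G by (simp_all add: gam_tangent gam_adj_tangent fp parts z s del: cv.scale_right_distrib)
  have "- ((1/2) \<cdot>\<^sub>c (c::coord)) = (-1/2) \<cdot>\<^sub>c c" for c by simp
  then show "gam T u (vlift A u a) (vlift A u b) = (-1/2) \<cdot>\<^sub>c hlift A u (gam_adj A p a b + gam_adj A p b a)"
    "gam_adj T u (vlift A u a) (hlift A u b) = (-1/2) \<cdot>\<^sub>c vlift A u (gam A p a b + gam_adj A p b a)"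
    using u a b L G by (simp_all add: gam_tangent gam_adj_tangent fp parts z s hlift_uminus vlift_uminus del: cv.scale_right_distrib)
qed

text \<open>Ordered so that \<open>sum_lessThan_double\<close> splits a trace into its horizontal
  and its vertical half.\<close>

definition lift_basis :: "'a itpoint \<Rightarrow> (nat \<Rightarrow> coord) \<Rightarrow> nat \<Rightarrow> coord" where
  "lift_basis u e i = (if i < mdim A then hlift A u (e i) else vlift A u (e (i - mdim A)))"

lemma lift_basis_orthonormal:
  assumes u: "u \<in> points T" and e: "orthonormal_basis A (met A) (foot u) e"
  shows "orthonormal_basis T g1 u (lift_basis u e)"
proof -
  have eR: "e i \<in> Rn (mdim A)" if "i < mdim A" for i using e that by (simp add: orthonormal_basis_def)
  have ee: "met A (foot u) (e i) (e j) = (if i = j then 1 else 0)" if "i < mdim A" "j < mdim A" for i j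
    using e that by (simp add: orthonormal_basis_def)
  show ?thesis
    unfolding orthonormal_basis_def
  proof (intro conjI allI impI)
    fix i assume i: "i < mdim T"
    show "lift_basis u e i \<in> Rn (mdim T)"
      using i hlift_Rn[OF u eR] vlift_Rn[OF eR] by (simp add: lift_basis_def)
    fix j assume j: "j < mdim T"
    show "g1 u (lift_basis u e i) (lift_basis u e j) = (if i = j then 1 else 0)"
      using i j by (auto simp: lift_basis_def g1_lifts[OF u eR eR] ee)
  qed
qed

lemma trace_tangent:
  assumes u: "u \<in> points T"
  shows "trace_tensor T (gam T) u = hlift A u (trace_tensor A (gam A) (foot u) - trace_tensor A (gam_adj A) (foot u))"
    and "trace_tensor T (gam_adj T) u = 2 \<cdot>\<^sub>c hlift A u (trace_tensor A (gam_adj A) (foot u))"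
proof -
  let ?n = "mdim A"
  define p where "p = foot u"
  have p: "p \<in> points A" unfolding p_def by (rule foot_points[OF u])
  have fp: "foot u = p" by (simp add: p_def)
  define e where "e = (SOME e. orthonormal_basis A (met A) p e)"
  have e: "orthonormal_basis A (met A) p e" unfolding e_def by (rule orthonormal_basis_some[OF p])
  have eR: "e i \<in> Rn ?n" if "i < ?n" for i using e that by (simp add: orthonormal_basis_def)
  note b = lift_basis_orthonormal[OF u, unfolded fp, OF e]
  note G = gam_Rn[OF p eR eR] gam_adj_Rn[OF p eR eR]
  \<comment> \<open>For equal arguments the two adjoint terms in the vertical block coincide, which
    absorbs the factor 1/2.\<close>
  have d: "c + c = 2 \<cdot>\<^sub>c c" for c :: coord by (simp add: fun_eq_iff coord_simps)
  have g1: "gam T u (vlift A u (e i)) (vlift A u (e i)) = - hlift A u (gam_adj A p (e i) (e i))" if i: "i < ?n" for i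
    using gam_tangent_lifts(4)[OF u eR[OF i] eR[OF i]] gam_adj_Rn[OF p eR[OF i] eR[OF i]] by (simp add: fp d hlift_scale[OF u])
  have "trace_tensor T (gam T) u = (\<Sum>i<?n. hlift A u (gam A p (e i) (e i))) + (\<Sum>i<?n. - hlift A u (gam_adj A p (e i) (e i)))"
    unfolding TT.trace_gam(1)[OF u b] sum_lessThan_double
    using gam_tangent_lifts(1)[OF u eR eR] g1 by (simp add: lift_basis_def fp)
  also have "\<dots> = hlift A u (\<Sum>i<?n. gam A p (e i) (e i)) + - hlift A u (\<Sum>i<?n. gam_adj A p (e i) (e i))"
    using hlift_sum[OF u, of "{..<?n}" "\<lambda>i. gam A p (e i) (e i)"]
      hlift_sum[OF u, of "{..<?n}" "\<lambda>i. gam_adj A p (e i) (e i)"] G by (simp add: sum_negf)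
  also have "\<dots> = hlift A u (trace_tensor A (gam A) p - trace_tensor A (gam_adj A) p)"
    unfolding trace_gam[OF p e, symmetric]
    using hlift_lin[OF u trace_gam_Rn[OF p], of 1 "-1"] by simp
  finally show "trace_tensor T (gam T) u = hlift A u (trace_tensor A (gam A) (foot u) - trace_tensor A (gam_adj A) (foot u))"
    by (simp add: fp)
  have g2: "gam_adj T u (vlift A u (e i)) (vlift A u (e i)) = hlift A u (gam_adj A p (e i) (e i))" if i: "i < ?n" for i
    using gam_tangent_lifts(8)[OF u eR[OF i] eR[OF i]] gam_adj_Rn[OF p eR[OF i] eR[OF i]] by (simp add: fp d hlift_scale[OF u])
  have "trace_tensor T (gam_adj T) u = (\<Sum>i<?n. hlift A u (gam_adj A p (e i) (e i))) + (\<Sum>i<?n. hlift A u (gam_adj A p (e i) (e i)))"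
    unfolding TT.trace_gam(2)[OF u b] sum_lessThan_double
    using gam_tangent_lifts(5)[OF u eR eR] g2 by (simp add: lift_basis_def fp)
  also have "\<dots> = 2 \<cdot>\<^sub>c hlift A u (trace_tensor A (gam_adj A) p)"
    unfolding d trace_gam(2)[OF p e]
    using hlift_sum[OF u, of "{..<?n}" "\<lambda>i. gam_adj A p (e i) (e i)"] G by simp
  finally show "trace_tensor T (gam_adj T) u = 2 \<cdot>\<^sub>c hlift A u (trace_tensor A (gam_adj A) (foot u))"
    by (simp add: fp)
qed

text \<open>Expresses the pullback through the differential of the projection, which drops the
  vertical part; this is the link to the lifts.\<close>

lemma pullback_foot:
  assumes u: "u \<in> points T"
  shows "pullback T A foot \<beta> u w = \<beta> (foot u) (hpart A u w)"
proof -
  have p: "foot u \<in> points A" by (rule foot_points[OF u])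
  have "differential T A foot u w = comp_in A (chart_at A (foot u)) (foot u) (hpart A u w)"
    unfolding differential_def comp_in_def
    using dirder_foot[OF u, of w "\<lambda>q. snd (chart_at A (foot u)) q _"] by (auto simp: hpart_def)
  then show ?thesis using comp_in_self[OF p hpart_Rn] by (simp add: pullback_def)
qed

text \<open>Both traces are horizontal lifts, so their inner products see only the horizontal part
  of \<open>w\<close>. These are the recursions that the iteration solves.\<close>

lemma koszul_tangent:
  assumes u: "u \<in> points T" and w: "w \<in> Rn (2 * mdim A)"
  shows "koszul_xi T u w = koszul_xi A (foot u) (hpart A u w) - koszul_alpha A (foot u) (hpart A u w)"
    and "koszul_alpha T u w = 2 * koszul_alpha A (foot u) (hpart A u w)"
proof -
  have p: "foot u \<in> points A" by (rule foot_points[OF u])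
  interpret I: inner_product_on "mdim A" "met A (foot u)" by (rule inner[OF p])
  note R = trace_gam_Rn[OF p]
  have h: "g1 u (hlift A u a) w = met A (foot u) a (hpart A u w)" if "a \<in> Rn (mdim A)" for a
    using g1_split[OF u that, of 0 w] I.zero_left[OF vpart_Rn[OF u w]] by (simp add: vlift_zero)
  show "koszul_xi T u w = koszul_xi A (foot u) (hpart A u w) - koszul_alpha A (foot u) (hpart A u w)"
    using R h I.minus_left[OF R hpart_Rn]
    by (simp add: koszul_xi_def koszul_alpha_def met_tangent trace_tangent[OF u])
  show "koszul_alpha T u w = 2 * koszul_alpha A (foot u) (hpart A u w)"
    using R h I.scale_left[OF R(2) hpart_Rn] hlift_scale[OF u R(2), of 2, symmetric]
    by (simp add: koszul_alpha_def met_tangent trace_tangent[OF u])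
qed

section \<open>The Lee form of the tangent bundle\<close>

abbreviation "J \<equiv> tangent_J A"

lemma J_parts:
  assumes u: "u \<in> points T" and w: "w \<in> Rn (2 * mdim A)"
  shows hpart_J: "hpart A u (J u w) = - vpart A u w" and vpart_J: "vpart A u (J u w) = hpart A u w"
    and J_Rn: "J u w \<in> Rn (2 * mdim A)"
proof -
  note R = hpart_Rn[of u w] vpart_Rn[OF u w]
  have eq: "J u w = vlift A u (hpart A u w) + hlift A u (- vpart A u w)"
    unfolding tangent_J_def hlift_uminus[OF u R(2)] by simp
  show "hpart A u (J u w) = - vpart A u w" "vpart A u (J u w) = hpart A u w"
    unfolding eq using R by (simp_all add: hpart_add vpart_add[OF u] hpart_hlift vpart_hlift hpart_vlift vpart_vlift[OF u])
  show "J u w \<in> Rn (2 * mdim A)" unfolding eq using R hlift_Rn[OF u] vlift_Rn by simp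
qed

lemma J_lin:
  assumes u: "u \<in> points T" and v: "v \<in> Rn (2 * mdim A)" and w: "w \<in> Rn (2 * mdim A)"
  shows "J u (a \<cdot>\<^sub>c v + b \<cdot>\<^sub>c w) = a \<cdot>\<^sub>c J u v + b \<cdot>\<^sub>c J u w"
  unfolding tangent_J_def
  using u v w by (simp add: hpart_lin vpart_lin hlift_lin vlift_lin vpart_Rn cv.scale_right_diff_distrib)

lemma J_add: "u \<in> points T \<Longrightarrow> v \<in> Rn (2 * mdim A) \<Longrightarrow> w \<in> Rn (2 * mdim A) \<Longrightarrow> J u (v + w) = J u v + J u w"
  using J_lin[of u v w 1 1] by simp

lemma J_scale: "u \<in> points T \<Longrightarrow> v \<in> Rn (2 * mdim A) \<Longrightarrow> J u (a \<cdot>\<^sub>c v) = a \<cdot>\<^sub>c J u v"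
  using J_lin[of u v v a 0] by simp

lemma J_sum:
  assumes u: "u \<in> points T" and "\<And>i. i \<in> S \<Longrightarrow> f i \<in> Rn (2 * mdim A)"
  shows "J u (\<Sum>i\<in>S. f i) = (\<Sum>i\<in>S. J u (f i))"
  using assms(2)
proof (induction S rule: infinite_finite_induct)
  case (insert i S)
  then show ?case using J_add[OF u, of "f i" "\<Sum>i\<in>S. f i"] by simp
qed (use J_scale[OF u, of 0 0] in simp_all)

lemma J_hlift: "u \<in> points T \<Longrightarrow> a \<in> Rn (mdim A) \<Longrightarrow> J u (hlift A u a) = vlift A u a"
  by (simp add: tangent_J_def hpart_hlift vpart_hlift hlift_zero)

lemma J_vlift: "u \<in> points T \<Longrightarrow> J u (vlift A u a) = - hlift A u a"
  by (simp add: tangent_J_def hpart_vlift vpart_vlift vlift_zero)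

lemma g1_J:
  assumes u: "u \<in> points T" and v: "v \<in> Rn (2 * mdim A)" and w: "w \<in> Rn (2 * mdim A)"
  shows "g1 u (J u v) (J u w) = g1 u v w"
proof -
  interpret I: inner_product_on "mdim A" "met A (foot u)" by (rule inner[OF foot_points[OF u]])
  show ?thesis
    using vpart_Rn[OF u v] vpart_Rn[OF u w]
    by (simp add: tangent_met_def hpart_J[OF u v] vpart_J[OF u v] hpart_J[OF u w] vpart_J[OF u w] I.uminus_left I.uminus_right)
qed

lemma J_smf:
  assumes X: "T.smf u X"
  shows "T.smf u (\<lambda>u'. J u' (X u'))"
proof -
  have u: "u \<in> points T" using X T.smf_points by blast
  note ev = T.eventually_near_points T.smf_eventually_Rn[OF X, unfolded mdim_tangent]
  have XX: "smal u (\<lambda>u'. hpart A u' (X u'))" "smal u (\<lambda>u'. vpart A u' (X u'))"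
    using X unfolding T_smf_iff[OF u] by auto
  have "\<forall>\<^sub>F u' in T.near u. J u' (X u') \<in> Rn (2 * mdim A)" using ev by eventually_elim (rule J_Rn)
  moreover have "smal u (\<lambda>u'. hpart A u' (J u' (X u')))"
  proof (rule smal_cong[OF _ smal_scale[OF T.sm_const[OF u, of "-1"] XX(2)]])
    show "\<forall>\<^sub>F u' in T.near u. (-1) \<cdot>\<^sub>c vpart A u' (X u') = hpart A u' (J u' (X u'))"
      using ev by eventually_elim (simp add: hpart_J)
  qed
  moreover have "smal u (\<lambda>u'. vpart A u' (J u' (X u')))"
  proof (rule smal_cong[OF _ XX(1)])
    show "\<forall>\<^sub>F u' in T.near u. hpart A u' (X u') = vpart A u' (J u' (X u'))"
      using ev by eventually_elim (simp add: vpart_J)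
  qed
  ultimately show ?thesis unfolding T_smf_iff[OF u] by blast
qed

text \<open>The two sides obey the same Leibniz rule, so their difference is tensorial in
  \<open>X\<close>. It vanishes on the frame of lifts, where \<open>J\<close> exchanges horizontal
  and vertical lifts up to sign while \<open>nb1\<close> treats both alike.\<close>

lemma nb1_J:
  assumes X: "T.smf u X" and v: "v \<in> Rn (2 * mdim A)"
  shows "nb1 u v (\<lambda>u'. J u' (X u')) = J u (nb1 u v X)"
proof
  fix j
  have u: "u \<in> points T" using X T.smf_points by blast
  have p: "foot u \<in> points A" by (rule foot_points[OF u])
  have v': "v \<in> Rn (mdim T)" using v by simp
  note nR = T.nab_Rn[OF _ v', unfolded mdim_tangent] and sR = T.smf_Rn[unfolded mdim_tangent]
  define F where "F X = (nb1 u v (\<lambda>u'. J u' (X u')) - J u (nb1 u v X)) j" for X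
  have "F X = 0"
  proof -
    obtain r where r: "X u = (\<Sum>i\<in>UNIV \<times> {..<mdim A}. r i \<cdot>\<^sub>c lift_frame u i u)"
      using lift_frame_span[OF u sR[OF X]] by blast
    have "F X = (\<Sum>i\<in>UNIV \<times> {..<mdim A}. r i * F (lift_frame u i))"
    proof (rule T.tensorial_frame[of u F, OF _ _ X lift_frame_smf[OF u] r])
      fix X Y assume X: "T.smf u X" and Y: "T.smf u Y"
      have "\<forall>\<^sub>F u' in T.near u. J u' (X u') + J u' (Y u') = J u' (X u' + Y u')"
        using T.eventually_near_points T.smf_eventually_Rn[OF X] T.smf_eventually_Rn[OF Y]
        by eventually_elim (simp add: J_add)
      from T.nab_cong[OF T.smf_add[OF J_smf[OF X] J_smf[OF Y]] v' this]
      have k: "nb1 u v (\<lambda>q. J q (X q + Y q)) = nb1 u v (\<lambda>q. J q (X q)) + nb1 u v (\<lambda>q. J q (Y q))"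
        using T.nab_add[OF J_smf[OF X] J_smf[OF Y] v'] by simp
      show "F (\<lambda>q. X q + Y q) = F X + F Y"
        using T.nab_add[OF X Y v'] J_add[OF u nR[OF X] nR[OF Y]]
        by (simp add: F_def k coord_simps)
    next
      fix f X assume f: "T.sm u f" and X: "T.smf u X"
      have "\<forall>\<^sub>F u' in T.near u. f u' \<cdot>\<^sub>c J u' (X u') = J u' (f u' \<cdot>\<^sub>c X u')"
        using T.eventually_near_points T.smf_eventually_Rn[OF X]
        by eventually_elim (simp add: J_scale)
      from T.nab_cong[OF T.smf_scale[OF f J_smf[OF X]] v' this]
      have k: "nb1 u v (\<lambda>q. J q (f q \<cdot>\<^sub>c X q)) = dirder T u v f \<cdot>\<^sub>c J u (X u) + f u \<cdot>\<^sub>c nb1 u v (\<lambda>q. J q (X q))"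
        using T.nab_leibniz[OF J_smf[OF X] f v'] by simp
      have k': "J u (nb1 u v (\<lambda>q. f q \<cdot>\<^sub>c X q)) = dirder T u v f \<cdot>\<^sub>c J u (X u) + f u \<cdot>\<^sub>c J u (nb1 u v X)"
        using T.nab_leibniz[OF X f v'] J_lin[OF u sR[OF X] nR[OF X]] by simp
      show "F (\<lambda>q. f q \<cdot>\<^sub>c X q) = f u * F X"
        by (simp add: F_def k k' coord_simps algebra_simps)
    qed
    moreover have "F (lift_frame u i) = 0" if i: "i \<in> UNIV \<times> {..<mdim A}" for i
    proof -
      define E where "E = coord_field A (chart_at A (foot u)) (snd i)"
      have E: "smf (foot u) E" unfolding E_def using frame_smf[OF p] i by auto
      note ev = T.eventually_near_points eventually_foot[OF smf_eventually_Rn[OF E] u]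
      note nE = nab_Rn[OF E hpart_Rn[of u v]]
      show ?thesis
      proof (cases "fst i")
        case True
        then have l: "lift_frame u i = hor A E" by (simp add: lift_frame_def E_def)
        have "\<forall>\<^sub>F u' in T.near u. J u' (hor A E u') = ver A E u'"
          using ev by eventually_elim (simp add: hor_def ver_def J_hlift)
        from T.nab_cong[OF J_smf[OF smf_hor[OF u E]] v' this]
        show ?thesis using nb1_hor[OF u v E] nb1_ver[OF u v E] J_hlift[OF u nE]
          by (simp add: l F_def coord_simps)
      next
        case False
        then have l: "lift_frame u i = ver A E" by (simp add: lift_frame_def E_def)
        have "\<forall>\<^sub>F u' in T.near u. J u' (ver A E u') = (-1) \<cdot>\<^sub>c hor A E u'"
          using ev by eventually_elim (simp add: hor_def ver_def J_vlift)
        from T.nab_cong[OF J_smf[OF smf_ver[OF u E]] v' this]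
        show ?thesis using nb1_hor[OF u v E] nb1_ver[OF u v E] J_vlift[OF u]
            T.nab_leibniz[OF smf_hor[OF u E] T.sm_const[OF u, of "-1"] v']
          by (simp add: l F_def coord_simps)
      qed
    qed
    ultimately show ?thesis by simp
  qed
  then show "nb1 u v (\<lambda>u'. J u' (X u')) j = J u (nb1 u v X) j" by (simp add: F_def coord_simps)
qed

text \<open>Since \<open>J\<close> commutes with \<open>nb1\<close>, the derivatives of the
  extension \<open>X\<close> cancel and only the difference tensor is left. This also shows that the
  description in \<open>cov_form2\<close> does not depend on the extensions.\<close>

lemma cov_form2_tangent:
  assumes u: "u \<in> points T" and v: "v \<in> Rn (2 * mdim A)" and a: "a \<in> Rn (2 * mdim A)" and b: "b \<in> Rn (2 * mdim A)"
  shows "cov_form2 T (levi_civita T g1) (fundamental_form g1 J) u v a b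
    = g1 u (gam T u v (J u a) - J u (gam T u v a)) b"
  unfolding cov_form2_def fundamental_form_def
proof (rule the_equality)
  interpret I: inner_product_on "2 * mdim A" "g1 u" by (rule TT.inner[OF u])
  have v': "v \<in> Rn (mdim T)" using v by simp
  define V where "V = T.const_ext u v"
  have V: "T.smf u V" "V u = v" unfolding V_def using T.smf_const_ext[OF u] T.const_ext_self[OF u v'] by auto
  show val: "\<forall>X Y. T.smf u X \<and> X u = a \<and> T.smf u Y \<and> Y u = b \<longrightarrow>
      g1 u (gam T u v (J u a) - J u (gam T u v a)) b = dirder T u v (\<lambda>q. g1 q (J q (X q)) (Y q))
        - g1 u (J u (levi_civita T g1 u v X)) b - g1 u (J u a) (levi_civita T g1 u v Y)"
  proof (intro allI impI; elim conjE)
    fix X Y assume X: "T.smf u X" "X u = a" and Y: "T.smf u Y" "Y u = b"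
    have JX: "T.smf u (\<lambda>q. J q (X q))" by (rule J_smf[OF X(1)])
    note nR = T.nab_Rn[OF _ v', unfolded mdim_tangent]
    have Ja: "J u a \<in> Rn (2 * mdim A)" by (rule J_Rn[OF u a])
    note G = TT.gam_Rn[OF u v a] TT.gam_Rn[OF u v Ja]
    have "dirder T u v (\<lambda>q. g1 q (J q (X q)) (Y q))
        = g1 u (levi_civita T g1 u v (\<lambda>q. J q (X q))) b + g1 u (J u a) (levi_civita T g1 u v Y)"
      using TT.levi_civita_metric[unfolded T.metric_connection_iff, rule_format, OF V(1) JX Y(1)] V(2) X(2) Y(2) by simp
    moreover have "levi_civita T g1 u v (\<lambda>q. J q (X q)) = J u (nb1 u v X) + gam T u v (J u a)"
      using TT.levi_civita_eq[OF JX v] nb1_J[OF X(1) v] TT.gam_eq[OF u v Ja] X(2) by simp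
    moreover have "J u (levi_civita T g1 u v X) = J u (nb1 u v X) + J u (gam T u v a)"
      using TT.levi_civita_eq[OF X(1) v] TT.gam_eq[OF u v a] X(2) J_add[OF u nR[OF X(1)] G(1)] by simp
    ultimately show "g1 u (gam T u v (J u a) - J u (gam T u v a)) b = dirder T u v (\<lambda>q. g1 q (J q (X q)) (Y q))
        - g1 u (J u (levi_civita T g1 u v X)) b - g1 u (J u a) (levi_civita T g1 u v Y)"
      using G J_Rn[OF u G(1)] J_Rn[OF u nR[OF X(1)]] b by (simp add: I.add_left I.minus_left)
  qed
  fix r assume r: "\<forall>X Y. T.smf u X \<and> X u = a \<and> T.smf u Y \<and> Y u = b \<longrightarrow>
      r = dirder T u v (\<lambda>q. g1 q (J q (X q)) (Y q))
        - g1 u (J u (levi_civita T g1 u v X)) b - g1 u (J u a) (levi_civita T g1 u v Y)"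
  have ext: "T.smf u (T.const_ext u a)" "T.const_ext u a u = a" "T.smf u (T.const_ext u b)" "T.const_ext u b u = b"
    using T.smf_const_ext[OF u] T.const_ext_self[OF u] a b by auto
  show "r = g1 u (gam T u v (J u a) - J u (gam T u v a)) b"
    using r[rule_format, of "T.const_ext u a" "T.const_ext u b"] val[rule_format, of "T.const_ext u a" "T.const_ext u b"] ext by simp
qed

lemma lee_tangent:
  assumes u: "u \<in> points T" and w: "w \<in> Rn (2 * mdim A)"
  shows "lee_form T g1 J u w = - koszul_xi T u w"
proof -
  let ?n = "mdim A"
  interpret I: inner_product_on "2 * ?n" "g1 u" by (rule TT.inner[OF u])
  define p where "p = foot u"
  have p: "p \<in> points A" unfolding p_def by (rule foot_points[OF u])
  have fp: "foot u = p" by (simp add: p_def)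
  define e where "e = (SOME e. orthonormal_basis A (met A) p e)"
  have e: "orthonormal_basis A (met A) p e" unfolding e_def by (rule orthonormal_basis_some[OF p])
  have eR: "e i \<in> Rn ?n" if "i < ?n" for i using e that by (simp add: orthonormal_basis_def)
  note b = lift_basis_orthonormal[OF u, unfolded fp, OF e]
  define f where "f = (SOME e. orthonormal_basis T g1 u e)"
  have f: "orthonormal_basis T g1 u f" unfolding f_def by (rule TT.orthonormal_basis_some[OF u])
  have fR: "f i \<in> Rn (2 * ?n)" if "i < 2 * ?n" for i using f that by (simp add: orthonormal_basis_def)
  define z where "z = J u w"
  have z: "z \<in> Rn (2 * ?n)" unfolding z_def by (rule J_Rn[OF u w])
  note GR = TT.gam_Rn[OF u] and JR = J_Rn[OF u]
  \<comment> \<open>The basis \<open>f\<close> comes from the choice in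
    \<open>codifferential\<close>; bilinearity of \<open>F\<close> is what permits exchanging it for
    a basis of lifts.\<close>
  define F where "F v a = g1 u (gam T u v (J u a) - J u (gam T u v a)) z" for v a
  have F: "F (r \<cdot>\<^sub>c x + s \<cdot>\<^sub>c y) a = r * F x a + s * F y a" "F a (r \<cdot>\<^sub>c x + s \<cdot>\<^sub>c y) = r * F a x + s * F a y"
    if "x \<in> Rn (2 * ?n)" "y \<in> Rn (2 * ?n)" "a \<in> Rn (2 * ?n)" for x y a r s
    using that z GR JR
    by (simp_all add: F_def J_lin[OF u] TT.gam_lin[OF u] I.bilin algebra_simps del: cv.scale_right_distrib)
  have "codifferential T g1 (fundamental_form g1 J) u z = - (\<Sum>i<2 * ?n. F (f i) (f i))"
    unfolding codifferential_def Let_def f_def[symmetric]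
    using cov_form2_tangent[OF u fR fR z] by (simp add: F_def)
  also have "(\<Sum>i<2 * ?n. F (f i) (f i)) = (\<Sum>i<2 * ?n. F (lift_basis u e i) (lift_basis u e i))"
    by (rule TT.trace_invariant_real[OF u F f b])
  also have "\<dots> = - g1 u (J u (trace_tensor T (gam T) u)) z"
  proof -
    let ?b = "lift_basis u e"
    have bR: "?b i \<in> Rn (2 * ?n)" if "i < 2 * ?n" for i using b that by (simp add: orthonormal_basis_def)
    have F1: "F (?b i) (?b i) = g1 u (gam T u (?b i) (J u (?b i))) z - g1 u (J u (gam T u (?b i) (?b i))) z" if "i < 2 * ?n" for i
      using bR[OF that] z GR JR by (simp add: F_def I.minus_left)
    have "(\<Sum>i<2 * ?n. F (?b i) (?b i))
        = (\<Sum>i<2 * ?n. g1 u (gam T u (?b i) (J u (?b i))) z) - (\<Sum>i<2 * ?n. g1 u (J u (gam T u (?b i) (?b i))) z)"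
      by (simp add: F1 sum_subtractf)
    also have "(\<Sum>i<2 * ?n. g1 u (gam T u (?b i) (J u (?b i))) z) = 0"
    proof -
      have "g1 u (gam T u (?b (i + ?n)) (J u (?b (i + ?n)))) z = - g1 u (gam T u (?b i) (J u (?b i))) z" if i: "i < ?n" for i
      proof -
        have h: "hlift A u (e i) \<in> Rn (2 * ?n)" "vlift A u (e i) \<in> Rn (2 * ?n)"
          using hlift_Rn[OF u eR[OF i]] vlift_Rn[OF eR[OF i]] .
        have "gam T u (vlift A u (e i)) (- hlift A u (e i)) = - gam T u (hlift A u (e i)) (vlift A u (e i))"
          using TT.gam_lin(2)[OF u h(1) h(1) h(2), of "-1" 0] TT.gam_sym[OF u h] by simp
        then show ?thesis using i J_hlift[OF u eR[OF i]] J_vlift[OF u] GR[OF h] z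
          by (simp add: lift_basis_def I.uminus_left)
      qed
      then show ?thesis unfolding sum_lessThan_double by (simp add: sum_negf)
    qed
    also have "(\<Sum>i<2 * ?n. g1 u (J u (gam T u (?b i) (?b i))) z) = g1 u (J u (trace_tensor T (gam T) u)) z"
    proof -
      have "J u (\<Sum>i<2 * ?n. gam T u (?b i) (?b i)) = (\<Sum>i<2 * ?n. J u (gam T u (?b i) (?b i)))"
        by (rule J_sum[OF u]) (use bR GR in auto)
      moreover have "g1 u (\<Sum>i<2 * ?n. J u (gam T u (?b i) (?b i))) z = (\<Sum>i<2 * ?n. g1 u (J u (gam T u (?b i) (?b i))) z)"
        by (rule I.sum_left) (use bR GR JR z in auto)
      ultimately show ?thesis unfolding TT.trace_gam(1)[OF u b] by simp
    qed
    finally show ?thesis by simp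
  qed
  finally have "codifferential T g1 (fundamental_form g1 J) u z = g1 u (J u (trace_tensor T (gam T) u)) z" by simp
  \<comment> \<open>The Lee form evaluates the codifferential at \<open>J u w\<close>, and the trace
    is preceded by \<open>J\<close> as well; \<open>J\<close> is an isometry and disappears.\<close>
  then show ?thesis
    using g1_J[OF u TT.trace_gam_Rn(1)[OF u] w]
    by (simp add: lee_form_def koszul_xi_def met_tangent z_def)
qed

end

section \<open>Iterated tangent bundles\<close>

lemma iter_tangent_Suc: "iter_tangent (Suc k) A = tangent (iter_tangent k A)"
  by (simp add: iter_tangent_def)

lemma iter_tangent_affine_metric: "affine_metric A \<Longrightarrow> affine_metric (iter_tangent k A)"
proof (induction k)
  case 0 then show ?case by (simp add: iter_tangent_def)
next
  case (Suc k)
  then interpret tangent_bundle "iter_tangent k A" by (simp add: tangent_bundle_def)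
  show ?case unfolding iter_tangent_Suc by (rule tangent_affine_metric)
qed

lemma iter_pullback_diff:
  "iter_pullback k A (\<lambda>p v. r * \<beta> p v - \<beta>' p v) u w = r * iter_pullback k A \<beta> u w - iter_pullback k A \<beta>' u w"
  by (induction k arbitrary: u w) (simp_all add: pullback_def)

text \<open>The recursion for \<xi> involves \<alpha> at the previous stage, so both are carried
  through the induction; the coefficient arises from
  \<open>2 ^ Suc k - 1 = (2 ^ k - 1) + 2 ^ k\<close>. The point and the vector are generalised
  because the induction hypothesis is used at their projections.\<close>

lemma iter_koszul:
  assumes "affine_metric A"
    and "u \<in> points (iter_tangent k A)" "w \<in> Rn (mdim (iter_tangent k A))"
  shows "koszul_alpha (iter_tangent k A) u w = 2 ^ k * iter_pullback k A (koszul_alpha A) u w \<and>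
    koszul_xi (iter_tangent k A) u w
      = iter_pullback k A (koszul_xi A) u w - (2 ^ k - 1) * iter_pullback k A (koszul_alpha A) u w"
  using assms(2,3)
proof (induction k arbitrary: u w)
  case 0 then show ?case by (simp add: iter_tangent_def)
next
  case (Suc k)
  interpret tangent_bundle "iter_tangent k A"
    using iter_tangent_affine_metric[OF assms(1)] by (simp add: tangent_bundle_def)
  have u: "u \<in> points T" and w: "w \<in> Rn (2 * mdim (iter_tangent k A))"
    using Suc.prems by (simp_all add: iter_tangent_Suc)
  have pb: "iter_pullback (Suc k) A \<beta> u w = iter_pullback k A \<beta> (foot u) (hpart (iter_tangent k A) u w)" for \<beta>
    using pullback_foot[OF u] by (simp add: iter_tangent_Suc)
  show ?case
    using Suc.IH[OF foot_points[OF u] hpart_Rn[of u w]] koszul_tangent[OF u w]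
    unfolding pb iter_tangent_Suc by (simp add: algebra_simps)
qed

text \<open>\<open>iter_J k\<close> is built from stage \<open>k - 1\<close>, so the result on the
  Lee form of a tangent bundle is applied to that stage.\<close>

lemma iter_lee_eq:
  assumes A: "affine_metric A" and k: "k \<ge> 1"
    and "u \<in> points (iter_tangent k A)" "w \<in> Rn (mdim (iter_tangent k A))"
  shows "iter_lee k A u w = - koszul_xi (iter_tangent k A) u w"
proof -
  obtain m where m: "k = Suc m" using k by (cases k) auto
  interpret tangent_bundle "iter_tangent m A"
    using iter_tangent_affine_metric[OF A] by (simp add: tangent_bundle_def)
  show ?thesis
    using lee_tangent assms(3,4) unfolding m iter_lee_def iter_J_def iter_tangent_Suc met_tangent by simp
qed

theorem proposition3p7:
  fixes A :: "'a itpoint affine_riemann"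
  assumes "affine_riemann_manifold A"
  shows
    "(\<forall>X Y. smooth_field A (points A) X \<longrightarrow> smooth_field A (points A) Y \<longrightarrow>
       (\<forall>u\<in>points (tangent A).
          on_fields (gam (tangent A)) (hor A X) (hor A Y) u
            = hor A (on_fields (gam A) X Y) u \<and>
          on_fields (gam (tangent A)) (hor A X) (ver A Y) u
            = (1/2) \<cdot>\<^sub>c ver A (on_fields (gam A) X Y + on_fields (gam_adj A) X Y) u \<and>
          on_fields (gam (tangent A)) (ver A Y) (hor A X) u
            = (1/2) \<cdot>\<^sub>c ver A (on_fields (gam A) X Y + on_fields (gam_adj A) X Y) u \<and>
          on_fields (gam (tangent A)) (ver A X) (ver A Y) u
            = (-1/2) \<cdot>\<^sub>c hor A (on_fields (gam_adj A) X Y + on_fields (gam_adj A) Y X) u \<and>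
          on_fields (gam_adj (tangent A)) (hor A X) (hor A Y) u
            = hor A (on_fields (gam_adj A) X Y) u \<and>
          on_fields (gam_adj (tangent A)) (hor A X) (ver A Y) u
            = (1/2) \<cdot>\<^sub>c ver A (on_fields (gam A) X Y + on_fields (gam_adj A) X Y) u \<and>
          on_fields (gam_adj (tangent A)) (ver A X) (hor A Y) u
            = (-1/2) \<cdot>\<^sub>c ver A (on_fields (gam A) X Y + on_fields (gam_adj A) Y X) u \<and>
          on_fields (gam_adj (tangent A)) (ver A X) (ver A Y) u
            = (1/2) \<cdot>\<^sub>c hor A (on_fields (gam_adj A) X Y + on_fields (gam_adj A) Y X) u)) \<and>
     (\<forall>u\<in>points (tangent A).
        trace_tensor (tangent A) (gam (tangent A)) u
          = hor A (trace_tensor A (gam A) - trace_tensor A (gam_adj A)) u \<and>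
        trace_tensor (tangent A) (gam_adj (tangent A)) u
          = 2 \<cdot>\<^sub>c hor A (trace_tensor A (gam_adj A)) u) \<and>
     (\<forall>k\<ge>1. \<forall>u\<in>points (iter_tangent k A). \<forall>w\<in>Rn (mdim (iter_tangent k A)).
        koszul_xi (iter_tangent k A) u w = - iter_lee k A u w \<and>
        koszul_alpha (iter_tangent k A) u w
          = 2 ^ k * iter_pullback k A (koszul_alpha A) u w \<and>
        iter_lee k A u w
          = iter_pullback k A (\<lambda>p v. (2 ^ k - 1) * koszul_alpha A p v - koszul_xi A p v) u w)"
proof -
  have A: "affine_metric A" by (rule affine_riemann_manifold_imp_affine_metric[OF assms])
  interpret tangent_bundle A using A by (simp add: tangent_bundle_def)
  show ?thesis
  \<comment> \<open>Conjunctions are split only where the left conjunct is universally quantified,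
    which gives three goals and keeps the equations within each block together.\<close>
  proof (intro conjI[of "\<forall>X Y. _ X Y"] conjI[of "\<forall>u\<in>_. _ u"] allI impI ballI, goal_cases)
    case (1 X Y u)
    have "X (foot u) \<in> Rn (mdim A)" "Y (foot u) \<in> Rn (mdim A)"
      using 1 foot_points[OF 1(3)] unfolding smooth_field_def by blast+
    from gam_tangent_lifts[OF 1(3) this] gam_tangent_lifts[OF 1(3) this(2,1)]
    show ?case by (simp add: on_fields_def hor_def ver_def plus_fun_apply)
  next
    case (2 u)
    then show ?case using trace_tangent by (simp add: hor_def minus_apply)
  next
    case (3 k u w)
    then show ?case
      using iter_koszul[OF A 3(2,3)] iter_lee_eq[OF A 3] by (simp add: iter_pullback_diff)
  qed
qed

end
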